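(* Let $X_1,X_2,\ldots$ be i.i.d. exponentially distributed random variables with density $\lambda e^{-\lambda x}$, $x\ge 0$, for some $\lambda>0$ (the null hypothesis $H_0$), and let $D_n^{(3)}$ be the statistic and $\delta_3^2$ the constant defined in the context. Then for $a>0$ $$\lim_{n\to\infty} n^{-1}\ln P_{H_0}\left(D_n^{(3)}>a\right)=-f_3(a),$$ where the function $f_3$ is continuous for sufficiently small $a>0$, and moreover $$f_3(a)=(18\delta_3^2)^{-1}a^2(1+o(1))\quad\text{as } a\to0,$$ where numerically $(18\delta_3^2)^{-1}\approx 2.479$.
   Context: For $t\ge 0$ and a sample $X_1,\ldots,X_n$ put $$H_n^{(3)}(t)=\frac1{n^3}\sum_{i_1,i_2,i_3=1}^n \mathbf 1\{\max(X_{i_1},X_{i_2},X_{i_3})<t\},$$ $$G_n^{(3)}(t)=\frac1{3!\,n^3}\sum_{i_1,i_2,i_3=1}^n\ \sum_{(j_1,j_2,j_3)}\mathbf 1\left\{\frac{X_{i_1}}{j_1}+\frac{X_{i_2}}{j_2}+\frac{X_{i_3}}{j_3}<t\right\},$$ where the inner sum runs over all $3!$ permutations $(j_1,j_2,j_3)$ of $(1,2,3)$, and $D_n^{(3)}=\sup_{t\ge0}\left|H_n^{(3)}(t)-G_n^{(3)}(t)\right|$. The distribution of $D_n^{(3)}$ under $H_0$ does not depend on $\lambda$. $P_{H_0}$ denotes probability when the $X_i$ are i.i.d. exponential. The convention $\ln 0=-\infty$ is used, so $f_3$ may take the value $+\infty$ for large $a$. With $F(x)=1-e^{-x}$, let $$\xi_3(s;t)=\mathbf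 1\{s<t\}\left[F^2(t)-F(2(t-s))+\tfrac23F(3(t-s))\right]-\mathbf 1\{s<2t\}\left[\tfrac12F(t-\tfrac s2)-\tfrac16F(3(t-\tfrac s2))\right]-\mathbf 1\{s<3t\}\left[\tfrac23F(t-\tfrac s3)-\tfrac13F(2(t-\tfrac s3))\right],$$ which for standard exponential (rate 1) independent $X_1,X_2,X_3$ is the conditional expectation given $X_1=s$ of the kernel $\mathbf 1\{\max(X_1,X_2,X_3)<t\}-\frac1{3!}\sum_{(j_1,j_2,j_3)}\mathbf 1\{\frac{X_1}{j_1}+\frac{X_2}{j_2}+\frac{X_3}{j_3}<t\}$. Let $\delta_3^2(t)=\operatorname{Var}(\xi_3(X;t))$ with $X$ standard exponential, and $\delta_3^2=\sup_{t\ge0}\delta_3^2(t)\approx0.02241$. *)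

theory Defs
  imports "HOL-Probability.Probability" "HOL-Combinatorics.Permutations" "HOL-Library.Landau_Symbols"
begin

text \<open>A sample of size \<open>n\<close> is given by the values \<open>x 1, \<dots>, x n\<close> of a function
  \<open>x :: nat \<Rightarrow> real\<close>; the value \<open>x 0\<close> is never used.\<close>

definition H3 :: "nat \<Rightarrow> (nat \<Rightarrow> real) \<Rightarrow> real \<Rightarrow> real" where
  "H3 n x t = 1 / real n ^ 3 *
     (\<Sum>i1\<in>{1..n}. \<Sum>i2\<in>{1..n}. \<Sum>i3\<in>{1..n}. of_bool (max (x i1) (max (x i2) (x i3)) < t))"

text \<open>A permutation \<open>(j\<^sub>1, j\<^sub>2, j\<^sub>3)\<close> of \<open>(1, 2, 3)\<close> is \<open>(\<sigma> 1, \<sigma> 2, \<sigma> 3)\<close>.\<close>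

definition G3 :: "nat \<Rightarrow> (nat \<Rightarrow> real) \<Rightarrow> real \<Rightarrow> real" where
  "G3 n x t = 1 / (fact 3 * real n ^ 3) *
     (\<Sum>i1\<in>{1..n}. \<Sum>i2\<in>{1..n}. \<Sum>i3\<in>{1..n}. \<Sum>\<sigma> | \<sigma> permutes {1, 2, 3::nat}.
        of_bool (x i1 / real (\<sigma> 1) + x i2 / real (\<sigma> 2) + x i3 / real (\<sigma> 3) < t))"

definition D3 :: "nat \<Rightarrow> (nat \<Rightarrow> real) \<Rightarrow> real" where
  "D3 n x = (SUP t\<in>{0..}. \<bar>H3 n x t - G3 n x t\<bar>)"

definition F_exp :: "real \<Rightarrow> real" where
  "F_exp x = 1 - exp (- x)"

definition xi3 :: "real \<Rightarrow> real \<Rightarrow> real" where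
  "xi3 s t =
     of_bool (s < t) * ((F_exp t)\<^sup>2 - F_exp (2 * (t - s)) + 2 / 3 * F_exp (3 * (t - s)))
   - of_bool (s < 2 * t) * (1 / 2 * F_exp (t - s / 2) - 1 / 6 * F_exp (3 * (t - s / 2)))
   - of_bool (s < 3 * t) * (2 / 3 * F_exp (t - s / 3) - 1 / 3 * F_exp (2 * (t - s / 3)))"

definition std_exp :: "real measure" where
  "std_exp = density lborel (exponential_density 1)"

definition delta3_sq_at :: "real \<Rightarrow> real" where
  "delta3_sq_at t = prob_space.variance std_exp (\<lambda>s. xi3 s t)"

definition delta3_sq :: real where
  "delta3_sq = (SUP t\<in>{0..}. delta3_sq_at t)"

text \<open>The logarithm of a probability, with \<open>ln 0 = -\<infinity>\<close> (the library's real \<open>ln\<close> has \<open>ln 0 = 0\<close>).\<close>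

definition ln_prob :: "real \<Rightarrow> ereal" where
  "ln_prob p = (if p = 0 then -\<infinity> else ereal (ln p))"

end

theory Submission
  imports Defs "HOL-Real_Asymp.Real_Asymp"
begin

text \<open>
  The rate function is the one of Sanov's theorem. The empirical measure \<open>L\<^sub>n\<close> of the sample
  satisfies \<open>H\<^sub>n(t) - G\<^sub>n(t) = T(L\<^sub>n, t)\<close>, where \<open>T(\<mu>, t) = F(t)^3 - W(t)\<close>, \<open>F(t) = \<mu>(-\<infinity>, t)\<close>, and
  \<open>W(t)\<close> is the mass that \<open>\<mu> \<times> \<mu> \<times> \<mu>\<close> gives to \<open>x + y/2 + z/3 < t\<close> (the six permutations give
  the same sum). Rescaling the sample changes neither the statistic nor its law, so the rate can be
  taken to be 1; \<open>E\<close> denotes the standard exponential law. The rate function is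
  \<open>J(a) = inf {K(f)}\<close> over bounded densities \<open>f\<close> with respect to \<open>E\<close> for which \<open>|T(f E, t)| > a\<close>
  for some \<open>t \<ge> 0\<close>, where \<open>K(f)\<close> is the integral of \<open>f ln f\<close>, the entropy relative to \<open>E\<close>.

  Large deviations. \<open>T\<close> is Lipschitz in the Kolmogorov distance (\<open>Tf_kolmogorov\<close>), so that only
  the counts of the sample in \<open>m\<close> cells of equal probability matter. For the upper bound
  (\<open>ldp_upper\<close>) the method of types applies: there are polynomially many vectors of counts, and
  Markov's inequality bounds the probability of each one by \<open>exp(-n K)\<close>, with the entropy \<open>K\<close> of the
  associated step density. The lower bound (\<open>ldp_lower\<close>) is a change of measure with the
  likelihood ratio of \<open>f\<close> and Chebyshev's inequality. Together they give the limit wherever \<open>J\<close> is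
  left continuous.

  Left continuity (\<open>J_left\<close>) is the heart of the matter. Near-minimizers for levels increasing to
  \<open>a\<close> have a weak limit \<open>Q\<close> without atoms, since bounded entropy forces uniform integrability, and
  \<open>|T(Q, t)| \<ge> a\<close> for some \<open>t\<close>. Let \<open>g\<close> be the first variation of \<open>|T|\<close> at \<open>Q\<close>; its \<open>Q\<close>-mean is
  \<open>|T(Q, t)|\<close>. If \<open>g\<close> exceeds \<open>a\<close> somewhere, mixing a little mass at this place into the
  near-minimizers raises \<open>|T|\<close> above \<open>a\<close> at arbitrarily small cost in entropy. Otherwise
  \<open>g = a\<close> holds \<open>Q\<close>-almost everywhere. This cannot happen if \<open>T(Q, t) > 0\<close>
  (\<open>no_degenerate_plus\<close>). If \<open>T(Q, t) < 0\<close>, it forces \<open>a \<le> 0.385\<close> and a gap in the support of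
  \<open>Q\<close> (\<open>degenerate_minus\<close>), which makes the entropy of \<open>Q\<close> larger than that of explicit
  trial densities that already exceed the level \<open>a\<close>.

  Behaviour at zero. For the exponential law \<open>T = 0\<close> identically, by Renyi's representation of
  order statistics (\<open>renyi\<close>), and the linear part of \<open>T(f E, t)\<close> at \<open>f = 1\<close> is three times the
  integral of \<open>f \<xi>\<close>, with \<open>\<xi> = xi3\<close> as a function of the first argument. The density \<open>1 + c \<xi>\<close>
  with \<open>c = a / (3 \<delta>\<^sup>2)\<close> up to higher order has entropy \<open>a\<^sup>2 / (18 \<delta>\<^sup>2) + O(a\<^sup>3)\<close>
  (\<open>rate_upper\<close>), and the Donsker-Varadhan inequality with a multiple of \<open>\<xi>\<close> shows that nothing
  is better (\<open>rate_lower\<close>).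

  The constant. With \<open>v = exp(-t/6)\<close> the variance is a polynomial in \<open>v\<close> plus \<open>t\<close> times another one.
  Replacing \<open>t = -6 ln v\<close> by rational bounds turns the estimate from above into the negativity of
  two polynomials of degree 36 on intervals, which is certified by Bernstein coefficients; one
  value near the maximum gives the estimate from below.
\<close>

section \<open>Triple integrals over the half space x + y/2 + z/3 < t\<close>

text \<open>Bounded Borel functions: closed under sums and products and integrable against every probability
  measure, so that all Fubini arguments below are free of side conditions.\<close>

definition bb :: "(real \<Rightarrow> real) \<Rightarrow> bool" where
  "bb f \<longleftrightarrow> f \<in> borel_measurable borel \<and> (\<exists>B. \<forall>x. \<bar>f x\<bar> \<le> B)"

lemma bb_meas [measurable_dest]: "bb f \<Longrightarrow> f \<in> borel_measurable borel"
  by (simp add: bb_def)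

lemma bb_bound: assumes "bb f" obtains B where "B \<ge> 0" "\<And>x. \<bar>f x\<bar> \<le> B"
proof -
  from assms obtain B where "\<forall>x. \<bar>f x\<bar> \<le> B" by (auto simp: bb_def)
  then show ?thesis by (intro that[of "max B 0"]) (auto simp: le_max_iff_disj)
qed

lemma bbI: "f \<in> borel_measurable borel \<Longrightarrow> (\<And>x. \<bar>f x\<bar> \<le> B) \<Longrightarrow> bb f"
  by (auto simp: bb_def)

lemma integral_abs_bound_rd: fixes f :: "'a \<Rightarrow> real" shows "\<bar>\<integral>x. f x \<partial>M\<bar> \<le> (\<integral>x. \<bar>f x\<bar> \<partial>M)"
  using integral_norm_bound[of M f] by simp

lemma bb_const [simp, intro]: "bb (\<lambda>x. c)"
  by (rule bbI[of _ "\<bar>c\<bar>"]) auto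

lemma bb_add [intro]: assumes "bb f" "bb g" shows "bb (\<lambda>x. f x + g x)"
proof -
  obtain B where B: "\<And>x. \<bar>f x\<bar> \<le> B" using bb_bound[OF assms(1)] by blast
  obtain C where C: "\<And>x. \<bar>g x\<bar> \<le> C" using bb_bound[OF assms(2)] by blast
  have "\<bar>f x + g x\<bar> \<le> B + C" for x
    using abs_triangle_ineq[of "f x" "g x"] B[of x] C[of x] by linarith
  then show ?thesis using assms by (intro bbI[of _ "B + C"]) (auto simp: bb_def)
qed

lemma bb_mult [intro]: assumes "bb f" "bb g" shows "bb (\<lambda>x. f x * g x)"
proof -
  obtain B where B: "B \<ge> 0" "\<And>x. \<bar>f x\<bar> \<le> B" using bb_bound[OF assms(1)] by blast
  obtain C where C: "C \<ge> 0" "\<And>x. \<bar>g x\<bar> \<le> C" using bb_bound[OF assms(2)] by blast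
  have "\<And>x. \<bar>f x * g x\<bar> \<le> B * C" using B C by (simp add: abs_mult mult_mono)
  then show ?thesis using assms by (intro bbI[of _ "B * C"]) (auto simp: bb_def)
qed

lemma bb_diff [intro]: assumes "bb f" "bb g" shows "bb (\<lambda>x. f x - g x)"
  using bb_add[OF assms(1) bb_mult[OF bb_const[of "-1"] assms(2)]] by simp

lemma bb_abs [intro]: "bb f \<Longrightarrow> bb (\<lambda>x. \<bar>f x\<bar>)"
  by (auto simp: bb_def)

lemma bb_ind [intro]: "A \<in> sets borel \<Longrightarrow> bb (indicator A)"
  by (rule bbI[of _ 1]) (auto simp: indicator_def)

lemma bb_of_bool [intro]: "Measurable.pred borel P \<Longrightarrow> bb (\<lambda>x. of_bool (P x))"
  by (rule bbI[of _ 1]) auto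

lemma (in real_distribution) bb_integrable: assumes "bb f" shows "integrable M f"
proof -
  obtain B where B: "\<And>x. \<bar>f x\<bar> \<le> B" using bb_bound[OF assms] by blast
  have "f \<in> borel_measurable M" using assms by (simp add: bb_def)
  then show ?thesis using B by (intro integrable_const_bound[of f B]) auto
qed

lemma real_distribution_fubini:
  fixes \<phi> :: "real \<times> real \<Rightarrow> real"
  assumes "real_distribution \<mu>" "real_distribution \<nu>"
    and m: "\<phi> \<in> borel_measurable (borel \<Otimes>\<^sub>M borel)" and b: "\<And>p. \<bar>\<phi> p\<bar> \<le> B"
  shows "(\<integral>x. (\<integral>y. \<phi> (x, y) \<partial>\<nu>) \<partial>\<mu>) = (\<integral>y. (\<integral>x. \<phi> (x, y) \<partial>\<mu>) \<partial>\<nu>)"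
proof -
  interpret \<mu>: real_distribution \<mu> by fact
  interpret \<nu>: real_distribution \<nu> by fact
  interpret P: pair_prob_space \<mu> \<nu> ..
  have s: "sets (\<mu> \<Otimes>\<^sub>M \<nu>) = sets (borel \<Otimes>\<^sub>M borel)"
    by (intro sets_pair_measure_cong) auto
  have "\<phi> \<in> borel_measurable (\<mu> \<Otimes>\<^sub>M \<nu>)" using m measurable_cong_sets[OF s refl] by blast
  then have "integrable (\<mu> \<Otimes>\<^sub>M \<nu>) \<phi>"
    using b by (intro P.integrable_const_bound[of _ B]) auto
  from P.Fubini_integral[of "\<lambda>x y. \<phi> (x,y)"] this show ?thesis by simp
qed

text \<open>The trilinear form behind \<open>T\<close>: first variations and mixtures are obtained by
  inserting different laws and weights in the three slots.\<close>

definition tri :: "real measure \<Rightarrow> real measure \<Rightarrow> real measure \<Rightarrow>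
    (real \<Rightarrow> real) \<Rightarrow> (real \<Rightarrow> real) \<Rightarrow> (real \<Rightarrow> real) \<Rightarrow> real \<Rightarrow> real" where
  "tri \<mu> \<nu> \<rho> f g h t =
     (\<integral>x. f x * (\<integral>y. g y * (\<integral>z. h z * of_bool (x + y / 2 + z / 3 < t) \<partial>\<rho>) \<partial>\<nu>) \<partial>\<mu>)"

text \<open>The distribution function with a strict inequality, which is the convention of the statistic.\<close>

definition lcdf :: "real measure \<Rightarrow> real \<Rightarrow> real" where
  "lcdf \<mu> x = measure \<mu> {..<x}"

lemma (in real_distribution) measurable_integral_bb:
  fixes \<phi> :: "_ \<Rightarrow> real"
  assumes [measurable]: "\<phi> \<in> borel_measurable (N \<Otimes>\<^sub>M borel)"
  shows "(\<lambda>x. \<integral>z. \<phi> (x, z) \<partial>M) \<in> borel_measurable N"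
proof -
  have s: "sets (N \<Otimes>\<^sub>M M) = sets (N \<Otimes>\<^sub>M borel)"
    by (intro sets_pair_measure_cong) auto
  have [measurable]: "\<phi> \<in> borel_measurable (N \<Otimes>\<^sub>M M)" using assms measurable_cong_sets[OF s refl] by blast
  show ?thesis using borel_measurable_lebesgue_integral[of "\<lambda>x z. \<phi> (x, z)" N] by simp
qed

lemma (in real_distribution) abs_integral_le:
  fixes f :: "real \<Rightarrow> real"
  assumes "f \<in> borel_measurable borel" "\<And>x. \<bar>f x\<bar> \<le> B"
  shows "\<bar>\<integral>x. f x \<partial>M\<bar> \<le> B"
proof -
  have "\<bar>\<integral>x. f x \<partial>M\<bar> \<le> (\<integral>x. \<bar>f x\<bar> \<partial>M)" by (rule integral_abs_bound_rd)
  also have "\<dots> \<le> (\<integral>x. B \<partial>M)" using assms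
    by (intro integral_mono integrable_const_bound[of _ B]) (auto intro: order_trans[OF abs_ge_zero])
  finally show ?thesis using prob_space by simp
qed

text \<open>Partial integrals of \<open>tri\<close> with one of the three variables held fixed. They are the
  densities of the three linear functionals that make up the first variation.\<close>

definition sl1 :: "real measure \<Rightarrow> real measure \<Rightarrow> (real \<Rightarrow> real) \<Rightarrow> (real \<Rightarrow> real) \<Rightarrow> real \<Rightarrow> real \<Rightarrow> real" where "sl1 \<nu> \<rho> g h t x = (\<integral>y. g y * (\<integral>z. h z * of_bool (x + y / 2 + z / 3 < t) \<partial>\<rho>) \<partial>\<nu>)"
definition sl2 :: "real measure \<Rightarrow> real measure \<Rightarrow> (real \<Rightarrow> real) \<Rightarrow> (real \<Rightarrow> real) \<Rightarrow> real \<Rightarrow> real \<Rightarrow> real" where "sl2 \<mu> \<rho> f h t y = (\<integral>x. f x * (\<integral>z. h z * of_bool (x + y / 2 + z / 3 < t) \<partial>\<rho>) \<partial>\<mu>)"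
definition sl3 :: "real measure \<Rightarrow> real measure \<Rightarrow> (real \<Rightarrow> real) \<Rightarrow> (real \<Rightarrow> real) \<Rightarrow> real \<Rightarrow> real \<Rightarrow> real" where "sl3 \<mu> \<nu> f g t z = (\<integral>x. f x * (\<integral>y. g y * of_bool (x + y / 2 + z / 3 < t) \<partial>\<nu>) \<partial>\<mu>)"

locale three = m1: real_distribution \<mu> + m2: real_distribution \<nu> + m3: real_distribution \<rho> for \<mu> \<nu> \<rho>
begin

lemma bounded_gen:
  assumes "real_distribution M" "bb h" "\<phi> \<in> borel_measurable (N \<Otimes>\<^sub>M borel)" "\<And>p. \<bar>\<phi> p\<bar> \<le> (B::real)"
  shows "(\<lambda>x. \<integral>z. h z * \<phi> (x, z) \<partial>M) \<in> borel_measurable N"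
    and "\<exists>C. \<forall>x. \<bar>\<integral>z. h z * \<phi> (x, z) \<partial>M\<bar> \<le> C"
proof -
  interpret real_distribution M by fact
  have [measurable]: "h \<in> borel_measurable borel" "\<phi> \<in> borel_measurable (N \<Otimes>\<^sub>M borel)" using assms by auto
  show "(\<lambda>x. \<integral>z. h z * \<phi> (x, z) \<partial>M) \<in> borel_measurable N"
    using measurable_integral_bb[of "\<lambda>p. h (snd p) * \<phi> p" N] by simp
  obtain H where H: "H \<ge> 0" "\<And>x. \<bar>h x\<bar> \<le> H" using bb_bound[OF assms(2)] by blast
  have "\<bar>\<integral>z. h z * \<phi> (x, z) \<partial>M\<bar> \<le> H * B" if "x \<in> space N" for x
  proof (rule abs_integral_le)
    show "(\<lambda>z. h z * \<phi> (x, z)) \<in> borel_measurable borel" using that by measurable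
    show "\<And>z. \<bar>h z * \<phi> (x, z)\<bar> \<le> H * B"
      using H assms(4) by (auto simp: abs_mult intro!: mult_mono order_trans[OF abs_ge_zero])
  qed
  moreover have "\<bar>\<integral>z. h z * \<phi> (x, z) \<partial>M\<bar> \<le> max (H * B) 0" for x
  proof (cases "integrable M (\<lambda>z. h z * \<phi> (x, z))")
    case True
    have "\<bar>\<integral>z. h z * \<phi> (x, z) \<partial>M\<bar> \<le> (\<integral>z. \<bar>h z * \<phi> (x, z)\<bar> \<partial>M)" by (rule integral_abs_bound_rd)
    also have "\<dots> \<le> (\<integral>z. H * B \<partial>M)"
      using H assms(4) integrable_abs[OF True] by (intro integral_mono) (auto simp: abs_mult intro!: mult_mono order_trans[OF abs_ge_zero])
    finally show ?thesis using prob_space by simp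
  qed (simp add: not_integrable_integral_eq)
  ultimately show "\<exists>C. \<forall>x. \<bar>\<integral>z. h z * \<phi> (x, z) \<partial>M\<bar> \<le> C" by blast
qed

definition kW :: "real \<Rightarrow> (real \<times> real) \<times> real \<Rightarrow> real" where "kW t p = (of_bool (fst (fst p) + snd (fst p) / 2 + snd p / 3 < t))"

lemma kW_meas [measurable]: "kW t \<in> borel_measurable ((borel \<Otimes>\<^sub>M borel) \<Otimes>\<^sub>M borel)"
  unfolding kW_def by measurable

lemma inner3: assumes "bb h"
  shows "(\<lambda>p. \<integral>z. h z * of_bool (fst p + snd p / 2 + z / 3 < t) \<partial>\<rho>) \<in> borel_measurable (borel \<Otimes>\<^sub>M borel)"
    and "\<exists>C. \<forall>p. \<bar>\<integral>z. h z * of_bool (fst p + snd p / 2 + z / 3 < t) \<partial>\<rho>\<bar> \<le> C"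
  using bounded_gen[OF m3.real_distribution_axioms assms kW_meas[of t], of 1] by (auto simp: kW_def)

lemma inner2: assumes "bb g"
  shows "(\<lambda>p. \<integral>y. g y * of_bool (fst p + y / 2 + snd p / 3 < t) \<partial>\<nu>) \<in> borel_measurable (borel \<Otimes>\<^sub>M borel)"
    and "\<exists>C. \<forall>p. \<bar>\<integral>y. g y * of_bool (fst p + y / 2 + snd p / 3 < t) \<partial>\<nu>\<bar> \<le> C"
proof -
  have m: "(\<lambda>p. kW t ((fst (fst p), snd p), snd (fst p))) \<in> borel_measurable ((borel \<Otimes>\<^sub>M borel) \<Otimes>\<^sub>M borel)"
    by measurable
  show "(\<lambda>p. \<integral>y. g y * of_bool (fst p + y / 2 + snd p / 3 < t) \<partial>\<nu>) \<in> borel_measurable (borel \<Otimes>\<^sub>M borel)"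
    "\<exists>C. \<forall>p. \<bar>\<integral>y. g y * of_bool (fst p + y / 2 + snd p / 3 < t) \<partial>\<nu>\<bar> \<le> C"
    using bounded_gen[OF m2.real_distribution_axioms assms m, of 1] by (auto simp: kW_def)
qed

lemma inner1: assumes "bb f"
  shows "(\<lambda>p. \<integral>x. f x * of_bool (x + fst p / 2 + snd p / 3 < t) \<partial>\<mu>) \<in> borel_measurable (borel \<Otimes>\<^sub>M borel)"
    and "\<exists>C. \<forall>p. \<bar>\<integral>x. f x * of_bool (x + fst p / 2 + snd p / 3 < t) \<partial>\<mu>\<bar> \<le> C"
proof -
  have m: "(\<lambda>p. kW t ((snd p, fst (fst p)), snd (fst p))) \<in> borel_measurable ((borel \<Otimes>\<^sub>M borel) \<Otimes>\<^sub>M borel)"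
    by measurable
  show "(\<lambda>p. \<integral>x. f x * of_bool (x + fst p / 2 + snd p / 3 < t) \<partial>\<mu>) \<in> borel_measurable (borel \<Otimes>\<^sub>M borel)"
    "\<exists>C. \<forall>p. \<bar>\<integral>x. f x * of_bool (x + fst p / 2 + snd p / 3 < t) \<partial>\<mu>\<bar> \<le> C"
    using bounded_gen[OF m1.real_distribution_axioms assms m, of 1] by (auto simp: kW_def)
qed

lemma bb_inner3: assumes "bb h"
  shows "bb (\<lambda>y. \<integral>z. h z * of_bool (x + y / 2 + z / 3 < t) \<partial>\<rho>)"
    and "bb (\<lambda>x. \<integral>z. h z * of_bool (x + y / 2 + z / 3 < t) \<partial>\<rho>)"
proof -
  note [measurable] = inner3(1)[OF assms, of t]
  have a: "(\<lambda>y. (\<lambda>p. \<integral>z. h z * of_bool (fst p + snd p / 2 + z / 3 < t) \<partial>\<rho>) (x, y)) \<in> borel_measurable borel"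
    by (rule measurable_compose[OF _ inner3(1)[OF assms]]) measurable
  have b: "(\<lambda>x. (\<lambda>p. \<integral>z. h z * of_bool (fst p + snd p / 2 + z / 3 < t) \<partial>\<rho>) (x, y)) \<in> borel_measurable borel"
    by (rule measurable_compose[OF _ inner3(1)[OF assms]]) measurable
  from inner3(2)[OF assms, of t] obtain C where "\<forall>p. \<bar>\<integral>z. h z * of_bool (fst p + snd p / 2 + z / 3 < t) \<partial>\<rho>\<bar> \<le> C" by blast
  then have "\<bar>\<integral>z. h z * of_bool (x + y / 2 + z / 3 < t) \<partial>\<rho>\<bar> \<le> C" for x y
    by (metis fst_conv snd_conv)
  then show "bb (\<lambda>y. \<integral>z. h z * of_bool (x + y / 2 + z / 3 < t) \<partial>\<rho>)"
    "bb (\<lambda>x. \<integral>z. h z * of_bool (x + y / 2 + z / 3 < t) \<partial>\<rho>)"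
    using a b by (auto simp: bb_def)
qed

lemma bb_inner2: assumes "bb g"
  shows "bb (\<lambda>x. \<integral>y. g y * of_bool (x + y / 2 + z / 3 < t) \<partial>\<nu>)"
    and "bb (\<lambda>z. \<integral>y. g y * of_bool (x + y / 2 + z / 3 < t) \<partial>\<nu>)"
proof -
  have a: "(\<lambda>z. (\<lambda>p. \<integral>y. g y * of_bool (fst p + y / 2 + snd p / 3 < t) \<partial>\<nu>) (x, z)) \<in> borel_measurable borel"
    by (rule measurable_compose[OF _ inner2(1)[OF assms]]) measurable
  have b: "(\<lambda>x. (\<lambda>p. \<integral>y. g y * of_bool (fst p + y / 2 + snd p / 3 < t) \<partial>\<nu>) (x, z)) \<in> borel_measurable borel"
    by (rule measurable_compose[OF _ inner2(1)[OF assms]]) measurable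
  from inner2(2)[OF assms, of t] obtain C where "\<forall>p. \<bar>\<integral>y. g y * of_bool (fst p + y / 2 + snd p / 3 < t) \<partial>\<nu>\<bar> \<le> C" by blast
  then have "\<bar>\<integral>y. g y * of_bool (x + y / 2 + z / 3 < t) \<partial>\<nu>\<bar> \<le> C" for x z
    by (metis fst_conv snd_conv)
  then show "bb (\<lambda>x. \<integral>y. g y * of_bool (x + y / 2 + z / 3 < t) \<partial>\<nu>)"
    "bb (\<lambda>z. \<integral>y. g y * of_bool (x + y / 2 + z / 3 < t) \<partial>\<nu>)"
    using a b by (auto simp: bb_def)
qed

lemma bb_sl:
  shows "bb g \<Longrightarrow> bb h \<Longrightarrow> bb (sl1 \<nu> \<rho> g h t)"
    and "bb f \<Longrightarrow> bb h \<Longrightarrow> bb (sl2 \<mu> \<rho> f h t)"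
    and "bb f \<Longrightarrow> bb g \<Longrightarrow> bb (sl3 \<mu> \<nu> f g t)"
proof -
  assume A: "bb g" "bb h"
  obtain C where C: "\<And>p. \<bar>\<integral>z. h z * of_bool (fst p + snd p / 2 + z / 3 < t) \<partial>\<rho>\<bar> \<le> C" using inner3(2)[OF A(2), of t] by blast
  show "bb (sl1 \<nu> \<rho> g h t)"
    using bounded_gen[OF m2.real_distribution_axioms A(1) inner3(1)[OF A(2), of t] C] by (auto simp: bb_def sl1_def[abs_def])
next
  assume A: "bb f" "bb h"
  obtain C where C: "\<And>p. \<bar>\<integral>z. h z * of_bool (fst p + snd p / 2 + z / 3 < t) \<partial>\<rho>\<bar> \<le> C" using inner3(2)[OF A(2), of t] by blast
  have m: "(\<lambda>p. (\<lambda>p. \<integral>z. h z * of_bool (fst p + snd p / 2 + z / 3 < t) \<partial>\<rho>) (snd p, fst p)) \<in> borel_measurable (borel \<Otimes>\<^sub>M borel)"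
    by (rule measurable_compose[OF _ inner3(1)[OF A(2)]]) measurable
  show "bb (sl2 \<mu> \<rho> f h t)"
    using bounded_gen[OF m1.real_distribution_axioms A(1) m, of C] C[of "(_,_)"] by (auto simp: bb_def sl2_def[abs_def])
next
  assume A: "bb f" "bb g"
  obtain C where C: "\<And>p. \<bar>\<integral>y. g y * of_bool (fst p + y / 2 + snd p / 3 < t) \<partial>\<nu>\<bar> \<le> C" using inner2(2)[OF A(2), of t] by blast
  have m: "(\<lambda>p. (\<lambda>p. \<integral>y. g y * of_bool (fst p + y / 2 + snd p / 3 < t) \<partial>\<nu>) (snd p, fst p)) \<in> borel_measurable (borel \<Otimes>\<^sub>M borel)"
    by (rule measurable_compose[OF _ inner2(1)[OF A(2)]]) measurable
  show "bb (sl3 \<mu> \<nu> f g t)"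
    using bounded_gen[OF m1.real_distribution_axioms A(1) m, of C] C[of "(_,_)"] by (auto simp: bb_def sl3_def[abs_def])
qed

lemma tri_sl1: "tri \<mu> \<nu> \<rho> f g h t = (\<integral>x. f x * sl1 \<nu> \<rho> g h t x \<partial>\<mu>)"
  by (simp add: tri_def sl1_def)

lemma tri_sl2: assumes "bb f" "bb g" "bb h"
  shows "tri \<mu> \<nu> \<rho> f g h t = (\<integral>y. g y * sl2 \<mu> \<rho> f h t y \<partial>\<nu>)"
proof -
  define \<phi> where "\<phi> p = f (fst p) * (g (snd p) * (\<integral>z. h z * of_bool (fst p + snd p / 2 + z / 3 < t) \<partial>\<rho>))" for p
  note [measurable] = inner3(1)[OF assms(3), of t]
  have [measurable]: "f \<in> borel_measurable borel" "g \<in> borel_measurable borel" using assms by auto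
  have m: "\<phi> \<in> borel_measurable (borel \<Otimes>\<^sub>M borel)" unfolding \<phi>_def by measurable
  obtain A where A: "A \<ge> 0" "\<And>x. \<bar>f x\<bar> \<le> A" using bb_bound[OF assms(1)] by blast
  obtain B where B: "B \<ge> 0" "\<And>x. \<bar>g x\<bar> \<le> B" using bb_bound[OF assms(2)] by blast
  obtain C where C: "\<And>p. \<bar>\<integral>z. h z * of_bool (fst p + snd p / 2 + z / 3 < t) \<partial>\<rho>\<bar> \<le> C" using inner3(2)[OF assms(3), of t] by blast
  have "\<bar>\<phi> p\<bar> \<le> A * (B * C)" for p
    unfolding \<phi>_def abs_mult using A B C by (intro mult_mono mult_nonneg_nonneg) auto
  from real_distribution_fubini[OF m1.real_distribution_axioms m2.real_distribution_axioms m this]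
  have "(\<integral>x. \<integral>y. \<phi> (x, y) \<partial>\<nu> \<partial>\<mu>) = (\<integral>y. \<integral>x. \<phi> (x, y) \<partial>\<mu> \<partial>\<nu>)" .
  moreover have "(\<integral>x. \<integral>y. \<phi> (x, y) \<partial>\<nu> \<partial>\<mu>) = tri \<mu> \<nu> \<rho> f g h t"
    by (simp add: \<phi>_def tri_def)
  moreover have "(\<integral>x. \<phi> (x, y) \<partial>\<mu>) = g y * sl2 \<mu> \<rho> f h t y" for y
    unfolding \<phi>_def sl2_def fst_conv snd_conv by (simp add: mult.left_commute[of _ "g y"])
  ultimately show ?thesis by simp
qed

lemma inner_swap: assumes "bb g" "bb h"
  shows "(\<integral>y. g y * (\<integral>z. h z * of_bool (x + y / 2 + z / 3 < t) \<partial>\<rho>) \<partial>\<nu>) =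
         (\<integral>z. h z * (\<integral>y. g y * of_bool (x + y / 2 + z / 3 < t) \<partial>\<nu>) \<partial>\<rho>)"
proof -
  define \<phi> where "\<phi> p = g (fst p) * (h (snd p) * of_bool (x + fst p / 2 + snd p / 3 < t))" for p
  have [measurable]: "h \<in> borel_measurable borel" "g \<in> borel_measurable borel" using assms by auto
  have m: "\<phi> \<in> borel_measurable (borel \<Otimes>\<^sub>M borel)" unfolding \<phi>_def by measurable
  obtain A where A: "A \<ge> 0" "\<And>x. \<bar>h x\<bar> \<le> A" using bb_bound[OF assms(2)] by blast
  obtain B where B: "B \<ge> 0" "\<And>x. \<bar>g x\<bar> \<le> B" using bb_bound[OF assms(1)] by blast
  have "\<bar>\<phi> p\<bar> \<le> B * (A * 1)" for p
    unfolding \<phi>_def abs_mult using A B by (intro mult_mono mult_nonneg_nonneg) auto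
  from real_distribution_fubini[OF m2.real_distribution_axioms m3.real_distribution_axioms m this]
  have "(\<integral>x. \<integral>y. \<phi> (x, y) \<partial>\<rho> \<partial>\<nu>) = (\<integral>y. \<integral>x. \<phi> (x, y) \<partial>\<nu> \<partial>\<rho>)" .
  moreover have "(\<integral>y. \<phi> (z, y) \<partial>\<rho>) = g z * (\<integral>y. h y * of_bool (x + z / 2 + y / 3 < t) \<partial>\<rho>)" for z
    by (simp add: \<phi>_def)
  moreover have "(\<integral>y. \<phi> (y, z) \<partial>\<nu>) = h z * (\<integral>y. g y * of_bool (x + y / 2 + z / 3 < t) \<partial>\<nu>)" for z
    unfolding \<phi>_def fst_conv snd_conv by (simp add: mult.left_commute[of _ "h z"])
  ultimately show ?thesis by simp
qed

lemma tri_sl3: assumes "bb f" "bb g" "bb h"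
  shows "tri \<mu> \<nu> \<rho> f g h t = (\<integral>z. h z * sl3 \<mu> \<nu> f g t z \<partial>\<rho>)"
proof -
  define \<phi> where "\<phi> p = f (fst p) * (h (snd p) * (\<integral>y. g y * of_bool (fst p + y / 2 + snd p / 3 < t) \<partial>\<nu>))" for p
  note [measurable] = inner2(1)[OF assms(2), of t]
  have [measurable]: "f \<in> borel_measurable borel" "h \<in> borel_measurable borel" using assms by auto
  have m: "\<phi> \<in> borel_measurable (borel \<Otimes>\<^sub>M borel)" unfolding \<phi>_def by measurable
  obtain A where A: "A \<ge> 0" "\<And>x. \<bar>f x\<bar> \<le> A" using bb_bound[OF assms(1)] by blast
  obtain B where B: "B \<ge> 0" "\<And>x. \<bar>h x\<bar> \<le> B" using bb_bound[OF assms(3)] by blast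
  obtain C where C: "\<And>p. \<bar>\<integral>y. g y * of_bool (fst p + y / 2 + snd p / 3 < t) \<partial>\<nu>\<bar> \<le> C" using inner2(2)[OF assms(2), of t] by blast
  have "\<bar>\<phi> p\<bar> \<le> A * (B * C)" for p
    unfolding \<phi>_def abs_mult using A B C by (intro mult_mono mult_nonneg_nonneg) auto
  from real_distribution_fubini[OF m1.real_distribution_axioms m3.real_distribution_axioms m this]
  have "(\<integral>x. \<integral>y. \<phi> (x, y) \<partial>\<rho> \<partial>\<mu>) = (\<integral>y. \<integral>x. \<phi> (x, y) \<partial>\<mu> \<partial>\<rho>)" .
  moreover have "(\<integral>x. \<integral>y. \<phi> (x, y) \<partial>\<rho> \<partial>\<mu>) = tri \<mu> \<nu> \<rho> f g h t"
    unfolding tri_def inner_swap[OF assms(2,3)] by (simp add: \<phi>_def)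
  moreover have "(\<integral>x. \<phi> (x, y) \<partial>\<mu>) = h y * sl3 \<mu> \<nu> f g t y" for y
    unfolding \<phi>_def sl3_def fst_conv snd_conv by (simp add: mult.left_commute[of _ "h y"])
  ultimately show ?thesis by simp
qed

lemma sl2_swap: assumes "bb f" "bb h"
  shows "sl2 \<mu> \<rho> f h t y = (\<integral>z. h z * (\<integral>x. f x * of_bool (x + y / 2 + z / 3 < t) \<partial>\<mu>) \<partial>\<rho>)"
proof -
  define \<phi> where "\<phi> p = f (fst p) * (h (snd p) * of_bool (fst p + y / 2 + snd p / 3 < t))" for p
  have [measurable]: "h \<in> borel_measurable borel" "f \<in> borel_measurable borel" using assms by auto
  have m: "\<phi> \<in> borel_measurable (borel \<Otimes>\<^sub>M borel)" unfolding \<phi>_def by measurable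
  obtain A where A: "A \<ge> 0" "\<And>x. \<bar>h x\<bar> \<le> A" using bb_bound[OF assms(2)] by blast
  obtain B where B: "B \<ge> 0" "\<And>x. \<bar>f x\<bar> \<le> B" using bb_bound[OF assms(1)] by blast
  have "\<bar>\<phi> p\<bar> \<le> B * (A * 1)" for p
    unfolding \<phi>_def abs_mult using A B by (intro mult_mono mult_nonneg_nonneg) auto
  from real_distribution_fubini[OF m1.real_distribution_axioms m3.real_distribution_axioms m this]
  have "(\<integral>x. \<integral>y. \<phi> (x, y) \<partial>\<rho> \<partial>\<mu>) = (\<integral>y. \<integral>x. \<phi> (x, y) \<partial>\<mu> \<partial>\<rho>)" .
  moreover have "(\<integral>y. \<phi> (z, y) \<partial>\<rho>) = f z * (\<integral>w. h w * of_bool (z + y / 2 + w / 3 < t) \<partial>\<rho>)" for z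
    by (simp add: \<phi>_def)
  moreover have "(\<integral>y. \<phi> (y, z) \<partial>\<mu>) = h z * (\<integral>x. f x * of_bool (x + y / 2 + z / 3 < t) \<partial>\<mu>)" for z
    unfolding \<phi>_def fst_conv snd_conv by (simp add: mult.left_commute[of _ "h z"])
  ultimately show ?thesis by (simp add: sl2_def)
qed

lemma tri_lin1: assumes "bb f" "bb f'" "bb g" "bb h"
  shows "tri \<mu> \<nu> \<rho> (\<lambda>x. a * f x + b * f' x) g h t = a * tri \<mu> \<nu> \<rho> f g h t + b * tri \<mu> \<nu> \<rho> f' g h t"
proof -
  have i: "integrable \<mu> (\<lambda>x. f x * sl1 \<nu> \<rho> g h t x)" "integrable \<mu> (\<lambda>x. f' x * sl1 \<nu> \<rho> g h t x)"
    using assms by (auto intro!: m1.bb_integrable bb_sl)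
  show ?thesis unfolding tri_sl1 by (simp add: distrib_right mult.assoc i)
qed

lemma tri_lin2: assumes "bb f" "bb g" "bb g'" "bb h"
  shows "tri \<mu> \<nu> \<rho> f (\<lambda>x. a * g x + b * g' x) h t = a * tri \<mu> \<nu> \<rho> f g h t + b * tri \<mu> \<nu> \<rho> f g' h t"
proof -
  have i: "integrable \<nu> (\<lambda>x. g x * sl2 \<mu> \<rho> f h t x)" "integrable \<nu> (\<lambda>x. g' x * sl2 \<mu> \<rho> f h t x)"
    using assms by (auto intro!: m2.bb_integrable bb_sl)
  have "bb (\<lambda>x. a * g x + b * g' x)" by (intro bb_add bb_mult bb_const assms)
  then show ?thesis using assms by (simp add: tri_sl2 distrib_right mult.assoc i)
qed

lemma tri_lin3: assumes "bb f" "bb g" "bb h" "bb h'"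
  shows "tri \<mu> \<nu> \<rho> f g (\<lambda>x. a * h x + b * h' x) t = a * tri \<mu> \<nu> \<rho> f g h t + b * tri \<mu> \<nu> \<rho> f g h' t"
proof -
  have i: "integrable \<rho> (\<lambda>x. h x * sl3 \<mu> \<nu> f g t x)" "integrable \<rho> (\<lambda>x. h' x * sl3 \<mu> \<nu> f g t x)"
    using assms by (auto intro!: m3.bb_integrable bb_sl)
  have "bb (\<lambda>x. a * h x + b * h' x)" by (intro bb_add bb_mult bb_const assms)
  then show ?thesis using assms by (simp add: tri_sl3 distrib_right mult.assoc i)
qed

lemma tri_abs: assumes "bb f" "bb g" "bb h"
  shows "\<bar>tri \<mu> \<nu> \<rho> f g h t\<bar> \<le> (\<integral>x. \<bar>f x\<bar> \<partial>\<mu>) * (\<integral>x. \<bar>g x\<bar> \<partial>\<nu>) * (\<integral>x. \<bar>h x\<bar> \<partial>\<rho>)"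
proof -
  let ?H = "\<integral>x. \<bar>h x\<bar> \<partial>\<rho>" and ?G = "\<integral>x. \<bar>g x\<bar> \<partial>\<nu>"
  have 1: "\<bar>\<integral>z. h z * of_bool (x + y / 2 + z / 3 < t) \<partial>\<rho>\<bar> \<le> ?H" for x y
  proof -
    have "bb (\<lambda>z. h z * of_bool (x + y / 2 + z / 3 < t))" using assms by (intro bb_mult bb_of_bool) auto
    have "\<bar>\<integral>z. h z * of_bool (x + y / 2 + z / 3 < t) \<partial>\<rho>\<bar> \<le> (\<integral>z. \<bar>h z * of_bool (x + y / 2 + z / 3 < t)\<bar> \<partial>\<rho>)"
      by (rule integral_abs_bound_rd)
    also have "\<dots> \<le> ?H"
      using \<open>bb (\<lambda>z. h z * of_bool (x + y / 2 + z / 3 < t))\<close> assms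
      by (intro integral_mono m3.bb_integrable bb_abs) (auto simp: abs_mult)
    finally show ?thesis .
  qed
  have 2: "\<bar>sl1 \<nu> \<rho> g h t x\<bar> \<le> ?G * ?H" for x
  proof -
    have b: "bb (\<lambda>y. g y * (\<integral>z. h z * of_bool (x + y / 2 + z / 3 < t) \<partial>\<rho>))"
      using assms by (intro bb_mult bb_inner3)
    have "\<bar>sl1 \<nu> \<rho> g h t x\<bar> \<le> (\<integral>y. \<bar>g y * (\<integral>z. h z * of_bool (x + y / 2 + z / 3 < t) \<partial>\<rho>)\<bar> \<partial>\<nu>)"
      unfolding sl1_def by (rule integral_abs_bound_rd)
    also have "\<dots> \<le> (\<integral>y. \<bar>g y\<bar> * ?H \<partial>\<nu>)"
      using assms b by (intro integral_mono m2.bb_integrable bb_abs bb_mult[OF bb_abs bb_const] b) (auto simp: abs_mult intro!: mult_left_mono 1)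
    finally show ?thesis by simp
  qed
  have b: "bb (\<lambda>x. f x * sl1 \<nu> \<rho> g h t x)"
    using assms by (intro bb_mult bb_sl)
  have "\<bar>tri \<mu> \<nu> \<rho> f g h t\<bar> \<le> (\<integral>x. \<bar>f x * sl1 \<nu> \<rho> g h t x\<bar> \<partial>\<mu>)"
    unfolding tri_sl1 by (rule integral_abs_bound_rd)
  also have "\<dots> \<le> (\<integral>x. \<bar>f x\<bar> * (?G * ?H) \<partial>\<mu>)"
    using assms b by (intro integral_mono m1.bb_integrable bb_abs bb_mult[OF bb_abs bb_const] b) (auto simp: abs_mult intro!: mult_left_mono 2)
  finally show ?thesis by simp
qed

lemma tri_mono: assumes "bb f" "bb g" "bb h" "bb f'" "bb g'" "bb h'"
  "\<And>x. 0 \<le> f x" "\<And>x. f x \<le> f' x" "\<And>x. 0 \<le> g x" "\<And>x. g x \<le> g' x" "\<And>x. 0 \<le> h x" "\<And>x. h x \<le> h' x"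
  shows "0 \<le> tri \<mu> \<nu> \<rho> f g h t" "tri \<mu> \<nu> \<rho> f g h t \<le> tri \<mu> \<nu> \<rho> f' g' h' t"
proof -
  have h0: "bb (\<lambda>z. h z * of_bool (x + y / 2 + z / 3 < t))" "bb (\<lambda>z. h' z * of_bool (x + y / 2 + z / 3 < t))" for x y
    using assms by (auto intro!: bb_mult bb_of_bool)
  have 1: "0 \<le> (\<integral>z. h z * of_bool (x + y / 2 + z / 3 < t) \<partial>\<rho>)"
    "(\<integral>z. h z * of_bool (x + y / 2 + z / 3 < t) \<partial>\<rho>) \<le> (\<integral>z. h' z * of_bool (x + y / 2 + z / 3 < t) \<partial>\<rho>)" for x y
    using assms m3.bb_integrable[OF h0(1)] m3.bb_integrable[OF h0(2)]
    by (auto intro!: integral_mono integral_nonneg_AE mult_right_mono)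
  have 0: "0 \<le> (\<integral>z. h' z * of_bool (x + y / 2 + z / 3 < t) \<partial>\<rho>)" for x y
    using 1 order_trans by blast
  have 3: "0 \<le> g' x" "0 \<le> h' x" "0 \<le> f' x" for x using assms order_trans by blast+
  have 2: "0 \<le> sl1 \<nu> \<rho> g h t x" "sl1 \<nu> \<rho> g h t x \<le> sl1 \<nu> \<rho> g' h' t x" for x
    unfolding sl1_def using assms 0 1 3
    by (auto intro!: integral_mono[of \<nu>] m2.bb_integrable bb_mult bb_inner3 integral_nonneg_AE mult_mono)
  show "0 \<le> tri \<mu> \<nu> \<rho> f g h t" "tri \<mu> \<nu> \<rho> f g h t \<le> tri \<mu> \<nu> \<rho> f' g' h' t"
    unfolding tri_sl1 using assms 2 3
    by (auto intro!: integral_mono m1.bb_integrable bb_mult bb_sl integral_nonneg_AE mult_mono)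
qed

end

section \<open>The Kolmogorov distance and the empirical measure\<close>

abbreviation one :: "real \<Rightarrow> real" where "one \<equiv> \<lambda>_. 1"

abbreviation W3 :: "real measure \<Rightarrow> real measure \<Rightarrow> real measure \<Rightarrow> real \<Rightarrow> real" where
  "W3 \<mu> \<nu> \<rho> t \<equiv> tri \<mu> \<nu> \<rho> one one one t"

definition Tf :: "real measure \<Rightarrow> real \<Rightarrow> real" where
  "Tf \<mu> t = (lcdf \<mu> t) ^ 3 - W3 \<mu> \<mu> \<mu> t"

lemma (in real_distribution) int_diff_le:
  assumes "bb f" "bb g" "\<And>x. \<bar>f x - g x\<bar> \<le> e"
  shows "\<bar>(\<integral>x. f x \<partial>M) - (\<integral>x. g x \<partial>M)\<bar> \<le> e"
proof -
  have "(\<integral>x. f x \<partial>M) - (\<integral>x. g x \<partial>M) = (\<integral>x. f x - g x \<partial>M)"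
    using assms by (simp add: bb_integrable)
  moreover have "(\<lambda>x. f x - g x) \<in> borel_measurable borel" by (rule bb_meas[OF bb_diff[OF assms(1,2)]])
  ultimately show ?thesis using abs_integral_le[of "\<lambda>x. f x - g x" e] assms(3) by simp
qed

lemma (in real_distribution) lcdf_nonneg [simp]: "0 \<le> lcdf M x"
  and lcdf_le_1 [simp]: "lcdf M x \<le> 1"
  by (simp_all add: lcdf_def)

lemma (in real_distribution) lcdf_mono: "x \<le> y \<Longrightarrow> lcdf M x \<le> lcdf M y"
  unfolding lcdf_def by (intro finite_measure_mono) auto

lemma (in real_distribution) integral_of_bool_lt: "(\<integral>z. of_bool (z < c) \<partial>M) = lcdf M c"
proof -
  have "(\<lambda>z. of_bool (z < c) :: real) = indicator {..<c}" by (auto simp: indicator_def)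
  then show ?thesis by (simp add: lcdf_def)
qed

context three
begin

lemma bb_inner1: assumes "bb f"
  shows "bb (\<lambda>y. \<integral>x. f x * of_bool (x + y / 2 + z / 3 < t) \<partial>\<mu>)"
    and "bb (\<lambda>z. \<integral>x. f x * of_bool (x + y / 2 + z / 3 < t) \<partial>\<mu>)"
proof -
  have a: "(\<lambda>z. (\<lambda>p. \<integral>x. f x * of_bool (x + fst p / 2 + snd p / 3 < t) \<partial>\<mu>) (y, z)) \<in> borel_measurable borel"
    by (rule measurable_compose[OF _ inner1(1)[OF assms]]) measurable
  have b: "(\<lambda>y. (\<lambda>p. \<integral>x. f x * of_bool (x + fst p / 2 + snd p / 3 < t) \<partial>\<mu>) (y, z)) \<in> borel_measurable borel"
    by (rule measurable_compose[OF _ inner1(1)[OF assms]]) measurable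
  from inner1(2)[OF assms, of t] obtain C where "\<forall>p. \<bar>\<integral>x. f x * of_bool (x + fst p / 2 + snd p / 3 < t) \<partial>\<mu>\<bar> \<le> C" by blast
  then have "\<bar>\<integral>x. f x * of_bool (x + y / 2 + z / 3 < t) \<partial>\<mu>\<bar> \<le> C" for y z
    by (metis fst_conv snd_conv)
  then show "bb (\<lambda>y. \<integral>x. f x * of_bool (x + y / 2 + z / 3 < t) \<partial>\<mu>)"
    "bb (\<lambda>z. \<integral>x. f x * of_bool (x + y / 2 + z / 3 < t) \<partial>\<mu>)"
    using a b by (auto simp: bb_def)
qed

lemma W3_slice3: "(\<integral>z. 1 * of_bool (x + y / 2 + z / 3 < t) \<partial>\<rho>) = lcdf \<rho> (3 * (t - x - y / 2))"
proof -
  have "(x + y / 2 + z / 3 < t) = (z < 3 * (t - x - y / 2))" for z by (auto simp: field_simps)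
  then show ?thesis by (simp add: m3.integral_of_bool_lt)
qed

lemma W3_slice2: "(\<integral>y. 1 * of_bool (x + y / 2 + z / 3 < t) \<partial>\<nu>) = lcdf \<nu> (2 * (t - x - z / 3))"
proof -
  have "(x + y / 2 + z / 3 < t) = (y < 2 * (t - x - z / 3))" for y by (auto simp: field_simps)
  then show ?thesis by (simp add: m2.integral_of_bool_lt)
qed

text \<open>Integrating out one variable leaves a distribution function, so that replacing one of the three
  laws costs at most its Kolmogorov distance.\<close>

lemma W3_slice1: "(\<integral>x. 1 * of_bool (x + y / 2 + z / 3 < t) \<partial>\<mu>) = lcdf \<mu> (t - y / 2 - z / 3)"
proof -
  have "(x + y / 2 + z / 3 < t) = (x < t - y / 2 - z / 3)" for x by (auto simp: field_simps)
  then show ?thesis by (simp add: m1.integral_of_bool_lt)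
qed

lemma W3_diff3:
  assumes "real_distribution \<rho>'" "\<And>x. \<bar>lcdf \<rho> x - lcdf \<rho>' x\<bar> \<le> e"
  shows "\<bar>W3 \<mu> \<nu> \<rho> t - W3 \<mu> \<nu> \<rho>' t\<bar> \<le> e"
proof -
  interpret T: three \<mu> \<nu> \<rho>' using assms(1) by (simp add: three_def m1.real_distribution_axioms m2.real_distribution_axioms)
  have "\<bar>sl1 \<nu> \<rho> one one t x - sl1 \<nu> \<rho>' one one t x\<bar> \<le> e" for x
    unfolding sl1_def
    by (rule m2.int_diff_le[OF bb_mult[OF bb_const bb_inner3(1)[OF bb_const]] bb_mult[OF bb_const T.bb_inner3(1)[OF bb_const]]])
       (simp only: W3_slice3[unfolded mult_1] T.W3_slice3[unfolded mult_1] mult_1 assms)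
  then show ?thesis unfolding tri_sl1 T.tri_sl1
    by (intro m1.int_diff_le bb_mult bb_const bb_sl T.bb_sl) auto
qed

lemma W3_diff2:
  assumes "real_distribution \<nu>'" "\<And>x. \<bar>lcdf \<nu> x - lcdf \<nu>' x\<bar> \<le> e"
  shows "\<bar>W3 \<mu> \<nu> \<rho> t - W3 \<mu> \<nu>' \<rho> t\<bar> \<le> e"
proof -
  interpret T: three \<mu> \<nu>' \<rho> using assms(1) by (simp add: three_def m1.real_distribution_axioms m3.real_distribution_axioms)
  have "\<bar>sl1 \<nu> \<rho> one one t x - sl1 \<nu>' \<rho> one one t x\<bar> \<le> e" for x
    unfolding sl1_def inner_swap[OF bb_const bb_const] T.inner_swap[OF bb_const bb_const]
    by (rule m3.int_diff_le[OF bb_mult[OF bb_const bb_inner2(2)[OF bb_const]] bb_mult[OF bb_const T.bb_inner2(2)[OF bb_const]]])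
       (simp only: W3_slice2[unfolded mult_1] T.W3_slice2[unfolded mult_1] mult_1 assms)
  then show ?thesis unfolding tri_sl1 T.tri_sl1
    by (intro m1.int_diff_le bb_mult bb_const bb_sl T.bb_sl) auto
qed

lemma W3_diff1:
  assumes "real_distribution \<mu>'" "\<And>x. \<bar>lcdf \<mu> x - lcdf \<mu>' x\<bar> \<le> e"
  shows "\<bar>W3 \<mu> \<nu> \<rho> t - W3 \<mu>' \<nu> \<rho> t\<bar> \<le> e"
proof -
  interpret T: three \<mu>' \<nu> \<rho> using assms(1) by (simp add: three_def m2.real_distribution_axioms m3.real_distribution_axioms)
  have "\<bar>sl2 \<mu> \<rho> one one t y - sl2 \<mu>' \<rho> one one t y\<bar> \<le> e" for y
    unfolding sl2_swap[OF bb_const bb_const] T.sl2_swap[OF bb_const bb_const]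
    by (rule m3.int_diff_le[OF bb_mult[OF bb_const bb_inner1(2)[OF bb_const]] bb_mult[OF bb_const T.bb_inner1(2)[OF bb_const]]]) (simp only: W3_slice1[unfolded mult_1] T.W3_slice1[unfolded mult_1] mult_1 assms)
  then show ?thesis unfolding tri_sl2[OF bb_const bb_const bb_const] T.tri_sl2[OF bb_const bb_const bb_const]
    by (intro m2.int_diff_le bb_mult bb_const bb_sl T.bb_sl) auto
qed

end

lemma W3_kolmogorov:
  assumes "real_distribution \<mu>" "real_distribution \<nu>" "real_distribution \<rho>"
    "real_distribution \<mu>'" "real_distribution \<nu>'" "real_distribution \<rho>'"
    and "\<And>x. \<bar>lcdf \<mu> x - lcdf \<mu>' x\<bar> \<le> e1" "\<And>x. \<bar>lcdf \<nu> x - lcdf \<nu>' x\<bar> \<le> e2" "\<And>x. \<bar>lcdf \<rho> x - lcdf \<rho>' x\<bar> \<le> e3"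
  shows "\<bar>W3 \<mu> \<nu> \<rho> t - W3 \<mu>' \<nu>' \<rho>' t\<bar> \<le> e1 + e2 + e3"
proof -
  interpret A: three \<mu> \<nu> \<rho> using assms by (simp add: three_def)
  interpret B: three \<mu>' \<nu> \<rho> using assms by (simp add: three_def)
  interpret C: three \<mu>' \<nu>' \<rho> using assms by (simp add: three_def)
  have "\<bar>W3 \<mu> \<nu> \<rho> t - W3 \<mu>' \<nu> \<rho> t\<bar> \<le> e1" by (rule A.W3_diff1[OF assms(4,7)])
  moreover have "\<bar>W3 \<mu>' \<nu> \<rho> t - W3 \<mu>' \<nu>' \<rho> t\<bar> \<le> e2" by (rule B.W3_diff2[OF assms(5,8)])
  moreover have "\<bar>W3 \<mu>' \<nu>' \<rho> t - W3 \<mu>' \<nu>' \<rho>' t\<bar> \<le> e3" by (rule C.W3_diff3[OF assms(6,9)])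
  ultimately show ?thesis by linarith
qed

lemma cube_diff_le:
  fixes a b :: real
  assumes "0 \<le> a" "a \<le> 1" "0 \<le> b" "b \<le> 1" "\<bar>a - b\<bar> \<le> e"
  shows "\<bar>a ^ 3 - b ^ 3\<bar> \<le> 3 * e"
proof -
  have "a ^ 3 - b ^ 3 = (a - b) * (a\<^sup>2 + a * b + b\<^sup>2)" by (simp add: power2_eq_square power3_eq_cube algebra_simps)
  moreover have "\<bar>a\<^sup>2 + a * b + b\<^sup>2\<bar> \<le> 3"
  proof -
    have "a\<^sup>2 \<le> 1" "b\<^sup>2 \<le> 1" "a * b \<le> 1" using assms by (auto simp: power_le_one mult_le_one)
    moreover have "0 \<le> a\<^sup>2" "0 \<le> b\<^sup>2" "0 \<le> a * b" using assms by auto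
    ultimately show ?thesis by linarith
  qed
  ultimately have "\<bar>a ^ 3 - b ^ 3\<bar> \<le> e * 3" using assms(5) by (simp add: abs_mult mult_mono)
  then show ?thesis by simp
qed

text \<open>Three from the cube and one for each of the three slots of \<open>W3\<close>.\<close>

lemma Tf_kolmogorov:
  assumes "real_distribution \<mu>" "real_distribution \<nu>" "\<And>x. \<bar>lcdf \<mu> x - lcdf \<nu> x\<bar> \<le> e"
  shows "\<bar>Tf \<mu> t - Tf \<nu> t\<bar> \<le> 6 * e"
proof -
  interpret m: real_distribution \<mu> by fact
  interpret n: real_distribution \<nu> by fact
  have "\<bar>(lcdf \<mu> t) ^ 3 - (lcdf \<nu> t) ^ 3\<bar> \<le> 3 * e" by (rule cube_diff_le) (use assms(3) in auto)
  moreover have "\<bar>W3 \<mu> \<mu> \<mu> t - W3 \<nu> \<nu> \<nu> t\<bar> \<le> e + e + e" by (rule W3_kolmogorov) fact+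
  ultimately show ?thesis unfolding Tf_def by linarith
qed

definition emp :: "nat \<Rightarrow> (nat \<Rightarrow> real) \<Rightarrow> real measure" where
  "emp n x = distr (uniform_count_measure {1..n}) borel x"

lemma emp_rd: assumes "n \<ge> 1" shows "real_distribution (emp n x)"
proof -
  interpret prob_space "uniform_count_measure {1..n}"
    using assms by (intro prob_space_uniform_count_measure) auto
  show ?thesis unfolding emp_def by (intro real_distribution_distr) (simp add: measurable_def)
qed

lemma emp_integral: assumes "f \<in> borel_measurable borel"
  shows "(\<integral>y. f y \<partial>(emp n x)) = (\<Sum>i\<in>{1..n}. f (x i)) / real n"
proof -
  have "x \<in> measurable (uniform_count_measure {1..n}) borel" by (simp add: measurable_def)
  then have "(\<integral>y. f y \<partial>(emp n x)) = (\<integral>i. f (x i) \<partial>(uniform_count_measure {1..n}))"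
    unfolding emp_def using assms by (subst integral_distr) auto
  also have "\<dots> = (\<Sum>i\<in>{1..n}. f (x i)) / real n"
    by (simp add: uniform_count_measure_def lebesgue_integral_point_measure_finite sum_divide_distrib)
  finally show ?thesis .
qed

lemma emp_lcdf: assumes "n \<ge> 1" shows "lcdf (emp n x) t = (\<Sum>i\<in>{1..n}. of_bool (x i < t)) / real n"
proof -
  interpret real_distribution "emp n x" by (rule emp_rd[OF assms])
  show ?thesis using emp_integral[of "\<lambda>y. of_bool (y < t)" n x] integral_of_bool_lt[of t] by simp
qed

lemma emp_W3: assumes "n \<ge> 1"
  shows "W3 (emp n x) (emp n x) (emp n x) t =
    (\<Sum>i\<in>{1..n}. \<Sum>j\<in>{1..n}. \<Sum>k\<in>{1..n}. of_bool (x i + x j / 2 + x k / 3 < t)) / real n ^ 3"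
proof -
  interpret three "emp n x" "emp n x" "emp n x" using emp_rd[OF assms] by (simp add: three_def)
  have 1: "(\<integral>z. 1 * of_bool (a + b / 2 + z / 3 < t) \<partial>(emp n x)) = (\<Sum>k\<in>{1..n}. of_bool (a + b / 2 + x k / 3 < t)) / real n" for a b
    by (subst emp_integral) auto
  have 2: "sl1 (emp n x) (emp n x) one one t a = (\<Sum>j\<in>{1..n}. (\<Sum>k\<in>{1..n}. of_bool (a + x j / 2 + x k / 3 < t)) / real n) / real n" for a
  proof -
    have "(\<lambda>y. 1 * (\<integral>z. (1::real) * of_bool (a + y / 2 + z / 3 < t) \<partial>(emp n x))) \<in> borel_measurable borel"
      by (rule bb_meas[OF bb_mult[OF bb_const bb_inner3(1)[OF bb_const]]])
    from emp_integral[OF this] show ?thesis unfolding sl1_def 1 by simp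
  qed
  have "(\<lambda>a. 1 * sl1 (emp n x) (emp n x) one one t a) \<in> borel_measurable borel"
    by (rule bb_meas[OF bb_mult[OF bb_const bb_sl(1)[OF bb_const bb_const]]])
  from emp_integral[OF this] show ?thesis unfolding tri_sl1 2
    by (simp add: sum_divide_distrib power3_eq_cube)
qed

lemma sum_cube:
  fixes a :: "'i \<Rightarrow> real"
  shows "(\<Sum>i\<in>A. \<Sum>j\<in>A. \<Sum>k\<in>A. a i * a j * a k) = (\<Sum>i\<in>A. a i) ^ 3"
  by (simp only: sum_distrib_left[symmetric] sum_distrib_right[symmetric] power3_eq_cube)

lemma H3_eq: assumes "n \<ge> 1" shows "H3 n x t = (lcdf (emp n x) t) ^ 3"
proof -
  have "of_bool (max a (max b c) < t) = (of_bool (a < t) * of_bool (b < t) * of_bool (c < t) :: real)" for a b c :: real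
    by auto
  then show ?thesis unfolding H3_def emp_lcdf[OF assms] power_divide
    by (simp only: sum_cube) simp
qed

text \<open>Relabelling the summation indices makes the six permutations contribute equally, which cancels
  the factor \<open>3!\<close>.\<close>

lemma perm_sum3:
  fixes f :: "(nat \<Rightarrow> nat) \<Rightarrow> real"
  assumes "\<And>\<sigma>. f \<sigma> = g (\<sigma> 1) (\<sigma> 2) (\<sigma> 3)"
  shows "(\<Sum>\<sigma> | \<sigma> permutes {1, 2, 3::nat}. f \<sigma>) =
    g 1 2 3 + g 1 3 2 + g 2 1 3 + g 2 3 1 + g 3 2 1 + g 3 1 2"
proof -
  have e: "{\<sigma>. \<sigma> permutes {}} = {id :: nat \<Rightarrow> nat}" by auto
  show ?thesis
    by (simp add: sum_over_permutations_insert assms e transpose_def)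
qed

lemma G3_eq: assumes "n \<ge> 1" shows "G3 n x t = W3 (emp n x) (emp n x) (emp n x) t"
proof -
  define S where "S a b c = (\<Sum>i\<in>{1..n}. \<Sum>j\<in>{1..n}. \<Sum>k\<in>{1..n}. of_bool (x i / real a + x j / real b + x k / real c < t) :: real)" for a b c
  have s1: "S a b c = S b a c" for a b c
    unfolding S_def by (subst sum.swap) (simp add: add_ac)
  have s2: "S a b c = S a c b" for a b c
    unfolding S_def by (subst sum.swap[of _ "{1..n}" "{1..n}"]) (simp add: add_ac)
  have ps: "(\<Sum>\<sigma> | \<sigma> permutes {1, 2, 3::nat}. of_bool (x i / real (\<sigma> 1) + x j / real (\<sigma> 2) + x k / real (\<sigma> 3) < t) :: real) =
      (let g = (\<lambda>a b c. of_bool (x i / real a + x j / real b + x k / real c < t))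
       in g 1 2 3 + g 1 3 2 + g 2 1 3 + g 2 3 1 + g 3 2 1 + g 3 1 2)" for i j k
    unfolding Let_def by (rule perm_sum3) simp
  have "G3 n x t = 1 / (fact 3 * real n ^ 3) * (S 1 2 3 + S 1 3 2 + S 2 1 3 + S 2 3 1 + S 3 2 1 + S 3 1 2)"
    unfolding G3_def ps Let_def S_def sum.distrib ..
  also have "S 1 3 2 = S 1 2 3" by (rule s2)
  also have "S 2 1 3 = S 1 2 3" by (rule s1)
  also have "S 3 2 1 = S 1 2 3" using s1 s2 by metis
  also have "S 2 3 1 = S 1 2 3" using s1 s2 by metis
  also have "S 3 1 2 = S 1 2 3" using s1 s2 by metis
  finally show ?thesis unfolding emp_W3[OF assms] S_def by (simp add: fact_numeral)
qed

lemma HG_eq: assumes "n \<ge> 1" shows "H3 n x t - G3 n x t = Tf (emp n x) t"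
  using H3_eq[OF assms] G3_eq[OF assms] by (simp add: Tf_def)

lemma (in three) W3_bounds: "0 \<le> W3 \<mu> \<nu> \<rho> t" "W3 \<mu> \<nu> \<rho> t \<le> 1"
  using tri_mono(1)[of one one one one one one t] tri_abs[of one one one t] by (auto simp: m1.prob_space[simplified] m2.prob_space[simplified] m3.prob_space[simplified])

lemma Tf_abs_le: assumes "real_distribution \<mu>" shows "\<bar>Tf \<mu> t\<bar> \<le> 1"
proof -
  interpret three \<mu> \<mu> \<mu> using assms by (simp add: three_def)
  have "(lcdf \<mu> t) ^ 3 \<le> 1" "0 \<le> (lcdf \<mu> t) ^ 3" by (auto simp: power_le_one)
  then show ?thesis using W3_bounds[of t] unfolding Tf_def by linarith
qed

text \<open>The supremum exceeds a level exactly if one of its members does; this removes the supremum from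
  all that follows.\<close>

lemma D3_gt_iff: assumes "n \<ge> 1" shows "D3 n x > a \<longleftrightarrow> (\<exists>t\<ge>0. \<bar>Tf (emp n x) t\<bar> > a)"
proof -
  have "bdd_above ((\<lambda>t. \<bar>Tf (emp n x) t\<bar>) ` {0..})"
    using Tf_abs_le[OF emp_rd[OF assms]] by (intro bdd_aboveI[of _ 1]) auto
  then show ?thesis unfolding D3_def HG_eq[OF assms]
    by (subst less_cSUP_iff) auto
qed

section \<open>Relative entropy with respect to the exponential law\<close>

lemma std_exp_sets [measurable_cong, simp]: "sets std_exp = sets borel"
  by (simp add: std_exp_def)

lemma std_exp_prob: "prob_space std_exp"
  unfolding std_exp_def by (rule prob_space_exponential_density) simp

global_interpretation E: real_distribution std_exp
proof -
  interpret prob_space std_exp by (rule std_exp_prob)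
  show "real_distribution std_exp" by standard (simp_all add: std_exp_def)
qed

lemma std_exp_integral:
  assumes [measurable]: "f \<in> borel_measurable borel"
  shows "(\<integral>x. f x \<partial>std_exp) = (\<integral>x. exponential_density 1 x * f x \<partial>lborel)"
  unfolding std_exp_def using assms
  by (subst integral_density) (auto simp: exponential_density_def)

lemma std_exp_integral_exp:
  assumes "0 \<le> c"
  shows "b \<noteq> 1 \<Longrightarrow> (\<integral>s. of_bool (s < c) * exp (b * s) \<partial>std_exp) = (exp ((b - 1) * c) - 1) / (b - 1)"
    and "b = 1 \<Longrightarrow> (\<integral>s. of_bool (s < c) * exp (b * s) \<partial>std_exp) = c"
proof -
  have e: "(\<integral>s. of_bool (s < c) * exp (b * s) \<partial>std_exp) = (\<integral>s. exp ((b - 1) * s) * indicator {0..c} s \<partial>lborel)"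
  proof -
    have "(\<integral>s. of_bool (s < c) * exp (b * s) \<partial>std_exp) = (\<integral>s. exponential_density 1 s * (of_bool (s < c) * exp (b * s)) \<partial>lborel)"
      by (rule std_exp_integral) measurable
    also have "\<dots> = (\<integral>s. exp ((b - 1) * s) * indicator {0..c} s \<partial>lborel)"
    proof (rule integral_cong_AE)
      show "AE s in lborel. exponential_density 1 s * (of_bool (s < c) * exp (b * s)) = exp ((b - 1) * s) * indicator {0..c} s"
        using AE_lborel_singleton[of c]
        by eventually_elim (auto simp: exponential_density_def indicator_def exp_add[symmetric] algebra_simps)
    qed measurable
    finally show ?thesis .
  qed
  show "(\<integral>s. of_bool (s < c) * exp (b * s) \<partial>std_exp) = (exp ((b - 1) * c) - 1) / (b - 1)" if "b \<noteq> 1"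
  proof -
    have "(\<integral>s. exp ((b - 1) * s) * indicator {0..c} s \<partial>lborel) = exp ((b - 1) * c) / (b - 1) - exp ((b - 1) * 0) / (b - 1)"
      using assms that by (intro integral_FTC_Icc_real) (auto intro!: derivative_eq_intros)
    then show ?thesis unfolding e by (simp add: diff_divide_distrib)
  qed
  show "(\<integral>s. of_bool (s < c) * exp (b * s) \<partial>std_exp) = c" if "b = 1"
  proof -
    have "(\<integral>s. exp ((b - 1) * s) * indicator {0..c} s \<partial>lborel) = c - 0"
      using assms that by (intro integral_FTC_Icc_real) (auto intro!: derivative_eq_intros)
    then show ?thesis unfolding e by simp
  qed
qed

lemma lcdf_std_exp: "0 \<le> x \<Longrightarrow> lcdf std_exp x = 1 - exp (- x)"
  using std_exp_integral_exp(1)[of x 0] E.integral_of_bool_lt[of x] by simp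

lemma lcdf_std_exp_0: "x \<le> 0 \<Longrightarrow> lcdf std_exp x = 0"
  using E.lcdf_mono[of x 0] lcdf_std_exp[of 0] E.lcdf_nonneg[of x] by simp

lemma AE_std_exp: "AE x in std_exp. 0 \<le> x"
proof -
  have "E.prob {..<0} = 0" using lcdf_std_exp_0[of 0] by (simp add: lcdf_def)
  then have "AE x in std_exp. x \<notin> {..<0}"
    by (subst E.prob_eq_0[symmetric]) auto
  then show ?thesis by (auto simp: not_less)
qed

text \<open>Bounded densities suffice: the step densities of the types and all trial densities are bounded,
  and boundedness makes every moment below finite.\<close>

definition DQ :: "(real \<Rightarrow> real) \<Rightarrow> bool" where
  "DQ f \<longleftrightarrow> bb f \<and> (\<forall>x. 0 \<le> f x) \<and> (\<integral>x. f x \<partial>std_exp) = 1"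

definition Kl :: "(real \<Rightarrow> real) \<Rightarrow> real" where
  "Kl f = (\<integral>x. f x * ln (f x) \<partial>std_exp)"

definition Qd :: "(real \<Rightarrow> real) \<Rightarrow> real measure" where
  "Qd f = density std_exp (\<lambda>x. ennreal (f x))"

lemma DQ_D: "DQ f \<Longrightarrow> bb f" "DQ f \<Longrightarrow> 0 \<le> f x" "DQ f \<Longrightarrow> (\<integral>x. f x \<partial>std_exp) = 1"
  by (auto simp: DQ_def)

lemma Qd_integral: assumes "DQ f" "g \<in> borel_measurable borel"
  shows "(\<integral>x. g x \<partial>(Qd f)) = (\<integral>x. f x * g x \<partial>std_exp)"
  unfolding Qd_def using assms DQ_D[OF assms(1)]
  by (subst integral_density) (auto simp: bb_def)

lemma Qd_rd: assumes "DQ f" shows "real_distribution (Qd f)"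
proof -
  note [measurable] = bb_meas[OF DQ_D(1)[OF assms]]
  have "emeasure (Qd f) UNIV = (\<integral>\<^sup>+x. ennreal (f x) \<partial>std_exp)"
    unfolding Qd_def by (subst emeasure_density) (auto simp: std_exp_def)
  also have "\<dots> = ennreal (\<integral>x. f x \<partial>std_exp)"
    using DQ_D[OF assms] by (intro nn_integral_eq_integral E.bb_integrable) auto
  finally have "emeasure (Qd f) (space (Qd f)) = 1" using DQ_D[OF assms] by (simp add: Qd_def std_exp_def)
  then interpret prob_space "Qd f" by (rule prob_spaceI)
  show ?thesis by standard (simp_all add: Qd_def std_exp_def)
qed

lemma Qd_measure: assumes "DQ f" "A \<in> sets borel"
  shows "measure (Qd f) A = (\<integral>x. f x * indicator A x \<partial>std_exp)"
proof -
  interpret real_distribution "Qd f" by (rule Qd_rd[OF assms(1)])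
  show ?thesis using Qd_integral[OF assms(1), of "indicator A"] assms(2) by simp
qed

lemma mult_ln_bounds:
  fixes x :: real assumes "0 \<le> x" "x \<le> B"
  shows "\<bar>x * ln x\<bar> \<le> 1 + B * B"
proof (cases "x = 0")
  case False
  then have p: "x > 0" using assms by simp
  have "ln x \<le> x" using ln_bound[OF p] .
  then have u: "x * ln x \<le> B * B" using assms p by (meson mult_left_mono mult_mono order_trans less_imp_le)
  have "ln (1 / x) \<le> 1 / x - 1" using p by (intro ln_le_minus_one) simp
  then have "x * (- ln x) \<le> x * (1 / x - 1)" using p by (intro mult_left_mono) (auto simp: ln_div)
  then have "- (x * ln x) \<le> 1 - x" using p by (simp add: right_diff_distrib)
  then show ?thesis using u p by (smt (verit) zero_le_square)
qed simp

lemma bb_mult_ln: assumes "bb f" "\<And>x. 0 \<le> f x" shows "bb (\<lambda>x. f x * ln (f x))"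
proof -
  obtain B where B: "\<And>x. \<bar>f x\<bar> \<le> B" using bb_bound[OF assms(1)] by blast
  note [measurable] = bb_meas[OF assms(1)]
  have "\<bar>f x * ln (f x)\<bar> \<le> 1 + B * B" for x
    using mult_ln_bounds[of "f x" B] assms(2)[of x] B[of x] by linarith
  then show ?thesis by (intro bbI) measurable
qed

lemma bb_exp: assumes "bb f" shows "bb (\<lambda>x. exp (f x))"
proof -
  obtain B where B: "\<And>x. \<bar>f x\<bar> \<le> B" using bb_bound[OF assms(1)] by blast
  note [measurable] = bb_meas[OF assms(1)]
  have "\<bar>exp (f x)\<bar> \<le> exp B" for x using B[of x] by simp
  then show ?thesis by (intro bbI) measurable
qed

lemma young_ln: fixes x y :: real assumes "0 \<le> x" shows "x * y \<le> x * ln x - x + exp y"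
proof (cases "x = 0")
  case False
  then have p: "x > 0" using assms by simp
  have "1 + (y - ln x) \<le> exp (y - ln x)" by (rule exp_ge_add_one_self)
  then have "x * (1 + (y - ln x)) \<le> x * exp (y - ln x)" using p by simp
  also have "x * exp (y - ln x) = exp y" using p by (simp add: exp_diff)
  finally show ?thesis by (simp add: algebra_simps)
qed simp

text \<open>Young's inequality between \<open>x ln x - x\<close> and its conjugate \<open>exp\<close>,
  integrated pointwise. The form with \<open>- 1 + E exp \<psi>\<close> instead of the logarithm
  is weaker and sufficient.\<close>

lemma donsker_varadhan:
  assumes "DQ f" "bb \<psi>"
  shows "(\<integral>x. f x * \<psi> x \<partial>std_exp) \<le> Kl f - 1 + (\<integral>x. exp (\<psi> x) \<partial>std_exp)"
proof -
  note d = DQ_D[OF assms(1)]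
  have i: "integrable std_exp f" "integrable std_exp (\<lambda>x. f x * \<psi> x)" "integrable std_exp (\<lambda>x. f x * ln (f x))"
    "integrable std_exp (\<lambda>x. exp (\<psi> x))"
    using d assms by (auto intro!: E.bb_integrable bb_mult bb_mult_ln bb_exp)
  have "(\<integral>x. f x * \<psi> x \<partial>std_exp) \<le> (\<integral>x. f x * ln (f x) - f x + exp (\<psi> x) \<partial>std_exp)"
    using i d by (intro integral_mono young_ln) auto
  also have "\<dots> = Kl f - 1 + (\<integral>x. exp (\<psi> x) \<partial>std_exp)"
    using i d by (simp add: Kl_def)
  finally show ?thesis .
qed

lemma Kl_nonneg: assumes "DQ f" shows "0 \<le> Kl f"
  using donsker_varadhan[OF assms bb_const[of 0]] E.prob_space by simp

text \<open>Bounded entropy is uniform integrability: a set of small probability \<open>p\<close> carries at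
  most \<open>(K + 1) / ln (1/p)\<close> of the mass.\<close>

lemma Kl_set_bound:
  assumes "DQ f" "A \<in> sets borel" "measure std_exp A \<le> p" "0 < p" "p < 1"
  shows "measure (Qd f) A * ln (1 / p) \<le> Kl f + 1"
proof -
  define \<psi> where "\<psi> x = ln (1 / p) * indicator A x" for x :: real
  have b: "bb \<psi>" unfolding \<psi>_def by (intro bb_mult bb_const bb_ind assms)
  have "(\<integral>x. f x * \<psi> x \<partial>std_exp) = measure (Qd f) A * ln (1 / p)"
    unfolding \<psi>_def Qd_measure[OF assms(1,2)] by (subst integral_mult_left_zero[symmetric]) (simp only: mult_ac)
  moreover have "(\<integral>x. exp (\<psi> x) \<partial>std_exp) \<le> 2"
  proof -
    have "exp (\<psi> x) = 1 + (1 / p - 1) * indicator A x" for x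
      using assms by (auto simp: \<psi>_def indicator_def)
    then have "(\<integral>x. exp (\<psi> x) \<partial>std_exp) = 1 + (1 / p - 1) * measure std_exp A"
      using assms(2) E.prob_space E.bb_integrable[OF bb_ind[OF assms(2)]]
      by (simp add: E.bb_integrable[OF bb_const])
    also have "\<dots> \<le> 1 + (1 / p - 1) * p" using assms by (intro add_left_mono mult_left_mono) auto
    also have "\<dots> \<le> 2" using assms by (simp add: left_diff_distrib)
    finally show ?thesis .
  qed
  ultimately show ?thesis using donsker_varadhan[OF assms(1) b] by linarith
qed

lemma exp_le_quad: fixes x :: real assumes "\<bar>x\<bar> \<le> 1" shows "exp x \<le> 1 + x + x\<^sup>2"
proof (cases "x \<ge> 0")
  case True then show ?thesis using exp_bound[of x] assms by simp
next
  case False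
  define y where "y = - x"
  have y: "0 < y" "y \<le> 1" using False assms by (auto simp: y_def)
  have "exp x = inverse (exp y)" by (simp add: y_def exp_minus)
  also have "\<dots> \<le> inverse (1 + y)" using y exp_ge_add_one_self[of y] by (intro le_imp_inverse_le) auto
  also have "\<dots> \<le> 1 - y + y\<^sup>2"
  proof -
    have "1 \<le> (1 + y) * (1 - y + y\<^sup>2)" using y by (simp add: algebra_simps power2_eq_square)
    then show ?thesis using y by (simp add: inverse_eq_divide divide_le_eq mult.commute)
  qed
  finally show ?thesis by (simp add: y_def)
qed

text \<open>A version of Pinsker's inequality; the best choice of \<open>l\<close> is the square root of the
  entropy.\<close>

lemma Kl_L1:
  assumes "DQ f" "0 < l" "l \<le> 1"
  shows "(\<integral>x. \<bar>f x - 1\<bar> \<partial>std_exp) \<le> Kl f / l + l"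
proof -
  note d = DQ_D[OF assms(1)]
  note [measurable] = bb_meas[OF d(1)]
  define \<psi> where "\<psi> x = l * sgn (f x - 1)" for x
  have bs: "bb (\<lambda>x. sgn (f x - 1))" by (intro bbI[of _ 1]) (auto simp: sgn_real_def)
  have b: "bb \<psi>" unfolding \<psi>_def by (intro bb_mult bb_const bs)
  have i: "integrable std_exp (\<lambda>x. sgn (f x - 1))" "integrable std_exp (\<lambda>x. f x * sgn (f x - 1))" "integrable std_exp f"
    "integrable std_exp (\<lambda>x. exp (\<psi> x))" "integrable std_exp \<psi>"
    using d bs b by (auto intro!: E.bb_integrable bb_mult bb_exp)
  have "exp (\<psi> x) \<le> 1 + \<psi> x + l\<^sup>2" for x
  proof -
    have "\<bar>\<psi> x\<bar> \<le> 1" "(\<psi> x)\<^sup>2 \<le> l\<^sup>2" using assms by (auto simp: \<psi>_def sgn_real_def)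
    then show ?thesis using exp_le_quad[of "\<psi> x"] by linarith
  qed
  then have "(\<integral>x. exp (\<psi> x) \<partial>std_exp) \<le> (\<integral>x. 1 + \<psi> x + l\<^sup>2 \<partial>std_exp)"
    using i by (intro integral_mono) auto
  also have "\<dots> = 1 + (\<integral>x. \<psi> x \<partial>std_exp) + l\<^sup>2" using i E.prob_space by simp
  finally have "(\<integral>x. f x * \<psi> x \<partial>std_exp) \<le> Kl f + (\<integral>x. \<psi> x \<partial>std_exp) + l\<^sup>2"
    using donsker_varadhan[OF assms(1) b] by linarith
  moreover have "(\<integral>x. f x * \<psi> x \<partial>std_exp) - (\<integral>x. \<psi> x \<partial>std_exp) = l * (\<integral>x. \<bar>f x - 1\<bar> \<partial>std_exp)"
  proof -
    have "\<bar>f x - 1\<bar> = f x * sgn (f x - 1) - sgn (f x - 1)" for x by (auto simp: sgn_real_def)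
    then show ?thesis using i by (simp add: \<psi>_def mult.left_commute right_diff_distrib)
  qed
  ultimately have "l * (\<integral>x. \<bar>f x - 1\<bar> \<partial>std_exp) \<le> Kl f + l\<^sup>2" by linarith
  then show ?thesis using assms by (simp add: field_simps power2_eq_square)
qed

definition mixd :: "real \<Rightarrow> (real \<Rightarrow> real) \<Rightarrow> (real \<Rightarrow> real) \<Rightarrow> real \<Rightarrow> real" where
  "mixd e f r x = (1 - e) * f x + e * r x"

lemma mixd_DQ: assumes "DQ f" "DQ r" "0 \<le> e" "e \<le> 1" shows "DQ (mixd e f r)"
proof -
  note d = DQ_D[OF assms(1)] DQ_D[OF assms(2)]
  have "integrable std_exp f" "integrable std_exp r" using d by (auto intro: E.bb_integrable)
  then have "(\<integral>x. mixd e f r x \<partial>std_exp) = 1" unfolding mixd_def using d by simp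
  moreover have "bb (mixd e f r)" unfolding mixd_def[abs_def] by (intro bb_add bb_mult bb_const d)
  ultimately show ?thesis using d assms by (simp add: DQ_def mixd_def)
qed

lemma mixd_Kl: assumes "DQ f" "DQ r" "0 < e" "e < 1"
  shows "Kl (mixd e f r) \<le> (1 - e) * Kl f + e * Kl r"
proof -
  note d = DQ_D[OF assms(1)] DQ_D[OF assms(2)]
  have m: "DQ (mixd e f r)" using assms by (intro mixd_DQ) auto
  have pw: "mixd e f r x * ln (mixd e f r x) \<le> (1 - e) * (f x * ln (f x)) + e * (r x * ln (r x))" for x
  proof (cases "mixd e f r x = 0")
    case True
    have "0 \<le> (1 - e) * f x" "0 \<le> e * r x" using d assms by auto
    then have "f x = 0" "r x = 0" using True assms by (auto simp: mixd_def add_nonneg_eq_0_iff)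
    then show ?thesis using True by simp
  next
    case False
    then have p: "mixd e f r x > 0" using DQ_D(2)[OF m, of x] by simp
    have "f x * ln (mixd e f r x) \<le> f x * ln (f x) - f x + mixd e f r x"
      using young_ln[of "f x" "ln (mixd e f r x)"] d p by simp
    moreover have "r x * ln (mixd e f r x) \<le> r x * ln (r x) - r x + mixd e f r x"
      using young_ln[of "r x" "ln (mixd e f r x)"] d p by simp
    ultimately have "(1 - e) * (f x * ln (mixd e f r x)) + e * (r x * ln (mixd e f r x)) \<le>
      (1 - e) * (f x * ln (f x) - f x + mixd e f r x) + e * (r x * ln (r x) - r x + mixd e f r x)"
      using assms by (intro add_mono mult_left_mono) auto
    also have "\<dots> = (1 - e) * (f x * ln (f x)) + e * (r x * ln (r x))"
      by (simp add: mixd_def algebra_simps)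
    finally show ?thesis by (simp add: mixd_def algebra_simps)
  qed
  have i: "integrable std_exp (\<lambda>x. mixd e f r x * ln (mixd e f r x))"
    "integrable std_exp (\<lambda>x. f x * ln (f x))" "integrable std_exp (\<lambda>x. r x * ln (r x))"
    using d DQ_D[OF m] by (auto intro!: E.bb_integrable bb_mult_ln)
  have "Kl (mixd e f r) \<le> (\<integral>x. (1 - e) * (f x * ln (f x)) + e * (r x * ln (r x)) \<partial>std_exp)"
    unfolding Kl_def using i pw by (intro integral_mono) auto
  also have "\<dots> = (1 - e) * Kl f + e * Kl r" unfolding Kl_def using i by simp
  finally show ?thesis .
qed

text \<open>The rate function: the cheapest entropy of a law whose statistic exceeds \<open>a\<close>. The
  strict inequality makes \<open>J\<close> right continuous for free.\<close>

definition J :: "real \<Rightarrow> ereal" where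
  "J a = (INF f\<in>{f. DQ f \<and> (\<exists>t\<ge>0. a < \<bar>Tf (Qd f) t\<bar>)}. ereal (Kl f))"

lemma W3_Qd:
  assumes "DQ f" "DQ g" "DQ h"
  shows "W3 (Qd f) (Qd g) (Qd h) t = tri std_exp std_exp std_exp f g h t"
proof -
  interpret Q: three "Qd f" "Qd g" "Qd h" using assms by (simp add: three_def Qd_rd)
  have 1: "(\<integral>z. 1 * of_bool (x + y / 2 + z / 3 < t) \<partial>(Qd h)) = (\<integral>z. h z * of_bool (x + y / 2 + z / 3 < t) \<partial>std_exp)" for x y
    by (subst Qd_integral[OF assms(3)]) auto
  have 2: "sl1 (Qd g) (Qd h) one one t x = sl1 std_exp std_exp g h t x" for x
    unfolding sl1_def
    using Qd_integral[OF assms(2) bb_meas[OF bb_mult[OF bb_const[of 1] Q.bb_inner3(1)[OF bb_const[of 1], of x t]]]]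
    by (simp only: 1[unfolded mult_1] mult_1)
  show ?thesis
    using Qd_integral[OF assms(1) bb_meas[OF bb_mult[OF bb_const[of 1] Q.bb_sl(1)[OF bb_const[of 1] bb_const[of 1], of t]]]]
    unfolding Q.tri_sl1 2 by (simp add: tri_def sl1_def)
qed

text \<open>Cells of equal probability: \<open>gpt m j\<close> is the quantile of level \<open>j/m\<close>
  of the exponential law, \<open>gidx m x\<close> the number of the cell that contains
  \<open>x\<close>, and \<open>gcdf\<close> the distribution function at these quantiles, with
  value 1 at the missing last one.\<close>

definition gpt :: "nat \<Rightarrow> nat \<Rightarrow> real" where "gpt m j = - ln (1 - real j / real m)"
definition gidx :: "nat \<Rightarrow> real \<Rightarrow> nat" where "gidx m x = nat \<lfloor>real m * (1 - exp (- x))\<rfloor>"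
definition gcdf :: "real measure \<Rightarrow> nat \<Rightarrow> nat \<Rightarrow> real" where
  "gcdf \<mu> m j = (if j < m then lcdf \<mu> (gpt m j) else 1)"

lemma gidx_lt: assumes "m \<ge> 1" shows "gidx m x < m"
proof -
  have "real m * (1 - exp (- x)) < real m" using assms by simp
  then have "\<lfloor>real m * (1 - exp (- x))\<rfloor> < int m" by (simp add: floor_less_iff)
  then show ?thesis using assms by (simp add: gidx_def)
qed

lemma gpt_nonneg: "j < m \<Longrightarrow> 0 \<le> gpt m j"
  by (auto simp: gpt_def divide_simps)

lemma exp_gpt: "j < m \<Longrightarrow> exp (- gpt m j) = 1 - real j / real m"
  by (auto simp: gpt_def divide_simps)

lemma gpt_le_iff: assumes "j < m" "0 \<le> x" shows "gpt m j \<le> x \<longleftrightarrow> j \<le> gidx m x"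
proof -
  have "gpt m j \<le> x \<longleftrightarrow> exp (- x) \<le> exp (- gpt m j)" by simp
  also have "\<dots> \<longleftrightarrow> real j \<le> real m * (1 - exp (- x))"
    unfolding exp_gpt[OF assms(1)] using assms by (simp add: field_simps)
  also have "\<dots> \<longleftrightarrow> int j \<le> \<lfloor>real m * (1 - exp (- x))\<rfloor>" by (simp add: le_floor_iff)
  also have "\<dots> \<longleftrightarrow> j \<le> gidx m x"
  proof -
    have "0 \<le> real m * (1 - exp (- x))" using assms by simp
    then have "0 \<le> \<lfloor>real m * (1 - exp (- x))\<rfloor>" by simp
    then show ?thesis unfolding gidx_def by linarith
  qed
  finally show ?thesis .
qed

lemma gcdf_sandwich:
  assumes "real_distribution \<mu>" "m \<ge> 1" "0 \<le> x"
  shows "gcdf \<mu> m (gidx m x) \<le> lcdf \<mu> x" "lcdf \<mu> x \<le> gcdf \<mu> m (Suc (gidx m x))"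
proof -
  interpret real_distribution \<mu> by fact
  have "gpt m (gidx m x) \<le> x" using gpt_le_iff[OF gidx_lt[OF assms(2)] assms(3)] by simp
  then show "gcdf \<mu> m (gidx m x) \<le> lcdf \<mu> x" using gidx_lt[OF assms(2), of x] by (simp add: gcdf_def lcdf_mono)
  show "lcdf \<mu> x \<le> gcdf \<mu> m (Suc (gidx m x))"
  proof (cases "Suc (gidx m x) < m")
    case True
    then have "x < gpt m (Suc (gidx m x))" using gpt_le_iff[OF True assms(3)] by (simp add: not_le[symmetric])
    then show ?thesis using True by (simp add: gcdf_def lcdf_mono)
  qed (simp add: gcdf_def)
qed

text \<open>Between two neighbouring quantiles both distribution functions are squeezed, hence the distance
  is controlled by its values on the grid and the largest cell.\<close>

lemma kolmogorov_grid:
  assumes \<mu>: "real_distribution \<mu>" and \<nu>: "real_distribution \<nu>" and m: "m \<ge> 1"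
    and z: "lcdf \<mu> 0 = 0" "lcdf \<nu> 0 = 0"
    and d: "\<And>j. j < m \<Longrightarrow> \<bar>gcdf \<mu> m j - gcdf \<nu> m j\<bar> \<le> d" "0 \<le> d"
    and h: "\<And>j. j < m \<Longrightarrow> gcdf \<nu> m (Suc j) - gcdf \<nu> m j \<le> h" "0 \<le> h"
  shows "\<bar>lcdf \<mu> x - lcdf \<nu> x\<bar> \<le> d + h"
proof (cases "x \<le> 0")
  case True
  interpret m: real_distribution \<mu> by fact
  interpret n: real_distribution \<nu> by fact
  have "lcdf \<mu> x = 0" "lcdf \<nu> x = 0"
    using m.lcdf_mono[OF True] n.lcdf_mono[OF True] z m.lcdf_nonneg[of x] n.lcdf_nonneg[of x] by linarith+
  then show ?thesis using d h by simp
next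
  case False
  let ?j = "gidx m x"
  have j: "?j < m" by (rule gidx_lt[OF m])
  have d': "\<bar>gcdf \<mu> m k - gcdf \<nu> m k\<bar> \<le> d" if "k \<le> m" for k
    using d that by (cases "k < m") (auto simp: gcdf_def)
  have "\<bar>gcdf \<mu> m ?j - gcdf \<nu> m ?j\<bar> \<le> d" "\<bar>gcdf \<mu> m (Suc ?j) - gcdf \<nu> m (Suc ?j)\<bar> \<le> d"
    "gcdf \<nu> m (Suc ?j) - gcdf \<nu> m ?j \<le> h" using d' h j by auto
  then show ?thesis using gcdf_sandwich[OF \<mu> m, of x] gcdf_sandwich[OF \<nu> m, of x] False by linarith
qed

lemma gcdf_std_exp: "j \<le> m \<Longrightarrow> m \<ge> 1 \<Longrightarrow> gcdf std_exp m j = real j / real m"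
  using exp_gpt[of j m] gpt_nonneg[of j m] by (auto simp: gcdf_def lcdf_std_exp)

section \<open>Large deviation bounds\<close>

lemma of_bool_left_const: "\<forall>\<^sub>F s in at_left t. (of_bool (c < s) :: real) = of_bool (c < (t::real))"
proof (cases "c < t")
  case True
  have "\<forall>\<^sub>F s in at_left t. c < s" using True by (intro eventually_at_leftI[OF _ True]) auto
  then show ?thesis by eventually_elim (use True in auto)
next
  case False
  have "\<forall>\<^sub>F s in at_left t. s < t" by (rule eventually_at_leftI[of "t - 1"]) auto
  then show ?thesis by eventually_elim (use False in auto)
qed

text \<open>For an empirical measure all indicators are left continuous in \<open>t\<close>, so that a
  rational \<open>t\<close> can witness an exceedance and the event is measurable.\<close>

lemma Tf_emp_left_const: assumes "n \<ge> 1"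
  shows "\<forall>\<^sub>F s in at_left t. Tf (emp n x) s = Tf (emp n x) t"
proof -
  have "\<forall>\<^sub>F s in at_left t. \<forall>i\<in>{1..n}. (of_bool (x i < s) :: real) = of_bool (x i < t)"
    by (intro eventually_ball_finite ballI of_bool_left_const) auto
  moreover have "\<forall>\<^sub>F s in at_left t. \<forall>i\<in>{1..n}. \<forall>j\<in>{1..n}. \<forall>k\<in>{1..n}.
      (of_bool (x i + x j / 2 + x k / 3 < s) :: real) = of_bool (x i + x j / 2 + x k / 3 < t)"
    by (intro eventually_ball_finite ballI of_bool_left_const) auto
  ultimately show ?thesis
  proof eventually_elim
    case (elim s)
    have "(\<Sum>i\<in>{1..n}. of_bool (x i < s) :: real) = (\<Sum>i\<in>{1..n}. of_bool (x i < t))"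
      using elim by (intro sum.cong) auto
    moreover have "(\<Sum>i\<in>{1..n}. \<Sum>j\<in>{1..n}. \<Sum>k\<in>{1..n}. of_bool (x i + x j / 2 + x k / 3 < s) :: real) =
      (\<Sum>i\<in>{1..n}. \<Sum>j\<in>{1..n}. \<Sum>k\<in>{1..n}. of_bool (x i + x j / 2 + x k / 3 < t))"
      using elim by (intro sum.cong refl) auto
    ultimately show ?case by (simp add: Tf_def emp_lcdf[OF assms] emp_W3[OF assms])
  qed
qed

lemma exceed_rational: assumes "n \<ge> 1"
  shows "(\<exists>t\<ge>0. a < \<bar>Tf (emp n x) t\<bar>) \<longleftrightarrow> (\<exists>q. 0 \<le> real_of_rat q \<and> a < \<bar>Tf (emp n x) (real_of_rat q)\<bar>)"
proof
  assume "\<exists>t\<ge>0. a < \<bar>Tf (emp n x) t\<bar>"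
  then obtain t where t: "t \<ge> 0" "a < \<bar>Tf (emp n x) t\<bar>" by blast
  show "\<exists>q. 0 \<le> real_of_rat q \<and> a < \<bar>Tf (emp n x) (real_of_rat q)\<bar>"
  proof (cases "t = 0")
    case True
    then show ?thesis using t by (intro exI[of _ 0]) simp
  next
    case False
    then have "t > 0" using t by simp
    from Tf_emp_left_const[OF assms, of x t] obtain b where b: "b < t" "\<And>s. b < s \<Longrightarrow> s < t \<Longrightarrow> Tf (emp n x) s = Tf (emp n x) t"
      unfolding eventually_at_left_field by blast
    obtain q where q: "max b 0 < real_of_rat q" "real_of_rat q < t"
      using of_rat_dense[of "max b 0" t] b \<open>t > 0\<close> by auto
    then show ?thesis using b(2)[of "real_of_rat q"] t by (intro exI[of _ q]) auto
  qed
qed blast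

lemma gidx_meas [measurable]: "gidx m \<in> measurable borel (count_space UNIV)"
  unfolding gidx_def by measurable

lemma bb_gidx: assumes "m \<ge> 1" shows "bb (\<lambda>x. \<phi> (gidx m x) :: real)"
proof (rule bbI)
  show "(\<lambda>x. \<phi> (gidx m x)) \<in> borel_measurable borel" by measurable
  show "\<bar>\<phi> (gidx m x)\<bar> \<le> Max ((\<lambda>j. \<bar>\<phi> j\<bar>) ` {..<m})" for x
    using gidx_lt[OF assms, of x] by (intro Max_ge) auto
qed

lemma gidx_tail: assumes "m \<ge> 1" "j \<le> m"
  shows "(\<integral>x. of_bool (gidx m x < j) \<partial>std_exp) = real j / real m"
proof (cases "j < m")
  case True
  have "(\<integral>x. of_bool (gidx m x < j) \<partial>std_exp) = (\<integral>x. (of_bool (x < gpt m j) :: real) \<partial>std_exp)"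
    using AE_std_exp by (intro integral_cong_AE) (auto simp: gpt_le_iff[OF True, symmetric] not_le[symmetric])
  then show ?thesis using E.integral_of_bool_lt[of "gpt m j"] gcdf_std_exp[OF assms(2,1)] True by (simp add: gcdf_def)
next
  case False
  then have "j = m" using assms by simp
  then show ?thesis using gidx_lt[OF assms(1)] E.prob_space assms by simp
qed

lemma gidx_cell: assumes "m \<ge> 1" "j < m"
  shows "(\<integral>x. of_bool (gidx m x = j) \<partial>std_exp) = 1 / real m"
proof -
  have "(of_bool (gidx m x = j) :: real) = of_bool (gidx m x < Suc j) - of_bool (gidx m x < j)" for x by auto
  then have "(\<integral>x. of_bool (gidx m x = j) \<partial>std_exp) = (\<integral>x. (of_bool (gidx m x < Suc j) :: real) - of_bool (gidx m x < j) \<partial>std_exp)"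
    by (simp only:)
  also have "\<dots> = real (Suc j) / real m - real j / real m"
    using gidx_tail[OF assms(1), of j] gidx_tail[OF assms(1), of "Suc j"] assms
      E.bb_integrable[OF bb_gidx[OF assms(1), of "\<lambda>i. of_bool (i < j)"]]
      E.bb_integrable[OF bb_gidx[OF assms(1), of "\<lambda>i. of_bool (i < Suc j)"]]
    by simp
  finally show ?thesis by (simp add: diff_divide_distrib[symmetric])
qed

lemma gidx_integral: assumes "m \<ge> 1"
  shows "(\<integral>x. \<phi> (gidx m x) \<partial>std_exp) = (\<Sum>j<m. \<phi> j) / real m"
proof -
  have "\<phi> (gidx m x) = (\<Sum>j<m. \<phi> j * of_bool (gidx m x = j))" for x
    using gidx_lt[OF assms, of x] by (simp add: of_bool_def if_distrib[of "\<lambda>b. _ * b"] sum.delta' cong: if_cong)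
  then have "(\<integral>x. \<phi> (gidx m x) \<partial>std_exp) = (\<integral>x. (\<Sum>j<m. \<phi> j * of_bool (gidx m x = j)) \<partial>std_exp)"
    by (simp only:)
  also have "\<dots> = (\<Sum>j<m. \<integral>x. \<phi> j * of_bool (gidx m x = j) \<partial>std_exp)"
    by (rule Bochner_Integration.integral_sum) (rule E.bb_integrable[OF bb_gidx[OF assms]])
  also have "\<dots> = (\<Sum>j<m. \<phi> j * (1 / real m))"
    using gidx_cell[OF assms] by (intro sum.cong) auto
  finally show ?thesis by (simp add: sum_divide_distrib)
qed

lemma gcdf_Qd: assumes "DQ f" "m \<ge> 1" "j \<le> m"
  shows "gcdf (Qd f) m j = (\<integral>x. f x * of_bool (gidx m x < j) \<partial>std_exp)"
proof (cases "j < m")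
  case True
  interpret Q: real_distribution "Qd f" by (rule Qd_rd[OF assms(1)])
  note [measurable] = bb_meas[OF DQ_D(1)[OF assms(1)]]
  have "gcdf (Qd f) m j = (\<integral>x. f x * of_bool (x < gpt m j) \<partial>std_exp)"
    using Qd_integral[OF assms(1), of "\<lambda>x. of_bool (x < gpt m j)"] True Q.integral_of_bool_lt by (simp add: gcdf_def)
  also have "\<dots> = (\<integral>x. f x * of_bool (gidx m x < j) \<partial>std_exp)"
    using AE_std_exp by (intro integral_cong_AE) (auto simp: gpt_le_iff[OF True, symmetric] not_le[symmetric])
  finally show ?thesis .
next
  case False
  then have "j = m" using assms by simp
  then show ?thesis using gidx_lt[OF assms(2)] DQ_D(3)[OF assms(1)] by (simp add: gcdf_def)
qed

lemma lcdf_Qd_0: assumes "DQ f" shows "lcdf (Qd f) 0 = 0"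
proof -
  note [measurable] = bb_meas[OF DQ_D(1)[OF assms]]
  have "lcdf (Qd f) 0 = (\<integral>x. f x * indicator {..<0} x \<partial>std_exp)"
    unfolding lcdf_def by (rule Qd_measure[OF assms]) simp
  also have "\<dots> = (\<integral>x. 0 \<partial>std_exp)"
    using AE_std_exp by (intro integral_cong_AE) (auto simp: indicator_def)
  finally show ?thesis by simp
qed

lemma emp_gcdf: assumes "n \<ge> 1" "m \<ge> 1" "j \<le> m" "\<And>i. i \<in> {1..n} \<Longrightarrow> 0 \<le> x i"
  shows "gcdf (emp n x) m j = (\<Sum>i\<in>{1..n}. of_bool (gidx m (x i) < j)) / real n"
proof (cases "j < m")
  case True
  have "(\<Sum>i\<in>{1..n}. of_bool (x i < gpt m j) :: real) = (\<Sum>i\<in>{1..n}. of_bool (gidx m (x i) < j))"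
    using assms(4) by (intro sum.cong) (auto simp: gpt_le_iff[OF True, symmetric] not_le[symmetric])
  then show ?thesis using True by (simp add: gcdf_def emp_lcdf[OF assms(1)])
next
  case False
  then show ?thesis using assms gidx_lt[OF assms(2)] by (simp add: gcdf_def less_le_trans)
qed

lemma emp_lcdf_0: assumes "n \<ge> 1" "\<And>i. i \<in> {1..n} \<Longrightarrow> 0 \<le> x i" shows "lcdf (emp n x) 0 = 0"
proof -
  have "(\<Sum>i\<in>{1..n}. of_bool (x i < 0) :: real) = 0" using assms(2) by (intro sum.neutral) (auto simp: not_less)
  then show ?thesis by (simp add: emp_lcdf[OF assms(1)])
qed

text \<open>The density that is constant on cells and has the given counts as cell masses: the type of a
  sample as a density.\<close>

definition stepd :: "nat \<Rightarrow> nat \<Rightarrow> (nat \<Rightarrow> nat) \<Rightarrow> real \<Rightarrow> real" where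
  "stepd m n N x = real m * (real (N (gidx m x)) / real n)"

definition ctype :: "nat \<Rightarrow> nat \<Rightarrow> (nat \<Rightarrow> real) \<Rightarrow> nat \<Rightarrow> nat" where
  "ctype m n x = (\<lambda>j\<in>{..<m}. card {i \<in> {1..n}. gidx m (x i) = j})"

lemma ctype_sum: assumes "m \<ge> 1"
  shows "(\<Sum>j<m. real (ctype m n x j) * \<phi> j) = (\<Sum>i\<in>{1..n}. \<phi> (gidx m (x i)))"
proof -
  have "(\<Sum>i\<in>{1..n}. \<phi> (gidx m (x i))) = (\<Sum>j<m. \<Sum>i\<in>{i\<in>{1..n}. gidx m (x i) = j}. \<phi> (gidx m (x i)))"
    using gidx_lt[OF assms] by (intro sum.group[symmetric]) auto
  also have "\<dots> = (\<Sum>j<m. real (ctype m n x j) * \<phi> j)"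
    by (intro sum.cong) (auto simp: ctype_def)
  finally show ?thesis by simp
qed

lemma stepd_DQ: assumes "m \<ge> 1" "n \<ge> 1" "(\<Sum>j<m. N j) = n" shows "DQ (stepd m n N)"
proof -
  have "(\<integral>x. stepd m n N x \<partial>std_exp) = (\<Sum>j<m. real m * (real (N j) / real n)) / real m"
    unfolding stepd_def by (rule gidx_integral[OF assms(1)])
  also have "\<dots> = (\<Sum>j<m. real (N j) / real n)"
    unfolding sum_divide_distrib using assms by (intro sum.cong) auto
  also have "\<dots> = real (\<Sum>j<m. N j) / real n"
    by (simp add: sum_divide_distrib)
  also have "\<dots> = 1" using assms by simp
  finally have "(\<integral>x. stepd m n N x \<partial>std_exp) = 1" .
  moreover have "bb (stepd m n N)" unfolding stepd_def[abs_def]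
    by (rule bb_gidx[OF assms(1), of "\<lambda>j. real m * (real (N j) / real n)"])
  moreover have "0 \<le> stepd m n N x" for x by (simp add: stepd_def)
  ultimately show ?thesis unfolding DQ_def by blast
qed

lemma stepd_gcdf: assumes "m \<ge> 1" "n \<ge> 1" "(\<Sum>j<m. N j) = n" "j \<le> m"
  shows "gcdf (Qd (stepd m n N)) m j = (\<Sum>k<m. real (N k) * of_bool (k < j)) / real n"
proof -
  have "gcdf (Qd (stepd m n N)) m j = (\<Sum>k<m. real m * (real (N k) / real n) * of_bool (k < j)) / real m"
    unfolding gcdf_Qd[OF stepd_DQ[OF assms(1-3)] assms(1,4)] stepd_def
    by (rule gidx_integral[OF assms(1)])
  also have "\<dots> = (\<Sum>k<m. real (N k) * of_bool (k < j)) / real n"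
    unfolding sum_divide_distrib using assms(1) by (intro sum.cong) auto
  finally show ?thesis .
qed

lemma ctype_total: assumes "m \<ge> 1" shows "(\<Sum>j<m. ctype m n x j) = n"
proof -
  have "real (\<Sum>j<m. ctype m n x j) = real n" using ctype_sum[OF assms, of n x "\<lambda>_. 1"] by simp
  then show ?thesis by linarith
qed

text \<open>The likelihood ratio of a type depends on the sample only through its type, with logarithm
  \<open>n\<close> times the entropy. This is what makes the Markov bound for one type sharp.\<close>

lemma stepd_prod: assumes m: "m \<ge> 1" and n: "n \<ge> 1"
  shows "(\<Prod>i\<in>{1..n}. stepd m n (ctype m n x) (x i)) = exp (real n * Kl (stepd m n (ctype m n x)))"
proof -
  let ?N = "ctype m n x"
  define L where "L j = ln (real m * (real (?N j) / real n))" for j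
  have pos: "stepd m n ?N (x i) > 0" if "i \<in> {1..n}" for i
  proof -
    have "card {i' \<in> {1..n}. gidx m (x i') = gidx m (x i)} > 0" using that by (subst card_gt_0_iff) auto
    then show ?thesis using gidx_lt[OF m, of "x i"] m n by (simp add: stepd_def ctype_def)
  qed
  have "(\<Prod>i\<in>{1..n}. stepd m n ?N (x i)) = (\<Prod>i\<in>{1..n}. exp (ln (stepd m n ?N (x i))))"
    using pos by (intro prod.cong) auto
  also have "\<dots> = exp (\<Sum>i\<in>{1..n}. L (gidx m (x i)))"
    by (simp add: exp_sum L_def stepd_def)
  also have "(\<Sum>i\<in>{1..n}. L (gidx m (x i))) = (\<Sum>j<m. real (?N j) * L j)"
    using ctype_sum[OF m, of n x L] by simp
  also have "\<dots> = real n * Kl (stepd m n ?N)"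
  proof -
    have "Kl (stepd m n ?N) = (\<Sum>j<m. real m * (real (?N j) / real n) * L j) / real m"
      unfolding Kl_def stepd_def L_def by (rule gidx_integral[OF m])
    also have "\<dots> = (\<Sum>j<m. real (?N j) * L j) / real n"
      using m by (simp add: sum_divide_distrib mult.assoc)
    finally show ?thesis using n by simp
  qed
  finally show ?thesis .
qed

text \<open>An exceedance is expensive. If the entropy of the type were below \<open>c\<close>, then all
  cells would have small mass, so the type would be close to the sample in Kolmogorov distance and
  would exceed the level \<open>a - 6 e\<close> itself, which costs at least \<open>c\<close> by
  definition of \<open>J\<close>.\<close>

lemma exceed_type_cost:
  assumes m: "m \<ge> 2" and n: "n \<ge> 1" and x: "\<And>i. i \<in> {1..n} \<Longrightarrow> 0 \<le> x i"
    and t: "0 \<le> t" "a < \<bar>Tf (emp n x) t\<bar>"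
    and c: "ereal c < J (a - 6 * e)" and e: "0 < e" "c + 1 \<le> e * ln (real m)"
  shows "c \<le> Kl (stepd m n (ctype m n x))"
proof (rule ccontr)
  let ?f = "stepd m n (ctype m n x)"
  assume neg: "\<not> c \<le> Kl ?f"
  have m1: "m \<ge> 1" using m by simp
  have D: "DQ ?f" by (rule stepd_DQ[OF m1 n ctype_total[OF m1]])
  have lm: "0 < ln (real m)" using m by simp
  have cell: "real (ctype m n x j) / real n \<le> e" if j: "j < m" for j
  proof -
    have A: "{x. gidx m x = j} \<in> sets borel" by measurable
    have i: "(\<lambda>x. indicator {x. gidx m x = j} x :: real) = (\<lambda>x. of_bool (gidx m x = j))" by (auto simp: indicator_def)
    have "measure std_exp {x. gidx m x = j} = (\<integral>x. indicator {x. gidx m x = j} x \<partial>std_exp)"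
      using A by simp
    also have "\<dots> = (\<integral>x. of_bool (gidx m x = j) \<partial>std_exp)" by (simp only: i)
    also have "\<dots> = 1 / real m" by (rule gidx_cell[OF m1 j])
    finally have "measure std_exp {x. gidx m x = j} = 1 / real m" .
    then have "measure (Qd ?f) {x. gidx m x = j} * ln (1 / (1 / real m)) \<le> Kl ?f + 1"
      using m by (intro Kl_set_bound[OF D A]) auto
    moreover have "measure (Qd ?f) {x. gidx m x = j} = real (ctype m n x j) / real n"
    proof -
      have "measure (Qd ?f) {x. gidx m x = j} = (\<integral>y. ?f y * of_bool (gidx m y = j) \<partial>std_exp)"
        unfolding Qd_measure[OF D A] i[THEN fun_cong] ..
      also have "\<dots> = (\<Sum>k<m. real m * (real (ctype m n x k) / real n) * of_bool (k = j)) / real m"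
        unfolding stepd_def by (rule gidx_integral[OF m1])
      also have "\<dots> = real (ctype m n x j) / real n"
        using j m by (simp add: of_bool_def if_distrib[of "\<lambda>b. _ * b"] sum.delta cong: if_cong)
      finally show ?thesis .
    qed
    ultimately have "real (ctype m n x j) / real n * ln (real m) \<le> Kl ?f + 1" by simp
    also have "\<dots> \<le> e * ln (real m)" using neg e by simp
    finally show ?thesis by (rule mult_right_le_imp_le[OF _ lm])
  qed
  have g: "gcdf (emp n x) m j = gcdf (Qd ?f) m j" if "j \<le> m" for j
  proof -
    have "gcdf (emp n x) m j = (\<Sum>i\<in>{1..n}. of_bool (gidx m (x i) < j)) / real n"
      by (rule emp_gcdf[OF n m1 that x])
    also have "\<dots> = (\<Sum>k<m. real (ctype m n x k) * of_bool (k < j)) / real n"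
      by (subst ctype_sum[OF m1, of n x "\<lambda>k. of_bool (k < j)"]) (rule refl)
    also have "\<dots> = gcdf (Qd ?f) m j" by (rule stepd_gcdf[OF m1 n ctype_total[OF m1] that, symmetric])
    finally show ?thesis .
  qed
  have "\<bar>lcdf (emp n x) y - lcdf (Qd ?f) y\<bar> \<le> 0 + e" for y
  proof (rule kolmogorov_grid[OF emp_rd[OF n] Qd_rd[OF D] m1 emp_lcdf_0[OF n x] lcdf_Qd_0[OF D]])
    fix j assume j: "j < m"
    show "\<bar>gcdf (emp n x) m j - gcdf (Qd ?f) m j\<bar> \<le> 0" using g j by simp
    have "gcdf (Qd ?f) m (Suc j) - gcdf (Qd ?f) m j =
      (\<Sum>k<m. real (ctype m n x k) * of_bool (k < Suc j) - real (ctype m n x k) * of_bool (k < j)) / real n"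
      using j by (simp add: stepd_gcdf[OF m1 n ctype_total[OF m1]] sum_subtractf diff_divide_distrib)
    also have "(\<Sum>k<m. real (ctype m n x k) * of_bool (k < Suc j) - real (ctype m n x k) * of_bool (k < j)) =
       (\<Sum>k<m. if k = j then real (ctype m n x k) else 0)" by (intro sum.cong) auto
    also have "\<dots> = real (ctype m n x j)" using j by simp
    finally show "gcdf (Qd ?f) m (Suc j) - gcdf (Qd ?f) m j \<le> e" using cell[OF j] by simp
  qed (use e in auto)
  then have "\<bar>Tf (emp n x) t - Tf (Qd ?f) t\<bar> \<le> 6 * e"
    by (intro Tf_kolmogorov emp_rd n Qd_rd D) simp
  then have "a - 6 * e < \<bar>Tf (Qd ?f) t\<bar>" using t by linarith
  then have "J (a - 6 * e) \<le> ereal (Kl ?f)" unfolding J_def using D t by (intro INF_lower) auto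
  then have "ereal c < ereal (Kl ?f)" using c by (rule less_le_trans[rotated])
  then show False using neg by simp
qed

locale iid_exp = prob_space M for M :: "'a measure" +
  fixes Y :: "nat \<Rightarrow> 'a \<Rightarrow> real"
  assumes indep: "indep_vars (\<lambda>_. borel) Y {1..}"
    and law: "\<And>i. i \<ge> 1 \<Longrightarrow> distr M borel (Y i) = std_exp"
begin

lemma Y_meas [measurable]: "i \<ge> 1 \<Longrightarrow> Y i \<in> borel_measurable M"
  using indep by (auto simp: indep_vars_def)

lemma Y_integral:
  fixes g :: "real \<Rightarrow> real"
  assumes "i \<ge> 1" "g \<in> borel_measurable borel"
  shows "(\<integral>\<omega>. g (Y i \<omega>) \<partial>M) = (\<integral>x. g x \<partial>std_exp)"
  using integral_distr[of "Y i" M borel g] assms law[of i] by simp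

lemma Y_nonneg: "AE \<omega> in M. \<forall>i\<in>{1..n}. 0 \<le> Y i \<omega>"
proof (rule AE_finite_allI)
  fix i assume "i \<in> {1..n}"
  then have i: "i \<ge> 1" by simp
  show "AE \<omega> in M. 0 \<le> Y i \<omega>"
    using AE_std_exp unfolding law[OF i, symmetric] using i by (subst (asm) AE_distr_iff) auto
qed simp

lemma prod_expectation:
  assumes "\<And>i. bb (g i)"
  shows "integrable M (\<lambda>\<omega>. \<Prod>i\<in>{1..n}. g i (Y i \<omega>))"
    and "(\<integral>\<omega>. (\<Prod>i\<in>{1..n}. g i (Y i \<omega>)) \<partial>M) = (\<Prod>i\<in>{1..n}. \<integral>x. g i x \<partial>std_exp)"
proof -
  have "indep_vars (\<lambda>_. borel) (\<lambda>i \<omega>. g i (Y i \<omega>)) {1..n}"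
    by (rule indep_vars_compose2[where X = Y and M' = "\<lambda>_. borel"])
      (use indep_vars_subset[OF indep, of "{1..n}"] bb_meas[OF assms] in auto)
  moreover have int: "integrable M (\<lambda>\<omega>. g i (Y i \<omega>))" if i: "i \<in> {1..n}" for i
  proof -
    have "integrable (distr M borel (Y i)) (g i)"
      using law[of i] i E.bb_integrable[OF assms] by simp
    then show ?thesis using i bb_meas[OF assms] by (subst (asm) integrable_distr_eq) auto
  qed
  ultimately show "integrable M (\<lambda>\<omega>. \<Prod>i\<in>{1..n}. g i (Y i \<omega>))"
    "(\<integral>\<omega>. (\<Prod>i\<in>{1..n}. g i (Y i \<omega>)) \<partial>M) = (\<Prod>i\<in>{1..n}. \<integral>x. g i x \<partial>std_exp)"
    using indep_vars_integrable[of "{1..n}" "\<lambda>i \<omega>. g i (Y i \<omega>)"]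
      indep_vars_lebesgue_integral[of "{1..n}" "\<lambda>i \<omega>. g i (Y i \<omega>)"]
    by (auto simp: Y_integral bb_meas[OF assms] intro!: prod.cong)
qed

definition Ev :: "nat \<Rightarrow> real \<Rightarrow> 'a set" where
  "Ev n a = {\<omega> \<in> space M. \<exists>t\<ge>0. a < \<bar>Tf (emp n (\<lambda>i. Y i \<omega>)) t\<bar>}"

lemma Ev_sets: assumes "n \<ge> 1" shows "Ev n a \<in> sets M"
proof -
  have [measurable]: "(\<lambda>\<omega>. Tf (emp n (\<lambda>i. Y i \<omega>)) t) \<in> borel_measurable M" for t
    unfolding Tf_def emp_lcdf[OF assms] emp_W3[OF assms]
    by (intro borel_measurable_diff borel_measurable_power borel_measurable_divide borel_measurable_sum) measurable
  show ?thesis unfolding Ev_def exceed_rational[OF assms] by measurable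
qed

text \<open>Sum the bound \<open>exp(-n c)\<close> over the types. The number of vectors of \<open>m\<close>
  counts that do not exceed \<open>n\<close> is at most \<open>(n + 1) ^ m\<close>.\<close>

lemma ldp_upper:
  assumes c: "ereal c < J (a - 6 * e)" and e: "0 < e"
  shows "\<exists>m. \<forall>n\<ge>1. prob (Ev n a) \<le> real (n + 1) ^ m * exp (- real n * c)"
proof -
  obtain m0 :: nat where m0: "exp ((c + 1) / e) \<le> real m0" using real_arch_simple by blast
  define m where "m = m0 + 2"
  have m: "m \<ge> 2" "m \<ge> 1" by (auto simp: m_def)
  have "exp ((c + 1) / e) \<le> real m" using m0 by (simp add: m_def)
  then have "(c + 1) / e \<le> ln (real m)" using m by (subst ln_ge_iff) auto
  then have lm: "c + 1 \<le> e * ln (real m)" using e by (simp add: field_simps)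
  have "prob (Ev n a) \<le> real (n + 1) ^ m * exp (- real n * c)" if n: "n \<ge> 1" for n
  proof -
    define \<Phi> where "\<Phi> = {N \<in> {..<m} \<rightarrow>\<^sub>E {0..n}. (\<Sum>j<m. N j) = n}"
    have fin: "finite \<Phi>" unfolding \<Phi>_def by (rule finite_subset[OF _ finite_PiE[of "{..<m}" "\<lambda>_. {0..n}"]]) auto
    have card: "card \<Phi> \<le> (n + 1) ^ m"
    proof -
      have "card \<Phi> \<le> card ({..<m} \<rightarrow>\<^sub>E {0..n})" unfolding \<Phi>_def by (intro card_mono finite_PiE) auto
      also have "\<dots> = (n + 1) ^ m" by (simp add: card_PiE)
      finally show ?thesis .
    qed
    have D: "DQ (stepd m n N)" if "N \<in> \<Phi>" for N
      using that stepd_DQ[OF m(2) n] by (simp add: \<Phi>_def)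
    define P where "P N \<omega> = (\<Prod>i\<in>{1..n}. stepd m n N (Y i \<omega>))" for N \<omega>
    have Pi: "integrable M (P N)" "(\<integral>\<omega>. P N \<omega> \<partial>M) = 1" if "N \<in> \<Phi>" for N
      unfolding P_def using prod_expectation[of "\<lambda>_. stepd m n N" n] DQ_D[OF D[OF that]] by auto
    have P0: "0 \<le> P N \<omega>" if "N \<in> \<Phi>" for N \<omega>
      unfolding P_def using DQ_D(2)[OF D[OF that]] by (intro prod_nonneg) auto
    have pw: "indicator (Ev n a) \<omega> \<le> exp (- real n * c) * (\<Sum>N\<in>\<Phi>. P N \<omega>)"
      if pos: "\<forall>i\<in>{1..n}. 0 \<le> Y i \<omega>" for \<omega>
    proof (cases "\<omega> \<in> Ev n a")
      case True
      let ?x = "\<lambda>i. Y i \<omega>"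
      from True obtain t where t: "0 \<le> t" "a < \<bar>Tf (emp n ?x) t\<bar>" by (auto simp: Ev_def)
      let ?N = "ctype m n ?x"
      have le: "ctype m n ?x j \<le> n" if "j < m" for j
      proof -
        have "card {i \<in> {1..n}. gidx m (?x i) = j} \<le> card {1..n}" by (rule card_mono) auto
        then show ?thesis using that by (simp add: ctype_def)
      qed
      have N: "?N \<in> \<Phi>" using ctype_total[OF m(2), of n ?x] le by (auto simp: \<Phi>_def ctype_def)
      have "c \<le> Kl (stepd m n ?N)"
        by (rule exceed_type_cost[OF m(1) n _ t c e lm]) (use pos in auto)
      then have "exp (real n * c) \<le> P ?N \<omega>"
        unfolding P_def stepd_prod[OF m(2) n, of ?x] by (simp add: mult_left_mono)
      also have "\<dots> \<le> (\<Sum>N\<in>\<Phi>. P N \<omega>)" using N P0 fin by (intro member_le_sum) auto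
      finally have "exp (- real n * c) * exp (real n * c) \<le> exp (- real n * c) * (\<Sum>N\<in>\<Phi>. P N \<omega>)"
        by (intro mult_left_mono) auto
      then show ?thesis using True by (simp add: exp_add[symmetric])
    next
      case False
      have "0 \<le> (\<Sum>N\<in>\<Phi>. P N \<omega>)" using P0 by (intro sum_nonneg) auto
      then show ?thesis using False by simp
    qed
    have ae: "AE \<omega> in M. indicator (Ev n a) \<omega> \<le> exp (- real n * c) * (\<Sum>N\<in>\<Phi>. P N \<omega>)"
      using Y_nonneg[of n] by eventually_elim (rule pw)
    have ii: "integrable M (indicator (Ev n a) :: _ \<Rightarrow> real)"
      using Ev_sets[OF n, of a] by (intro integrable_const_bound[of _ 1]) auto
    have "prob (Ev n a) = (\<integral>\<omega>. indicator (Ev n a) \<omega> \<partial>M)" using Ev_sets[OF n] by simp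
    also have "\<dots> \<le> (\<integral>\<omega>. exp (- real n * c) * (\<Sum>N\<in>\<Phi>. P N \<omega>) \<partial>M)"
      using ii Pi ae
      by (intro integral_mono_AE) (auto intro!: integrable_mult_right Bochner_Integration.integrable_sum)
    also have "\<dots> = exp (- real n * c) * real (card \<Phi>)"
      using Pi by (simp add: Bochner_Integration.integral_sum)
    also have "\<dots> \<le> exp (- real n * c) * real ((n + 1) ^ m)" using card by (intro mult_left_mono) (auto simp del: of_nat_power)
    finally show ?thesis by (simp add: mult.commute)
  qed
  then show ?thesis by blast
qed

text \<open>Under the measure with likelihood ratio \<open>\<Prod> f (Y i)\<close> the variables are
  independent with density \<open>f\<close>, so centred summands are orthogonal.\<close>

lemma weighted_second_moment:
  assumes f: "DQ f" and h: "h \<in> borel_measurable borel" "bb (\<lambda>x. f x * h x)" "bb (\<lambda>x. f x * (h x)\<^sup>2)"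
    and z: "(\<integral>x. f x * h x \<partial>std_exp) = 0"
  shows "integrable M (\<lambda>\<omega>. (\<Prod>i\<in>{1..n}. f (Y i \<omega>)) * (\<Sum>i\<in>{1..n}. h (Y i \<omega>))\<^sup>2)"
    and "(\<integral>\<omega>. (\<Prod>i\<in>{1..n}. f (Y i \<omega>)) * (\<Sum>i\<in>{1..n}. h (Y i \<omega>))\<^sup>2 \<partial>M) =
      real n * (\<integral>x. f x * (h x)\<^sup>2 \<partial>std_exp)"
proof -
  define u where "u i j k x = f x * (if k = i then h x else 1) * (if k = j then h x else 1)" for i j k :: nat and x
  have bu: "bb (u i j k)" for i j k
  proof -
    have "u i j k = (if k = i then (if k = j then (\<lambda>x. f x * (h x)\<^sup>2) else (\<lambda>x. f x * h x)) else (if k = j then (\<lambda>x. f x * h x) else f))"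
      by (auto simp: u_def fun_eq_iff power2_eq_square)
    then show ?thesis using h DQ_D(1)[OF f] by (auto simp del: bb_const)
  qed
  have e: "(\<Prod>i\<in>{1..n}. f (Y i \<omega>)) * (\<Sum>i\<in>{1..n}. h (Y i \<omega>))\<^sup>2 =
      (\<Sum>i\<in>{1..n}. \<Sum>j\<in>{1..n}. \<Prod>k\<in>{1..n}. u i j k (Y k \<omega>))" for \<omega>
  proof -
    have "(\<Prod>k\<in>{1..n}. u i j k (Y k \<omega>)) = (\<Prod>i\<in>{1..n}. f (Y i \<omega>)) * (h (Y i \<omega>) * h (Y j \<omega>))"
      if "i \<in> {1..n}" "j \<in> {1..n}" for i j
      using that by (simp add: u_def prod.distrib prod.delta mult.assoc)
    then have "(\<Sum>i\<in>{1..n}. \<Sum>j\<in>{1..n}. \<Prod>k\<in>{1..n}. u i j k (Y k \<omega>)) =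
        (\<Sum>i\<in>{1..n}. \<Sum>j\<in>{1..n}. (\<Prod>i\<in>{1..n}. f (Y i \<omega>)) * (h (Y i \<omega>) * h (Y j \<omega>)))"
      by (intro sum.cong refl)
    moreover have "(\<Sum>i\<in>{1..n}. h (Y i \<omega>))\<^sup>2 = (\<Sum>i\<in>{1..n}. \<Sum>j\<in>{1..n}. h (Y i \<omega>) * h (Y j \<omega>))"
      by (simp only: power2_eq_square sum_product)
    ultimately show ?thesis by (simp only: sum_distrib_left)
  qed
  have v: "(\<Prod>k\<in>{1..n}. \<integral>x. u i j k x \<partial>std_exp) = (if i = j then (\<integral>x. f x * (h x)\<^sup>2 \<partial>std_exp) else 0)"
    if "i \<in> {1..n}" "j \<in> {1..n}" for i j
  proof (cases "i = j")
    case True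
    have "(\<integral>x. u i j k x \<partial>std_exp) = (if k = i then (\<integral>x. f x * (h x)\<^sup>2 \<partial>std_exp) else 1)" for k
      using True DQ_D(3)[OF f] by (auto simp: u_def power2_eq_square mult.assoc)
    then show ?thesis using True that by simp
  next
    case False
    have "(\<integral>x. u i j i x \<partial>std_exp) = 0" using False z by (simp add: u_def)
    then show ?thesis using False that by (auto intro!: prod_zero bexI[of _ i])
  qed
  have I: "integrable M (\<lambda>\<omega>. \<Prod>k\<in>{1..n}. u i j k (Y k \<omega>))"
    and V: "(\<integral>\<omega>. (\<Prod>k\<in>{1..n}. u i j k (Y k \<omega>)) \<partial>M) = (\<Prod>k\<in>{1..n}. \<integral>x. u i j k x \<partial>std_exp)" for i j
    using prod_expectation[of "u i j" n] bu by auto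
  show "integrable M (\<lambda>\<omega>. (\<Prod>i\<in>{1..n}. f (Y i \<omega>)) * (\<Sum>i\<in>{1..n}. h (Y i \<omega>))\<^sup>2)"
    unfolding e by (intro Bochner_Integration.integrable_sum I)
  have "(\<integral>\<omega>. (\<Prod>i\<in>{1..n}. f (Y i \<omega>)) * (\<Sum>i\<in>{1..n}. h (Y i \<omega>))\<^sup>2 \<partial>M) =
     (\<Sum>i\<in>{1..n}. \<Sum>j\<in>{1..n}. \<Prod>k\<in>{1..n}. \<integral>x. u i j k x \<partial>std_exp)"
    unfolding e V[symmetric]
    by (simp only: Bochner_Integration.integral_sum Bochner_Integration.integrable_sum I)
  also have "\<dots> = (\<Sum>i\<in>{1..n}. \<Sum>j\<in>{1..n}. if i = j then (\<integral>x. f x * (h x)\<^sup>2 \<partial>std_exp) else 0)"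
    by (intro sum.cong refl v)
  also have "\<dots> = real n * (\<integral>x. f x * (h x)\<^sup>2 \<partial>std_exp)" by simp
  finally show "(\<integral>\<omega>. (\<Prod>i\<in>{1..n}. f (Y i \<omega>)) * (\<Sum>i\<in>{1..n}. h (Y i \<omega>))\<^sup>2 \<partial>M) =
      real n * (\<integral>x. f x * (h x)\<^sup>2 \<partial>std_exp)" .
qed

end

lemma mult_ln_square_bound:
  fixes x :: real assumes "0 \<le> x" "x \<le> B"
  shows "x * (ln x)\<^sup>2 \<le> 8 + 8 * B\<^sup>2"
proof -
  have "\<bar>sqrt x * ln (sqrt x)\<bar> \<le> 1 + sqrt x * sqrt x" by (rule mult_ln_bounds) (use assms in auto)
  then have "(sqrt x * ln (sqrt x))\<^sup>2 \<le> (1 + x)\<^sup>2"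
    using assms by (intro power2_le_iff_abs_le[THEN iffD2]) auto
  moreover have "x * (ln x)\<^sup>2 = 4 * (sqrt x * ln (sqrt x))\<^sup>2"
    using assms by (simp add: ln_sqrt power_mult_distrib power_divide)
  moreover have "(1 + x)\<^sup>2 \<le> (1 + B)\<^sup>2" using assms by (intro power_mono) auto
  moreover have "4 * (1 + B)\<^sup>2 \<le> 8 + 8 * B\<^sup>2"
  proof -
    have "2 * B \<le> 1 + B\<^sup>2" using sum_squares_ge_zero[of "B - 1" 0] by (simp add: power2_eq_square algebra_simps)
    then show ?thesis by (simp add: power2_eq_square algebra_simps)
  qed
  ultimately show ?thesis by linarith
qed

context iid_exp begin

text \<open>Tilt the sample to density \<open>f\<close>. With tilted probability at least one half, the
  empirical measure is close to \<open>f E\<close> on a fine grid and the mean of \<open>ln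
  f\<close> is close to the entropy, by Chebyshev's inequality; on this event the statistic
  exceeds \<open>a\<close> and the likelihood ratio is at most \<open>exp(n (K + e))\<close>.\<close>

lemma ldp_lower:
  assumes f: "DQ f" and t: "0 \<le> t" "a < \<bar>Tf (Qd f) t\<bar>" and e: "0 < e"
  shows "\<exists>n0. \<forall>n\<ge>n0. exp (- real n * (Kl f + e)) / 2 \<le> prob (Ev n a)"
proof -
  note d = DQ_D[OF f]
  note [measurable] = bb_meas[OF d(1)]
  define s where "s = (\<bar>Tf (Qd f) t\<bar> - a) / 14"
  have s: "s > 0" using t by (simp add: s_def)
  obtain B where B: "B \<ge> 0" "\<And>x. \<bar>f x\<bar> \<le> B" using bb_bound[OF d(1)] by blast
  obtain m :: nat where "B / s + 1 \<le> real m" using real_arch_simple by blast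
  then have m: "m \<ge> 1" "B / real m \<le> s"
  proof -
    assume h: "B / s + 1 \<le> real m"
    have "0 \<le> B / s" using B s by simp
    then have p: "0 < real m" using h by linarith
    then show "m \<ge> 1" by simp
    have "B / s \<le> real m" using h by simp
    then show "B / real m \<le> s" using p s by (simp add: field_simps)
  qed
  define G where "G j = gcdf (Qd f) m j" for j
  define h where "h j x = (of_bool (gidx m x < j) - G j :: real)" for j x
  define L where "L x = ln (f x) - Kl f" for x
  have bh: "bb (h j)" for j unfolding h_def
    by (rule bb_gidx[OF m(1), of "\<lambda>i. of_bool (i < j) - G j"])
  have zh: "(\<integral>x. f x * h j x \<partial>std_exp) = 0" if "j \<le> m" for j
  proof -
    have i: "integrable std_exp f" "integrable std_exp (\<lambda>x. f x * of_bool (gidx m x < j))"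
      by (auto intro!: E.bb_integrable bb_mult d bb_gidx[OF m(1), of "\<lambda>i. of_bool (i < j)"])
    have "f x * h j x = f x * of_bool (gidx m x < j) - G j * f x" for x by (simp add: h_def algebra_simps)
    then show ?thesis using i d(3) gcdf_Qd[OF f m(1) that] by (simp add: G_def)
  qed
  have Lm: "L \<in> borel_measurable borel" unfolding L_def by measurable
  have bl: "bb (\<lambda>x. f x * ln (f x))" by (rule bb_mult_ln[OF d(1,2)])
  have bl2: "bb (\<lambda>x. f x * (ln (f x))\<^sup>2)"
  proof (rule bbI)
    show "\<bar>f x * (ln (f x))\<^sup>2\<bar> \<le> 8 + 8 * B\<^sup>2" for x
      using mult_ln_square_bound[of "f x" B] d(2)[of x] B(2)[of x] by simp
  qed measurable
  have bL: "bb (\<lambda>x. f x * L x)"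
    using bb_diff[OF bl bb_mult[OF d(1) bb_const[of "Kl f"]]] by (simp add: L_def algebra_simps)
  have bL2: "bb (\<lambda>x. f x * (L x)\<^sup>2)"
  proof -
    have eq: "f x * (L x)\<^sup>2 = f x * (ln (f x))\<^sup>2 + ((- 2 * Kl f) * (f x * ln (f x)) + (Kl f)\<^sup>2 * f x)" for x
      by (simp add: L_def power2_eq_square algebra_simps)
    show ?thesis unfolding eq
      by (rule bb_add[OF bl2 bb_add[OF bb_mult[OF bb_const bl] bb_mult[OF bb_const d(1)]]])
  qed
  have zL: "(\<integral>x. f x * L x \<partial>std_exp) = 0"
  proof -
    have i: "integrable std_exp f" "integrable std_exp (\<lambda>x. f x * ln (f x))"
      by (auto intro!: E.bb_integrable d bl)
    have "f x * L x = f x * ln (f x) - Kl f * f x" for x by (simp add: L_def algebra_simps)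
    then show ?thesis using i d(3) by (simp add: Kl_def)
  qed
  define C where "C = (\<Sum>j<m. \<integral>x. f x * (h j x)\<^sup>2 \<partial>std_exp) / (s / real m)\<^sup>2 + (\<integral>x. f x * (L x)\<^sup>2 \<partial>std_exp) / e\<^sup>2"
  have bh2: "bb (\<lambda>x. f x * h j x)" "bb (\<lambda>x. f x * (h j x)\<^sup>2)" for j
    by (auto simp: power2_eq_square intro!: bb_mult d bh)
  have main: "1 - C / real n \<le> exp (real n * (Kl f + e)) * prob (Ev n a)" if n: "n \<ge> 1" for n
  proof -
    define P where "P \<omega> = (\<Prod>i\<in>{1..n}. f (Y i \<omega>))" for \<omega>
    define S where "S j \<omega> = (\<Sum>i\<in>{1..n}. h j (Y i \<omega>))" for j \<omega>
    define SL where "SL \<omega> = (\<Sum>i\<in>{1..n}. L (Y i \<omega>))" for \<omega>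
    define r where "r = real n * (s / real m)"
    define q where "q = real n * e"
    have rq: "r > 0" "q > 0" using n m s e by (auto simp: r_def q_def)
    have P0: "0 \<le> P \<omega>" for \<omega> unfolding P_def by (intro prod_nonneg) (auto simp: d)
    have IP: "integrable M P" "(\<integral>\<omega>. P \<omega> \<partial>M) = 1"
      unfolding P_def using prod_expectation[of "\<lambda>_. f" n] d by auto
    have IS: "integrable M (\<lambda>\<omega>. P \<omega> * (S j \<omega>)\<^sup>2)" "(\<integral>\<omega>. P \<omega> * (S j \<omega>)\<^sup>2 \<partial>M) = real n * (\<integral>x. f x * (h j x)\<^sup>2 \<partial>std_exp)"
      if "j < m" for j
      unfolding P_def S_def
      using weighted_second_moment[OF f bb_meas[OF bh] bh2 zh[of j], of n] that by auto
    have IL: "integrable M (\<lambda>\<omega>. P \<omega> * (SL \<omega>)\<^sup>2)" "(\<integral>\<omega>. P \<omega> * (SL \<omega>)\<^sup>2 \<partial>M) = real n * (\<integral>x. f x * (L x)\<^sup>2 \<partial>std_exp)"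
      unfolding P_def SL_def
      using weighted_second_moment[OF f Lm bL bL2 zL, of n] by auto
    have pw: "P \<omega> - ((\<Sum>j<m. P \<omega> * (S j \<omega>)\<^sup>2) / r\<^sup>2 + P \<omega> * (SL \<omega>)\<^sup>2 / q\<^sup>2) \<le> exp (real n * (Kl f + e)) * indicator (Ev n a) \<omega>"
      if pos: "\<forall>i\<in>{1..n}. 0 \<le> Y i \<omega>" and sp: "\<omega> \<in> space M" for \<omega>
    proof -
      define T where "T = (\<Sum>j<m. (S j \<omega>)\<^sup>2) / r\<^sup>2 + (SL \<omega>)\<^sup>2 / q\<^sup>2"
      have T0: "0 \<le> T" unfolding T_def by (intro add_nonneg_nonneg divide_nonneg_nonneg sum_nonneg) auto
      have eq: "P \<omega> - ((\<Sum>j<m. P \<omega> * (S j \<omega>)\<^sup>2) / r\<^sup>2 + P \<omega> * (SL \<omega>)\<^sup>2 / q\<^sup>2) = P \<omega> * (1 - T)"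
        by (simp add: T_def sum_distrib_left[symmetric] algebra_simps)
      show ?thesis
      proof (cases "T < 1")
        case False
        then have "P \<omega> * (1 - T) \<le> 0" using P0 by (intro mult_nonneg_nonpos) auto
        then show ?thesis unfolding eq by (rule order_trans) auto
      next
        case True
        have Sj: "\<bar>S j \<omega>\<bar> < r" if "j < m" for j
        proof -
          have "(S j \<omega>)\<^sup>2 \<le> (\<Sum>j<m. (S j \<omega>)\<^sup>2)" using that by (intro member_le_sum) auto
          then have "(S j \<omega>)\<^sup>2 / r\<^sup>2 \<le> (\<Sum>j<m. (S j \<omega>)\<^sup>2) / r\<^sup>2" by (intro divide_right_mono) auto
          also have "\<dots> \<le> T" unfolding T_def by simp
          finally have "(S j \<omega>)\<^sup>2 / r\<^sup>2 < 1" using True by linarith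
          then have "(S j \<omega>)\<^sup>2 < r\<^sup>2" using rq by (simp add: divide_less_eq_1)
          then have "\<bar>S j \<omega>\<bar>\<^sup>2 < r\<^sup>2" by simp
          then show ?thesis by (rule power_less_imp_less_base[OF _ less_imp_le[OF rq(1)]])
        qed
        have SLq: "SL \<omega> < q"
        proof -
          have "(SL \<omega>)\<^sup>2 / q\<^sup>2 \<le> T" unfolding T_def by (auto intro!: sum_nonneg divide_nonneg_nonneg)
          then have "(SL \<omega>)\<^sup>2 / q\<^sup>2 < 1" using True by linarith
          then have "(SL \<omega>)\<^sup>2 < q\<^sup>2" using rq by (simp add: divide_less_eq_1)
          then show ?thesis by (rule power_less_imp_less_base[OF _ less_imp_le[OF rq(2)]])
        qed
        let ?x = "\<lambda>i. Y i \<omega>"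
        have "\<bar>lcdf (emp n ?x) y - lcdf (Qd f) y\<bar> \<le> s / real m + B / real m" for y
        proof (rule kolmogorov_grid[OF emp_rd[OF n] Qd_rd[OF f] m(1) emp_lcdf_0[OF n] lcdf_Qd_0[OF f]])
          fix j assume j: "j < m"
          have "gcdf (emp n ?x) m j = (\<Sum>i\<in>{1..n}. of_bool (gidx m (?x i) < j)) / real n"
            by (rule emp_gcdf[OF n m(1)]) (use j pos in auto)
          then have eq: "gcdf (emp n ?x) m j - gcdf (Qd f) m j = S j \<omega> / real n"
            using n by (simp add: S_def h_def sum_subtractf G_def field_simps)
          have "\<bar>S j \<omega>\<bar> / real n \<le> r / real n" using Sj[OF j] by (intro divide_right_mono) auto
          also have "\<dots> = s / real m" using n by (simp add: r_def)
          finally show "\<bar>gcdf (emp n ?x) m j - gcdf (Qd f) m j\<bar> \<le> s / real m"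
            unfolding eq by (simp add: abs_divide)
          have i: "integrable std_exp (\<lambda>x. f x * of_bool (gidx m x < k))" "integrable std_exp (\<lambda>x. of_bool (gidx m x = k) :: real)" for k
            by (auto intro!: E.bb_integrable bb_mult d bb_gidx[OF m(1), of "\<lambda>i. of_bool (i < k)"] bb_gidx[OF m(1), of "\<lambda>i. of_bool (i = k)"])
          have "gcdf (Qd f) m (Suc j) - gcdf (Qd f) m j =
              (\<integral>x. f x * of_bool (gidx m x < Suc j) - f x * of_bool (gidx m x < j) \<partial>std_exp)"
            using j i by (simp add: gcdf_Qd[OF f m(1)])
          also have "\<dots> \<le> (\<integral>x. B * of_bool (gidx m x = j) \<partial>std_exp)"
          proof (rule integral_mono)
            show "f x * of_bool (gidx m x < Suc j) - f x * of_bool (gidx m x < j) \<le> B * of_bool (gidx m x = j)" for x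
              using B(2)[of x] by auto
          qed (use i in auto)
          also have "\<dots> = B / real m" using gidx_cell[OF m(1) j] by simp
          finally show "gcdf (Qd f) m (Suc j) - gcdf (Qd f) m j \<le> B / real m" .
        qed (use B s pos in auto)
        moreover have "s / real m + B / real m \<le> 2 * s" if "s / real m \<le> s" using that m(2) by linarith
        moreover have "s / real m \<le> s" using m(1) s mult_left_mono[of 1 "real m" s] by (simp add: divide_le_eq)
        ultimately have "\<bar>lcdf (emp n ?x) y - lcdf (Qd f) y\<bar> \<le> 2 * s" for y
          using order_trans by blast
        then have "\<bar>Tf (emp n ?x) t - Tf (Qd f) t\<bar> \<le> 6 * (2 * s)"
          by (intro Tf_kolmogorov emp_rd n Qd_rd f)
        moreover have "14 * s = \<bar>Tf (Qd f) t\<bar> - a" by (simp add: s_def)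
        ultimately have "a < \<bar>Tf (emp n ?x) t\<bar>" using s by linarith
        then have ev: "\<omega> \<in> Ev n a" using t sp by (auto simp: Ev_def)
        have "P \<omega> \<le> exp (real n * (Kl f + e))"
        proof (cases "\<exists>i\<in>{1..n}. f (?x i) = 0")
          case True
          then have "P \<omega> = 0" unfolding P_def by (intro prod_zero) auto
          then show ?thesis by simp
        next
          case False
          then have "P \<omega> = (\<Prod>i\<in>{1..n}. exp (ln (f (?x i))))"
            unfolding P_def using d(2) by (intro prod.cong) (auto simp: order_less_le)
          also have "\<dots> = exp (\<Sum>i\<in>{1..n}. ln (f (?x i)))" by (simp add: exp_sum)
          also have "(\<Sum>i\<in>{1..n}. ln (f (?x i))) = SL \<omega> + real n * Kl f"
            by (simp add: SL_def L_def sum_subtractf)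
          finally show ?thesis using SLq by (simp add: q_def algebra_simps)
        qed
        moreover have "P \<omega> * (1 - T) \<le> P \<omega> * 1" using T0 P0 by (intro mult_left_mono) auto
        ultimately show ?thesis unfolding eq using ev by simp
      qed
    qed
    have ae: "AE \<omega> in M. P \<omega> - ((\<Sum>j<m. P \<omega> * (S j \<omega>)\<^sup>2) / r\<^sup>2 + P \<omega> * (SL \<omega>)\<^sup>2 / q\<^sup>2) \<le> exp (real n * (Kl f + e)) * indicator (Ev n a) \<omega>"
      using Y_nonneg[of n] AE_space by eventually_elim (rule pw)
    have ii: "integrable M (indicator (Ev n a) :: _ \<Rightarrow> real)"
      using Ev_sets[OF n, of a] by (intro integrable_const_bound[of _ 1]) auto
    have Isum: "integrable M (\<lambda>\<omega>. \<Sum>j<m. P \<omega> * (S j \<omega>)\<^sup>2)" using IS by (intro Bochner_Integration.integrable_sum) auto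
    have vsum: "(\<integral>\<omega>. (\<Sum>j<m. P \<omega> * (S j \<omega>)\<^sup>2) \<partial>M) = real n * (\<Sum>j<m. \<integral>x. f x * (h j x)\<^sup>2 \<partial>std_exp)"
      using IS by (simp add: Bochner_Integration.integral_sum sum_distrib_left)
    have "(\<integral>\<omega>. P \<omega> - ((\<Sum>j<m. P \<omega> * (S j \<omega>)\<^sup>2) / r\<^sup>2 + P \<omega> * (SL \<omega>)\<^sup>2 / q\<^sup>2) \<partial>M) =
        1 - (real n * (\<Sum>j<m. \<integral>x. f x * (h j x)\<^sup>2 \<partial>std_exp) / r\<^sup>2 + real n * (\<integral>x. f x * (L x)\<^sup>2 \<partial>std_exp) / q\<^sup>2)"
      using IP Isum vsum IL by simp
    also have "\<dots> = 1 - C / real n"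
      using n by (simp add: C_def r_def q_def power_mult_distrib add_divide_distrib power2_eq_square mult_ac)
    finally have "1 - C / real n = (\<integral>\<omega>. P \<omega> - ((\<Sum>j<m. P \<omega> * (S j \<omega>)\<^sup>2) / r\<^sup>2 + P \<omega> * (SL \<omega>)\<^sup>2 / q\<^sup>2) \<partial>M)" ..
    also have "\<dots> \<le> (\<integral>\<omega>. exp (real n * (Kl f + e)) * indicator (Ev n a) \<omega> \<partial>M)"
      using IP Isum IL ii ae by (intro integral_mono_AE) auto
    also have "\<dots> = exp (real n * (Kl f + e)) * prob (Ev n a)" using Ev_sets[OF n] by simp
    finally show ?thesis .
  qed
  obtain n0 :: nat where n0: "2 * \<bar>C\<bar> \<le> real n0" using real_arch_simple by blast
  show ?thesis
  proof (intro exI[of _ "n0 + 1"] allI impI)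
    fix n assume n: "n0 + 1 \<le> n"
    then have n1: "n \<ge> 1" and "2 * \<bar>C\<bar> \<le> real n" using n0 by linarith+
    then have "C / real n \<le> 1 / 2" by (simp add: field_simps)
    then have "1 / 2 \<le> exp (real n * (Kl f + e)) * prob (Ev n a)" using main[OF n1] by linarith
    then have "exp (- real n * (Kl f + e)) * (1 / 2) \<le> exp (- real n * (Kl f + e)) * (exp (real n * (Kl f + e)) * prob (Ev n a))"
      by (intro mult_left_mono) auto
    also have "\<dots> = prob (Ev n a)" by (simp add: mult.assoc[symmetric] exp_add[symmetric])
    finally show "exp (- real n * (Kl f + e)) / 2 \<le> prob (Ev n a)" by simp
  qed
qed

end

section \<open>Laws without atoms\<close>

lemma (in real_distribution) isCont_integral_affine:
  fixes g :: "real \<Rightarrow> real"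
  assumes c: "\<And>x. isCont g x" and b: "\<And>x. \<bar>g x\<bar> \<le> 1"
  shows "isCont (\<lambda>s. \<integral>y. g (a * s + b * y + d) \<partial>M) s0"
proof (rule continuous_at_sequentiallyI)
  fix u :: "nat \<Rightarrow> real" assume u: "u \<longlonglongrightarrow> s0"
  have m [measurable]: "g \<in> borel_measurable borel"
    using c by (intro borel_measurable_continuous_onI) (simp add: continuous_at_imp_continuous_on)
  show "(\<lambda>n. \<integral>y. g (a * u n + b * y + d) \<partial>M) \<longlonglongrightarrow> (\<integral>y. g (a * s0 + b * y + d) \<partial>M)"
  proof (rule integral_dominated_convergence[where w = "\<lambda>_. 1"])
    show "AE y in M. (\<lambda>n. g (a * u n + b * y + d)) \<longlonglongrightarrow> g (a * s0 + b * y + d)"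
      using u by (intro AE_I2 isCont_tendsto_compose[OF c] tendsto_intros)
    show "(\<lambda>y. g (a * s0 + b * y + d)) \<in> borel_measurable M" by measurable
    show "\<And>n. (\<lambda>y. g (a * u n + b * y + d)) \<in> borel_measurable M" by measurable
    show "\<And>n. AE y in M. norm (g (a * u n + b * y + d)) \<le> 1" using b by (intro AE_I2) simp
  qed simp
qed

lemma (in three) sl_antimono:
  assumes "bb f" "bb g" "bb h" "\<And>x. 0 \<le> f x" "\<And>x. 0 \<le> g x" "\<And>x. 0 \<le> h x" "s \<le> s'"
  shows "sl1 \<nu> \<rho> g h t s' \<le> sl1 \<nu> \<rho> g h t s"
    and "sl2 \<mu> \<rho> f h t s' \<le> sl2 \<mu> \<rho> f h t s"
    and "sl3 \<mu> \<nu> f g t s' \<le> sl3 \<mu> \<nu> f g t s"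
proof -
  have b3: "integrable \<rho> (\<lambda>z. h z * of_bool (x + y / 2 + z / 3 < t))" for x y
    using assms by (intro m3.bb_integrable bb_mult bb_of_bool) auto
  have b2: "integrable \<nu> (\<lambda>y. g y * of_bool (x + y / 2 + z / 3 < t))" for x z
    using assms by (intro m2.bb_integrable bb_mult bb_of_bool) auto
  have 3: "(\<integral>z. h z * of_bool (x + y / 2 + z / 3 < t) \<partial>\<rho>) \<le> (\<integral>z. h z * of_bool (x' + y' / 2 + z / 3 < t) \<partial>\<rho>)"
    if "x' \<le> x" "y' \<le> y" for x y x' y'
    using that assms b3 by (intro integral_mono) auto
  have 2: "(\<integral>y. g y * of_bool (x + y / 2 + z / 3 < t) \<partial>\<nu>) \<le> (\<integral>y. g y * of_bool (x + y / 2 + z' / 3 < t) \<partial>\<nu>)"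
    if "z' \<le> z" for x z z'
    using that assms b2 by (intro integral_mono) auto
  show "sl1 \<nu> \<rho> g h t s' \<le> sl1 \<nu> \<rho> g h t s" unfolding sl1_def
    using assms by (intro integral_mono mult_left_mono 3 m2.bb_integrable bb_mult bb_inner3) auto
  show "sl2 \<mu> \<rho> f h t s' \<le> sl2 \<mu> \<rho> f h t s" unfolding sl2_def
    using assms by (intro integral_mono mult_left_mono 3 m1.bb_integrable bb_mult bb_inner3) auto
  show "sl3 \<mu> \<nu> f g t s' \<le> sl3 \<mu> \<nu> f g t s" unfolding sl3_def
    using assms by (intro integral_mono mult_left_mono 2 m1.bb_integrable bb_mult bb_inner2) auto
qed

lemma (in three) sl_nonneg:
  assumes "\<And>x. 0 \<le> f x" "\<And>x. 0 \<le> g x" "\<And>x. 0 \<le> h x"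
  shows "0 \<le> sl1 \<nu> \<rho> g h t s" "0 \<le> sl2 \<mu> \<rho> f h t s" "0 \<le> sl3 \<mu> \<nu> f g t s"
  unfolding sl1_def sl2_def sl3_def using assms
  by (auto intro!: Bochner_Integration.integral_nonneg mult_nonneg_nonneg)

lemma return_rd: "real_distribution (return borel (x::real))"
proof -
  interpret prob_space "return borel x" by (rule prob_space_return) simp
  show ?thesis by standard auto
qed

lemma (in three) sl1_return:
  assumes "bb g" "bb h" shows "sl1 \<nu> \<rho> g h t s = tri (return borel s) \<nu> \<rho> one g h t"
proof -
  have "(\<lambda>x. 1 * sl1 \<nu> \<rho> g h t x) \<in> borel_measurable borel" by (rule bb_meas[OF bb_mult[OF bb_const bb_sl(1)[OF assms]]])
  from integral_return[OF _ this, of s] show ?thesis by (simp add: tri_def sl1_def)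
qed

text \<open>The properties of the weak limits of laws with bounded entropy that the variational argument
  uses.\<close>

locale atomless = real_distribution Q for Q :: "real measure" +
  assumes at0: "lcdf Q 0 = 0" and atom: "\<And>x. measure Q {x} = 0"
begin

sublocale th: three Q Q Q ..

lemma lcdf_cdf: "lcdf Q x = cdf Q x"
proof -
  have "measure Q {..x} = measure Q {..<x} + measure Q {x}"
    by (subst finite_measure_Union[symmetric]) (auto intro!: arg_cong[where f = "measure Q"])
  then show ?thesis using atom by (simp add: lcdf_def cdf_def)
qed

lemma isCont_lcdf: "isCont (lcdf Q) x"
  using isCont_cdf[of x] atom lcdf_cdf by (simp add: fun_eq_iff[symmetric] ext[of "lcdf Q" "cdf Q"])

lemma abs_lcdf: "\<bar>lcdf Q x\<bar> \<le> 1" by simp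

lemma AE_nonneg: "AE x in Q. 0 \<le> x"
proof -
  have "prob {..<0} = 0" using at0 by (simp add: lcdf_def)
  then have "AE x in Q. x \<notin> {..<0}" by (subst prob_eq_0[symmetric]) auto
  then show ?thesis by (auto simp: not_less)
qed

lemma AE_neq: "AE x in Q. x \<noteq> a"
proof -
  have "AE x in Q. x \<notin> {a}" using atom[of a] by (subst prob_eq_0[symmetric]) auto
  then show ?thesis by simp
qed

lemma sl1_one: "sl1 Q Q one one t s = (\<integral>y. lcdf Q (3 * (t - s - y / 2)) \<partial>Q)"
  unfolding sl1_def th.W3_slice3 by simp
lemma sl2_one: "sl2 Q Q one one t s = (\<integral>y. lcdf Q (3 * (t - y - s / 2)) \<partial>Q)"
  unfolding sl2_def th.W3_slice3 by simp
lemma sl3_one: "sl3 Q Q one one t s = (\<integral>y. lcdf Q (2 * (t - y - s / 3)) \<partial>Q)"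
  unfolding sl3_def th.W3_slice2 by simp

lemma isCont_sl: "isCont (sl1 Q Q one one t) s" "isCont (sl2 Q Q one one t) s" "isCont (sl3 Q Q one one t) s"
proof -
  note * = isCont_integral_affine[OF isCont_lcdf abs_lcdf]
  have eq: "sl1 Q Q one one t = (\<lambda>s. \<integral>y. lcdf Q (- 3 * s + (- 3 / 2) * y + 3 * t) \<partial>Q)"
    by (simp add: fun_eq_iff sl1_one algebra_simps)
  show "isCont (sl1 Q Q one one t) s" unfolding eq by (rule *)
  have eq: "sl2 Q Q one one t = (\<lambda>s. \<integral>y. lcdf Q ((- 3 / 2) * s + (- 3) * y + 3 * t) \<partial>Q)"
    by (simp add: fun_eq_iff sl2_one algebra_simps)
  show "isCont (sl2 Q Q one one t) s" unfolding eq by (rule *)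
  have eq: "sl3 Q Q one one t = (\<lambda>s. \<integral>y. lcdf Q ((- 2 / 3) * s + (- 2) * y + 2 * t) \<partial>Q)"
    by (simp add: fun_eq_iff sl3_one algebra_simps)
  show "isCont (sl3 Q Q one one t) s" unfolding eq by (rule *)
qed

lemma isCont_Tf: "isCont (Tf Q) t"
proof -
  define \<psi> where "\<psi> u = (\<integral>y. lcdf Q (3 * u + (- 3 / 2) * y + 0) \<partial>Q)" for u
  have c: "isCont \<psi> u" for u unfolding \<psi>_def by (rule isCont_integral_affine[OF isCont_lcdf abs_lcdf])
  have b: "\<bar>\<psi> u\<bar> \<le> 1" for u unfolding \<psi>_def
  proof (rule abs_integral_le)
    have "lcdf Q \<in> borel_measurable borel"
      using isCont_lcdf by (intro borel_measurable_continuous_onI) (simp add: continuous_at_imp_continuous_on)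
    then show "(\<lambda>y. lcdf Q (3 * u + (- 3 / 2) * y + 0)) \<in> borel_measurable borel" by measurable
  qed simp
  have "W3 Q Q Q t = (\<integral>x. \<psi> (1 * t + (- 1) * x + 0) \<partial>Q)" for t
    unfolding th.tri_sl1 sl1_one \<psi>_def by (simp add: algebra_simps)
  then have eq: "W3 Q Q Q = (\<lambda>t. \<integral>x. \<psi> (1 * t + (- 1) * x + 0) \<partial>Q)" by (rule ext)
  have "isCont (W3 Q Q Q) t" unfolding eq by (rule isCont_integral_affine[OF c b])
  then show ?thesis unfolding Tf_def[abs_def] by (intro continuous_intros isCont_lcdf)
qed

text \<open>If all three points lie below \<open>m\<close>, then \<open>x + y/2 + z/3 < 11/6 m\<close>,
  because \<open>1 + 1/2 + 1/3 = 11/6\<close>.\<close>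

lemma tri_below:
  assumes "11 / 6 * m \<le> t"
  shows "tri Q Q Q (\<lambda>x. of_bool (x < m)) (\<lambda>x. of_bool (x < m)) (\<lambda>x. of_bool (x < m)) t = (lcdf Q m) ^ 3"
proof -
  define L where "L x = (of_bool (x < m) :: real)" for x
  have IL: "(\<integral>z. L z \<partial>Q) = lcdf Q m" unfolding L_def by (rule integral_of_bool_lt)
  have 1: "L x * (L y * (\<integral>z. L z * of_bool (x + y / 2 + z / 3 < t) \<partial>Q)) = L x * (L y * lcdf Q m)" for x y
  proof (cases "x < m \<and> y < m")
    case True
    then have "L z * of_bool (x + y / 2 + z / 3 < t) = L z" for z using assms by (auto simp: L_def)
    then show ?thesis by (simp only: IL)
  qed (auto simp: L_def)
  have "tri Q Q Q L L L t = (\<integral>x. (\<integral>y. L x * (L y * (\<integral>z. L z * of_bool (x + y / 2 + z / 3 < t) \<partial>Q)) \<partial>Q) \<partial>Q)"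
    unfolding tri_def by simp
  also have "\<dots> = (lcdf Q m) ^ 3"
    unfolding 1 by (simp add: IL power3_eq_cube)
  finally show ?thesis unfolding L_def[abs_def] .
qed

text \<open>Both \<open>F^3\<close> and \<open>W\<close> tend to one, so that a positive level can only be
  attained at a bounded \<open>t\<close>.\<close>

lemma Tf_at_top: "(Tf Q \<longlongrightarrow> 0) at_top"
proof -
  have l: "(lcdf Q \<longlongrightarrow> 1) at_top" using cdf_lim_at_top_prob lcdf_cdf by (simp add: ext[of "lcdf Q" "cdf Q"])
  have lt: "((\<lambda>t. lcdf Q (6 / 11 * t)) \<longlongrightarrow> 1) at_top"
    by (rule filterlim_compose[OF l]) (rule filterlim_tendsto_pos_mult_at_top[OF tendsto_const], simp, rule filterlim_ident)
  have "W3 Q Q Q t \<ge> (lcdf Q (6 / 11 * t)) ^ 3" for t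
  proof -
    have "tri Q Q Q (\<lambda>x. of_bool (x < 6 / 11 * t)) (\<lambda>x. of_bool (x < 6 / 11 * t)) (\<lambda>x. of_bool (x < 6 / 11 * t)) t \<le> W3 Q Q Q t"
      by (rule th.tri_mono) (auto intro!: bb_of_bool)
    moreover have "tri Q Q Q (\<lambda>x. of_bool (x < 6 / 11 * t)) (\<lambda>x. of_bool (x < 6 / 11 * t)) (\<lambda>x. of_bool (x < 6 / 11 * t)) t = (lcdf Q (6 / 11 * t)) ^ 3"
      by (rule tri_below) simp
    ultimately show ?thesis by linarith
  qed
  moreover have "W3 Q Q Q t \<le> 1" for t by (rule th.W3_bounds)
  moreover have "(lcdf Q t) ^ 3 \<le> 1" for t by (simp add: power_le_one)
  ultimately have b: "\<And>t. (lcdf Q t) ^ 3 - 1 \<le> Tf Q t" "\<And>t. Tf Q t \<le> 1 - (lcdf Q (6 / 11 * t)) ^ 3"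
  proof -
    assume h: "\<And>t. (lcdf Q (6 / 11 * t)) ^ 3 \<le> W3 Q Q Q t" "\<And>t. W3 Q Q Q t \<le> 1" "\<And>t. (lcdf Q t) ^ 3 \<le> 1"
    show "(lcdf Q t) ^ 3 - 1 \<le> Tf Q t" for t unfolding Tf_def using h(2)[of t] by linarith
    show "Tf Q t \<le> 1 - (lcdf Q (6 / 11 * t)) ^ 3" for t unfolding Tf_def using h(1)[of t] h(3)[of t] by linarith
  qed
  have 1: "((\<lambda>t. (lcdf Q t) ^ 3 - 1) \<longlongrightarrow> 1 ^ 3 - 1) at_top" by (intro tendsto_intros l)
  have 2: "((\<lambda>t. 1 - (lcdf Q (6 / 11 * t)) ^ 3) \<longlongrightarrow> 1 - 1 ^ 3) at_top" by (intro tendsto_intros lt)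
  show ?thesis by (rule tendsto_sandwich[of "\<lambda>t. (lcdf Q t) ^ 3 - 1" _ _ "\<lambda>t. 1 - (lcdf Q (6 / 11 * t)) ^ 3"])
    (use 1 2 b in auto)
qed

text \<open>One third of the first variation of \<open>W\<close> in the direction of a point mass at
  \<open>s\<close>, that is, the conditional probability of the event given one of the three
  points, averaged over the three slots.\<close>

definition gG :: "real \<Rightarrow> real \<Rightarrow> real" where
  "gG t s = (sl1 Q Q one one t s + sl2 Q Q one one t s + sl3 Q Q one one t s) / 3"

lemma bb_gG: "bb (gG t)"
proof -
  have "bb (\<lambda>s. (1 / 3) * (sl1 Q Q one one t s + sl2 Q Q one one t s + sl3 Q Q one one t s))"
    by (rule bb_mult[OF bb_const bb_add[OF bb_add[OF th.bb_sl(1)[OF bb_const bb_const] th.bb_sl(2)[OF bb_const bb_const]] th.bb_sl(3)[OF bb_const bb_const]]])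
  then show ?thesis by (simp add: gG_def[abs_def])
qed

lemma gG_integral: "(\<integral>s. gG t s \<partial>Q) = W3 Q Q Q t"
proof -
  note i = bb_integrable[OF th.bb_sl(1)[OF bb_const bb_const]] bb_integrable[OF th.bb_sl(2)[OF bb_const bb_const]] bb_integrable[OF th.bb_sl(3)[OF bb_const bb_const]]
  have "(\<integral>s. sl1 Q Q one one t s \<partial>Q) = W3 Q Q Q t" "(\<integral>s. sl2 Q Q one one t s \<partial>Q) = W3 Q Q Q t" "(\<integral>s. sl3 Q Q one one t s \<partial>Q) = W3 Q Q Q t"
    using th.tri_sl1[of one one one t] th.tri_sl2[of one one one t] th.tri_sl3[of one one one t] by auto
  then show ?thesis unfolding gG_def using i by simp
qed

lemma gG_antimono: "s \<le> s' \<Longrightarrow> gG t s' \<le> gG t s"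
  unfolding gG_def using th.sl_antimono[of one one one s s' t] by simp

lemma gG_nonneg: "0 \<le> gG t s"
  unfolding gG_def using th.sl_nonneg[of one one one t s] by simp

lemma isCont_gG: "isCont (gG t) s"
  unfolding gG_def[abs_def] using isCont_sl by (intro continuous_intros) auto

text \<open>All three slices are decreasing, so a flat stretch of their sum is a flat stretch of each.\<close>

lemma sl_eq_of_gG_eq: assumes "s \<le> s'" "gG t s = gG t s'"
  shows "sl1 Q Q one one t s = sl1 Q Q one one t s'" "sl2 Q Q one one t s = sl2 Q Q one one t s'"
    "sl3 Q Q one one t s = sl3 Q Q one one t s'"
  using th.sl_antimono[of one one one s s' t] assms unfolding gG_def by auto

lemma gG_limit_ge:
  assumes "0 < t" "\<And>s. 0 \<le> s \<Longrightarrow> s < t \<Longrightarrow> c \<le> gG t s" shows "c \<le> gG t t"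
proof -
  have "(gG t \<longlongrightarrow> gG t t) (at_left t)" using isCont_gG[of t t] by (simp add: isCont_def filterlim_at_split)
  moreover have "\<forall>\<^sub>F s in at_left t. c \<le> gG t s"
    using assms by (intro eventually_at_leftI[of 0]) auto
  ultimately show ?thesis by (rule tendsto_lowerbound) simp
qed

lemma gG_limit_le:
  assumes "\<And>s. t < s \<Longrightarrow> gG t s \<le> c" shows "gG t t \<le> c"
proof -
  have "(gG t \<longlongrightarrow> gG t t) (at_right t)" using isCont_gG[of t t] by (simp add: isCont_def filterlim_at_split)
  moreover have "\<forall>\<^sub>F s in at_right t. gG t s \<le> c"
    using assms by (intro eventually_at_rightI[of t "t + 1"]) auto
  ultimately show ?thesis by (rule tendsto_upperbound) simp
qed

lemma sl1_vanish: assumes "bb g" "bb h" "t \<le> s" shows "sl1 Q Q g h t s = 0"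
proof -
  have "g y * (\<integral>z. h z * of_bool (s + y / 2 + z / 3 < t) \<partial>Q) = 0" if "0 \<le> y" for y
  proof -
    have "(\<integral>z. h z * of_bool (s + y / 2 + z / 3 < t) \<partial>Q) = (\<integral>z. 0 \<partial>Q)"
    proof (rule integral_cong_AE)
      show "(\<lambda>z. h z * of_bool (s + y / 2 + z / 3 < t)) \<in> borel_measurable Q" using bb_meas[OF assms(2)] by measurable
      show "AE z in Q. h z * of_bool (s + y / 2 + z / 3 < t) = 0"
        using AE_nonneg by eventually_elim (use that assms in auto)
    qed simp
    then show ?thesis by simp
  qed
  then have "sl1 Q Q g h t s = (\<integral>y. 0 \<partial>Q)" unfolding sl1_def
    using AE_nonneg bb_meas[OF bb_mult[OF assms(1) th.bb_inner3(1)[OF assms(2)]]]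
    by (intro integral_cong_AE) (auto elim!: eventually_mono)
  then show ?thesis by simp
qed

text \<open>If the variation equals \<open>a > 0\<close> on the support, the support lies below
  \<open>t\<close>, because beyond \<open>t\<close> the variation is not positive. Hence \<open>F
  = 1\<close>, and \<open>gG\<close> is flat with value \<open>1 - a\<close> from the support up
  to \<open>t\<close>. There \<open>sl1\<close> vanishes, so it vanishes on the support. Hence
  \<open>W = 0\<close> and \<open>1 - a\<close>, the mean of \<open>gG\<close>, is zero.\<close>

lemma no_degenerate_plus:
  assumes t: "0 < t" and a: "0 < a" "a < 1"
    and le: "\<And>s. 0 \<le> s \<Longrightarrow> s \<noteq> t \<Longrightarrow> (lcdf Q t)\<^sup>2 * of_bool (s < t) - gG t s \<le> a"
    and ae: "AE s in Q. (lcdf Q t)\<^sup>2 * of_bool (s < t) - gG t s = a"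
  shows False
proof -
  have lt: "AE s in Q. s < t"
    using ae
  proof eventually_elim
    case (elim s)
    show ?case
    proof (rule ccontr)
      assume "\<not> s < t"
      then have "- gG t s = a" using elim by simp
      then show False using gG_nonneg[of t s] a by linarith
    qed
  qed
  then have F: "lcdf Q t = 1" using prob_eq_1[of "{..<t}"] by (simp add: lcdf_def)
  have lim: "1 - a \<le> gG t t"
  proof (rule gG_limit_ge[OF t])
    fix s assume "0 \<le> s" "s < t" then show "1 - a \<le> gG t s" using le[of s] F by simp
  qed
  have "AE s in Q. gG t s = 1 - a" using ae lt by eventually_elim (use F in auto)
  then have "AE s in Q. sl1 Q Q one one t s = 0" using lt
  proof eventually_elim
    case (elim s)
    then have "gG t s = gG t t" using lim gG_antimono[of s t t] by simp
    then have "sl1 Q Q one one t s = sl1 Q Q one one t t" using elim by (intro sl_eq_of_gG_eq(1)) auto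
    then show ?case using sl1_vanish[OF bb_const bb_const, of t t] by simp
  qed
  then have "(\<integral>s. sl1 Q Q one one t s \<partial>Q) = (\<integral>s. 0 \<partial>Q)"
    using bb_meas[OF th.bb_sl(1)[OF bb_const bb_const]] by (intro integral_cong_AE) auto
  then have W: "W3 Q Q Q t = 0" unfolding th.tri_sl1 by simp
  have "(\<integral>s. gG t s \<partial>Q) = (\<integral>s. 1 - a \<partial>Q)"
    using \<open>AE s in Q. gG t s = 1 - a\<close> bb_meas[OF bb_gG] by (intro integral_cong_AE) auto
  then show False using W a gG_integral[of t] prob_space by simp
qed

end

section \<open>The degenerate optimum\<close>

text \<open>\<open>A1\<close>, \<open>A2\<close> and \<open>G\<close> are the masses of the parts of the
  event in which exactly the second, exactly the third, or both of these points lie above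
  \<open>t\<close>; the first point always lies below. The equations are the optimality conditions
  summed over the support below and above \<open>t\<close>.\<close>

lemma degenerate_algebra:
  fixes F q A1 A2 G a :: real
  assumes F: "0 < F" "0 < q" "F + q = 1" and n: "0 \<le> A1" "0 \<le> A2" "0 < G"
    and a: "a = A1 + A2 + G" "3 * q * a = A1 + A2 + 2 * G" "F * G \<le> q * A1" "F * G \<le> q * A2"
    and b: "A1 \<le> F\<^sup>2 * q" "A2 \<le> F\<^sup>2 * q" "G \<le> F * q\<^sup>2"
  shows "1 / 3 \<le> q" "q \<le> 0.43" "a \<le> 0.385"
proof -
  define S where "S = A1 + A2"
  have 1: "S * (3 * q - 1) = G * (2 - 3 * q)" using a by (simp add: S_def algebra_simps)
  have 2: "2 * (F * G) \<le> q * S" using a by (simp add: S_def algebra_simps)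
  have "0 < q * S" using 2 F n by (smt (verit) mult_pos_pos)
  then have S: "0 < S" using F by (simp add: zero_less_mult_iff)
  show q1: "1 / 3 \<le> q"
  proof (rule ccontr)
    assume "\<not> 1 / 3 \<le> q"
    then have "S * (3 * q - 1) < 0" "0 < G * (2 - 3 * q)" using S n by (auto simp: mult_less_0_iff zero_less_mult_iff)
    then show False using 1 by simp
  qed
  have "(2 * (F * G)) * (3 * q - 1) \<le> (q * S) * (3 * q - 1)" using 2 q1 by (intro mult_right_mono) auto
  also have "\<dots> = q * (G * (2 - 3 * q))" by (simp only: mult.assoc 1)
  finally have "G * (2 * F * (3 * q - 1)) \<le> G * (q * (2 - 3 * q))" by (simp add: algebra_simps)
  then have "2 * F * (3 * q - 1) \<le> q * (2 - 3 * q)" using n(3) by (simp add: mult_le_cancel_left)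
  moreover have "F = 1 - q" using F by simp
  ultimately have 3: "0 \<le> 3 * q\<^sup>2 - 6 * q + 2" by (simp add: algebra_simps power2_eq_square)
  show "q \<le> 0.43"
  proof (rule ccontr)
    assume "\<not> q \<le> 0.43"
    then have "(1 - q)\<^sup>2 \<le> (0.57)\<^sup>2" using F by (intro power_mono) auto
    then have "3 * q\<^sup>2 - 6 * q + 2 < 0" by (simp add: power2_eq_square algebra_simps)
    then show False using 3 by simp
  qed
  have "a \<le> 2 * (F\<^sup>2 * q) + F * q\<^sup>2" using a b by simp
  also have "\<dots> = F - F ^ 3" using F(3) by (simp add: \<open>F = 1 - q\<close> power2_eq_square power3_eq_cube algebra_simps)
  also have "\<dots> \<le> 0.385"
  proof -
    have "(F - c)\<^sup>2 * (F + 2 * c) = F ^ 3 - 3 * c\<^sup>2 * F + 2 * c ^ 3" for c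
      by (simp add: power2_eq_square power3_eq_cube algebra_simps)
    note this[of "0.5774"]
    moreover have "0 \<le> (F - 0.5774)\<^sup>2 * (F + 2 * 0.5774)" using F by simp
    ultimately have "0 \<le> F ^ 3 - 3 * 0.5774\<^sup>2 * F + 2 * 0.5774 ^ 3" by linarith
    moreover have "3 * 0.5774\<^sup>2 * F \<ge> 1 * F" using F by (intro mult_right_mono) (auto simp: power2_eq_square)
    moreover have "2 * 0.5774 ^ 3 \<le> (0.385 :: real)" by (simp add: power3_eq_cube)
    ultimately show ?thesis by linarith
  qed
  finally show "a \<le> 0.385" .
qed

context atomless begin

text \<open>The event contains at most the whole product cell.\<close>

lemma cell_tri_le:
  assumes "bb f" "bb g" "bb h" "\<And>x. 0 \<le> f x" "\<And>x. 0 \<le> g x" "\<And>x. 0 \<le> h x"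
  shows "tri Q Q Q f g h t \<le> (\<integral>x. f x \<partial>Q) * (\<integral>x. g x \<partial>Q) * (\<integral>x. h x \<partial>Q)"
  using th.tri_abs[OF assms(1-3), of t] assms(4-6) by simp

text \<open>Classify the three points as low (below \<open>t\<close>) or high. The first point of the event
  is always low, and constancy of the variation on the low and on the high part of the support
  gives linear relations between the masses of the classes. They determine \<open>F\<close> up to
  a short interval. A class of positive mass has to respect \<open>x + y/2 + z/3 < t\<close> at
  the upper end of the low support, and this yields the gaps below \<open>t\<close>. The first
  alternative is the case in which no triple with two high points contributes.\<close>

lemma degenerate_minus:
  assumes t: "0 < t" and a: "0 < a" "a = W3 Q Q Q t - (lcdf Q t) ^ 3"
    and le: "\<And>s. 0 \<le> s \<Longrightarrow> s \<noteq> t \<Longrightarrow> gG t s - (lcdf Q t)\<^sup>2 * of_bool (s < t) \<le> a"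
    and ae: "AE s in Q. gG t s - (lcdf Q t)\<^sup>2 * of_bool (s < t) = a"
  defines "F \<equiv> lcdf Q t"
  shows "0 < F \<and> F < 1 \<and>
    (F = 2 / 3 \<and> a \<le> 8 / 27 \<and> measure Q {t..<6 / 5 * t} = 0 \<and> measure Q {2 / 5 * t<..<t} = 0 \<or>
     0.57 \<le> F \<and> F \<le> 2 / 3 \<and> a \<le> 0.385 \<and> measure Q {t / 6<..<t} = 0)"
proof -
  define L where "L x = (of_bool (x < t) :: real)" for x
  define H where "H x = (of_bool (t \<le> x) :: real)" for x
  define q where "q = 1 - F"
  have bL: "bb L" unfolding L_def[abs_def] by (intro bb_of_bool) measurable
  have bH: "bb H" unfolding H_def[abs_def] by (intro bb_of_bool) measurable
  have L0: "0 \<le> L x" "L x \<le> 1" and H0: "0 \<le> H x" "H x \<le> 1" for x by (auto simp: L_def H_def)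
  have LH: "L x = 1 - H x" for x by (auto simp: L_def H_def)
  have one_LH: "one = (\<lambda>x. 1 * L x + 1 * H x)" by (auto simp: LH)
  have IL: "(\<integral>x. L x \<partial>Q) = F" unfolding L_def F_def by (rule integral_of_bool_lt)
  have IH: "(\<integral>x. H x \<partial>Q) = q"
  proof -
    have "(\<integral>x. H x \<partial>Q) = (\<integral>x. 1 - L x \<partial>Q)" by (simp add: LH)
    then show ?thesis using bb_integrable[OF bL] IL prob_space by (simp add: q_def)
  qed
  have Fb: "0 \<le> F" "F \<le> 1" by (simp_all add: F_def)
  have split2: "tri Q Q Q f one h t = tri Q Q Q f L h t + tri Q Q Q f H h t" if "bb f" "bb h" for f h
    using th.tri_lin2[OF that(1) bL bH that(2), of 1 1 t] by (subst one_LH) simp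
  have split3: "tri Q Q Q f g one t = tri Q Q Q f g L t + tri Q Q Q f g H t" if "bb f" "bb g" for f g
    using th.tri_lin3[OF that bL bH, of 1 1 t] by (subst one_LH) simp
  have split1: "tri Q Q Q one g h t = tri Q Q Q L g h t + tri Q Q Q H g h t" if "bb g" "bb h" for g h
    using th.tri_lin1[OF bL bH that, of 1 1 t] by (subst one_LH) simp
  have H1: "tri Q Q Q H g h t = 0" if "bb g" "bb h" for g h
  proof -
    have "H x * sl1 Q Q g h t x = 0" for x using sl1_vanish[OF that, of t x] by (auto simp: H_def)
    then have "(\<lambda>x. H x * sl1 Q Q g h t x) = (\<lambda>_. 0)" by (rule ext)
    then show ?thesis unfolding th.tri_sl1 by simp
  qed
  define A1 where "A1 = tri Q Q Q L H L t"
  define A2 where "A2 = tri Q Q Q L L H t"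
  define G where "G = tri Q Q Q L H H t"
  have nn: "0 \<le> A1" "0 \<le> A2" "0 \<le> G" unfolding A1_def A2_def G_def
    by (rule th.tri_mono(1)[OF bL bH bL bL bH bL] th.tri_mono(1)[OF bL bL bH bL bL bH] th.tri_mono(1)[OF bL bH bH bL bH bH]; simp add: L0 H0)+
  have ub: "A1 \<le> F\<^sup>2 * q" "A2 \<le> F\<^sup>2 * q" "G \<le> F * q\<^sup>2"
    using cell_tri_le[OF bL bH bL, of t] cell_tri_le[OF bL bL bH, of t] cell_tri_le[OF bL bH bH, of t]
    by (simp_all add: A1_def A2_def G_def IL IH L0 H0 power2_eq_square mult_ac)
  have W: "W3 Q Q Q t = tri Q Q Q L L L t + A1 + A2 + G"
    using split1[of one one] split2[OF bL, of one] split3[OF bL bL] split3[OF bL bH] H1[of one one]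
    by (simp add: A1_def A2_def G_def)
  have LLL: "tri Q Q Q L L L t \<le> F ^ 3"
    using cell_tri_le[OF bL bL bL, of t] by (simp add: IL L0 power3_eq_cube)
  \<comment> \<open>The variation is constant on either part of the support, and it is a sum of monotone slices.\<close>
  have g0: "gG t 0 \<le> a + F\<^sup>2" using le[of 0] t by (simp add: F_def)
  have lowc: "AE s in Q. s < t \<longrightarrow> gG t s = gG t 0"
    using ae AE_nonneg
  proof eventually_elim
    case (elim s)
    then show ?case using g0 gG_antimono[of 0 s t] by (auto simp: F_def)
  qed
  have gt: "gG t t \<le> a"
  proof (rule gG_limit_le)
    fix s assume "t < s" then show "gG t s \<le> a" using le[of s] t by simp
  qed
  have Fpos: "0 < F"
  proof (rule ccontr)
    assume "\<not> 0 < F"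
    then have "F = 0" using Fb by simp
    then have "W3 Q Q Q t = 0" using W LLL ub nn th.tri_mono(1)[OF bL bL bL bL bL bL, of t] L0 by simp
    then show False using a \<open>F = 0\<close> by (simp add: F_def)
  qed
  have qpos: "0 < q"
  proof (rule ccontr)
    assume "\<not> 0 < q"
    then have "F = 1" using Fb by (simp add: q_def)
    then show False using a th.W3_bounds(2)[of t] by (simp add: F_def)
  qed
  define low where "low s \<longleftrightarrow> 0 \<le> s \<and> s < t \<and> measure Q {s<..<t} \<noteq> 0" for s
  have low_c: "gG t s = gG t 0" if "low s" for s
  proof -
    have "\<not> (AE x in Q. x \<notin> {s<..<t})"
      using that by (subst prob_eq_0[symmetric]) (auto simp: low_def)
    moreover have "AE x in Q. x \<notin> {s<..<t}" if "\<And>x. s < x \<Longrightarrow> x < t \<Longrightarrow> gG t x \<noteq> gG t 0"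
      using lowc by eventually_elim (use that in auto)
    ultimately obtain x where x: "gG t x = gG t 0" "s < x" "x < t" by blast
    then show ?thesis using gG_antimono[of s x t] gG_antimono[of 0 s t] that by (simp add: low_def)
  qed
  have low_sl: "sl1 Q Q one one t s = sl1 Q Q one one t 0" "sl2 Q Q one one t s = sl2 Q Q one one t 0"
    "sl3 Q Q one one t s = sl3 Q Q one one t 0" if "low s" for s
    using sl_eq_of_gG_eq[of 0 s t] low_c[OF that] that by (auto simp: low_def)
  \<comment> \<open>Monotonicity also passes the constancy on to the slices with the weights low and high, whose sums are the slices.\<close>
  have low_sl1: "sl1 Q Q g h t s = sl1 Q Q g h t 0"
    if lw: "low s" and gh: "bb g" "bb h" "\<And>x. 0 \<le> g x" "\<And>x. g x \<le> 1" "\<And>x. 0 \<le> h x" "\<And>x. h x \<le> 1" for s g h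
  proof -
    have s0: "0 \<le> s" using lw by (simp add: low_def)
    define g' where "g' x = 1 - g x" for x
    define h' where "h' x = 1 - h x" for x
    have b: "bb g'" "bb h'" unfolding g'_def[abs_def] h'_def[abs_def] by (rule bb_diff[OF bb_const gh(1)], rule bb_diff[OF bb_const gh(2)])
    have n: "0 \<le> g' x" "0 \<le> h' x" for x using gh by (auto simp: g'_def h'_def)
    have og: "one = (\<lambda>x. 1 * g x + 1 * g' x)" and oh: "one = (\<lambda>x. 1 * h x + 1 * h' x)" by (auto simp: g'_def h'_def)
    have sp: "sl1 Q Q one one t r = sl1 Q Q g h t r + sl1 Q Q g' h t r + (sl1 Q Q g h' t r + sl1 Q Q g' h' t r)" for r
    proof -
      interpret r: three "return borel r" Q Q by (intro three.intro return_rd real_distribution_axioms)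
      have 1: "sl1 Q Q one k t r = sl1 Q Q g k t r + sl1 Q Q g' k t r" if "bb k" for k
        unfolding r.sl1_return[OF bb_const that] r.sl1_return[OF gh(1) that] r.sl1_return[OF b(1) that]
        using r.tri_lin2[OF bb_const gh(1) b(1) that, of 1 1 1 t] by (subst og) simp
      have "sl1 Q Q one one t r = sl1 Q Q one h t r + sl1 Q Q one h' t r"
        unfolding r.sl1_return[OF bb_const bb_const] r.sl1_return[OF bb_const gh(2)] r.sl1_return[OF bb_const b(2)]
        using r.tri_lin3[OF bb_const bb_const gh(2) b(2), of 1 1 1 1 t] by (subst (3) oh) simp
      then show ?thesis using 1[OF gh(2)] 1[OF b(2)] by simp
    qed
    have "sl1 Q Q g h t s \<le> sl1 Q Q g h t 0" "sl1 Q Q g' h t s \<le> sl1 Q Q g' h t 0"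
      "sl1 Q Q g h' t s \<le> sl1 Q Q g h' t 0" "sl1 Q Q g' h' t s \<le> sl1 Q Q g' h' t 0"
      using th.sl_antimono(1)[OF bb_const gh(1) gh(2), of 1 0 s t] th.sl_antimono(1)[OF bb_const b(1) gh(2), of 1 0 s t]
        th.sl_antimono(1)[OF bb_const gh(1) b(2), of 1 0 s t] th.sl_antimono(1)[OF bb_const b(1) b(2), of 1 0 s t]
        gh n s0 by auto
    then show ?thesis using low_sl(1)[OF lw] sp[of s] sp[of 0] by linarith
  qed
  have low_sl2: "sl2 Q Q L H t s = sl2 Q Q L H t 0" if lw: "low s" for s
  proof -
    have s0: "0 \<le> s" using lw by (simp add: low_def)
    have sp: "sl2 Q Q one one t r = sl2 Q Q L L t r + sl2 Q Q H L t r + (sl2 Q Q L H t r + sl2 Q Q H H t r)" for r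
    proof -
      interpret r: three Q "return borel r" Q by (intro three.intro return_rd real_distribution_axioms)
      have e: "sl2 Q Q f h t r = tri Q (return borel r) Q f one h t" if "bb f" "bb h" for f h
      proof -
        have "(\<lambda>x. 1 * sl2 Q Q f h t x) \<in> borel_measurable borel" by (rule bb_meas[OF bb_mult[OF bb_const th.bb_sl(2)[OF that]]])
        from integral_return[OF _ this, of r] show ?thesis by (simp add: r.tri_sl2[OF that(1) bb_const that(2)])
      qed
      have 1: "sl2 Q Q one k t r = sl2 Q Q L k t r + sl2 Q Q H k t r" if "bb k" for k
        unfolding e[OF bb_const that] e[OF bL that] e[OF bH that]
        using r.tri_lin1[OF bL bH bb_const that, of 1 1 1 t] by (subst one_LH) simp
      have "sl2 Q Q one one t r = sl2 Q Q one L t r + sl2 Q Q one H t r"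
        unfolding e[OF bb_const bb_const] e[OF bb_const bL] e[OF bb_const bH]
        using r.tri_lin3[OF bb_const bb_const bL bH, of 1 1 1 1 t] by (subst (3) one_LH) simp
      then show ?thesis using 1[OF bL] 1[OF bH] by simp
    qed
    have "sl2 Q Q L L t s \<le> sl2 Q Q L L t 0" "sl2 Q Q L H t s \<le> sl2 Q Q L H t 0"
      "sl2 Q Q H L t s \<le> sl2 Q Q H L t 0" "sl2 Q Q H H t s \<le> sl2 Q Q H H t 0"
      using th.sl_antimono(2)[OF bL bb_const bL, of 1 0 s t] th.sl_antimono(2)[OF bL bb_const bH, of 1 0 s t]
        th.sl_antimono(2)[OF bH bb_const bL, of 1 0 s t] th.sl_antimono(2)[OF bH bb_const bH, of 1 0 s t]
        L0 H0 s0 by auto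
    then show ?thesis using low_sl(2)[OF lw] sp[of s] sp[of 0] by linarith
  qed
  \<comment> \<open>Above the top \<open>m\<close> of the low part there is no mass up to \<open>t\<close>.\<close>
  define m where "m = Sup {s. low s}"
  have low0: "low 0"
  proof -
    have "F = measure Q ({..<0} \<union> {0} \<union> {0<..<t})" unfolding F_def lcdf_def using t by (intro arg_cong[where f = "measure Q"]) auto
    also have "\<dots> \<le> measure Q ({..<0} \<union> {0}) + measure Q {0<..<t}" by (rule measure_Un_le) auto
    also have "measure Q ({..<0} \<union> {0}) \<le> measure Q {..<0} + measure Q {0}" by (rule measure_Un_le) auto
    finally show ?thesis using Fpos at0 atom[of 0] t by (auto simp: low_def lcdf_def)
  qed
  have bdd: "bdd_above {s. low s}" by (intro bdd_aboveI[of _ t]) (auto simp: low_def)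
  have m0: "0 \<le> m" unfolding m_def using low0 bdd by (intro cSup_upper) auto
  have below_m: "low s" if "0 \<le> s" "s < m" for s
  proof -
    have "\<exists>x\<in>{s. low s}. s < x" using that low0 unfolding m_def by (intro less_cSupD) auto
    then obtain s' where s': "low s'" "s < s'" by auto
    have "measure Q {s'<..<t} \<le> measure Q {s<..<t}" using s' by (intro finite_measure_mono) auto
    then have "measure Q {s<..<t} \<noteq> 0" using s'(1) measure_nonneg[of Q "{s'<..<t}"] unfolding low_def by linarith
    then show ?thesis using that s' by (simp add: low_def)
  qed
  have AE_m: "AE x in Q. x < t \<longrightarrow> x < m"
  proof -
    have "AE x in Q. x \<notin> {m + 1 / real (Suc n)<..<t}" for n
    proof -
      have "\<not> low (m + 1 / real (Suc n))"
      proof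
        assume "low (m + 1 / real (Suc n))"
        then have "m + 1 / real (Suc n) \<le> m" unfolding m_def using bdd by (intro cSup_upper) auto
        then show False by (simp add: field_simps)
      qed
      then have "m + 1 / real (Suc n) < t \<longrightarrow> measure Q {m + 1 / real (Suc n)<..<t} = 0"
        using m0 by (auto simp: low_def)
      then show ?thesis by (cases "m + 1 / real (Suc n) < t") (simp_all add: prob_eq_0)
    qed
    then have "AE x in Q. \<forall>n. x \<notin> {m + 1 / real (Suc n)<..<t}" unfolding AE_all_countable by blast
    then show ?thesis using AE_neq[of m]
    proof eventually_elim
      case (elim x)
      show ?case
      proof (rule impI, rule ccontr)
        assume "x < t" "\<not> x < m"
        then have "x - m > 0" using elim by simp
        then obtain n where "1 / real (Suc n) < x - m" using nat_approx_posE by blast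
        then show False using elim(1) \<open>x < t\<close> by (auto dest: spec[of _ n])
      qed
    qed
  qed
  have null_low: "measure Q {s<..<t} = 0" if "m \<le> s" for s
  proof -
    have "AE x in Q. x \<notin> {s<..<t}" using AE_m by eventually_elim (use that in auto)
    then show ?thesis using prob_eq_0[of "{s<..<t}"] by simp
  qed
  have AE_cong: "(\<integral>x. f x \<partial>Q) = (\<integral>x. g x \<partial>Q)" if "bb f" "bb g" "AE x in Q. f x = g x" for f g :: "real \<Rightarrow> real"
    using bb_meas[OF that(1)] bb_meas[OF that(2)] that(3) by (intro integral_cong_AE) simp_all
  have box: "sl1 Q Q b c t s = (\<integral>x. b x \<partial>Q) * (\<integral>x. c x \<partial>Q)"
    if "\<And>y z. b y \<noteq> 0 \<Longrightarrow> c z \<noteq> 0 \<Longrightarrow> s + y / 2 + z / 3 < t" for b c :: "real \<Rightarrow> real" and s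
  proof -
    have e: "b y * (\<integral>z. c z * of_bool (s + y / 2 + z / 3 < t) \<partial>Q) = b y * (\<integral>z. c z \<partial>Q)" for y
    proof (cases "b y = 0")
      case False
      then have "c z * of_bool (s + y / 2 + z / 3 < t) = c z" for z using that[of y z] by (cases "c z = 0") auto
      then show ?thesis by (simp only:)
    qed simp
    show ?thesis unfolding sl1_def e by simp
  qed
  have nobox: "sl1 Q Q b c t s = 0"
    if bc: "bb b" "bb c" and ae0: "AE y in Q. AE z in Q. b y \<noteq> 0 \<longrightarrow> c z \<noteq> 0 \<longrightarrow> \<not> s + y / 2 + z / 3 < t" for b c s
  proof -
    have "AE y in Q. b y * (\<integral>z. c z * of_bool (s + y / 2 + z / 3 < t) \<partial>Q) = 0"
      using ae0
    proof eventually_elim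
      case (elim y)
      show ?case
      proof (cases "b y = 0")
        case False
        have "(\<integral>z. c z * of_bool (s + y / 2 + z / 3 < t) \<partial>Q) = (\<integral>z. 0 \<partial>Q)"
        proof (rule AE_cong)
          show "AE z in Q. c z * of_bool (s + y / 2 + z / 3 < t) = 0"
            using elim by eventually_elim (use False in auto)
          show "bb (\<lambda>z. c z * of_bool (s + y / 2 + z / 3 < t))" by (intro bb_mult bc bb_of_bool) measurable
        qed simp
        then show ?thesis by simp
      qed simp
    qed
    then have "sl1 Q Q b c t s = (\<integral>y. 0 \<partial>Q)" unfolding sl1_def
      by (intro AE_cong bb_mult bc th.bb_inner3 bb_const)
    then show ?thesis by simp
  qed
  have ob_int: "(\<integral>x. of_bool (x \<in> S) \<partial>Q) = measure Q S" if "S \<in> sets borel" for S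
  proof -
    have "(\<lambda>x. of_bool (x \<in> S) :: real) = indicator S" by (auto simp: indicator_def)
    then show ?thesis using that by simp
  qed
  have bob: "bb (\<lambda>x. of_bool (x \<in> S))" if "S \<in> sets borel" for S
    using bb_ind[OF that] by (simp add: indicator_def[abs_def])
  have low_611: "11 / 6 * s \<le> t" if lw: "low s" for s
  proof (rule ccontr)
    assume n: "\<not> 11 / 6 * s \<le> t"
    let ?b = "\<lambda>x. of_bool (x \<in> {s<..<t}) :: real"
    have "sl1 Q Q ?b ?b t 0 = measure Q {s<..<t} * measure Q {s<..<t}"
      by (subst box) (use t ob_int[of "{s<..<t}"] in auto)
    moreover have "sl1 Q Q ?b ?b t s = 0"
      by (intro nobox bob AE_I2) (use n in auto)
    moreover have "sl1 Q Q ?b ?b t s = sl1 Q Q ?b ?b t 0"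
      by (rule low_sl1[OF lw]) (auto intro!: bob)
    ultimately show False using lw by (simp add: low_def)
  qed
  have m_611: "11 / 6 * m \<le> t"
  proof -
    have "m \<le> 6 / 11 * t" unfolding m_def using low0 low_611 by (intro cSup_least) (auto simp: field_simps)
    then show ?thesis by simp
  qed
  have Fm: "lcdf Q m = F"
  proof -
    have "(\<integral>x. of_bool (x < m) \<partial>Q) = (\<integral>x. L x \<partial>Q)"
    proof (rule AE_cong)
      show "AE x in Q. of_bool (x < m) = L x" using AE_m by eventually_elim (use m_611 t in \<open>auto simp: L_def\<close>)
      show "bb (\<lambda>x. of_bool (x < m))" by (intro bb_of_bool) measurable
    qed (rule bL)
    then show ?thesis using IL integral_of_bool_lt[of m] by simp
  qed
  have LLL_eq: "tri Q Q Q L L L t = F ^ 3"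
  proof -
    have "tri Q Q Q (\<lambda>x. of_bool (x < m)) (\<lambda>x. of_bool (x < m)) (\<lambda>x. of_bool (x < m)) t \<le> tri Q Q Q L L L t"
      by (rule th.tri_mono) (use bL m_611 t in \<open>auto simp: L_def intro!: bb_of_bool\<close>)
    then show ?thesis using LLL tri_below[OF m_611] Fm by simp
  qed
  have aS: "a = A1 + A2 + G" using W LLL_eq a by (simp add: F_def)
  have qa: "3 * q * a = A1 + A2 + 2 * G"
  proof -
    have "(\<integral>s. H s * gG t s \<partial>Q) = (\<integral>s. a * H s \<partial>Q)"
    proof (rule AE_cong)
      show "AE s in Q. H s * gG t s = a * H s" using ae by eventually_elim (auto simp: H_def)
    qed (intro bb_mult bH bb_gG bb_const)+
    then have "(\<integral>s. H s * gG t s \<partial>Q) = a * q" by (simp add: IH)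
    moreover have "(\<integral>s. H s * gG t s \<partial>Q) = (tri Q Q Q H one one t + tri Q Q Q one H one t + tri Q Q Q one one H t) / 3"
    proof -
      have i: "integrable Q (\<lambda>s. H s * sl1 Q Q one one t s)" "integrable Q (\<lambda>s. H s * sl2 Q Q one one t s)"
        "integrable Q (\<lambda>s. H s * sl3 Q Q one one t s)"
        by (intro bb_integrable bb_mult bH th.bb_sl bb_const)+
      have e: "H s * gG t s = (H s * sl1 Q Q one one t s + H s * sl2 Q Q one one t s + H s * sl3 Q Q one one t s) / 3" for s
        by (simp add: gG_def algebra_simps)
      show ?thesis
        unfolding e th.tri_sl1[of H one one] th.tri_sl2[OF bb_const bH bb_const] th.tri_sl3[OF bb_const bb_const bH]
        using i by simp
    qed
    moreover have "tri Q Q Q H one one t = 0" by (rule H1) auto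
    moreover have "tri Q Q Q one H one t = A1 + G"
      using split1[OF bH bb_const[of 1]] H1[OF bH bb_const[of 1]] split3[OF bL bH] by (simp add: A1_def G_def)
    moreover have "tri Q Q Q one one H t = A2 + G"
      using split1[OF bb_const[of 1] bH] H1[OF bb_const[of 1] bH] split2[OF bL bH] by (simp add: A2_def G_def)
    ultimately show ?thesis by (simp add: algebra_simps)
  qed
  have cheb: "F * (\<integral>x. H x * u x \<partial>Q) \<le> q * (\<integral>x. L x * u x \<partial>Q)"
    if "bb u" "\<And>x y. x \<le> y \<Longrightarrow> u y \<le> u x" for u
  proof -
    have "(\<integral>x. H x * u x \<partial>Q) \<le> (\<integral>x. H x * u t \<partial>Q)"
      using that(1) by (intro integral_mono bb_integrable bb_mult bH bb_const) (auto simp: H_def that(2))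
    moreover have "(\<integral>x. L x * u t \<partial>Q) \<le> (\<integral>x. L x * u x \<partial>Q)"
      using that(1) by (intro integral_mono bb_integrable bb_mult bL bb_const) (auto simp: L_def that(2))
    ultimately have "(\<integral>x. H x * u x \<partial>Q) \<le> q * u t" "F * u t \<le> (\<integral>x. L x * u x \<partial>Q)"
      by (simp_all add: IH IL)
    then have "F * (\<integral>x. H x * u x \<partial>Q) \<le> F * (q * u t)" "q * (F * u t) \<le> q * (\<integral>x. L x * u x \<partial>Q)"
      using Fpos qpos by (auto intro!: mult_left_mono)
    then show ?thesis by (simp add: mult.left_commute)
  qed
  have FA: "F * G \<le> q * A1" "F * G \<le> q * A2"
    using cheb[of "sl3 Q Q L H t"] cheb[of "sl2 Q Q L H t"] th.bb_sl(3)[OF bL bH] th.bb_sl(2)[OF bL bH]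
      th.sl_antimono(3)[OF bL bH bL] th.sl_antimono(2)[OF bL bb_const[of 1] bH] L0 H0
    unfolding A1_def A2_def G_def th.tri_sl3[OF bL bH bL] th.tri_sl2[OF bL bL bH]
    by (auto simp: th.tri_sl3[OF bL bH bH] th.tri_sl2[OF bL bH bH, unfolded th.tri_sl3[OF bL bH bH]])
  have AE_low: "AE x in Q. x < t \<longrightarrow> low x" using AE_m AE_nonneg by eventually_elim (use below_m in auto)
  have GHH: "G = F * sl1 Q Q H H t 0"
  proof -
    have "(\<integral>x. L x * sl1 Q Q H H t x \<partial>Q) = (\<integral>x. L x * sl1 Q Q H H t 0 \<partial>Q)"
    proof (rule AE_cong)
      show "AE x in Q. L x * sl1 Q Q H H t x = L x * sl1 Q Q H H t 0"
        using AE_low by eventually_elim (use low_sl1[OF _ bH bH] H0 in \<open>auto simp: L_def\<close>)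
    qed (intro bb_mult bL th.bb_sl bH bb_const)+
    then show ?thesis by (simp add: G_def th.tri_sl1 IL)
  qed
  show ?thesis
  proof (cases "G = 0")
    case True
    have q3: "q = 1 / 3" using qa aS True a(1) by simp
    have F3: "F = 2 / 3" using q3 by (simp add: q_def)
    have a8: "a \<le> 8 / 27" using aS ub True unfolding F3 q3 by (simp add: power2_eq_square)
    have HH0: "sl1 Q Q H H t 0 = 0" using GHH True Fpos by simp
    have gap: "measure Q {t..<6 / 5 * t} = 0"
    proof -
      let ?b = "\<lambda>x. of_bool (x \<in> {t..<6 / 5 * t}) :: real"
      interpret r: three "return borel 0" Q Q by (intro three.intro return_rd real_distribution_axioms)
      have "sl1 Q Q ?b ?b t 0 = measure Q {t..<6 / 5 * t} * measure Q {t..<6 / 5 * t}"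
        by (subst box) (use ob_int[of "{t..<6 / 5 * t}"] in auto)
      moreover have "sl1 Q Q ?b ?b t 0 \<le> sl1 Q Q H H t 0"
      proof -
        have bb': "bb ?b" by (rule bob) simp
        show ?thesis unfolding r.sl1_return[OF bH bH] r.sl1_return[OF bb' bb']
          by (rule r.tri_mono(2)[OF bb_const bb' bb' bb_const bH bH]) (auto simp: H_def)
      qed
      ultimately have "measure Q {t..<6 / 5 * t} * measure Q {t..<6 / 5 * t} \<le> 0" using HH0 by linarith
      then show ?thesis by (metis measure_nonneg mult_nonneg_nonneg order_antisym mult_eq_0_iff)
    qed
    have AEH: "AE x in Q. H x \<noteq> 0 \<longrightarrow> 6 / 5 * t \<le> x"
    proof -
      have "AE x in Q. x \<notin> {t..<6 / 5 * t}" using gap by (subst prob_eq_0[symmetric]) auto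
      then show ?thesis by eventually_elim (auto simp: H_def)
    qed
    have "m \<le> 2 / 5 * t"
    proof (rule ccontr)
      assume "\<not> m \<le> 2 / 5 * t"
      define s where "s = 2 / 5 * t"
      have ls: "low s" unfolding s_def using \<open>\<not> m \<le> 2 / 5 * t\<close> t by (intro below_m) auto
      have "sl1 Q Q H L t s = 0"
      proof (rule nobox[OF bH bL])
        show "AE y in Q. AE z in Q. H y \<noteq> 0 \<longrightarrow> L z \<noteq> 0 \<longrightarrow> \<not> s + y / 2 + z / 3 < t"
          using AEH
        proof eventually_elim
          case (elim y)
          show ?case using AE_nonneg by eventually_elim (use elim in \<open>auto simp: s_def\<close>)
        qed
      qed
      then have HL0: "sl1 Q Q H L t 0 = 0" using low_sl1[OF ls bH bL] L0 H0 by simp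
      have "A1 = (\<integral>x. 0 \<partial>Q)" unfolding A1_def th.tri_sl1
      proof (rule AE_cong)
        show "AE x in Q. L x * sl1 Q Q H L t x = 0"
          using AE_low by eventually_elim (use low_sl1[OF _ bH bL] L0 H0 HL0 in \<open>auto simp: L_def\<close>)
      qed (intro bb_mult bL th.bb_sl bH bb_const)+
      then have A10: "A1 = 0" by simp
      let ?b = "\<lambda>x. of_bool (x \<in> {s<..<t}) :: real"
      have bb': "bb ?b" by (rule bob) simp
      define v where "v y = (\<integral>z. H z * of_bool (0 + y / 2 + z / 3 < t) \<partial>Q)" for y
      have "sl1 Q Q ?b H t s = 0"
      proof (rule nobox[OF bb' bH])
        show "AE y in Q. AE z in Q. ?b y \<noteq> 0 \<longrightarrow> H z \<noteq> 0 \<longrightarrow> \<not> s + y / 2 + z / 3 < t"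
        proof (rule AE_I2)
          fix y
          show "AE z in Q. ?b y \<noteq> 0 \<longrightarrow> H z \<noteq> 0 \<longrightarrow> \<not> s + y / 2 + z / 3 < t"
            using AEH by eventually_elim (auto simp: s_def)
        qed
      qed
      then have "sl1 Q Q ?b H t 0 = 0" using low_sl1[OF ls bb' bH] H0 by simp
      then have "(\<integral>y. ?b y * v y \<partial>Q) = 0" by (simp add: sl1_def v_def)
      moreover have "integrable Q (\<lambda>y. ?b y * v y)" unfolding v_def by (intro bb_integrable bb_mult bb' th.bb_inner3 bH)
      moreover have v0: "0 \<le> v y" for y unfolding v_def by (intro Bochner_Integration.integral_nonneg mult_nonneg_nonneg H0) auto
      ultimately have "AE y in Q. ?b y * v y = 0" by (subst (asm) integral_nonneg_eq_0_iff_AE) auto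
      then have AEv: "AE y in Q. y \<in> {s<..<t} \<longrightarrow> (v y = 0 \<and> low y)" using AE_low by eventually_elim auto
      moreover have "\<not> (AE y in Q. y \<notin> {s<..<t})"
        using ls by (subst prob_eq_0[symmetric]) (auto simp: low_def)
      moreover have "AE y in Q. y \<notin> {s<..<t}" if "\<And>y. \<not> (v y = 0 \<and> low y)"
        using AEv by eventually_elim (use that in blast)
      ultimately obtain y where y: "v y = 0" "low y" by blast
      have "sl2 Q Q L H t y = (\<integral>x. 0 \<partial>Q)" unfolding sl2_def
      proof (rule AE_cong)
        show "AE x in Q. L x * (\<integral>z. H z * of_bool (x + y / 2 + z / 3 < t) \<partial>Q) = 0"
          using AE_nonneg
        proof eventually_elim
          case (elim x)
          have bz: "bb (\<lambda>z. H z * of_bool (w + y / 2 + z / 3 < t))" for w by (intro bb_mult bH bb_of_bool) measurable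
          have "(\<integral>z. H z * of_bool (x + y / 2 + z / 3 < t) \<partial>Q) \<le> v y" unfolding v_def
            using elim H0 by (intro integral_mono bb_integrable bz) auto
          moreover have "0 \<le> (\<integral>z. H z * of_bool (x + y / 2 + z / 3 < t) \<partial>Q)"
            by (intro Bochner_Integration.integral_nonneg mult_nonneg_nonneg H0) auto
          ultimately show ?case using y by simp
        qed
      qed (intro bb_mult bL th.bb_inner3 bH bb_const)+
      then have LH0: "sl2 Q Q L H t 0 = 0" using low_sl2[OF y(2)] by simp
      have "A2 = (\<integral>x. 0 \<partial>Q)" unfolding A2_def th.tri_sl2[OF bL bL bH]
      proof (rule AE_cong)
        show "AE x in Q. L x * sl2 Q Q L H t x = 0"
          using AE_low by eventually_elim (use low_sl2 LH0 in \<open>auto simp: L_def\<close>)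
      qed (intro bb_mult bL th.bb_sl bH bb_const)+
      then have "a = 0" using aS A10 True by simp
      then show False using a by simp
    qed
    then show ?thesis using F3 a8 gap null_low[of "2 / 5 * t"] by simp
  next
    case False
    then have Gp: "0 < G" using nn by simp
    have "m \<le> t / 6"
    proof (rule ccontr)
      assume "\<not> m \<le> t / 6"
      then have ls: "low (t / 6)" using t by (intro below_m) auto
      have "sl1 Q Q H H t (t / 6) = 0" by (intro nobox bH AE_I2) (auto simp: H_def)
      then have "sl1 Q Q H H t 0 = 0" using low_sl1[OF ls bH bH] H0 by simp
      then show False using GHH False by simp
    qed
    moreover have "1 / 3 \<le> q" "q \<le> 0.43" "a \<le> 0.385"
      using degenerate_algebra[OF Fpos qpos _ nn(1,2) Gp aS qa FA ub] by (auto simp: q_def)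
    ultimately show ?thesis using null_low[of "t / 6"] Fpos by (auto simp: q_def)
  qed
qed

end

section \<open>The exponential law\<close>

lemma Qd_atom: assumes "DQ f" shows "measure (Qd f) {x} = 0"
proof -
  note [measurable] = bb_meas[OF DQ_D(1)[OF assms]]
  have "measure (Qd f) {x} = (\<integral>y. f y * indicator {x} y \<partial>std_exp)" by (rule Qd_measure[OF assms]) simp
  also have "\<dots> = (\<integral>y. exponential_density 1 y * (f y * indicator {x} y) \<partial>lborel)"
    by (rule std_exp_integral) measurable
  also have "\<dots> = (\<integral>y. (0::real) \<partial>(lborel :: real measure))"
  proof (rule integral_cong_AE)
    show "AE y in lborel. exponential_density 1 y * (f y * indicator {x} y) = 0"
      using AE_lborel_singleton[of x] by eventually_elim auto
  qed measurable
  finally show ?thesis by simp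
qed

lemma DQ_one: "DQ one"
  using E.prob_space by (simp add: DQ_def)

lemma Qd_atomless: assumes "DQ f" shows "atomless (Qd f)"
  by (intro atomless.intro Qd_rd assms atomless_axioms.intro lcdf_Qd_0 Qd_atom)

lemma Qd_one: "Qd one = std_exp"
  unfolding Qd_def by (simp add: density_1)

global_interpretation EA: atomless std_exp
  using Qd_atomless[OF DQ_one] unfolding Qd_one .

lemma std_exp_integrable_exp: "integrable std_exp (\<lambda>x. of_bool (x < c) * exp (k * x))"
proof -
  have m: "(\<lambda>x. of_bool (x < c) * exp (k * x) :: real) \<in> borel_measurable std_exp" by measurable
  have "AE x in std_exp. norm (of_bool (x < c) * exp (k * x)) \<le> exp (\<bar>k\<bar> * \<bar>c\<bar>)"
    using AE_std_exp
  proof eventually_elim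
    case (elim x)
    have "k * x \<le> \<bar>k\<bar> * \<bar>c\<bar>" if "x < c"
    proof -
      have "k * x \<le> \<bar>k\<bar> * x" using elim by (intro mult_right_mono) auto
      also have "\<dots> \<le> \<bar>k\<bar> * \<bar>c\<bar>" using that elim by (intro mult_left_mono) auto
      finally show ?thesis .
    qed
    then show ?case by auto
  qed
  then show ?thesis using m by (intro E.integrable_const_bound)
qed

text \<open>The distribution function of a sum of two scaled exponential variables, from which all slices of
  the exponential law follow.\<close>

lemma std_exp_convolution:
  assumes ab: "0 < b" "k * b \<noteq> 1" "0 < k"
  shows "(\<integral>x. lcdf std_exp (k * (u - b * x)) \<partial>std_exp) =
    (if 0 < u then (1 - exp (- (u / b))) - exp (- (k * u)) * ((exp ((k * b - 1) * (u / b)) - 1) / (k * b - 1)) else 0)"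
proof (cases "0 < u")
  case True
  define c where "c = u / b"
  have c: "0 \<le> c" using True ab by (simp add: c_def)
  have eq: "lcdf std_exp (k * (u - b * x)) = of_bool (x < c) * exp (0 * x) - exp (- (k * u)) * (of_bool (x < c) * exp ((k * b) * x))" for x
  proof (cases "x < c")
    case True
    then have "0 \<le> k * (u - b * x)" using ab by (simp add: c_def field_simps)
    moreover have "exp (- (k * (u - b * x))) = exp (- (k * u)) * exp ((k * b) * x)"
      by (simp add: exp_add[symmetric] algebra_simps)
    ultimately show ?thesis using True by (simp add: lcdf_std_exp)
  next
    case False
    then have "k * (u - b * x) \<le> 0" using ab by (auto simp: c_def field_simps mult_le_0_iff)
    then show ?thesis using False by (simp add: lcdf_std_exp_0)
  qed
  have "(\<integral>x. lcdf std_exp (k * (u - b * x)) \<partial>std_exp) =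
      (\<integral>x. of_bool (x < c) * exp (0 * x) \<partial>std_exp) - exp (- (k * u)) * (\<integral>x. of_bool (x < c) * exp ((k * b) * x) \<partial>std_exp)"
    unfolding eq using std_exp_integrable_exp[of c 0] std_exp_integrable_exp[of c "k * b"] by simp
  also have "\<dots> = (1 - exp (- c)) - exp (- (k * u)) * ((exp ((k * b - 1) * c) - 1) / (k * b - 1))"
    unfolding std_exp_integral_exp(1)[OF c ab(2)] using std_exp_integral_exp(1)[OF c, of 0] by simp
  finally show ?thesis using True by (simp add: c_def)
next
  case False
  have "AE x in std_exp. lcdf std_exp (k * (u - b * x)) = 0"
    using AE_std_exp
  proof eventually_elim
    case (elim x)
    have "0 \<le> b * x" using elim ab by simp
    then have "k * (u - b * x) \<le> 0" using False ab by (intro mult_nonneg_nonpos) auto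
    then show ?case by (rule lcdf_std_exp_0)
  qed
  moreover have "lcdf std_exp \<in> borel_measurable borel"
    using EA.isCont_lcdf by (intro borel_measurable_continuous_onI) (simp add: continuous_at_imp_continuous_on)
  ultimately have "(\<integral>x. lcdf std_exp (k * (u - b * x)) \<partial>std_exp) = (\<integral>x. 0 \<partial>std_exp)"
    by (intro integral_cong_AE) (auto intro: measurable_compose[rotated])
  then show ?thesis using False by simp
qed

lemma sl1_std_exp: "sl1 std_exp std_exp one one t s =
    of_bool (s < t) * (1 - 3 * exp (- (2 * (t - s))) + 2 * exp (- (3 * (t - s))))"
proof -
  have "sl1 std_exp std_exp one one t s = (\<integral>x. lcdf std_exp (3 * ((t - s) - (1 / 2) * x)) \<partial>std_exp)"
    unfolding EA.sl1_one by (simp add: algebra_simps)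
  also have "\<dots> = of_bool (s < t) * (1 - 3 * exp (- (2 * (t - s))) + 2 * exp (- (3 * (t - s))))"
  proof -
    have "exp (- (3 * (t - s))) * exp (t - s) = exp (- (2 * (t - s)))" by (simp add: exp_add[symmetric])
    then show ?thesis by (subst std_exp_convolution) (auto simp: algebra_simps)
  qed
  finally show ?thesis .
qed

lemma sl2_std_exp: "sl2 std_exp std_exp one one t s =
    of_bool (s < 2 * t) * (1 - 3 / 2 * exp (- (t - s / 2)) + 1 / 2 * exp (- (3 * (t - s / 2))))"
proof -
  have "sl2 std_exp std_exp one one t s = (\<integral>x. lcdf std_exp (3 * ((t - s / 2) - 1 * x)) \<partial>std_exp)"
    unfolding EA.sl2_one by (simp add: algebra_simps)
  also have "\<dots> = of_bool (s < 2 * t) * (1 - 3 / 2 * exp (- (t - s / 2)) + 1 / 2 * exp (- (3 * (t - s / 2))))"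
  proof -
    have "exp (- (3 * (t - s / 2))) * exp (2 * (t - s / 2)) = exp (- (t - s / 2))" by (simp add: exp_add[symmetric])
    then show ?thesis by (subst std_exp_convolution) (auto simp: field_simps)
  qed
  finally show ?thesis .
qed

lemma sl3_std_exp: "sl3 std_exp std_exp one one t s =
    of_bool (s < 3 * t) * (1 - 2 * exp (- (t - s / 3)) + exp (- (2 * (t - s / 3))))"
proof -
  have "sl3 std_exp std_exp one one t s = (\<integral>x. lcdf std_exp (2 * ((t - s / 3) - 1 * x)) \<partial>std_exp)"
    unfolding EA.sl3_one by (simp add: algebra_simps)
  also have "\<dots> = of_bool (s < 3 * t) * (1 - 2 * exp (- (t - s / 3)) + exp (- (2 * (t - s / 3))))"
  proof -
    have "exp (- (2 * (t - s / 3))) * exp (t - s / 3) = exp (- (t - s / 3))" by (simp add: exp_add[symmetric])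
    then show ?thesis by (subst std_exp_convolution) (auto simp: field_simps)
  qed
  finally show ?thesis .
qed

text \<open>The sum \<open>x + y/2 + z/3\<close> of exponential variables has the law of their maximum: the
  null hypothesis makes \<open>T\<close> vanish.\<close>

lemma renyi: assumes "0 \<le> t" shows "W3 std_exp std_exp std_exp t = (lcdf std_exp t) ^ 3"
proof -
  define v where "v = exp (- t)"
  have c: "0 \<le> 3 * t" using assms by simp
  have eq: "sl3 std_exp std_exp one one t s = of_bool (s < 3 * t) * exp (0 * s) -
     2 * v * (of_bool (s < 3 * t) * exp ((1 / 3) * s)) + v\<^sup>2 * (of_bool (s < 3 * t) * exp ((2 / 3) * s))" for s
  proof -
    have "exp (- (t - s / 3)) = v * exp ((1 / 3) * s)" "exp (- (2 * (t - s / 3))) = v\<^sup>2 * exp ((2 / 3) * s)"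
      by (simp_all add: v_def exp_add[symmetric] exp_double[symmetric])
    then show ?thesis by (simp add: sl3_std_exp)
  qed
  note i = std_exp_integrable_exp[of "3 * t" 0] std_exp_integrable_exp[of "3 * t" "1 / 3"] std_exp_integrable_exp[of "3 * t" "2 / 3"]
  have "W3 std_exp std_exp std_exp t = (\<integral>s. sl3 std_exp std_exp one one t s \<partial>std_exp)"
    using EA.th.tri_sl3[of one one one t] by simp
  also have "\<dots> = (\<integral>s. of_bool (s < 3 * t) * exp (0 * s) \<partial>std_exp) -
     2 * v * (\<integral>s. of_bool (s < 3 * t) * exp ((1 / 3) * s) \<partial>std_exp) + v\<^sup>2 * (\<integral>s. of_bool (s < 3 * t) * exp ((2 / 3) * s) \<partial>std_exp)"
    unfolding eq using i by simp
  also have "\<dots> = (exp ((0 - 1) * (3 * t)) - 1) / (0 - 1) - 2 * v * ((exp ((1 / 3 - 1) * (3 * t)) - 1) / (1 / 3 - 1)) +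
      v\<^sup>2 * ((exp ((2 / 3 - 1) * (3 * t)) - 1) / (2 / 3 - 1))"
    by (subst (1 2 3) std_exp_integral_exp(1)[OF c]) auto
  also have "exp ((0 - 1) * (3 * t)) = v ^ 3" by (simp add: v_def exp_of_nat_mult[symmetric])
  also have "exp ((1 / 3 - 1) * (3 * t)) = v ^ 2" by (simp add: v_def exp_of_nat_mult[symmetric])
  also have "exp ((2 / 3 - 1) * (3 * t)) = v" by (simp add: v_def)
  also have "(v ^ 3 - 1) / (0 - 1) - 2 * v * ((v ^ 2 - 1) / (1 / 3 - 1)) + v\<^sup>2 * ((v - 1) / (2 / 3 - 1)) = (1 - v) ^ 3"
    by (simp add: field_simps power2_eq_square power3_eq_cube)
  finally show ?thesis using assms by (simp add: v_def lcdf_std_exp)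
qed

text \<open>The trilinear polarization of \<open>T\<close> along densities, not symmetrized in the three
  slots; mixtures expand by \<open>Td_mixd\<close>.\<close>

definition Td :: "(real \<Rightarrow> real) \<Rightarrow> (real \<Rightarrow> real) \<Rightarrow> (real \<Rightarrow> real) \<Rightarrow> real \<Rightarrow> real" where
  "Td f g h t = lcdf (Qd f) t * lcdf (Qd g) t * lcdf (Qd h) t - tri std_exp std_exp std_exp f g h t"

lemma Tf_Td: "DQ f \<Longrightarrow> Tf (Qd f) t = Td f f f t"
  by (simp add: Tf_def Td_def W3_Qd power3_eq_cube)

lemma Td_abs: assumes "DQ f" "DQ g" "DQ h" shows "\<bar>Td f g h t\<bar> \<le> 1"
proof -
  interpret f: real_distribution "Qd f" by (rule Qd_rd) fact
  interpret g: real_distribution "Qd g" by (rule Qd_rd) fact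
  interpret h: real_distribution "Qd h" by (rule Qd_rd) fact
  interpret x: three "Qd f" "Qd g" "Qd h" ..
  have "lcdf (Qd f) t * lcdf (Qd g) t * lcdf (Qd h) t \<le> 1" by (intro mult_le_one) auto
  moreover have "0 \<le> lcdf (Qd f) t * lcdf (Qd g) t * lcdf (Qd h) t" by simp
  ultimately show ?thesis using x.W3_bounds[of t] unfolding W3_Qd[OF assms, of t] Td_def by linarith
qed

lemma lcdf_Qd: assumes "DQ f" shows "lcdf (Qd f) t = (\<integral>x. f x * of_bool (x < t) \<partial>std_exp)"
proof -
  interpret f: real_distribution "Qd f" by (rule Qd_rd) fact
  show ?thesis using Qd_integral[OF assms, of "\<lambda>x. of_bool (x < t)"] f.integral_of_bool_lt[of t] by simp
qed

lemma lcdf_mixd: assumes "DQ f" "DQ r" "0 \<le> e" "e \<le> 1"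
  shows "lcdf (Qd (mixd e f r)) t = (1 - e) * lcdf (Qd f) t + e * lcdf (Qd r) t"
proof -
  have i: "integrable std_exp (\<lambda>x. f x * of_bool (x < t))" "integrable std_exp (\<lambda>x. r x * of_bool (x < t))"
    by (auto intro!: E.bb_integrable bb_mult DQ_D(1)[OF assms(1)] DQ_D(1)[OF assms(2)] bb_of_bool)
  have "mixd e f r x * of_bool (x < t) = (1 - e) * (f x * of_bool (x < t)) + e * (r x * of_bool (x < t))" for x
    by (simp add: mixd_def algebra_simps)
  then show ?thesis using i by (simp add: lcdf_Qd[OF mixd_DQ[OF assms]] lcdf_Qd assms)
qed

lemma Td_mixd:
  assumes d: "DQ f" "DQ r" and e: "0 \<le> e" "e \<le> 1"
  shows "Td (mixd e f r) (mixd e f r) (mixd e f r) t =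
    (1 - e) ^ 3 * Td f f f t + e * (1 - e)\<^sup>2 * (Td r f f t + Td f r f t + Td f f r t) +
    e\<^sup>2 * (1 - e) * (Td f r r t + Td r f r t + Td r r f t) + e ^ 3 * Td r r r t"
proof -
  have m: "mixd e f r = (\<lambda>x. (1 - e) * f x + e * r x)" by (simp add: mixd_def fun_eq_iff)
  note b = DQ_D(1)[OF d(1)] DQ_D(1)[OF d(2)] DQ_D(1)[OF mixd_DQ[OF d e]]
  have t1: "tri std_exp std_exp std_exp (mixd e f r) g h t = (1 - e) * tri std_exp std_exp std_exp f g h t + e * tri std_exp std_exp std_exp r g h t"
    if "bb g" "bb h" for g h unfolding m by (rule EA.th.tri_lin1) (use b that in auto)
  have t2: "tri std_exp std_exp std_exp g (mixd e f r) h t = (1 - e) * tri std_exp std_exp std_exp g f h t + e * tri std_exp std_exp std_exp g r h t"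
    if "bb g" "bb h" for g h unfolding m by (rule EA.th.tri_lin2) (use b that in auto)
  have t3: "tri std_exp std_exp std_exp g h (mixd e f r) t = (1 - e) * tri std_exp std_exp std_exp g h f t + e * tri std_exp std_exp std_exp g h r t"
    if "bb g" "bb h" for g h unfolding m by (rule EA.th.tri_lin3) (use b that in auto)
  show ?thesis unfolding Td_def lcdf_mixd[OF d e]
    by (simp add: t1 t2 t3 b power2_eq_square power3_eq_cube) (simp add: algebra_simps)
qed

section \<open>Compactness of entropy sublevel sets\<close>

text \<open>The expansion of \<open>T\<close> along a mixture: the linear gain \<open>3 e k\<close> beats
  the quadratic error because \<open>10 e \<le> k\<close>, and the errors \<open>n\<close> from
  replacing the limit law by near-minimizers because \<open>18 n < e k\<close>.\<close>

lemma mixture_gain: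
  fixes \<sigma> e k a n :: real
  assumes d: "DQ f" "DQ r" and s: "\<bar>\<sigma>\<bar> = 1"
    and e: "0 < e" "e \<le> 1 / 2" "10 * e \<le> k" and k: "0 < k" "a + k \<le> 1" and a: "0 < a"
    and n: "0 \<le> n" "18 * n < e * k"
    and T0: "a - 6 * n \<le> \<sigma> * Td f f f t"
    and T1: "3 * (a + k - 4 * n) \<le> \<sigma> * (Td r f f t + Td f r f t + Td f f r t)"
  shows "a < \<bar>Tf (Qd (mixd e f r)) t\<bar>"
proof -
  have e1: "0 \<le> e" "e \<le> 1" using e by auto
  have b: "- 1 \<le> \<sigma> * x" if "\<bar>x\<bar> \<le> 1" for x
  proof -
    have "\<bar>\<sigma> * x\<bar> \<le> 1" using that s by (simp add: abs_mult)
    then show ?thesis by linarith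
  qed
  have T2: "- 3 \<le> \<sigma> * (Td f r r t + Td r f r t + Td r r f t)"
    using b[OF Td_abs[OF d(1) d(2) d(2), of t]] b[OF Td_abs[OF d(2) d(1) d(2), of t]] b[OF Td_abs[OF d(2) d(2) d(1), of t]]
    by (simp add: distrib_left)
  have T3: "- 1 \<le> \<sigma> * Td r r r t" by (rule b[OF Td_abs[OF d(2) d(2) d(2)]])
  have "\<sigma> * Tf (Qd (mixd e f r)) t = (1 - e) ^ 3 * (\<sigma> * Td f f f t) + e * (1 - e)\<^sup>2 * (\<sigma> * (Td r f f t + Td f r f t + Td f f r t)) +
      e\<^sup>2 * (1 - e) * (\<sigma> * (Td f r r t + Td r f r t + Td r r f t)) + e ^ 3 * (\<sigma> * Td r r r t)"
    unfolding Tf_Td[OF mixd_DQ[OF d e1]] Td_mixd[OF d e1] by (simp add: distrib_left mult.left_commute)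
  also have "\<dots> \<ge> (1 - e) ^ 3 * (a - 6 * n) + e * (1 - e)\<^sup>2 * (3 * (a + k - 4 * n)) + e\<^sup>2 * (1 - e) * (- 3) + e ^ 3 * (- 1)"
    using e1 T0 T1 T2 T3 by (intro add_mono mult_left_mono) auto
  finally have 1: "(1 - e) ^ 3 * (a - 6 * n) + e * (1 - e)\<^sup>2 * (3 * (a + k - 4 * n)) + e\<^sup>2 * (1 - e) * (- 3) + e ^ 3 * (- 1)
     \<le> \<sigma> * Tf (Qd (mixd e f r)) t" .
  have "(1 - e) ^ 3 * (a - 6 * n) + e * (1 - e)\<^sup>2 * (3 * (a + k - 4 * n)) + e\<^sup>2 * (1 - e) * (- 3) + e ^ 3 * (- 1) =
    a + 3 * e * k - (6 * (1 - e) ^ 3 + 12 * e * (1 - e)\<^sup>2) * n - e\<^sup>2 * ((3 * a + 6 * k + 3) - e * (2 * a + 3 * k + 2))"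
    by (simp add: power2_eq_square power3_eq_cube algebra_simps)
  moreover have "(6 * (1 - e) ^ 3 + 12 * e * (1 - e)\<^sup>2) * n \<le> 18 * n"
  proof (rule mult_right_mono)
    have "(1 - e) ^ 3 \<le> 1" "e * (1 - e)\<^sup>2 \<le> 1" using e1 by (auto intro!: power_le_one mult_le_one)
    then show "6 * (1 - e) ^ 3 + 12 * e * (1 - e)\<^sup>2 \<le> 18" by simp
  qed (rule n)
  moreover have "e\<^sup>2 * ((3 * a + 6 * k + 3) - e * (2 * a + 3 * k + 2)) \<le> e\<^sup>2 * 10"
  proof (rule mult_left_mono)
    have "0 \<le> e * (2 * a + 3 * k + 2)" using e1 a k by (intro mult_nonneg_nonneg) auto
    then show "3 * a + 6 * k + 3 - e * (2 * a + 3 * k + 2) \<le> 10" using k a by linarith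
  qed simp
  moreover have "e\<^sup>2 * 10 \<le> e * k" using e by (simp add: power2_eq_square)
  moreover have "0 < e * k" using e k by simp
  ultimately have "a < \<sigma> * Tf (Qd (mixd e f r)) t" using 1 n(2) by linarith
  also have "\<dots> \<le> \<bar>Tf (Qd (mixd e f r)) t\<bar>" using s by (metis abs_ge_self abs_mult mult_1)
  finally show ?thesis .
qed

lemma lcdf_std_exp_lipschitz: assumes "x \<le> y" shows "lcdf std_exp y - lcdf std_exp x \<le> y - x"
proof (cases "x \<le> 0")
  case True
  then show ?thesis using assms exp_ge_add_one_self[of "- y"] by (cases "y \<le> 0") (auto simp: lcdf_std_exp_0 lcdf_std_exp)
next
  case False
  have "exp (- x) - exp (- y) = exp (- x) * (1 - exp (- (y - x)))" by (simp add: exp_add[symmetric] right_diff_distrib)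
  also have "\<dots> \<le> 1 * (1 - exp (- (y - x)))" using False assms by (intro mult_right_mono) auto
  also have "\<dots> \<le> y - x" using exp_ge_add_one_self[of "- (y - x)"] unfolding mult_1 by linarith
  finally show ?thesis using False assms by (simp add: lcdf_std_exp)
qed

lemma (in real_distribution) measure_Ico: "x \<le> y \<Longrightarrow> measure M {x..<y} = lcdf M y - lcdf M x"
proof -
  assume "x \<le> y"
  then have "{..<y} - {..<x} = {x..<y}" by auto
  moreover have "measure M ({..<y} - {..<x}) = measure M {..<y} - measure M {..<x}"
    using \<open>x \<le> y\<close> by (intro finite_measure_Diff) auto
  ultimately show ?thesis by (simp add: lcdf_def)
qed

lemma (in real_distribution) continuity_point: assumes "x < y" shows "\<exists>z. x < z \<and> z < y \<and> measure M {z} = 0"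
proof (rule ccontr)
  assume "\<not> ?thesis"
  then have "{x<..<y} \<subseteq> {z. measure M {z} > 0}" using measure_nonneg[of M] by (auto simp: order_less_le)
  then have "countable {x<..<y}" using countable_atoms countable_subset by blast
  then show False using uncountable_open_interval[of x y] assms by simp
qed

text \<open>Helly selection. Bounded entropy gives tightness and equicontinuity of the distribution
  functions through \<open>Kl_set_bound\<close>, so the limit has no atoms and the convergence is
  uniform.\<close>

lemma compactness:
  assumes D: "\<And>k. DQ (f k)" and K: "\<And>k. Kl (f k) \<le> C"
  shows "\<exists>s Q. strict_mono (s :: nat \<Rightarrow> nat) \<and> atomless Q \<and> (\<forall>x. (\<lambda>k. lcdf (Qd (f (s k))) x) \<longlonglongrightarrow> lcdf Q x) \<and>
    (\<forall>e>0. \<forall>\<^sub>F k in sequentially. \<forall>x. \<bar>lcdf (Qd (f (s k))) x - lcdf Q x\<bar> \<le> e)"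
proof -
  define \<mu> where "\<mu> k = Qd (f k)" for k
  interpret Qk: atomless "\<mu> k" for k unfolding \<mu>_def by (rule Qd_atomless[OF D])
  have C: "0 \<le> C" using Kl_nonneg[OF D] K order_trans by blast
  have small: "measure (\<mu> k) A \<le> e" if e: "0 < e" and A: "A \<in> sets borel" "measure std_exp A \<le> exp (- ((C + 1) / e))" for k A e
  proof -
    have "measure (\<mu> k) A * ln (1 / exp (- ((C + 1) / e))) \<le> Kl (f k) + 1"
      unfolding \<mu>_def by (rule Kl_set_bound[OF D A]) (use C e in auto)
    also have "\<dots> \<le> C + 1" using K by simp
    also have "ln (1 / exp (- ((C + 1) / e))) = (C + 1) / e" by (simp add: ln_div)
    finally have "measure (\<mu> k) A * (C + 1) \<le> e * (C + 1)" using e by (simp add: field_simps)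
    then show ?thesis using C by (simp add: mult_le_cancel_right)
  qed
  have tight: "tight \<mu>" unfolding tight_def
  proof (intro conjI allI impI)
    fix n show "real_distribution (\<mu> n)" by (rule Qk.real_distribution_axioms)
  next
    fix e :: real assume e: "e > 0"
    define R where "R = (C + 1) / (e / 2)"
    have R: "0 < R" using e C by (simp add: R_def)
    have "measure (\<mu> n) {-1<..R} > 1 - e" for n
    proof -
      have "measure std_exp {R..} = 1 - lcdf std_exp R"
      proof -
        have "{R..} = space std_exp - {..<R}" by auto
        then show ?thesis unfolding lcdf_def using E.prob_compl[of "{..<R}"] by simp
      qed
      then have "measure std_exp {R..} \<le> exp (- ((C + 1) / (e / 2)))" using R by (simp add: lcdf_std_exp R_def)
      then have "measure (\<mu> n) {R..} \<le> e / 2" using e by (intro small) auto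
      moreover have "measure (\<mu> n) {R..} = 1 - lcdf (\<mu> n) R"
      proof -
        have "{R..} = space (\<mu> n) - {..<R}" by auto
        then show ?thesis unfolding lcdf_def using Qk.prob_compl[of "{..<R}" n] by simp
      qed
      moreover have "lcdf (\<mu> n) R = measure (\<mu> n) {0..<R}" using Qk.measure_Ico[of 0 R n] R Qk.at0 by simp
      moreover have "measure (\<mu> n) {0..<R} \<le> measure (\<mu> n) {-1<..R}" by (intro Qk.finite_measure_mono) auto
      ultimately show ?thesis using e by linarith
    qed
    then show "\<exists>a b. a < b \<and> (\<forall>n. 1 - e < measure (\<mu> n) {a<..b})" using R by (intro exI[of _ "- 1"] exI[of _ R]) auto
  qed
  obtain s Q where s: "strict_mono (s :: nat \<Rightarrow> nat)" and Q: "real_distribution Q" and w: "weak_conv_m (\<mu> \<circ> s) Q"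
    using tight_imp_convergent_subsubsequence[OF tight strict_mono_id] by auto
  interpret Q: real_distribution Q by (rule Q)
  have lim: "(\<lambda>k. lcdf (\<mu> (s k)) x) \<longlonglongrightarrow> cdf Q x" if "measure Q {x} = 0" for x
    using w that unfolding weak_conv_m_def weak_conv_def Q.isCont_cdf Qk.lcdf_cdf by simp
  have atom: "measure Q {x} = 0" for x
  proof -
    have le: "measure Q {x} \<le> 0 + e" if e: "e > 0" for e
    proof -
      define p where "p = exp (- ((C + 1) / e))"
      have p: "p > 0" by (simp add: p_def)
      obtain y1 where y1: "x - p / 2 < y1" "y1 < x" "measure Q {y1} = 0" using Q.continuity_point[of "x - p / 2" x] p by auto
      obtain y2 where y2: "x < y2" "y2 < x + p / 2" "measure Q {y2} = 0" using Q.continuity_point[of x "x + p / 2"] p by auto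
      have "lcdf (\<mu> k) y2 - lcdf (\<mu> k) y1 \<le> e" for k
      proof -
        have "measure std_exp {y1..<y2} \<le> p"
          using E.measure_Ico[of y1 y2] lcdf_std_exp_lipschitz[of y1 y2] y1 y2 by simp
        then have "measure (\<mu> k) {y1..<y2} \<le> e" using e unfolding p_def by (intro small) auto
        then show ?thesis using Qk.measure_Ico[of y1 y2 k] y1 y2 by simp
      qed
      moreover have "(\<lambda>k. lcdf (\<mu> (s k)) y2 - lcdf (\<mu> (s k)) y1) \<longlonglongrightarrow> cdf Q y2 - cdf Q y1"
        by (intro tendsto_diff lim y1 y2)
      ultimately have "cdf Q y2 - cdf Q y1 \<le> e" by (intro LIMSEQ_le_const2) auto
      moreover have "measure Q {x} \<le> measure Q {y1<..y2}" using y1 y2 by (intro Q.finite_measure_mono) auto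
      ultimately show ?thesis using Q.cdf_diff_eq[of y1 y2] y1 y2 by simp
    qed
    have "measure Q {x} \<le> 0" by (rule field_le_epsilon[OF le])
    then show ?thesis using measure_nonneg[of Q "{x}"] by linarith
  qed
  have lc: "lcdf Q x = cdf Q x" for x
  proof -
    have u: "{..x} = {..<x} \<union> {x}" by auto
    have "measure Q {..x} = measure Q {..<x} + measure Q {x}"
      unfolding u by (rule Q.finite_measure_Union) auto
    then show ?thesis using atom by (simp add: lcdf_def cdf_def)
  qed
  have lim': "(\<lambda>k. lcdf (\<mu> (s k)) x) \<longlonglongrightarrow> lcdf Q x" for x using lim atom lc by simp
  have at0: "lcdf Q 0 = 0" using LIMSEQ_unique[OF lim'[of 0]] by (simp add: Qk.at0)
  have al: "atomless Q" by (intro atomless.intro Q atomless_axioms.intro at0 atom)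
  have unif: "\<forall>\<^sub>F k in sequentially. \<forall>x. \<bar>lcdf (\<mu> (s k)) x - lcdf Q x\<bar> \<le> e" if e: "e > 0" for e
  proof -
    obtain m0 :: nat where m0: "exp ((C + 1) / (e / 2)) \<le> real m0" using real_arch_simple by blast
    define m where "m = m0 + 2"
    have m: "m \<ge> 2" "m \<ge> 1" by (auto simp: m_def)
    have mb: "1 / real m \<le> exp (- ((C + 1) / (e / 2)))"
    proof -
      have "exp ((C + 1) / (e / 2)) \<le> real m" using m0 by (simp add: m_def)
      then have "inverse (real m) \<le> inverse (exp ((C + 1) / (e / 2)))" by (intro le_imp_inverse_le) auto
      then show ?thesis by (simp add: exp_minus inverse_eq_divide)
    qed
    have glim: "(\<lambda>k. gcdf (\<mu> (s k)) m j) \<longlonglongrightarrow> gcdf Q m j" for j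
      using lim' by (cases "j < m") (auto simp: gcdf_def)
    have cell: "gcdf (\<mu> k) m (Suc j) - gcdf (\<mu> k) m j \<le> e / 2" if j: "j < m" for j k
    proof -
      define A where "A = (if Suc j < m then {gpt m j..<gpt m (Suc j)} else {gpt m j..})"
      have gm: "gpt m j \<le> gpt m (Suc j)" if "Suc j < m"
      proof -
        have "exp (- gpt m (Suc j)) \<le> exp (- gpt m j)" unfolding exp_gpt[OF that] exp_gpt[OF j]
          using m by (simp add: divide_right_mono)
        then show ?thesis by simp
      qed
      have meas: "measure \<nu> A = gcdf \<nu> m (Suc j) - gcdf \<nu> m j" if "real_distribution \<nu>" for \<nu>
      proof -
        interpret real_distribution \<nu> by fact
        show ?thesis
        proof (cases "Suc j < m")
          case True
          then show ?thesis using measure_Ico[OF gm] j by (simp add: A_def gcdf_def)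
        next
          case False
          have "{gpt m j..} = space \<nu> - {..<gpt m j}" by auto
          then show ?thesis using prob_compl[of "{..<gpt m j}"] j False by (simp add: A_def gcdf_def lcdf_def)
        qed
      qed
      have "measure std_exp A = 1 / real m"
        using meas[OF E.real_distribution_axioms] j m by (simp add: gcdf_std_exp diff_divide_distrib[symmetric])
      then have "measure (\<mu> k) A \<le> e / 2" using e mb by (intro small) (auto simp: A_def)
      then show ?thesis using meas[OF Qk.real_distribution_axioms] by simp
    qed
    have cellQ: "gcdf Q m (Suc j) - gcdf Q m j \<le> e / 2" if j: "j < m" for j
    proof (rule LIMSEQ_le_const2)
      show "(\<lambda>k. gcdf (\<mu> (s k)) m (Suc j) - gcdf (\<mu> (s k)) m j) \<longlonglongrightarrow> gcdf Q m (Suc j) - gcdf Q m j"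
        by (intro tendsto_diff glim)
    qed (use cell[OF j] in auto)
    have "\<forall>\<^sub>F k in sequentially. \<forall>j\<in>{..<m}. \<bar>gcdf (\<mu> (s k)) m j - gcdf Q m j\<bar> < e / 2"
    proof (intro eventually_ball_finite ballI)
      fix j
      show "\<forall>\<^sub>F k in sequentially. \<bar>gcdf (\<mu> (s k)) m j - gcdf Q m j\<bar> < e / 2"
        using tendstoD[OF glim[of j], of "e / 2"] e by (simp add: dist_real_def)
    qed simp
    then show ?thesis
    proof eventually_elim
      case (elim k)
      have "\<bar>lcdf (\<mu> (s k)) x - lcdf Q x\<bar> \<le> e / 2 + e / 2" for x
      proof (rule kolmogorov_grid[OF Qk.real_distribution_axioms Q m(2) Qk.at0 at0])
        fix j assume j: "j < m"
        show "\<bar>gcdf (\<mu> (s k)) m j - gcdf Q m j\<bar> \<le> e / 2" using elim j by (intro less_imp_le) auto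
        show "gcdf Q m (Suc j) - gcdf Q m j \<le> e / 2" by (rule cellQ[OF j])
      qed (use e in auto)
      then show ?case by simp
    qed
  qed
  show ?thesis
    by (intro exI[of _ s] exI[of _ Q] conjI allI impI s al lim'[unfolded \<mu>_def] unif[unfolded \<mu>_def])
qed

text \<open>If the limit puts mass \<open>F\<close> below \<open>m\<close>, none between \<open>m\<close>
  and \<open>h\<close>, and \<open>1 - F\<close> above \<open>h\<close>, then the entropy is at
  least that of the two-cell law with cell probabilities \<open>1 - exp(-m)\<close> and
  \<open>exp(-h)\<close> under \<open>E\<close>. This uses the Donsker-Varadhan inequality with a
  two-valued function.\<close>

lemma limit_entropy_bound:
  assumes D: "\<And>k. DQ (f k)" and K: "\<And>k. Kl (f k) \<le> c + 1 / real (Suc k)" and s: "strict_mono (s :: nat \<Rightarrow> nat)"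
    and lim: "\<And>x. (\<lambda>k. lcdf (Qd (f (s k))) x) \<longlonglongrightarrow> lcdf Q x"
    and mh: "0 < m" "m \<le> h" and F: "lcdf Q m = F" "lcdf Q h = F" "0 < F" "F < 1"
  shows "F * ln F - F * ln (1 - exp (- m)) + (1 - F) * ln (1 - F) + (1 - F) * h \<le> c"
proof -
  define \<alpha> where "\<alpha> = ln (F / (1 - exp (- m)))"
  define \<beta> where "\<beta> = ln ((1 - F) * exp h)"
  have m1: "0 < 1 - exp (- m)" using mh by simp
  have ea: "exp \<alpha> = F / (1 - exp (- m))" "exp \<beta> = (1 - F) * exp h" using F m1 by (auto simp: \<alpha>_def \<beta>_def)
  have key: "\<alpha> * F + \<beta> * (1 - F) \<le> c + e" if e: "0 < e" for e
  proof -
    define B where "B = - ln e"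
    have eB: "exp (- B) = e" using e by (simp add: B_def)
    define \<psi> where "\<psi> x = \<alpha> * of_bool (x < m) + (- B) * (of_bool (x < h) - of_bool (x < m)) + \<beta> * (1 - of_bool (x < h))" for x :: real
    have bo: "bb (\<lambda>x. of_bool (x < z))" for z :: real by (intro bb_of_bool) measurable
    have b\<psi>: "bb \<psi>" unfolding \<psi>_def[abs_def] by (intro bb_add bb_mult bb_diff bb_const bo)
    have step: "\<alpha> * lcdf (Qd g) m + (- B) * (lcdf (Qd g) h - lcdf (Qd g) m) + \<beta> * (1 - lcdf (Qd g) h) \<le> Kl g - 1 + (F + e + (1 - F))"
      if g: "DQ g" for g
    proof -
      have i: "integrable std_exp (\<lambda>x. g x * of_bool (x < z))" "integrable std_exp g" for z
        by (intro E.bb_integrable bb_mult bo DQ_D[OF g])+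
      have "g x * \<psi> x = \<alpha> * (g x * of_bool (x < m)) + (- B) * (g x * of_bool (x < h) - g x * of_bool (x < m)) + \<beta> * (g x - g x * of_bool (x < h))" for x
        by (simp add: \<psi>_def algebra_simps)
      then have l: "(\<integral>x. g x * \<psi> x \<partial>std_exp) = \<alpha> * lcdf (Qd g) m + (- B) * (lcdf (Qd g) h - lcdf (Qd g) m) + \<beta> * (1 - lcdf (Qd g) h)"
        using i DQ_D(3)[OF g] by (simp add: lcdf_Qd[OF g])
      have io: "integrable std_exp (\<lambda>x. of_bool (x < z) :: real)" for z by (rule E.bb_integrable[OF bo])
      have "exp (\<psi> x) = exp \<alpha> * of_bool (x < m) + e * (of_bool (x < h) - of_bool (x < m)) + exp \<beta> * (1 - of_bool (x < h))" for x
        using mh by (auto simp: \<psi>_def eB)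
      then have "(\<integral>x. exp (\<psi> x) \<partial>std_exp) = exp \<alpha> * lcdf std_exp m + e * (lcdf std_exp h - lcdf std_exp m) + exp \<beta> * (1 - lcdf std_exp h)"
        using io E.prob_space by (simp add: E.integral_of_bool_lt)
      also have "\<dots> \<le> F + e * 1 + (1 - F)"
      proof -
        have "exp \<alpha> * lcdf std_exp m = F" using m1 mh by (simp add: ea lcdf_std_exp)
        moreover have "exp \<beta> * (1 - lcdf std_exp h) = 1 - F" using mh by (simp add: ea lcdf_std_exp mult.assoc exp_add[symmetric])
        moreover have "e * (lcdf std_exp h - lcdf std_exp m) \<le> e * 1"
          using e E.lcdf_le_1[of h] E.lcdf_nonneg[of m] by (intro mult_left_mono) linarith+
        ultimately show ?thesis by linarith
      qed
      finally show ?thesis using donsker_varadhan[OF g b\<psi>] l by simp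
    qed
    have "(\<lambda>k. \<alpha> * lcdf (Qd (f (s k))) m + (- B) * (lcdf (Qd (f (s k))) h - lcdf (Qd (f (s k))) m) + \<beta> * (1 - lcdf (Qd (f (s k))) h))
        \<longlonglongrightarrow> \<alpha> * lcdf Q m + (- B) * (lcdf Q h - lcdf Q m) + \<beta> * (1 - lcdf Q h)"
      by (intro tendsto_intros lim)
    moreover have "(\<lambda>k. c + 1 / real (Suc (s k)) + e) \<longlonglongrightarrow> c + 0 + e"
    proof (intro tendsto_intros)
      have "(\<lambda>k. 1 / real (Suc k)) \<longlonglongrightarrow> 0" using lim_inverse_n' LIMSEQ_Suc by blast
      from LIMSEQ_subseq_LIMSEQ[OF this s] show "(\<lambda>k. 1 / real (Suc (s k))) \<longlonglongrightarrow> 0" by (simp add: comp_def)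
    qed
    moreover have "\<alpha> * lcdf (Qd (f (s k))) m + (- B) * (lcdf (Qd (f (s k))) h - lcdf (Qd (f (s k))) m) + \<beta> * (1 - lcdf (Qd (f (s k))) h) \<le> c + 1 / real (Suc (s k)) + e" for k
      using step[OF D[of "s k"]] K[of "s k"] by linarith
    ultimately have "\<alpha> * lcdf Q m + (- B) * (lcdf Q h - lcdf Q m) + \<beta> * (1 - lcdf Q h) \<le> c + 0 + e"
      by (intro LIMSEQ_le) auto
    then show ?thesis using F by simp
  qed
  have "\<alpha> * F + \<beta> * (1 - F) \<le> c" by (rule field_le_epsilon[OF key])
  moreover have "\<alpha> = ln F - ln (1 - exp (- m))" using F m1 by (simp add: \<alpha>_def ln_div)
  moreover have "\<beta> = ln (1 - F) + h" using F by (simp add: \<beta>_def ln_mult)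
  ultimately show ?thesis by (simp add: algebra_simps)
qed

section \<open>Trial densities and entropy estimates\<close>

text \<open>The exponential law conditioned on \<open>[c, d)\<close>.\<close>

definition idens :: "real \<Rightarrow> real \<Rightarrow> real \<Rightarrow> real" where
  "idens c d x = of_bool (c \<le> x \<and> x < d) / (exp (- c) - exp (- d))"

lemma bb_ico: "bb (\<lambda>x. of_bool (c \<le> x \<and> x < d))"
  by (intro bb_of_bool) measurable

lemma idens_mass: assumes "0 \<le> c" "c < d"
  shows "(\<integral>x. of_bool (c \<le> x \<and> x < d) \<partial>std_exp) = exp (- c) - exp (- d)"
proof -
  have "(\<lambda>x. of_bool (c \<le> x \<and> x < d) :: real) = indicator {c..<d}" by (auto simp: indicator_def)
  then have "(\<integral>x. of_bool (c \<le> x \<and> x < d) \<partial>std_exp) = measure std_exp {c..<d}" by simp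
  also have "\<dots> = exp (- c) - exp (- d)" using E.measure_Ico[of c d] assms by (simp add: lcdf_std_exp)
  finally show ?thesis .
qed

lemma idens_DQ: assumes "0 \<le> c" "c < d" shows "DQ (idens c d)"
proof -
  have p: "0 < exp (- c) - exp (- d)" using assms by simp
  have "bb (\<lambda>x. of_bool (c \<le> x \<and> x < d) * (1 / (exp (- c) - exp (- d))))" by (rule bb_mult[OF bb_ico bb_const])
  then have "bb (idens c d)" by (simp add: idens_def[abs_def])
  moreover have "(\<integral>x. idens c d x \<partial>std_exp) = 1" unfolding idens_def using idens_mass[OF assms] p by simp
  moreover have "0 \<le> idens c d x" for x unfolding idens_def using p by simp
  ultimately show ?thesis unfolding DQ_def by blast
qed

lemma mix_idens_Kl:
  fixes e c d :: real
  assumes "0 \<le> c" "c < d"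
  defines "p \<equiv> exp (- c) - exp (- d)"
  shows "Kl (mixd e one (idens c d)) = p * ((1 - e + e / p) * ln (1 - e + e / p)) + (1 - p) * ((1 - e) * ln (1 - e))"
proof -
  let ?k = "(1 - e + e / p) * ln (1 - e + e / p) - (1 - e) * ln (1 - e)"
  have "mixd e one (idens c d) x * ln (mixd e one (idens c d) x) = (1 - e) * ln (1 - e) + ?k * of_bool (c \<le> x \<and> x < d)" for x
    by (simp add: mixd_def idens_def p_def)
  then have "Kl (mixd e one (idens c d)) = (\<integral>x. (1 - e) * ln (1 - e) + ?k * of_bool (c \<le> x \<and> x < d) \<partial>std_exp)"
    unfolding Kl_def by (simp only:)
  also have "\<dots> = (1 - e) * ln (1 - e) + ?k * p"
    using idens_mass[OF assms(1,2)] E.bb_integrable[OF bb_ico[of c d]] E.prob_space by (simp add: p_def)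
  finally show ?thesis by (simp add: algebra_simps)
qed

lemma J_le: "DQ f \<Longrightarrow> 0 \<le> t \<Longrightarrow> a < \<bar>Tf (Qd f) t\<bar> \<Longrightarrow> J a \<le> ereal (Kl f)"
  unfolding J_def by (intro INF_lower) auto

lemma J_mono: "a \<le> b \<Longrightarrow> J a \<le> J b"
  unfolding J_def by (intro INF_superset_mono) (auto intro: order_le_less_trans)

text \<open>Mix into \<open>E\<close> the law \<open>E\<close> conditioned on \<open>[c, 11/6 c)\<close>.
  With \<open>t = 11/6 c\<close> three points of this interval have maximum below
  \<open>t\<close>, but never \<open>x + y/2 + z/3 < t\<close>: the conditioned law alone attains
  the value 1. The choice \<open>c = 6 l\<close>, \<open>t = 11 l\<close> with \<open>exp(-l) = w
  = 8/9\<close> makes all masses powers of a rational number and suffices for the levels needed.\<close>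

lemma trial:
  fixes e :: real
  assumes e: "0 < e" "e < 1"
  defines "w \<equiv> (8 / 9 :: real)"
  defines "p \<equiv> w ^ 6 - w ^ 11"
  assumes a: "a < ((1 - e) * (1 - w ^ 11) + e) ^ 3 - ((1 - e) ^ 3 * (1 - w ^ 11) ^ 3 +
      e * (1 - e)\<^sup>2 * ((1 - 3 * w ^ 10 + 2 * w ^ 15) + (1 - 3 / 2 * w ^ 8 + 1 / 2 * w ^ 24) + (1 - 2 * w ^ 9 + w ^ 18)) +
      e\<^sup>2 * (1 - e) * (3 * (1 - w ^ 6)))"
  shows "J a \<le> ereal (p * ((1 - e + e / p) * ln (1 - e + e / p)) + (1 - p) * ((1 - e) * ln (1 - e)))"
proof -
  define l where "l = - ln w"
  have l: "0 < l" by (simp add: l_def w_def)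
  have ew: "exp (- (real n * l)) = w ^ n" for n
    by (simp add: l_def w_def exp_of_nat_mult)
  define c where "c = 6 * l"
  define t where "t = 11 * l"
  have ct: "0 \<le> c" "c < t" "0 \<le> t" using l by (auto simp: c_def t_def)
  have ec: "exp (- c) = w ^ 6" "exp (- t) = w ^ 11" using ew[of 6] ew[of 11] by (simp_all add: c_def t_def)
  define r where "r = idens c t"
  have D: "DQ r" unfolding r_def by (rule idens_DQ[OF ct(1,2)])
  note b = DQ_D(1)[OF D] and r0 = DQ_D(2)[OF D] and r1 = DQ_D(3)[OF D]
  have rz: "r x = 0" if "x < c" for x using that by (simp add: r_def idens_def)
  have lr: "lcdf (Qd r) t = 1"
  proof -
    have e: "r x * of_bool (x < t) = r x" for x by (simp add: r_def idens_def)
    show ?thesis unfolding lcdf_Qd[OF D] e by (rule r1)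
  qed
  let ?E = std_exp
  have up: "(\<integral>x. r x * u x \<partial>?E) \<le> u c" if "bb u" "\<And>x y. x \<le> y \<Longrightarrow> u y \<le> u x" for u
  proof -
    have "(\<integral>x. r x * u x \<partial>?E) \<le> (\<integral>x. r x * u c \<partial>?E)"
    proof (rule integral_mono)
      fix x show "r x * u x \<le> r x * u c" using rz[of x] r0[of x] that(2)[of c x] by (cases "x < c") (auto intro: mult_left_mono)
    qed (intro E.bb_integrable bb_mult b bb_const that)+
    then show ?thesis using r1 by simp
  qed
  have s1: "tri ?E ?E ?E r one one t \<le> 1 - 3 * w ^ 10 + 2 * w ^ 15"
  proof -
    have "tri ?E ?E ?E r one one t \<le> sl1 ?E ?E one one t c" unfolding EA.th.tri_sl1
      by (rule up) (auto intro!: EA.th.bb_sl EA.th.sl_antimono(1)[of one])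
    also have "\<dots> = 1 - 3 * w ^ 10 + 2 * w ^ 15"
      using l ew[of 10] ew[of 15] by (simp add: sl1_std_exp c_def t_def)
    finally show ?thesis .
  qed
  have s2: "tri ?E ?E ?E one r one t \<le> 1 - 3 / 2 * w ^ 8 + 1 / 2 * w ^ 24"
  proof -
    have "tri ?E ?E ?E one r one t \<le> sl2 ?E ?E one one t c" unfolding EA.th.tri_sl2[OF bb_const b bb_const]
      by (rule up) (auto intro!: EA.th.bb_sl EA.th.sl_antimono(2)[of _ one])
    also have "\<dots> = 1 - 3 / 2 * w ^ 8 + 1 / 2 * w ^ 24"
      using l ew[of 8] ew[of 24] by (simp add: sl2_std_exp c_def t_def)
    finally show ?thesis .
  qed
  have s3: "tri ?E ?E ?E one one r t \<le> 1 - 2 * w ^ 9 + w ^ 18"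
  proof -
    have "tri ?E ?E ?E one one r t \<le> sl3 ?E ?E one one t c" unfolding EA.th.tri_sl3[OF bb_const bb_const b]
      by (rule up) (auto intro!: EA.th.bb_sl EA.th.sl_antimono(3)[of _ _ one])
    also have "\<dots> = 1 - 2 * w ^ 9 + w ^ 18"
      using l ew[of 9] ew[of 18] by (simp add: sl3_std_exp c_def t_def)
    finally show ?thesis .
  qed
  have z3: "r x * (\<integral>z. r z * of_bool (u + z / 3 < t) \<partial>?E) = 0" if "t \<le> u + c / 3" for x u
  proof -
    have e: "r z * of_bool (u + z / 3 < t) = 0" for z using rz[of z] that by (cases "z < c") auto
    show ?thesis unfolding e by simp
  qed
  have z2: "(\<integral>y. r y * of_bool (u + y / 2 < t) \<partial>?E) = 0" if "t \<le> u + c / 2" for u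
  proof -
    have e: "r y * of_bool (u + y / 2 < t) = 0" for y using rz[of y] that by (cases "y < c") auto
    show ?thesis unfolding e by simp
  qed
  have ts: "t = c + c / 2 + c / 3" by (simp add: c_def t_def)
  have v1: "sl1 ?E ?E r r t x = 0" if "c \<le> x" for x
  proof -
    have e: "r y * (\<integral>z. r z * of_bool (x + y / 2 + z / 3 < t) \<partial>?E) = 0" for y
    proof (cases "y < c")
      case False
      then have "t \<le> (x + y / 2) + c / 3" using that ts by linarith
      then show ?thesis by (rule z3)
    qed (simp add: rz)
    show ?thesis unfolding sl1_def e by simp
  qed
  have v2: "sl2 ?E ?E r r t y = 0" if "c \<le> y" for y
  proof -
    have e: "r x * (\<integral>z. r z * of_bool (x + y / 2 + z / 3 < t) \<partial>?E) = 0" for x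
    proof (cases "x < c")
      case False
      then have "t \<le> (x + y / 2) + c / 3" using that ts by linarith
      then show ?thesis by (rule z3)
    qed (simp add: rz)
    show ?thesis unfolding sl2_def e by simp
  qed
  have v3: "sl3 ?E ?E r r t z = 0" if "c \<le> z" for z
  proof -
    have e: "r x * (\<integral>y. r y * of_bool (x + y / 2 + z / 3 < t) \<partial>?E) = 0" for x
    proof (cases "x < c")
      case False
      then have "t \<le> (x + z / 3) + c / 2" using that ts by linarith
      moreover have "x + y / 2 + z / 3 < t \<longleftrightarrow> (x + z / 3) + y / 2 < t" for y by linarith
      ultimately show ?thesis using z2[of "x + z / 3"] by (simp only: mult_zero_right)
    qed (simp add: rz)
    show ?thesis unfolding sl3_def e by simp
  qed
  have le1: "sl1 ?E ?E r r t x \<le> 1" "sl2 ?E ?E r r t x \<le> 1" "sl3 ?E ?E r r t x \<le> 1" for x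
  proof -
    interpret x1: three "return borel x" ?E ?E by (intro three.intro return_rd E.real_distribution_axioms)
    have "\<bar>sl1 ?E ?E r r t x\<bar> \<le> (\<integral>x. 1 \<partial>return borel x) * (\<integral>x. \<bar>r x\<bar> \<partial>?E) * (\<integral>x. \<bar>r x\<bar> \<partial>?E)"
      unfolding x1.sl1_return[OF b b] using x1.tri_abs[OF bb_const b b, of 1 t] by simp
    then show "sl1 ?E ?E r r t x \<le> 1" using r0 r1 x1.m1.prob_space by simp
    interpret x2: three ?E "return borel x" ?E by (intro three.intro return_rd E.real_distribution_axioms)
    have "(\<lambda>y. 1 * sl2 ?E ?E r r t y) \<in> borel_measurable borel" by (rule bb_meas[OF bb_mult[OF bb_const EA.th.bb_sl(2)[OF b b]]])
    from integral_return[OF _ this, of x] have "sl2 ?E ?E r r t x = tri ?E (return borel x) ?E r one r t"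
      by (simp add: x2.tri_sl2[OF b bb_const b])
    then show "sl2 ?E ?E r r t x \<le> 1" using x2.tri_abs[OF b bb_const b, of 1 t] r0 r1 x1.m1.prob_space by simp
    interpret x3: three ?E ?E "return borel x" by (intro three.intro return_rd E.real_distribution_axioms)
    have "(\<lambda>y. 1 * sl3 ?E ?E r r t y) \<in> borel_measurable borel" by (rule bb_meas[OF bb_mult[OF bb_const EA.th.bb_sl(3)[OF b b]]])
    from integral_return[OF _ this, of x] have "sl3 ?E ?E r r t x = tri ?E ?E (return borel x) r r one t"
      by (simp add: x3.tri_sl3[OF b b bb_const])
    then show "sl3 ?E ?E r r t x \<le> 1" using x3.tri_abs[OF b b bb_const, of 1 t] r0 r1 x1.m1.prob_space by simp
  qed
  have pc: "(\<integral>x. of_bool (x < c) \<partial>?E) = 1 - w ^ 6" using E.integral_of_bool_lt[of c] ct ec by (simp add: lcdf_std_exp)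
  have low: "(\<integral>x. 1 * u x \<partial>?E) \<le> 1 - w ^ 6" if "bb u" "\<And>x. c \<le> x \<Longrightarrow> u x = 0" "\<And>x. u x \<le> 1" for u
  proof -
    have "(\<integral>x. 1 * u x \<partial>?E) \<le> (\<integral>x. of_bool (x < c) \<partial>?E)"
    proof (rule integral_mono)
      show "integrable ?E (\<lambda>x. 1 * u x)" by (intro E.bb_integrable bb_mult bb_const that)
      show "integrable ?E (\<lambda>x. of_bool (x < c) :: real)" by (intro E.bb_integrable bb_of_bool) measurable
      show "1 * u x \<le> of_bool (x < c)" for x using that(2)[of x] that(3)[of x] by (cases "x < c") auto
    qed
    then show ?thesis using pc by simp
  qed
  have q1: "tri ?E ?E ?E one r r t \<le> 1 - w ^ 6" unfolding EA.th.tri_sl1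
    by (rule low[OF EA.th.bb_sl(1)[OF b b] v1 le1(1)])
  have q2: "tri ?E ?E ?E r one r t \<le> 1 - w ^ 6" unfolding EA.th.tri_sl2[OF b bb_const b]
    by (rule low[OF EA.th.bb_sl(2)[OF b b] v2 le1(2)])
  have q3: "tri ?E ?E ?E r r one t \<le> 1 - w ^ 6" unfolding EA.th.tri_sl3[OF b b bb_const]
    by (rule low[OF EA.th.bb_sl(3)[OF b b] v3 le1(3)])
  have rrr: "tri ?E ?E ?E r r r t = 0"
  proof -
    have e: "r x * sl1 ?E ?E r r t x = 0" for x using rz[of x] v1[of x] by (cases "x < c") auto
    show ?thesis unfolding EA.th.tri_sl1 e by simp
  qed
  have W: "tri ?E ?E ?E one one one t = (1 - w ^ 11) ^ 3" using renyi[OF ct(3)] ct ec by (simp add: lcdf_std_exp)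
  have lE: "lcdf (Qd one) t = 1 - w ^ 11" using ct ec by (simp add: Qd_one lcdf_std_exp)
  have e1: "0 \<le> e" "e \<le> 1" "0 \<le> 1 - e" using e by auto
  let ?m = "mixd e one r"
  have m: "DQ ?m" using e by (intro mixd_DQ DQ_one D) auto
  have "Tf (Qd ?m) t = ((1 - e) * (1 - w ^ 11) + e) ^ 3 - ((1 - e) ^ 3 * (1 - w ^ 11) ^ 3 +
      e * (1 - e)\<^sup>2 * (tri ?E ?E ?E r one one t + tri ?E ?E ?E one r one t + tri ?E ?E ?E one one r t) +
      e\<^sup>2 * (1 - e) * (tri ?E ?E ?E one r r t + tri ?E ?E ?E r one r t + tri ?E ?E ?E r r one t))"
    unfolding Tf_Td[OF m] Td_mixd[OF DQ_one D e1(1,2)] unfolding Td_def lE lr W rrr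
    by (simp add: power2_eq_square power3_eq_cube algebra_simps)
  also have "\<dots> \<ge> ((1 - e) * (1 - w ^ 11) + e) ^ 3 - ((1 - e) ^ 3 * (1 - w ^ 11) ^ 3 +
      e * (1 - e)\<^sup>2 * ((1 - 3 * w ^ 10 + 2 * w ^ 15) + (1 - 3 / 2 * w ^ 8 + 1 / 2 * w ^ 24) + (1 - 2 * w ^ 9 + w ^ 18)) +
      e\<^sup>2 * (1 - e) * (3 * (1 - w ^ 6)))"
    using s1 s2 s3 q1 q2 q3 e1
    by (intro diff_left_mono add_mono order_refl mult_left_mono mult_nonneg_nonneg) auto
  finally have "a < \<bar>Tf (Qd ?m) t\<bar>" using a by linarith
  then have "J a \<le> ereal (Kl ?m)" by (rule J_le[OF m ct(3)])
  also have "Kl ?m = p * ((1 - e + e / p) * ln (1 - e + e / p)) + (1 - p) * ((1 - e) * ln (1 - e))"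
    unfolding r_def using mix_idens_Kl[OF ct(1,2), of e] by (simp add: ec p_def)
  finally show ?thesis .
qed

text \<open>Four terms of the series of \<open>ln ((1 + y) / (1 - y))\<close>.\<close>

lemma ln_bounds4:
  fixes x y :: real
  assumes "x > 1" "y = (x - 1) / (x + 1)"
  shows "2 * y + 2 * y ^ 3 / 3 + 2 * y ^ 5 / 5 + 2 * y ^ 7 / 7 \<le> ln x"
    "ln x \<le> 2 * y + 2 * y ^ 3 / 3 + 2 * y ^ 5 / 5 + 2 * y ^ 7 / 7 + 2 * (y ^ 9 / 9 / (1 - y\<^sup>2))"
proof -
  have s: "(\<Sum>k<4. 2 * y ^ (2 * k + 1) / real (2 * k + 1)) = 2 * y + 2 * y ^ 3 / 3 + 2 * y ^ 5 / 5 + 2 * y ^ 7 / 7"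
    by (simp add: lessThan_nat_numeral eval_nat_numeral)
  show "2 * y + 2 * y ^ 3 / 3 + 2 * y ^ 5 / 5 + 2 * y ^ 7 / 7 \<le> ln x"
    "ln x \<le> 2 * y + 2 * y ^ 3 / 3 + 2 * y ^ 5 / 5 + 2 * y ^ 7 / 7 + 2 * (y ^ 9 / 9 / (1 - y\<^sup>2))"
    using ln_approx_bounds[OF assms(1), of 4] unfolding s assms(2)[symmetric] by (simp_all add: field_simps)
qed

lemma ln_numeric:
  "ln (5 / 3 :: real) \<ge> 0.51" "ln (3 :: real) \<le> 1.0987" "ln (3 :: real) \<ge> 1.09" "ln (2 :: real) \<le> 0.694"
  "ln (100 / 43 :: real) \<ge> 0.843" "ln (100 / 38 :: real) \<ge> 0.96" "ln (20 / 7 :: real) \<ge> 1"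
  "ln (303 / 100 :: real) \<le> 1.11" "ln (332 / 100 :: real) \<le> 1.21"
proof -
  show "ln (5 / 3 :: real) \<ge> 0.51" using ln_bounds4(1)[of "5 / 3" "1 / 4"] by (simp add: power_divide)
  show "ln (3 :: real) \<le> 1.0987" using ln_bounds4(2)[of "3" "1 / 2"] by (simp add: power_divide)
  show "ln (3 :: real) \<ge> 1.09" using ln_bounds4(1)[of "3" "1 / 2"] by (simp add: power_divide)
  show "ln (2 :: real) \<le> 0.694" using ln_bounds4(2)[of "2" "1 / 3"] by (simp add: power_divide)
  show "ln (100 / 43 :: real) \<ge> 0.843" using ln_bounds4(1)[of "100 / 43" "57 / 143"] by (simp add: power_divide)
  show "ln (100 / 38 :: real) \<ge> 0.96" using ln_bounds4(1)[of "100 / 38" "62 / 138"] by (simp add: power_divide)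
  show "ln (20 / 7 :: real) \<ge> 1" using ln_bounds4(1)[of "20 / 7" "13 / 27"] by (simp add: power_divide)
  show "ln (303 / 100 :: real) \<le> 1.11" using ln_bounds4(2)[of "303 / 100" "203 / 403"] by (simp add: power_divide)
  show "ln (332 / 100 :: real) \<le> 1.21" using ln_bounds4(2)[of "332 / 100" "232 / 432"] by (simp add: power_divide)
qed

lemma mult_ln_upper:
  assumes "0 \<le> A" "0 < v" "v \<le> x" "ln x \<le> (L::real)" shows "A * ln v \<le> A * L"
  using assms by (intro mult_left_mono) (auto intro: order_trans[OF ln_mono])

text \<open>The trial density with \<open>e = 0.57\<close>.\<close>

lemma J_trial_1: "J (8 / 27) \<le> ereal 0.46"
proof -
  define p where "p = (8 / 9 :: real) ^ 6 - (8 / 9) ^ 11"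
  have p: "2195 / 10000 \<le> p" "p \<le> 2196 / 10000" unfolding p_def by (simp_all add: power_numeral_reduce)
  have "J (8 / 27) \<le> ereal (p * ((1 - 57 / 100 + 57 / 100 / p) * ln (1 - 57 / 100 + 57 / 100 / p)) + (1 - p) * ((1 - 57 / 100) * ln (1 - 57 / 100)))"
    unfolding p_def by (rule trial) (simp_all add: power_numeral_reduce power2_eq_square)
  also have "\<dots> \<le> ereal 0.46"
  proof -
    define V where "V = 1 - 57 / 100 + 57 / 100 / p"
    have v: "p * V = 43 / 100 * p + 57 / 100" using p by (simp add: V_def field_simps)
    have "p * (V * ln V) = (p * V) * ln V" by (simp only: mult.assoc)
    also have "\<dots> = (43 / 100 * p + 57 / 100) * ln V" by (simp only: v)
    also have "\<dots> \<le> (43 / 100 * p + 57 / 100) * (111 / 100)"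
    proof (rule mult_ln_upper[where x = "303 / 100"])
      have "57 / 100 / p \<le> 2.6" using p by (simp add: divide_le_eq)
      then show "V \<le> 303 / 100" by (simp add: V_def)
      show "0 < V" unfolding V_def using p by (intro add_pos_pos) auto
    qed (use p ln_numeric in auto)
    finally have "p * (V * ln V) \<le> (43 / 100 * p + 57 / 100) * (111 / 100)" .
    moreover have "ln (43 / 100 :: real) \<le> - 843 / 1000" using ln_numeric(5) by (simp add: ln_div)
    then have "(1 - p) * (43 / 100 * ln (43 / 100)) \<le> (1 - p) * (43 / 100 * (- 843 / 1000))" using p by (intro mult_left_mono) auto
    moreover have "(1 - p) * ((1 - 57 / 100) * ln (1 - 57 / 100)) = (1 - p) * (43 / 100 * ln (43 / 100))" by simp
    moreover have "X + Z \<le> 46 / 100" if "X \<le> (43 / 100 * p + 57 / 100) * (111 / 100)" "Z \<le> (1 - p) * (43 / 100 * (- 843 / 1000))" for X Z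
      using that p by argo
    ultimately have "p * (V * ln V) + (1 - p) * ((1 - 57 / 100) * ln (1 - 57 / 100)) \<le> 46 / 100" by metis
    then show ?thesis by (simp add: V_def)
  qed
  finally show ?thesis .
qed

text \<open>The trial density with \<open>e = 0.65\<close>.\<close>

lemma J_trial_2: "J 0.385 \<le> ereal 0.65"
proof -
  define p where "p = (8 / 9 :: real) ^ 6 - (8 / 9) ^ 11"
  have p: "2195 / 10000 \<le> p" "p \<le> 2196 / 10000" unfolding p_def by (simp_all add: power_numeral_reduce)
  have "J 0.385 \<le> ereal (p * ((1 - 65 / 100 + 65 / 100 / p) * ln (1 - 65 / 100 + 65 / 100 / p)) + (1 - p) * ((1 - 65 / 100) * ln (1 - 65 / 100)))"
    unfolding p_def by (rule trial) (simp_all add: power_numeral_reduce power2_eq_square)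
  also have "\<dots> \<le> ereal 0.65"
  proof -
    define V where "V = 1 - 65 / 100 + 65 / 100 / p"
    have v: "p * V = 35 / 100 * p + 65 / 100" using p by (simp add: V_def field_simps)
    have "p * (V * ln V) = (p * V) * ln V" by (simp only: mult.assoc)
    also have "\<dots> = (35 / 100 * p + 65 / 100) * ln V" by (simp only: v)
    also have "\<dots> \<le> (35 / 100 * p + 65 / 100) * (121 / 100)"
    proof (rule mult_ln_upper[where x = "332 / 100"])
      have "65 / 100 / p \<le> 2.97" using p by (simp add: divide_le_eq)
      then show "V \<le> 332 / 100" by (simp add: V_def)
      show "0 < V" unfolding V_def using p by (intro add_pos_pos) auto
    qed (use p ln_numeric in auto)
    finally have "p * (V * ln V) \<le> (35 / 100 * p + 65 / 100) * (121 / 100)" .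
    moreover have "ln (7 / 20 :: real) \<le> - 1" using ln_numeric(7) by (simp add: ln_div)
    then have "(1 - p) * (35 / 100 * ln (7 / 20)) \<le> (1 - p) * (35 / 100 * (- 1))" using p by (intro mult_left_mono) auto
    moreover have "(1 - p) * ((1 - 65 / 100) * ln (1 - 65 / 100)) = (1 - p) * (35 / 100 * ln (7 / 20))" by simp
    moreover have "X + Z \<le> 65 / 100" if "X \<le> (35 / 100 * p + 65 / 100) * (121 / 100)" "Z \<le> (1 - p) * (35 / 100 * (- 1))" for X Z
      using that p by argo
    ultimately have "p * (V * ln V) + (1 - p) * ((1 - 65 / 100) * ln (1 - 65 / 100)) \<le> 65 / 100" by metis
    then show ?thesis by (simp add: V_def)
  qed
  finally show ?thesis .
qed

text \<open>With \<open>y = exp(-2t/5)\<close> both logarithms are replaced by their tangents at the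
  minimizer \<open>y = 3/5\<close>, after which \<open>y\<close> cancels.\<close>

lemma entropy_case_1:
  fixes t c :: real
  assumes t: "0 < t"
    and h: "2 / 3 * ln (2 / 3) - 2 / 3 * ln (1 - exp (- (2 / 5 * t))) + (1 - 2 / 3) * ln (1 - 2 / 3) + (1 - 2 / 3) * (6 / 5 * t) \<le> c"
  shows "0.46 \<le> c"
proof -
  define y where "y = exp (- (2 / 5 * t))"
  have y: "0 < y" "y < 1" using t by (auto simp: y_def)
  have "ln y = - (2 / 5 * t)" by (simp add: y_def)
  have "ln ((1 - y) / (2 / 5)) \<le> (1 - y) / (2 / 5) - 1" using y by (intro ln_le_minus_one) auto
  moreover have "ln ((1 - y) / (2 / 5)) = ln (1 - y) - ln (2 / 5)" using y by (intro ln_divide_pos) auto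
  ultimately have 1: "ln (1 - y) \<le> (1 - y) / (2 / 5) - 1 + ln (2 / 5)" by linarith
  have "ln (y / (3 / 5)) \<le> y / (3 / 5) - 1" using y by (intro ln_le_minus_one) auto
  moreover have "ln (y / (3 / 5)) = ln y - ln (3 / 5)" using y by (intro ln_divide_pos) auto
  ultimately have 2: "ln y \<le> y / (3 / 5) - 1 + ln (3 / 5)" by linarith
  have l: "ln (2 / 3 :: real) = ln 2 - ln 3" "ln (2 / 5 :: real) = ln 2 - ln 5" "ln (3 / 5 :: real) = ln 3 - ln 5"
    "ln (1 - 2 / 3 :: real) = - ln 3" "ln (5 / 3 :: real) = ln 5 - ln 3"
    by (simp_all add: ln_div)
  have "2 / 3 * (ln 2 - ln 3) - 2 / 3 * (5 / 2 * (1 - y) - 1 + (ln 2 - ln 5)) - 1 / 3 * ln 3 - (5 / 3 * y - 1 + (ln 3 - ln 5)) \<le> c"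
    using h 1 2 \<open>ln y = - (2 / 5 * t)\<close> unfolding y_def[symmetric] l by argo
  then have "5 / 3 * ln (5 / 3) - 1 / 3 * ln 3 \<le> c" unfolding l by argo
  then show ?thesis using ln_numeric(1,2) by simp
qed

text \<open>The same with tangents at the minimizer in \<open>exp(-t/6)\<close>, which depends on
  \<open>F\<close>.\<close>

lemma entropy_case_2:
  fixes t c F :: real
  assumes t: "0 < t" and F: "0.57 \<le> F" "F \<le> 2 / 3"
    and h: "F * ln F - F * ln (1 - exp (- (t / 6))) + (1 - F) * ln (1 - F) + (1 - F) * t \<le> c"
  shows "0.65 \<le> c"
proof -
  define y where "y = exp (- (t / 6))"
  have y: "0 < y" "y < 1" using t by (auto simp: y_def)
  have ly: "ln y = - (t / 6)" by (simp add: y_def)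
  define q where "q = 1 - F"
  have q: "1 / 3 \<le> q" "q \<le> 0.43" using F by (auto simp: q_def)
  define D where "D = 1 + 5 * q"
  have D: "D > 0" "D = F + 6 * q" using q by (auto simp: D_def q_def)
  have F0: "F > 0" using F by simp
  have "ln ((1 - y) / (F / D)) \<le> (1 - y) / (F / D) - 1" using y D F0 by (intro ln_le_minus_one) auto
  then have "F * ln ((1 - y) / (F / D)) \<le> F * ((1 - y) / (F / D) - 1)" using F0 by (intro mult_left_mono) auto
  also have "\<dots> = D * (1 - y) - F" using F0 D by (simp add: field_simps)
  also have "ln ((1 - y) / (F / D)) = ln (1 - y) - ln F + ln D"
  proof -
    have "ln ((1 - y) / (F / D)) = ln (1 - y) - ln (F / D)" using y F0 D(1) by (intro ln_divide_pos) auto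
    also have "ln (F / D) = ln F - ln D" using F0 D(1) by (intro ln_divide_pos) auto
    finally show ?thesis by simp
  qed
  finally have 1: "F * ln (1 - y) \<le> D * (1 - y) - F + F * ln F - F * ln D" by (simp add: algebra_simps)
  have "ln (y / (6 * q / D)) \<le> y / (6 * q / D) - 1" using y D q by (intro ln_le_minus_one) auto
  then have "6 * q * ln (y / (6 * q / D)) \<le> 6 * q * (y / (6 * q / D) - 1)" using q by (intro mult_left_mono) auto
  also have "\<dots> = D * y - 6 * q" using q D(1) by (simp add: field_simps)
  also have "ln (y / (6 * q / D)) = ln y - ln 6 - ln q + ln D"
  proof -
    have "ln (y / (6 * q / D)) = ln y - ln (6 * q / D)" using y q D(1) by (intro ln_divide_pos) auto
    also have "ln (6 * q / D) = ln (6 * q) - ln D" using q D(1) by (intro ln_divide_pos) auto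
    also have "ln (6 * q) = ln 6 + ln q" using q by (intro ln_mult_pos) auto
    finally show ?thesis by simp
  qed
  finally have 2: "6 * q * ln y \<le> D * y - 6 * q + 6 * q * ln 6 + 6 * q * ln q - 6 * q * ln D" by (simp add: algebra_simps)
  have "F * ln F - F * ln (1 - y) + q * ln q - 6 * q * ln y \<le> c" using h ly unfolding y_def[symmetric] q_def[symmetric] by simp
  then have "F * ln F - (D * (1 - y) - F + F * ln F - F * ln D) + q * ln q - (D * y - 6 * q + 6 * q * ln 6 + 6 * q * ln q - 6 * q * ln D) \<le> c"
    using 1 2 by linarith
  moreover have "F * ln F - (D * (1 - y) - F + F * ln F - F * ln D) + q * ln q - (D * y - 6 * q + 6 * q * ln 6 + 6 * q * ln q - 6 * q * ln D) =
     D * ln D - 5 * q * ln q - 6 * q * ln 6" unfolding D(2) by (simp add: algebra_simps)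
  ultimately have 3: "D * ln D - 5 * q * ln q - 6 * q * ln 6 \<le> c" by simp
  have "ln (3 / D) \<le> 3 / D - 1" using D by (intro ln_le_minus_one) auto
  then have "D * ln (3 / D) \<le> D * (3 / D - 1)" using D by (intro mult_left_mono) auto
  then have 4: "D * ln 3 + D - 3 \<le> D * ln D" using D(1) by (simp add: ln_divide_pos algebra_simps)
  have D3: "D * 1.09 \<le> D * ln 3" using ln_numeric(3) D by (intro mult_left_mono) auto
  have "ln (q / (38 / 100)) \<le> q / (38 / 100) - 1" using q by (intro ln_le_minus_one) auto
  moreover have "ln (q / (38 / 100)) = ln q - ln (38 / 100)" using q by (intro ln_divide_pos) auto
  moreover have "ln (38 / 100 :: real) = - ln (100 / 38)" using ln_inverse[of "100 / 38 :: real"] by simp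
  ultimately have "ln q \<le> q / (38 / 100) - 1 - ln (100 / 38)" by linarith
  then have "ln q \<le> q / 0.38 - 1.96" using ln_numeric(6) by simp
  then have "5 * q * ln q \<le> 5 * q * (q / 0.38 - 1.96)" using q by (intro mult_left_mono) auto
  note D3 this
  moreover have "ln (6 :: real) \<le> 1.8"
  proof -
    have "ln (6 :: real) = ln 2 + ln 3" using ln_mult[of 2 "3::real"] by simp
    then show ?thesis using ln_numeric(2,4) by simp
  qed
  then have "6 * q * ln 6 \<le> 6 * q * 1.8" using q by (intro mult_left_mono) auto
  ultimately have "D * 1.09 + D - 3 - 5 * q * (q / 0.38 - 1.96) - 6 * q * 1.8 \<le> c" using 3 4 by linarith
  moreover have "5 * q * (q / 0.38 - 1.96) = 250 / 19 * (q * q) - 98 / 10 * q" by (simp add: field_simps)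
  moreover have "0 \<le> (q - 1 / 3) * (43 / 100 - q)" using q by simp
  moreover have "(q - 1 / 3) * (43 / 100 - q) = q * 43 / 100 - q * q - 43 / 300 + q / 3" by (simp add: field_simps)
  ultimately have "D * 1.09 + D - 3 - (250 / 19 * (q * 43 / 100 - 43 / 300 + q / 3) - 98 / 10 * q) - 6 * q * 1.8 \<le> c" by argo
  then have "(1 + 5 * q) * (109 / 100) + (1 + 5 * q) - 3 - (250 / 19 * (q * 43 / 100 - 43 / 300 + q / 3) - 98 / 10 * q) - 6 * q * (18 / 10) \<le> c"
    by (simp add: D_def)
  moreover have "1 / 3 \<le> q" "q \<le> 43 / 100" using q by simp_all
  ultimately have "65 / 100 \<le> c" by argo
  then show ?thesis by simp
qed

section \<open>Left continuity of the rate function\<close>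

lemma (in atomless) gG_le_1: "gG t s \<le> 1"
proof -
  have b: "\<bar>\<integral>y. lcdf Q (k * y + d) \<partial>Q\<bar> \<le> 1" for k d
  proof (rule abs_integral_le)
    have "lcdf Q \<in> borel_measurable borel"
      using isCont_lcdf by (intro borel_measurable_continuous_onI) (simp add: continuous_at_imp_continuous_on)
    then show "(\<lambda>y. lcdf Q (k * y + d)) \<in> borel_measurable borel" by measurable
  qed simp
  have "sl1 Q Q one one t s \<le> 1" unfolding sl1_one using b[of "- 3 / 2" "3 * (t - s)"] by (simp add: algebra_simps)
  moreover have "sl2 Q Q one one t s \<le> 1" unfolding sl2_one using b[of "- 3" "3 * (t - s / 2)"] by (simp add: algebra_simps)
  moreover have "sl3 Q Q one one t s \<le> 1" unfolding sl3_one using b[of "- 2" "2 * (t - s / 3)"] by (simp add: algebra_simps)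
  ultimately show ?thesis unfolding gG_def by simp
qed

lemma (in atomless) Tf_0: "Tf Q 0 = 0"
proof -
  have "W3 Q Q Q 0 = (\<integral>x. 0 \<partial>Q)" unfolding th.tri_sl1
  proof (rule integral_cong_AE)
    show "AE x in Q. 1 * sl1 Q Q one one 0 x = 0"
      using AE_nonneg by eventually_elim (simp add: sl1_vanish)
    show "(\<lambda>x. 1 * sl1 Q Q one one 0 x) \<in> borel_measurable Q"
      using bb_meas[OF bb_mult[OF bb_const th.bb_sl(1)[OF bb_const bb_const]], of 1] by simp
  qed simp
  then show ?thesis by (simp add: Tf_def at0)
qed

text \<open>\<open>T\<close> is continuous in \<open>t\<close>, vanishes at 0 and at infinity, so a supremum
  of at least \<open>a > 0\<close> is attained.\<close>

lemma (in atomless) Tf_attains: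
  assumes a: "0 < a" and seq: "\<And>e. 0 < e \<Longrightarrow> \<exists>u\<ge>0. a - e \<le> \<bar>Tf Q u\<bar>"
  shows "\<exists>t>0. a \<le> \<bar>Tf Q t\<bar>"
proof -
  have "((\<lambda>t. \<bar>Tf Q t\<bar>) \<longlongrightarrow> \<bar>0\<bar>) at_top" by (intro tendsto_rabs Tf_at_top)
  then have "\<forall>\<^sub>F t in at_top. \<bar>Tf Q t\<bar> < a / 2" using a by (auto dest: order_tendstoD(2)[of _ 0 _ "a / 2"])
  then obtain R where R: "\<And>t. R \<le> t \<Longrightarrow> \<bar>Tf Q t\<bar> < a / 2" unfolding eventually_at_top_linorder by blast
  have "continuous_on {0..max R 0} (\<lambda>t. \<bar>Tf Q t\<bar>)"
    using isCont_Tf by (intro continuous_on_rabs continuous_at_imp_continuous_on) auto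
  then obtain t where t: "t \<in> {0..max R 0}" "\<And>u. u \<in> {0..max R 0} \<Longrightarrow> \<bar>Tf Q u\<bar> \<le> \<bar>Tf Q t\<bar>"
    using continuous_attains_sup[of "{0..max R 0}" "\<lambda>t. \<bar>Tf Q t\<bar>"] by auto
  have le: "a \<le> \<bar>Tf Q t\<bar> + e" if e: "0 < e" for e
  proof -
    obtain u where u: "0 \<le> u" "a - min e (a / 2) \<le> \<bar>Tf Q u\<bar>" using seq[of "min e (a / 2)"] e a by auto
    then have "\<not> R \<le> u" using R[of u] by auto
    then have "\<bar>Tf Q u\<bar> \<le> \<bar>Tf Q t\<bar>" using u by (intro t(2)) auto
    then show ?thesis using u by auto
  qed
  have "a \<le> \<bar>Tf Q t\<bar>" by (rule field_le_epsilon[OF le])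
  moreover have "t \<noteq> 0" using Tf_0 calculation a by auto
  ultimately show ?thesis using t by (intro exI[of _ t]) auto
qed

text \<open>At a point \<open>u\<close> where the variation exceeds \<open>a\<close>, mix mass spread over a
  short interval at \<open>u\<close> into a late near-minimizer. By \<open>mixture_gain\<close>
  the level \<open>a\<close> is exceeded, and the cost in entropy tends to zero with the mixing
  weight.\<close>

lemma nondegenerate_improves:
  assumes Q: "atomless Q" and D: "\<And>k. DQ (f k)" and K: "\<And>k. Kl (f k) \<le> c + 1 / real (Suc k)" and s: "strict_mono (s :: nat \<Rightarrow> nat)"
    and unif: "\<And>e. 0 < e \<Longrightarrow> \<forall>\<^sub>F k in sequentially. \<forall>x. \<bar>lcdf (Qd (f (s k))) x - lcdf Q x\<bar> \<le> e"
    and a: "0 < a" and t: "0 < t" and \<sigma>: "\<bar>\<sigma>\<bar> = 1" "a \<le> \<sigma> * Tf Q t"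
    and u: "0 \<le> u" "u \<noteq> t" "a < \<sigma> * ((lcdf Q t)\<^sup>2 * of_bool (u < t) - atomless.gG Q t u)"
  shows "J a \<le> ereal c"
proof -
  interpret Q: atomless Q by (rule Q)
  define F where "F = lcdf Q t"
  define g where "g x = \<sigma> * (F\<^sup>2 * of_bool (x < t) - Q.gG t x)" for x
  define k where "k = (g u - a) / 2"
  have k: "0 < k" using u by (simp add: k_def g_def F_def)
  have gb: "g x \<le> 1" for x
  proof -
    have "0 \<le> F\<^sup>2 * of_bool (x < t)" "F\<^sup>2 * of_bool (x < t) \<le> 1" unfolding F_def by (auto simp: power_le_one)
    then have "\<bar>F\<^sup>2 * of_bool (x < t) - Q.gG t x\<bar> \<le> 1" using Q.gG_nonneg[of t x] Q.gG_le_1[of t x] by linarith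
    then have "\<bar>g x\<bar> \<le> 1" using \<sigma> by (simp add: g_def abs_mult)
    then show ?thesis by simp
  qed
  have ak: "a + k \<le> 1" "a + 2 * k = g u" using gb[of u] k unfolding k_def by argo+
  obtain d0 where d0: "d0 > 0" "\<And>x. \<bar>x - u\<bar> < d0 \<Longrightarrow> \<bar>Q.gG t x - Q.gG t u\<bar> < k"
  proof -
    have "\<exists>d>0. \<forall>x. norm (x - u) < d \<longrightarrow> norm (Q.gG t x - Q.gG t u) < k"
      using Q.isCont_gG[where t = t and s = u] k by (simp add: continuous_at_real_range)
    then show ?thesis using that by auto
  qed
  define d where "d = (if u < t then min d0 (t - u) else d0)"
  have d: "d > 0" using d0 by (auto simp: d_def)
  have gl: "a + k \<le> g x" if "u \<le> x" "x < u + d" for x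
  proof -
    have "\<bar>Q.gG t x - Q.gG t u\<bar> < k" using that by (intro d0(2)) (auto simp: d_def split: if_splits)
    moreover have "(x < t) = (u < t)" using that u by (auto simp: d_def split: if_splits)
    ultimately have "\<bar>g x - g u\<bar> \<le> k" using \<sigma>(1) by (simp add: g_def right_diff_distrib[symmetric] abs_mult)
    then show ?thesis using ak by linarith
  qed
  define r where "r = idens u (u + d)"
  have r: "DQ r" unfolding r_def using u d by (intro idens_DQ) auto
  interpret R: real_distribution "Qd r" by (rule Qd_rd[OF r])
  interpret RQQ: three "Qd r" Q Q ..
  interpret QRQ: three Q "Qd r" Q ..
  interpret QQR: three Q Q "Qd r" ..
  have bg: "bb (Q.gG t)" by (rule Q.bb_gG)
  have bl: "bb (\<lambda>x. of_bool (x < t))" by (intro bb_of_bool) measurable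
  have bG: "bb g" unfolding g_def[abs_def] by (intro bb_mult bb_const bb_diff bl bg)
  have gain: "3 * (a + k) \<le> \<sigma> * (3 * (lcdf (Qd r) t * F\<^sup>2) - (W3 (Qd r) Q Q t + W3 Q (Qd r) Q t + W3 Q Q (Qd r) t))"
  proof -
    have W: "W3 (Qd r) Q Q t + W3 Q (Qd r) Q t + W3 Q Q (Qd r) t = 3 * (\<integral>x. Q.gG t x \<partial>Qd r)"
    proof -
      note i = R.bb_integrable[OF Q.th.bb_sl(1)[OF bb_const bb_const]] R.bb_integrable[OF Q.th.bb_sl(2)[OF bb_const bb_const]] R.bb_integrable[OF Q.th.bb_sl(3)[OF bb_const bb_const]]
      have "W3 (Qd r) Q Q t = (\<integral>x. sl1 Q Q one one t x \<partial>Qd r)" using RQQ.tri_sl1[of one one one t] by simp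
      moreover have "W3 Q (Qd r) Q t = (\<integral>x. sl2 Q Q one one t x \<partial>Qd r)" using QRQ.tri_sl2[of one one one t] by simp
      moreover have "W3 Q Q (Qd r) t = (\<integral>x. sl3 Q Q one one t x \<partial>Qd r)" using QQR.tri_sl3[of one one one t] by simp
      ultimately show ?thesis unfolding Q.gG_def using i by simp
    qed
    have "(\<integral>x. r x * (a + k) \<partial>std_exp) \<le> (\<integral>x. r x * g x \<partial>std_exp)"
    proof (rule integral_mono)
      show "r x * (a + k) \<le> r x * g x" for x
      proof (cases "u \<le> x \<and> x < u + d")
        case True then show ?thesis using gl[of x] DQ_D(2)[OF r, of x] by (intro mult_left_mono) auto
      qed (auto simp: r_def idens_def)
    qed (intro E.bb_integrable bb_mult bb_const DQ_D(1)[OF r] bG)+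
    then have "a + k \<le> (\<integral>x. g x \<partial>Qd r)" using DQ_D(3)[OF r] Qd_integral[OF r bb_meas[OF bG]] by simp
    also have "\<dots> = \<sigma> * (F\<^sup>2 * lcdf (Qd r) t - (\<integral>x. Q.gG t x \<partial>Qd r))"
      unfolding g_def using R.bb_integrable[OF bl] R.bb_integrable[OF bg] by (simp add: R.integral_of_bool_lt)
    finally show ?thesis unfolding W by (simp add: algebra_simps)
  qed
  have improved: "J a \<le> ereal (c + 1 / real (Suc (s j)) + e * (\<bar>c\<bar> + \<bar>Kl r\<bar>))"
    if e: "0 < e" "e \<le> 1 / 2" "10 * e \<le> k" and n: "n = e * k / 36"
      and j: "\<forall>x. \<bar>lcdf (Qd (f (s j))) x - lcdf Q x\<bar> \<le> n" for e n j
  proof -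
    let ?f = "f (s j)"
    have "0 < e * k" using e k by simp
    then have n0: "0 \<le> n" "18 * n < e * k" unfolding n by auto
    interpret f: real_distribution "Qd ?f" by (rule Qd_rd[OF D])
    have "\<bar>Tf (Qd ?f) t - Tf Q t\<bar> \<le> 6 * n" by (rule Tf_kolmogorov[OF f.real_distribution_axioms Q.real_distribution_axioms]) (use j in auto)
    then have "\<bar>\<sigma> * Tf (Qd ?f) t - \<sigma> * Tf Q t\<bar> \<le> 6 * n" using \<sigma>(1) by (simp add: right_diff_distrib[symmetric] abs_mult)
    then have T0: "a - 6 * n \<le> \<sigma> * Td ?f ?f ?f t" using \<sigma>(2) unfolding Tf_Td[OF D, symmetric] by linarith
    have w: "\<bar>W3 (Qd r) (Qd ?f) (Qd ?f) t - W3 (Qd r) Q Q t\<bar> \<le> 0 + n + n"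
      "\<bar>W3 (Qd ?f) (Qd r) (Qd ?f) t - W3 Q (Qd r) Q t\<bar> \<le> n + 0 + n"
      "\<bar>W3 (Qd ?f) (Qd ?f) (Qd r) t - W3 Q Q (Qd r) t\<bar> \<le> n + n + 0"
      by (rule W3_kolmogorov; use j in \<open>simp add: f.real_distribution_axioms R.real_distribution_axioms Q.real_distribution_axioms\<close>)+
    have l: "\<bar>lcdf (Qd r) t * (lcdf (Qd ?f) t)\<^sup>2 - lcdf (Qd r) t * F\<^sup>2\<bar> \<le> 2 * n"
    proof -
      have "(lcdf (Qd ?f) t)\<^sup>2 - F\<^sup>2 = (lcdf (Qd ?f) t - F) * (lcdf (Qd ?f) t + F)" by (simp add: power2_eq_square algebra_simps)
      moreover have "\<bar>lcdf (Qd ?f) t - F\<bar> \<le> n" using j by (simp add: F_def)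
      moreover have "\<bar>lcdf (Qd ?f) t + F\<bar> \<le> 2" unfolding F_def using f.lcdf_le_1[of t] Q.lcdf_le_1[of t] f.lcdf_nonneg[of t] Q.lcdf_nonneg[of t] by linarith
      ultimately have "\<bar>(lcdf (Qd ?f) t)\<^sup>2 - F\<^sup>2\<bar> \<le> n * 2" using n0 unfolding abs_mult by (simp add: abs_mult mult_mono)
      then have "\<bar>lcdf (Qd r) t\<bar> * \<bar>(lcdf (Qd ?f) t)\<^sup>2 - F\<^sup>2\<bar> \<le> 1 * (n * 2)" by (intro mult_mono) auto
      then have "\<bar>lcdf (Qd r) t * ((lcdf (Qd ?f) t)\<^sup>2 - F\<^sup>2)\<bar> \<le> 2 * n" unfolding abs_mult by linarith
      then show ?thesis unfolding right_diff_distrib .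
    qed
    let ?S = "Td r ?f ?f t + Td ?f r ?f t + Td ?f ?f r t"
    let ?L = "3 * (lcdf (Qd r) t * F\<^sup>2) - (W3 (Qd r) Q Q t + W3 Q (Qd r) Q t + W3 Q Q (Qd r) t)"
    have "?S = 3 * (lcdf (Qd r) t * (lcdf (Qd ?f) t)\<^sup>2) - (W3 (Qd r) (Qd ?f) (Qd ?f) t + W3 (Qd ?f) (Qd r) (Qd ?f) t + W3 (Qd ?f) (Qd ?f) (Qd r) t)"
      unfolding Td_def W3_Qd[OF r D D] W3_Qd[OF D r D] W3_Qd[OF D D r] by (simp add: power2_eq_square)
    then have "\<bar>?S - ?L\<bar> \<le> 12 * n" using w l by linarith
    then have "\<bar>\<sigma> * ?S - \<sigma> * ?L\<bar> \<le> 12 * n" using \<sigma>(1) by (simp only: right_diff_distrib[symmetric] abs_mult) simp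
    moreover have "3 * (a + k - 4 * n) \<le> y" if "\<bar>y - x\<bar> \<le> 12 * n" "3 * (a + k) \<le> x" for x y :: real
    proof -
      have "x - y \<le> 12 * n" using that(1) by (simp add: abs_le_iff)
      then show ?thesis using that(2) by argo
    qed
    ultimately have T1: "3 * (a + k - 4 * n) \<le> \<sigma> * ?S" using gain by blast
    have "a < \<bar>Tf (Qd (mixd e ?f r)) t\<bar>"
      by (rule mixture_gain[OF D r \<sigma>(1) e k ak(1) a n0 T0 T1])
    then have "J a \<le> ereal (Kl (mixd e ?f r))" using e t by (intro J_le mixd_DQ D r) auto
    also have "Kl (mixd e ?f r) \<le> (1 - e) * Kl ?f + e * Kl r" using e by (intro mixd_Kl D r) auto
    also have "\<dots> \<le> (1 - e) * (c + 1 / real (Suc (s j))) + e * Kl r" using K[of "s j"] e by (intro add_right_mono mult_left_mono) auto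
    also have "\<dots> \<le> c + 1 / real (Suc (s j)) + e * (\<bar>c\<bar> + \<bar>Kl r\<bar>)"
    proof -
      have *: "(1 - e) * (c + d) + e * q \<le> c + d + e * (\<bar>c\<bar> + \<bar>q\<bar>)" if "0 \<le> d" for d q :: real
      proof -
        have "0 \<le> e * d" "e * q \<le> e * \<bar>q\<bar>" using e that by (auto intro!: mult_left_mono)
        moreover have "e * (- c) \<le> e * \<bar>c\<bar>" by (rule mult_left_mono) (use e in auto)
        ultimately show ?thesis by (simp add: algebra_simps)
      qed
      show ?thesis by (rule *) simp
    qed
    finally show ?thesis by simp
  qed
  show ?thesis
  proof (rule ereal_le_epsilon2)
    fix z :: real assume z: "0 < z"
    define Z where "Z = z / (2 * (\<bar>c\<bar> + \<bar>Kl r\<bar> + 1))"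
    define e where "e = min (1 / 2) (min (k / 10) Z)"
    have zp: "0 < Z" unfolding Z_def using z by (intro divide_pos_pos) auto
    have e': "0 < e" "e \<le> 1 / 2" "e \<le> Z" "e \<le> k / 10"
      unfolding e_def using zp k by linarith+
    have e: "0 < e" "e \<le> 1 / 2" "e \<le> z / (2 * (\<bar>c\<bar> + \<bar>Kl r\<bar> + 1))" "e \<le> k / 10" using e' by (simp_all add: Z_def)
    have e10: "10 * e \<le> k" using e(4) by simp
    have "e * (\<bar>c\<bar> + \<bar>Kl r\<bar>) \<le> z / (2 * (\<bar>c\<bar> + \<bar>Kl r\<bar> + 1)) * (\<bar>c\<bar> + \<bar>Kl r\<bar> + 1)" using e by (intro mult_mono) auto
    also have "\<dots> = z / 2" by (simp add: field_simps)
    finally have ez: "e * (\<bar>c\<bar> + \<bar>Kl r\<bar>) \<le> z / 2" .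
    have l0: "(\<lambda>k. 1 / real (Suc (s k))) \<longlonglongrightarrow> 0"
    proof -
      have "(\<lambda>k. 1 / real (Suc k)) \<longlonglongrightarrow> 0" using LIMSEQ_Suc[OF lim_inverse_n'] by simp
      from LIMSEQ_subseq_LIMSEQ[OF this s] show ?thesis by (simp add: comp_def)
    qed
    have "\<forall>\<^sub>F j in sequentially. \<forall>x. \<bar>lcdf (Qd (f (s j))) x - lcdf Q x\<bar> \<le> e * k / 36" using e k by (intro unif) auto
    moreover have "\<forall>\<^sub>F j in sequentially. 1 / real (Suc (s j)) < z / 2" using order_tendstoD(2)[OF l0, of "z / 2"] z by simp
    ultimately have "\<forall>\<^sub>F j in sequentially. J a \<le> ereal (c + z)"
    proof eventually_elim
      case (elim j)
      have "J a \<le> ereal (c + 1 / real (Suc (s j)) + e * (\<bar>c\<bar> + \<bar>Kl r\<bar>))" by (rule improved[OF e(1,2) e10 refl elim(1)])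
      also have "\<dots> \<le> ereal (c + z)" using elim(2) ez by simp
      finally show ?case .
    qed
    then show "J a \<le> ereal c + ereal z" by simp
  qed
qed

text \<open>Near-minimizers below \<open>a\<close> converge along a subsequence to a law \<open>Q\<close>
  that attains the level. The non-degenerate case is \<open>nondegenerate_improves\<close>. In the
  degenerate case the gap in the support of \<open>Q\<close> forces \<open>c \<ge> 0.46\<close> or
  \<open>c \<ge> 0.65\<close>, which the trial densities undercut at every level \<open>a \<le>
  8/27\<close> or \<open>a \<le> 0.385\<close>, respectively.\<close>

lemma J_left:
  assumes a: "0 < a" "a < 1" and Jc: "\<And>b. b < a \<Longrightarrow> J b \<le> ereal c"
  shows "J a \<le> ereal c"
proof -
  have "\<exists>f t. DQ f \<and> Kl f \<le> c + 1 / real (Suc k) \<and> 0 \<le> t \<and> a - 1 / real (Suc k) < \<bar>Tf (Qd f) t\<bar>" for k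
  proof -
    have "J (a - 1 / real (Suc k)) \<le> ereal c" by (rule Jc) simp
    also have "\<dots> < ereal (c + 1 / real (Suc k))" by simp
    finally show ?thesis unfolding J_def INF_less_iff by (auto intro: less_imp_le)
  qed
  then have "\<forall>k. \<exists>p. DQ (fst p) \<and> Kl (fst p) \<le> c + 1 / real (Suc k) \<and> 0 \<le> snd p \<and> a - 1 / real (Suc k) < \<bar>Tf (Qd (fst p)) (snd p)\<bar>"
    by simp
  from choice[OF this] obtain p where p: "\<forall>k. DQ (fst (p k)) \<and> Kl (fst (p k)) \<le> c + 1 / real (Suc k) \<and> 0 \<le> snd (p k) \<and> a - 1 / real (Suc k) < \<bar>Tf (Qd (fst (p k))) (snd (p k))\<bar>"
    by blast
  define f where "f k = fst (p k)" for k
  define t where "t k = snd (p k)" for k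
  have D: "\<And>k. DQ (f k)" and K: "\<And>k. Kl (f k) \<le> c + 1 / real (Suc k)"
    and t: "\<And>k. 0 \<le> t k" "\<And>k. a - 1 / real (Suc k) < \<bar>Tf (Qd (f k)) (t k)\<bar>"
    using p by (simp_all add: f_def t_def)
  have K': "Kl (f k) \<le> c + 1" for k using K[of k] by (rule order_trans) (simp add: divide_le_eq)
  obtain s Q where s: "strict_mono (s :: nat \<Rightarrow> nat)" and Q: "atomless Q"
    and lim: "\<And>x. (\<lambda>k. lcdf (Qd (f (s k))) x) \<longlonglongrightarrow> lcdf Q x"
    and unif: "\<And>e. 0 < e \<Longrightarrow> \<forall>\<^sub>F k in sequentially. \<forall>x. \<bar>lcdf (Qd (f (s k))) x - lcdf Q x\<bar> \<le> e"
    using compactness[of f "c + 1", OF D K'] by auto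
  interpret Q: atomless Q by (rule Q)
  have l0: "(\<lambda>k. 1 / real (Suc (s k))) \<longlonglongrightarrow> 0"
  proof -
    have "(\<lambda>k. 1 / real (Suc k)) \<longlonglongrightarrow> 0" using LIMSEQ_Suc[OF lim_inverse_n'] by simp
    from LIMSEQ_subseq_LIMSEQ[OF this s] show ?thesis by (simp add: comp_def)
  qed
  have "\<exists>u\<ge>0. a - e \<le> \<bar>Tf Q u\<bar>" if e: "0 < e" for e
  proof -
    have "\<forall>\<^sub>F k in sequentially. \<forall>x. \<bar>lcdf (Qd (f (s k))) x - lcdf Q x\<bar> \<le> e / 12" using e by (intro unif) auto
    moreover have "\<forall>\<^sub>F k in sequentially. 1 / real (Suc (s k)) < e / 2" using order_tendstoD(2)[OF l0, of "e / 2"] e by simp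
    ultimately have "\<forall>\<^sub>F k in sequentially. a - e \<le> \<bar>Tf Q (t (s k))\<bar>"
    proof eventually_elim
      case (elim k)
      have "\<bar>Tf (Qd (f (s k))) (t (s k)) - Tf Q (t (s k))\<bar> \<le> 6 * (e / 12)"
        by (rule Tf_kolmogorov[OF Qd_rd[OF D] Q.real_distribution_axioms]) (use elim in auto)
      then show ?case using t(2)[of "s k"] elim by linarith
    qed
    then obtain k where "a - e \<le> \<bar>Tf Q (t (s k))\<bar>" using eventually_happens[of _ sequentially] by auto
    then show ?thesis using t(1) by blast
  qed
  then obtain \<tau> where \<tau>: "0 < \<tau>" "a \<le> \<bar>Tf Q \<tau>\<bar>" using Q.Tf_attains[OF a(1)] by blast
  define \<sigma> where "\<sigma> = sgn (Tf Q \<tau>)"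
  have \<sigma>: "\<bar>\<sigma>\<bar> = 1" "a \<le> \<sigma> * Tf Q \<tau>" "\<sigma> = 1 \<or> \<sigma> = - 1" using \<tau> a by (auto simp: \<sigma>_def sgn_real_def split: if_splits)
  define F where "F = lcdf Q \<tau>"
  define g where "g x = \<sigma> * (F\<^sup>2 * of_bool (x < \<tau>) - Q.gG \<tau> x)" for x
  show ?thesis
  proof (cases "\<exists>u\<ge>0. u \<noteq> \<tau> \<and> a < g u")
    case True
    then obtain u where u: "0 \<le> u" "u \<noteq> \<tau>" "a < g u" by blast
    show ?thesis
      by (rule nondegenerate_improves[OF Q D K s unif a(1) \<tau>(1) \<sigma>(1,2) u(1,2)]) (use u in \<open>simp_all add: g_def F_def\<close>)
  next
    case False
    then have gle: "g u \<le> a" if "0 \<le> u" "u \<noteq> \<tau>" for u using that by (meson not_le)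
    have bl: "bb (\<lambda>x. of_bool (x < \<tau>))" by (intro bb_of_bool) measurable
    have bG: "bb g" unfolding g_def[abs_def] by (intro bb_mult bb_const bb_diff bl Q.bb_gG)
    have ig: "(\<integral>x. g x \<partial>Q) = \<sigma> * Tf Q \<tau>"
    proof -
      have "(\<integral>x. g x \<partial>Q) = \<sigma> * (F\<^sup>2 * F - W3 Q Q Q \<tau>)"
        unfolding g_def using Q.bb_integrable[OF bl] Q.bb_integrable[OF Q.bb_gG] by (simp add: Q.integral_of_bool_lt Q.gG_integral F_def)
      then show ?thesis by (simp add: Tf_def F_def power2_eq_square power3_eq_cube)
    qed
    have nn: "AE x in Q. 0 \<le> a - g x" using Q.AE_nonneg Q.AE_neq[of \<tau>] by eventually_elim (use gle in auto)
    have ii: "integrable Q (\<lambda>x. a - g x)" by (intro Q.bb_integrable bb_diff bb_const bG)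
    have "(\<integral>x. a - g x \<partial>Q) = a - \<sigma> * Tf Q \<tau>" using Q.bb_integrable[OF bG] ig Q.prob_space by simp
    moreover have "0 \<le> (\<integral>x. a - g x \<partial>Q)" by (rule integral_nonneg_AE[OF nn])
    ultimately have eqa: "a = \<sigma> * Tf Q \<tau>" "(\<integral>x. a - g x \<partial>Q) = 0" using \<sigma>(2) by auto
    have ae: "AE x in Q. g x = a"
      using integral_nonneg_eq_0_iff_AE[OF ii nn] eqa(2) by (auto elim: eventually_mono)
    have "\<sigma> \<noteq> 1"
    proof
      assume s1: "\<sigma> = 1"
      show False
        by (rule Q.no_degenerate_plus[OF \<tau>(1) a]) (use gle ae in \<open>simp_all add: g_def s1 F_def\<close>)
    qed
    then have s1: "\<sigma> = - 1" using \<sigma> by blast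
    have aW: "a = W3 Q Q Q \<tau> - F ^ 3" using eqa(1) by (simp add: s1 Tf_def F_def)
    have gle': "\<And>u. 0 \<le> u \<Longrightarrow> u \<noteq> \<tau> \<Longrightarrow> Q.gG \<tau> u - F\<^sup>2 * of_bool (u < \<tau>) \<le> a" using gle by (simp add: g_def s1)
    have ae': "AE u in Q. Q.gG \<tau> u - F\<^sup>2 * of_bool (u < \<tau>) = a" using ae by (simp add: g_def s1)
    have deg: "0 < F \<and> F < 1 \<and>
      (F = 2 / 3 \<and> a \<le> 8 / 27 \<and> measure Q {\<tau>..<6 / 5 * \<tau>} = 0 \<and> measure Q {2 / 5 * \<tau><..<\<tau>} = 0 \<or>
       0.57 \<le> F \<and> F \<le> 2 / 3 \<and> a \<le> 0.385 \<and> measure Q {\<tau> / 6<..<\<tau>} = 0)"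
      unfolding F_def by (rule Q.degenerate_minus[OF \<tau>(1) a(1)]) (use aW gle' ae' in \<open>simp_all add: F_def\<close>)
    have eqF: "lcdf Q m = F" if "0 < m" "m < \<tau>" "measure Q {m<..<\<tau>} = 0" for m
    proof -
      have "measure Q {m..<\<tau>} \<le> measure Q ({m} \<union> {m<..<\<tau>})" by (intro Q.finite_measure_mono) auto
      also have "\<dots> \<le> measure Q {m} + measure Q {m<..<\<tau>}" by (rule measure_Un_le) auto
      finally have "measure Q {m..<\<tau>} \<le> 0" using that Q.atom[of m] by simp
      then show ?thesis using Q.measure_Ico[of m \<tau>] that Q.lcdf_mono[of m \<tau>] by (simp add: F_def)
    qed
    from deg have F: "0 < F" "F < 1" by auto
    from deg show ?thesis
    proof (elim conjE disjE)
      assume h: "F = 2 / 3" "a \<le> 8 / 27" "measure Q {\<tau>..<6 / 5 * \<tau>} = 0" "measure Q {2 / 5 * \<tau><..<\<tau>} = 0"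
      have l1: "lcdf Q (2 / 5 * \<tau>) = F" using \<tau> h by (intro eqF) auto
      have l2: "lcdf Q (6 / 5 * \<tau>) = F" using Q.measure_Ico[of \<tau> "6 / 5 * \<tau>"] \<tau> h by (simp add: F_def)
      have "F * ln F - F * ln (1 - exp (- (2 / 5 * \<tau>))) + (1 - F) * ln (1 - F) + (1 - F) * (6 / 5 * \<tau>) \<le> c"
        by (rule limit_entropy_bound[OF D K s lim _ _ l1 l2 F]) (use \<tau> in auto)
      then have "0.46 \<le> c" unfolding h(1) by (rule entropy_case_1[OF \<tau>(1)])
      then show ?thesis using order_trans[OF J_mono[OF h(2)] J_trial_1] by (metis ereal_less_eq(3) order_trans)
    next
      assume h: "0.57 \<le> F" "F \<le> 2 / 3" "a \<le> 0.385" "measure Q {\<tau> / 6<..<\<tau>} = 0"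
      have l1: "lcdf Q (\<tau> / 6) = F" using \<tau> h by (intro eqF) auto
      have l2: "lcdf Q \<tau> = F" by (simp add: F_def)
      have "F * ln F - F * ln (1 - exp (- (\<tau> / 6))) + (1 - F) * ln (1 - F) + (1 - F) * \<tau> \<le> c"
        by (rule limit_entropy_bound[OF D K s lim _ _ l1 l2 F]) (use \<tau> in auto)
      then have "0.65 \<le> c" by (rule entropy_case_2[OF \<tau>(1) h(1,2)])
      then show ?thesis using order_trans[OF J_mono[OF h(3)] J_trial_2] by (metis ereal_less_eq(3) order_trans)
    qed
  qed
qed

section \<open>Quadratic behaviour of the rate function at zero\<close>

text \<open>\<open>xi3\<close> is one third of the first variation of \<open>T\<close> at the exponential
  law.\<close>

lemma xi3_eq: assumes "0 \<le> t"
  shows "xi3 s t = (lcdf std_exp t)\<^sup>2 * of_bool (s < t) - EA.gG t s"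
proof -
  have "b * (A - (1 - p) + 2 / 3 * (1 - q)) - b' * (1 / 2 * (1 - p') - 1 / 6 * (1 - q')) - b'' * (2 / 3 * (1 - p'') - 1 / 3 * (1 - q'')) =
      A * b - (b * (1 - 3 * p + 2 * q) + b' * (1 - 3 / 2 * p' + 1 / 2 * q') + b'' * (1 - 2 * p'' + q'')) / 3"
    for b b' b'' A p p' p'' q q' q'' :: real by (simp add: field_simps)
  then show ?thesis unfolding xi3_def F_exp_def EA.gG_def sl1_std_exp sl2_std_exp sl3_std_exp lcdf_std_exp[OF assms] .
qed

lemma bb_xi3: assumes "0 \<le> t" shows "bb (\<lambda>s. xi3 s t)"
proof -
  have l: "bb (\<lambda>s. of_bool (s < t))" by (intro bb_of_bool) measurable
  show ?thesis unfolding xi3_eq[OF assms]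
    by (rule bb_diff[OF bb_mult[OF bb_const l] EA.bb_gG])
qed

lemma xi3_abs: assumes "0 \<le> t" shows "\<bar>xi3 s t\<bar> \<le> 1"
proof -
  have "0 \<le> (lcdf std_exp t)\<^sup>2 * of_bool (s < t)" "(lcdf std_exp t)\<^sup>2 * of_bool (s < t) \<le> 1" by (auto simp: power_le_one)
  then show ?thesis unfolding xi3_eq[OF assms] using EA.gG_nonneg[of t s] EA.gG_le_1[of t s] by linarith
qed

text \<open>This is \<open>renyi\<close> again: the mean of the first variation is \<open>T\<close> itself.\<close>

lemma xi3_mean: assumes "0 \<le> t" shows "(\<integral>s. xi3 s t \<partial>std_exp) = 0"
proof -
  have l: "bb (\<lambda>s. of_bool (s < t))" by (intro bb_of_bool) measurable
  have "(\<integral>s. xi3 s t \<partial>std_exp) = (lcdf std_exp t)\<^sup>2 * lcdf std_exp t - W3 std_exp std_exp std_exp t"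
    unfolding xi3_eq[OF assms] using E.bb_integrable[OF l] E.bb_integrable[OF EA.bb_gG]
    by (simp add: E.integral_of_bool_lt EA.gG_integral)
  then show ?thesis using renyi[OF assms] by (simp add: power2_eq_square power3_eq_cube)
qed

lemma delta3_sq_at_eq: assumes "0 \<le> t" shows "delta3_sq_at t = (\<integral>s. (xi3 s t)\<^sup>2 \<partial>std_exp)"
  unfolding delta3_sq_at_def using xi3_mean[OF assms] by simp

lemma delta3_sq_at_bounds: assumes "0 \<le> t" shows "0 \<le> delta3_sq_at t" "delta3_sq_at t \<le> 1"
proof -
  show "0 \<le> delta3_sq_at t" unfolding delta3_sq_at_eq[OF assms] by (intro Bochner_Integration.integral_nonneg) simp
  have b: "bb (\<lambda>s. (xi3 s t)\<^sup>2)" using bb_mult[OF bb_xi3[OF assms] bb_xi3[OF assms]] by (simp add: power2_eq_square)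
  have "(xi3 s t)\<^sup>2 \<le> 1" for s using xi3_abs[OF assms, of s] by (simp add: abs_square_le_1)
  then have "(\<integral>s. (xi3 s t)\<^sup>2 \<partial>std_exp) \<le> (\<integral>s. 1 \<partial>std_exp)" by (intro integral_mono E.bb_integrable b) auto
  then show "delta3_sq_at t \<le> 1" unfolding delta3_sq_at_eq[OF assms] using E.prob_space by simp
qed

lemma delta3_sq_upper: assumes "0 \<le> t" shows "delta3_sq_at t \<le> delta3_sq"
  unfolding delta3_sq_def using assms delta3_sq_at_bounds by (intro cSUP_upper bdd_aboveI[of _ 1]) auto

text \<open>Expand the trilinear form around the density 1, where \<open>T\<close> vanishes; the cube and
  the products of at least two deviations are quadratic in the \<open>L\<^sup>1\<close> distance.\<close>

lemma Tf_expansion: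
  assumes f: "DQ f" and t: "0 \<le> t"
  shows "\<bar>Tf (Qd f) t - 3 * (\<integral>s. f s * xi3 s t \<partial>std_exp)\<bar> \<le> 7 * (\<integral>s. \<bar>f s - 1\<bar> \<partial>std_exp)\<^sup>2"
proof -
  let ?E = std_exp
  define h where "h s = f s - 1" for s
  define N where "N = (\<integral>s. \<bar>h s\<bar> \<partial>?E)"
  have bf: "bb f" by (rule DQ_D(1)[OF f])
  have bh: "bb h" unfolding h_def[abs_def] by (intro bb_diff bf bb_const)
  have N0: "0 \<le> N" unfolding N_def by simp
  have fh: "f = (\<lambda>s. 1 * one s + 1 * h s)" by (simp add: h_def)
  have bl: "bb (\<lambda>s. of_bool (s < t))" by (intro bb_of_bool) measurable
  define F where "F = lcdf ?E t"
  define \<delta> where "\<delta> = (\<integral>s. h s * of_bool (s < t) \<partial>?E)"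
  have Ff: "lcdf (Qd f) t = F + \<delta>"
  proof -
    have "f s * of_bool (s < t) = of_bool (s < t) + h s * of_bool (s < t)" for s by (simp add: h_def algebra_simps)
    then show ?thesis unfolding lcdf_Qd[OF f] \<delta>_def F_def
      using E.bb_integrable[OF bl] E.bb_integrable[OF bb_mult[OF bh bl]] by (simp add: E.integral_of_bool_lt)
  qed
  interpret Q: real_distribution "Qd f" by (rule Qd_rd[OF f])
  have Fb: "0 \<le> F" "F \<le> 1" by (simp_all add: F_def)
  have \<delta>1: "\<bar>\<delta>\<bar> \<le> 1" using Ff Q.lcdf_nonneg[of t] Q.lcdf_le_1[of t] Fb by linarith
  have \<delta>N: "\<bar>\<delta>\<bar> \<le> N"
  proof -
    have "\<bar>\<delta>\<bar> \<le> (\<integral>s. \<bar>h s * of_bool (s < t)\<bar> \<partial>?E)" unfolding \<delta>_def by (rule integral_abs_bound_rd)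
    also have "\<dots> \<le> N" unfolding N_def by (intro integral_mono E.bb_integrable bb_abs bb_mult bh bl) (auto simp: abs_mult)
    finally show ?thesis .
  qed
  have cub: "\<bar>(F + \<delta>) ^ 3 - (F ^ 3 + 3 * F\<^sup>2 * \<delta>)\<bar> \<le> 4 * N\<^sup>2"
  proof -
    have "(F + \<delta>) ^ 3 - (F ^ 3 + 3 * F\<^sup>2 * \<delta>) = \<delta>\<^sup>2 * (3 * F + \<delta>)" by (simp add: power2_eq_square power3_eq_cube algebra_simps)
    moreover have "\<bar>3 * F + \<delta>\<bar> \<le> 4" using Fb \<delta>1 by linarith
    moreover have "\<delta>\<^sup>2 \<le> N\<^sup>2" using power_mono[OF \<delta>N, of 2] by simp
    ultimately have "\<bar>(F + \<delta>) ^ 3 - (F ^ 3 + 3 * F\<^sup>2 * \<delta>)\<bar> \<le> N\<^sup>2 * 4" by (simp add: abs_mult mult_mono)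
    then show ?thesis by simp
  qed
  let ?T = "\<lambda>u v w. tri ?E ?E ?E u v w t"
  have t1: "?T f v w = ?T one v w + ?T h v w" if "bb v" "bb w" for v w
    using EA.th.tri_lin1[OF bb_const[of 1] bh that, of 1 1 t] by (subst fh) simp
  have t2: "?T u f w = ?T u one w + ?T u h w" if "bb u" "bb w" for u w
    using EA.th.tri_lin2[OF that(1) bb_const[of 1] bh that(2), of 1 1 t] by (subst fh) simp
  have t3: "?T u v f = ?T u v one + ?T u v h" if "bb u" "bb v" for u v
    using EA.th.tri_lin3[OF that bb_const[of 1] bh, of 1 1 t] by (subst fh) simp
  have expand: "?T f f f = ?T one one one + (?T h one one + ?T one h one + ?T one one h) + (?T h h f + ?T h one h + ?T one h h)"
    using t1[OF bf bf] t2[OF bb_const[of 1] bf] t2[OF bh bf] t3[OF bb_const[of 1] bb_const[of 1]] t3[OF bb_const[of 1] bh] t3[OF bh bb_const[of 1]]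
    by linarith
  have If: "(\<integral>s. \<bar>f s\<bar> \<partial>?E) = 1" using DQ_D(2,3)[OF f] by simp
  have I1: "(\<integral>s. \<bar>1\<bar> \<partial>?E) = (1::real)" using E.prob_space by simp
  have b: "\<bar>?T h h f\<bar> \<le> N\<^sup>2" "\<bar>?T h one h\<bar> \<le> N\<^sup>2" "\<bar>?T one h h\<bar> \<le> N\<^sup>2"
    using EA.th.tri_abs[OF bh bh bf, of t] EA.th.tri_abs[OF bh bb_const[of 1] bh, of t] EA.th.tri_abs[OF bb_const[of 1] bh bh, of t]
    unfolding If I1 N_def[symmetric] by (simp_all add: power2_eq_square)
  have lin: "3 * (\<integral>s. f s * xi3 s t \<partial>?E) = 3 * F\<^sup>2 * \<delta> - (?T h one one + ?T one h one + ?T one one h)"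
  proof -
    note sl = EA.th.bb_sl(1)[OF bb_const[of 1] bb_const[of 1], of t] EA.th.bb_sl(2)[OF bb_const[of 1] bb_const[of 1], of t] EA.th.bb_sl(3)[OF bb_const[of 1] bb_const[of 1], of t]
    have i: "integrable ?E (\<lambda>s. h s * of_bool (s < t))" "integrable ?E (\<lambda>s. h s * sl1 ?E ?E one one t s)"
      "integrable ?E (\<lambda>s. h s * sl2 ?E ?E one one t s)" "integrable ?E (\<lambda>s. h s * sl3 ?E ?E one one t s)" "integrable ?E (\<lambda>s. xi3 s t)"
      "integrable ?E (\<lambda>s. h s * xi3 s t)"
      by (intro E.bb_integrable bb_mult bh bl sl bb_xi3 t)+
    have "f s * xi3 s t = xi3 s t + h s * xi3 s t" for s by (simp add: h_def algebra_simps)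
    then have "(\<integral>s. f s * xi3 s t \<partial>?E) = (\<integral>s. h s * xi3 s t \<partial>?E)" using i xi3_mean[OF t] by simp
    also have "\<dots> = (\<integral>s. F\<^sup>2 * (h s * of_bool (s < t)) - (h s * sl1 ?E ?E one one t s + h s * sl2 ?E ?E one one t s + h s * sl3 ?E ?E one one t s) / 3 \<partial>?E)"
      unfolding xi3_eq[OF t] EA.gG_def F_def by (simp add: algebra_simps add_divide_distrib)
    also have "\<dots> = F\<^sup>2 * \<delta> - (?T h one one + ?T one h one + ?T one one h) / 3"
      unfolding EA.th.tri_sl1[of h] EA.th.tri_sl2[OF bb_const bh bb_const] EA.th.tri_sl3[OF bb_const bb_const bh] \<delta>_def
      using i by simp
    finally show ?thesis by argo
  qed
  have "Tf (Qd f) t = (F + \<delta>) ^ 3 - ?T f f f" unfolding Tf_def Ff W3_Qd[OF f f f] ..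
  moreover have "?T one one one = F ^ 3" unfolding F_def by (rule renyi[OF t])
  ultimately have "Tf (Qd f) t - 3 * (\<integral>s. f s * xi3 s t \<partial>?E) =
     ((F + \<delta>) ^ 3 - (F ^ 3 + 3 * F\<^sup>2 * \<delta>)) - (?T h h f + ?T h one h + ?T one h h)"
    unfolding expand lin by simp
  then show ?thesis using cub b unfolding h_def[symmetric] N_def[symmetric] by linarith
qed

lemma exp_le_cubic: fixes x :: real assumes "\<bar>x\<bar> \<le> 1" shows "exp x \<le> 1 + x + x\<^sup>2 / 2 + \<bar>x\<bar> ^ 3"
proof -
  have "\<exists>t. \<bar>t\<bar> \<le> \<bar>x\<bar> \<and> exp x = (\<Sum>m<3. x ^ m / fact m) + exp t / fact 3 * x ^ 3"
    by (rule Maclaurin_exp_le)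
  then obtain t where t: "\<bar>t\<bar> \<le> \<bar>x\<bar>" "exp x = (\<Sum>m<3. x ^ m / fact m) + exp t / fact 3 * x ^ 3" by blast
  have "exp t \<le> exp 1" using t assms by simp
  also have "\<dots> \<le> 3" by (rule exp_le)
  finally have "exp t / fact 3 \<le> 1" by (simp add: fact_numeral)
  have "exp t / fact 3 * x ^ 3 \<le> exp t / fact 3 * \<bar>x\<bar> ^ 3" by (intro mult_left_mono) (auto simp: power_abs[symmetric])
  also have "\<dots> \<le> 1 * \<bar>x\<bar> ^ 3" using \<open>exp t / fact 3 \<le> 1\<close> by (intro mult_right_mono) auto
  finally show ?thesis using t(2) by (simp add: lessThan_nat_numeral fact_numeral)
qed

text \<open>A law that exceeds \<open>a\<close> and has entropy at most \<open>a\<^sup>2 / (18 v)\<close> is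
  within \<open>O(a)\<close> of \<open>E\<close> in \<open>L\<^sup>1\<close>, so that the
  remainder of the expansion is \<open>O(a\<^sup>2)\<close> and \<open>\<xi>\<close> has mean at
  least \<open>a / 3 - O(a\<^sup>2)\<close>. The Donsker-Varadhan inequality for \<open>\<mu>
  \<xi>\<close> with the optimal \<open>\<mu> = a / (3 v)\<close> then bounds the entropy below.\<close>

lemma rate_lower:
  assumes v: "0 < delta3_sq"
  shows "\<exists>C a0. 0 < a0 \<and> (\<forall>a. 0 < a \<and> a < a0 \<longrightarrow> ereal (a\<^sup>2 / (18 * delta3_sq) - C * a ^ 3) \<le> J a)"
proof -
  define v where "v = delta3_sq"
  have v0: "0 < v" using v by (simp add: v_def)
  define C where "C = 14 / 81 / v\<^sup>2 + 1 / (27 * v ^ 3)"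
  have C0: "0 \<le> C" using v0 by (simp add: C_def)
  define a0 where "a0 = min 1 (min (3 * v) (18 * v))"
  have a0: "0 < a0" using v0 by (simp add: a0_def)
  have "a\<^sup>2 / (18 * v) - C * a ^ 3 \<le> Kl f" if a: "0 < a" "a < a0" and f: "DQ f" and t: "0 \<le> t" "a < \<bar>Tf (Qd f) t\<bar>" for a f t
  proof (rule ccontr)
    assume neg: "\<not> a\<^sup>2 / (18 * v) - C * a ^ 3 \<le> Kl f"
    define \<kappa> where "\<kappa> = a\<^sup>2 / (18 * v)"
    have \<kappa>0: "0 < \<kappa>" using a v0 by (simp add: \<kappa>_def)
    have a1: "a \<le> 1" "a \<le> 3 * v" "a \<le> 18 * v" using a by (auto simp: a0_def)
    have "a * a \<le> 1 * (18 * v)" using a a1 by (intro mult_mono) auto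
    then have \<kappa>1: "\<kappa> \<le> 1" using v0 by (simp add: \<kappa>_def power2_eq_square)
    have K: "Kl f \<le> \<kappa>" 
    proof -
      have "0 \<le> C * a ^ 3" using C0 a by simp
      then show ?thesis using neg unfolding \<kappa>_def by linarith
    qed
    define N where "N = (\<integral>s. \<bar>f s - 1\<bar> \<partial>std_exp)"
    have "N \<le> Kl f / sqrt \<kappa> + sqrt \<kappa>" unfolding N_def using \<kappa>0 \<kappa>1 by (intro Kl_L1 f) auto
    also have "\<dots> \<le> \<kappa> / sqrt \<kappa> + sqrt \<kappa>" using K \<kappa>0 by (intro add_right_mono divide_right_mono) auto
    also have "\<dots> = 2 * sqrt \<kappa>" using \<kappa>0 by (simp add: real_div_sqrt)
    finally have "N \<le> 2 * sqrt \<kappa>" .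
    moreover have "0 \<le> N" unfolding N_def by simp
    ultimately have "N\<^sup>2 \<le> (2 * sqrt \<kappa>)\<^sup>2" by (intro power_mono)
    then have N2: "N\<^sup>2 \<le> 4 * \<kappa>" using \<kappa>0 by (simp add: power_mult_distrib)
    define I where "I = (\<integral>s. f s * xi3 s t \<partial>std_exp)"
    have "\<bar>Tf (Qd f) t\<bar> \<le> 3 * \<bar>I\<bar> + 28 * \<kappa>"
      using Tf_expansion[OF f t(1)] N2 unfolding I_def[symmetric] N_def[symmetric] by linarith
    then have I: "a - 28 * \<kappa> \<le> 3 * \<bar>I\<bar>" using t by linarith
    define \<mu> where "\<mu> = a / (3 * v)"
    have \<mu>: "0 < \<mu>" "\<mu> \<le> 1" using a a1 v0 by (auto simp: \<mu>_def)
    define \<sigma> where "\<sigma> = (if 0 \<le> I then 1 else - 1 :: real)"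
    have \<sigma>: "\<sigma> * I = \<bar>I\<bar>" "\<bar>\<sigma>\<bar> = 1" by (auto simp: \<sigma>_def)
    note bx = bb_xi3[OF t(1)]
    have b: "bb (\<lambda>s. (\<mu> * \<sigma>) * xi3 s t)" by (rule bb_mult[OF bb_const bx])
    have b2: "bb (\<lambda>s. (xi3 s t)\<^sup>2)" using bb_mult[OF bx bx] by (simp add: power2_eq_square)
    have "(\<integral>s. exp ((\<mu> * \<sigma>) * xi3 s t) \<partial>std_exp) \<le> (\<integral>s. 1 + (\<mu> * \<sigma>) * xi3 s t + \<mu>\<^sup>2 / 2 * (xi3 s t)\<^sup>2 + \<mu> ^ 3 \<partial>std_exp)"
    proof (rule integral_mono)
      show "integrable std_exp (\<lambda>s. exp ((\<mu> * \<sigma>) * xi3 s t))" by (rule E.bb_integrable[OF bb_exp[OF b]])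
      show "integrable std_exp (\<lambda>s. 1 + (\<mu> * \<sigma>) * xi3 s t + \<mu>\<^sup>2 / 2 * (xi3 s t)\<^sup>2 + \<mu> ^ 3)"
        by (rule E.bb_integrable[OF bb_add[OF bb_add[OF bb_add[OF bb_const b] bb_mult[OF bb_const b2]] bb_const]])
      fix s
      have ab: "\<bar>(\<mu> * \<sigma>) * xi3 s t\<bar> = \<mu> * \<bar>xi3 s t\<bar>" using \<sigma> \<mu> by (simp add: abs_mult)
      have le: "\<mu> * \<bar>xi3 s t\<bar> \<le> \<mu> * 1" using xi3_abs[OF t(1), of s] \<mu> by (intro mult_left_mono) auto
      have "exp ((\<mu> * \<sigma>) * xi3 s t) \<le> 1 + (\<mu> * \<sigma>) * xi3 s t + ((\<mu> * \<sigma>) * xi3 s t)\<^sup>2 / 2 + \<bar>(\<mu> * \<sigma>) * xi3 s t\<bar> ^ 3"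
        
      proof (rule exp_le_cubic)
        show "\<bar>(\<mu> * \<sigma>) * xi3 s t\<bar> \<le> 1" unfolding ab using le \<mu> by linarith
      qed
      moreover have "\<bar>(\<mu> * \<sigma>) * xi3 s t\<bar> ^ 3 \<le> \<mu> ^ 3" using ab le \<mu> by (intro power_mono) auto
      moreover have "((\<mu> * \<sigma>) * xi3 s t)\<^sup>2 = \<mu>\<^sup>2 * (xi3 s t)\<^sup>2"
      proof -
        have "\<sigma>\<^sup>2 = 1" by (simp add: \<sigma>_def)
        then show ?thesis by (simp add: power_mult_distrib)
      qed
      ultimately show "exp ((\<mu> * \<sigma>) * xi3 s t) \<le> 1 + (\<mu> * \<sigma>) * xi3 s t + \<mu>\<^sup>2 / 2 * (xi3 s t)\<^sup>2 + \<mu> ^ 3" by simp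
    qed
    also have "\<dots> = 1 + \<mu>\<^sup>2 / 2 * delta3_sq_at t + \<mu> ^ 3"
      using E.bb_integrable[OF bx] E.bb_integrable[OF b2] xi3_mean[OF t(1)] E.prob_space
      by (simp add: delta3_sq_at_eq[OF t(1)])
    also have "\<dots> \<le> 1 + \<mu>\<^sup>2 / 2 * v + \<mu> ^ 3"
      using delta3_sq_upper[OF t(1)] by (simp add: v_def mult_left_mono)
    finally have e: "(\<integral>s. exp ((\<mu> * \<sigma>) * xi3 s t) \<partial>std_exp) \<le> 1 + \<mu>\<^sup>2 / 2 * v + \<mu> ^ 3" .
    have "(\<integral>s. f s * ((\<mu> * \<sigma>) * xi3 s t) \<partial>std_exp) = \<mu> * (\<sigma> * I)"
      unfolding I_def by (simp add: mult.left_commute[of "f _"] mult.assoc)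
    then have "\<mu> * \<bar>I\<bar> \<le> Kl f + \<mu>\<^sup>2 / 2 * v + \<mu> ^ 3" using donsker_varadhan[OF f b] e \<sigma> by simp
    moreover have "\<mu> * (a - 28 * \<kappa>) \<le> \<mu> * (3 * \<bar>I\<bar>)" using I \<mu> by (intro mult_left_mono) auto
    ultimately have "\<mu> * (a - 28 * \<kappa>) / 3 - \<mu>\<^sup>2 / 2 * v - \<mu> ^ 3 \<le> Kl f" by simp
    moreover have "\<mu> * (a - 28 * \<kappa>) / 3 - \<mu>\<^sup>2 / 2 * v - \<mu> ^ 3 = a\<^sup>2 / (18 * v) - C * a ^ 3"
      using v0 by (simp add: \<mu>_def \<kappa>_def C_def power2_eq_square power3_eq_cube field_simps)
    ultimately show False using neg by simp
  qed
  then have "ereal (a\<^sup>2 / (18 * v) - C * a ^ 3) \<le> J a" if "0 < a" "a < a0" for a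
    unfolding J_def using that by (intro INF_greatest) auto
  then show ?thesis using a0 unfolding v_def by blast
qed

text \<open>The difference of the two sides has derivative \<open>y ^ 3 / (1 + y)\<close> and hence its
  minimum at 0; in particular the bound holds on both sides of 0.\<close>

lemma ln_cubic_upper: fixes x :: real assumes "- 1 < x" shows "ln (1 + x) \<le> x - x\<^sup>2 / 2 + x ^ 3 / 3"
proof -
  define g where "g x = x - x\<^sup>2 / 2 + x ^ 3 / 3 - ln (1 + x)" for x :: real
  have d: "(g has_real_derivative (y ^ 3 / (1 + y))) (at y)" if "- 1 < y" for y
  proof -
    have p: "1 + y > 0" using that by linarith
    have "(g has_real_derivative (1 - y + y\<^sup>2 - 1 / (1 + y))) (at y)"
      unfolding g_def[abs_def] using p by (auto intro!: derivative_eq_intros simp: power2_eq_square)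
    moreover have "1 - y + y\<^sup>2 - 1 / (1 + y) = y ^ 3 / (1 + y)" using p by (simp add: field_simps power2_eq_square power3_eq_cube)
    ultimately show ?thesis by simp
  qed
  have "g 0 \<le> g x"
  proof (cases "0 \<le> x")
    case True
    show ?thesis
    proof (rule DERIV_nonneg_imp_nondecreasing[OF True])
      fix y assume "0 \<le> y" "y \<le> x"
      then show "\<exists>d. (g has_real_derivative d) (at y) \<and> 0 \<le> d" using assms by (intro exI[of _ "y ^ 3 / (1 + y)"] conjI d) auto
    qed
  next
    case False
    then have "x \<le> 0" by simp
    then show ?thesis
    proof (rule DERIV_nonpos_imp_nonincreasing)
      fix y assume y: "x \<le> y" "y \<le> 0"
      have "y ^ 3 \<le> 0" using y by (simp add: power_le_zero_eq)
      then have "y ^ 3 / (1 + y) \<le> 0" using y assms by (intro divide_nonpos_nonneg) auto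
      then show "\<exists>d. (g has_real_derivative d) (at y) \<and> d \<le> 0" using y assms by (intro exI[of _ "y ^ 3 / (1 + y)"] conjI d) auto
    qed
  qed
  then show ?thesis by (simp add: g_def)
qed

lemma entropy_pointwise: fixes x :: real assumes "\<bar>x\<bar> \<le> 1 / 2" shows "(1 + x) * ln (1 + x) \<le> x + x\<^sup>2 / 2 + \<bar>x\<bar> ^ 3"
proof -
  have "(1 + x) * ln (1 + x) \<le> (1 + x) * (x - x\<^sup>2 / 2 + x ^ 3 / 3)"
    using ln_cubic_upper[of x] assms by (intro mult_left_mono) auto
  also have "\<dots> = x + x\<^sup>2 / 2 + (- (x ^ 3) / 6 + x ^ 4 / 3)"
    by (simp add: power2_eq_square power3_eq_cube power4_eq_xxxx field_simps)
  also have "- (x ^ 3) / 6 + x ^ 4 / 3 \<le> \<bar>x\<bar> ^ 3"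
  proof -
    have "x ^ 4 = \<bar>x\<bar> * \<bar>x\<bar> ^ 3" by (simp add: power_abs[symmetric] power4_eq_xxxx power3_eq_cube abs_mult[symmetric])
    also have "\<dots> \<le> (1 / 2) * \<bar>x\<bar> ^ 3" using assms by (intro mult_right_mono) auto
    finally have "x ^ 4 \<le> \<bar>x\<bar> ^ 3 / 2" by simp
    moreover have "- (x ^ 3) \<le> \<bar>x\<bar> ^ 3" by (simp add: power_abs[symmetric])
    moreover have "0 \<le> \<bar>x\<bar> ^ 3" by simp
    ultimately show ?thesis by linarith
  qed
  finally show ?thesis by simp
qed

text \<open>The density \<open>1 + c \<xi>\<close> attains the bound to first order. The term \<open>\<eta>
  a\<^sup>2\<close> in \<open>c\<close> compensates the quadratic remainder of
  \<open>Tf_expansion\<close>.\<close>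

lemma rate_upper:
  assumes t: "0 \<le> t" and v: "0 < delta3_sq_at t"
  shows "\<exists>C a0. 0 < a0 \<and> (\<forall>a. 0 < a \<and> a < a0 \<longrightarrow> J a \<le> ereal (a\<^sup>2 / (18 * delta3_sq_at t) + C * a ^ 3))"
proof -
  define v where "v = delta3_sq_at t"
  have v0: "0 < v" using v by (simp add: v_def)
  define \<eta> where "\<eta> = 4 / v\<^sup>2"
  have \<eta>0: "0 < \<eta>" using v0 by (simp add: \<eta>_def)
  define C where "C = 3 * \<eta> / (18 * v) + 8 / (27 * v ^ 3)"
  define a0 where "a0 = min (1 / \<eta>) (3 * v / 4)"
  have a0: "0 < a0" using v0 \<eta>0 by (simp add: a0_def)
  note bx = bb_xi3[OF t]
  have b2: "bb (\<lambda>s. (xi3 s t)\<^sup>2)" using bb_mult[OF bx bx] by (simp add: power2_eq_square)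
  have "J a \<le> ereal (a\<^sup>2 / (18 * v) + C * a ^ 3)" if a: "0 < a" "a < a0" for a
  proof -
    have a1: "\<eta> * a \<le> 1" "a \<le> 3 * v / 4" using a \<eta>0 by (auto simp: a0_def field_simps)
    define c where "c = a / (3 * v) * (1 + \<eta> * a)"
    have c0: "0 < c" using a v0 \<eta>0 by (simp add: c_def add_pos_pos)
    have c2: "c \<le> 2 * a / (3 * v)"
    proof -
      have "a / (3 * v) * (1 + \<eta> * a) \<le> a / (3 * v) * 2" using a1 a v0 by (intro mult_left_mono) auto
      then show ?thesis by (simp add: c_def)
    qed
    have c12: "c \<le> 1 / 2"
    proof -
      have "2 * a / (3 * v) \<le> 1 / 2" using a1 v0 by (simp add: field_simps)
      then show ?thesis using c2 by linarith
    qed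
    define f where "f s = 1 + c * xi3 s t" for s
    have cx: "\<bar>c * xi3 s t\<bar> \<le> c" for s
    proof -
      have "c * \<bar>xi3 s t\<bar> \<le> c * 1" using xi3_abs[OF t, of s] c0 by (intro mult_left_mono) auto
      then show ?thesis using c0 by (simp add: abs_mult)
    qed
    have f: "DQ f"
    proof -
      have "bb f" unfolding f_def[abs_def] by (rule bb_add[OF bb_const bb_mult[OF bb_const bx]])
      moreover have "0 \<le> f s" for s using cx[of s] c12 unfolding f_def by linarith
      moreover have "(\<integral>s. f s \<partial>std_exp) = 1" unfolding f_def using E.bb_integrable[OF bx] xi3_mean[OF t] E.prob_space by simp
      ultimately show ?thesis by (simp add: DQ_def)
    qed
    have I: "(\<integral>s. f s * xi3 s t \<partial>std_exp) = c * v"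
    proof -
      have "f s * xi3 s t = xi3 s t + c * (xi3 s t)\<^sup>2" for s by (simp add: f_def power2_eq_square algebra_simps)
      then show ?thesis using E.bb_integrable[OF bx] E.bb_integrable[OF b2] xi3_mean[OF t] by (simp add: v_def delta3_sq_at_eq[OF t])
    qed
    have N: "(\<integral>s. \<bar>f s - 1\<bar> \<partial>std_exp)\<^sup>2 \<le> c\<^sup>2"
    proof (rule power_mono)
      have "(\<integral>s. \<bar>f s - 1\<bar> \<partial>std_exp) \<le> (\<integral>s. c \<partial>std_exp)"
        using cx by (intro integral_mono E.bb_integrable bb_abs bb_diff bb_const DQ_D(1)[OF f]) (simp_all add: f_def)
      then show "(\<integral>s. \<bar>f s - 1\<bar> \<partial>std_exp) \<le> c" using E.prob_space by simp
    qed simp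
    have "7 * c\<^sup>2 \<le> 7 * (2 * a / (3 * v))\<^sup>2" using c2 c0 by (intro mult_left_mono power_mono) auto
    also have "\<dots> = 28 / 9 * (a\<^sup>2 / v\<^sup>2)" by (simp add: power2_eq_square)
    also have "\<dots> < 4 * (a\<^sup>2 / v\<^sup>2)"
    proof -
      have "0 < a\<^sup>2 / v\<^sup>2" using a v0 by simp
      then show ?thesis by argo
    qed
    also have "\<dots> = \<eta> * a\<^sup>2" by (simp add: \<eta>_def)
    finally have "7 * c\<^sup>2 < \<eta> * a\<^sup>2" .
    moreover have "3 * (c * v) = a + \<eta> * a\<^sup>2" using v0 by (simp add: c_def field_simps power2_eq_square)
    ultimately have "a < \<bar>Tf (Qd f) t\<bar>" using Tf_expansion[OF f t] N unfolding I by linarith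
    then have "J a \<le> ereal (Kl f)" by (rule J_le[OF f t])
    also have "Kl f \<le> a\<^sup>2 / (18 * v) + C * a ^ 3"
    proof -
      have "Kl f \<le> (\<integral>s. c * xi3 s t + c\<^sup>2 / 2 * (xi3 s t)\<^sup>2 + c ^ 3 \<partial>std_exp)" unfolding Kl_def
      proof (rule integral_mono)
        show "integrable std_exp (\<lambda>s. f s * ln (f s))" by (rule E.bb_integrable[OF bb_mult_ln[OF DQ_D(1,2)[OF f]]])
        show "integrable std_exp (\<lambda>s. c * xi3 s t + c\<^sup>2 / 2 * (xi3 s t)\<^sup>2 + c ^ 3)"
          by (rule E.bb_integrable[OF bb_add[OF bb_add[OF bb_mult[OF bb_const bx] bb_mult[OF bb_const b2]] bb_const]])
        fix s
        have "f s * ln (f s) \<le> c * xi3 s t + (c * xi3 s t)\<^sup>2 / 2 + \<bar>c * xi3 s t\<bar> ^ 3"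
          unfolding f_def using cx[of s] c12 by (intro entropy_pointwise) linarith
        moreover have "\<bar>c * xi3 s t\<bar> ^ 3 \<le> c ^ 3" using cx[of s] by (intro power_mono) auto
        ultimately show "f s * ln (f s) \<le> c * xi3 s t + c\<^sup>2 / 2 * (xi3 s t)\<^sup>2 + c ^ 3" by (simp add: power_mult_distrib)
      qed
      also have "\<dots> = c\<^sup>2 / 2 * v + c ^ 3"
        using E.bb_integrable[OF bx] E.bb_integrable[OF b2] xi3_mean[OF t] E.prob_space by (simp add: v_def delta3_sq_at_eq[OF t])
      also have "c\<^sup>2 / 2 * v \<le> a\<^sup>2 / (18 * v) * (1 + 3 * \<eta> * a)"
      proof -
        have "(1 + \<eta> * a)\<^sup>2 = 1 + 2 * (\<eta> * a) + (\<eta> * a) * (\<eta> * a)" by (simp add: power2_eq_square algebra_simps)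
        also have "(\<eta> * a) * (\<eta> * a) \<le> 1 * (\<eta> * a)" using a1 a \<eta>0 by (intro mult_right_mono) auto
        finally have "(1 + \<eta> * a)\<^sup>2 \<le> 1 + 3 * \<eta> * a" by simp
        moreover have "c\<^sup>2 / 2 * v = a\<^sup>2 / (18 * v) * (1 + \<eta> * a)\<^sup>2"
          using v0 by (simp add: c_def power_mult_distrib power_divide) (simp add: power2_eq_square field_simps)
        ultimately show ?thesis using v0 by (simp add: mult_left_mono divide_right_mono)
      qed
      also have "c ^ 3 \<le> (2 * a / (3 * v)) ^ 3" using c2 c0 by (intro power_mono) auto
      also have "a\<^sup>2 / (18 * v) * (1 + 3 * \<eta> * a) + (2 * a / (3 * v)) ^ 3 = a\<^sup>2 / (18 * v) + C * a ^ 3"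
        using v0 by (simp add: C_def power2_eq_square power3_eq_cube field_simps)
      finally show ?thesis by simp
    qed
    finally show ?thesis by simp
  qed
  then show ?thesis using a0 unfolding v_def by blast
qed

section \<open>Sign certificates for polynomials\<close>

text \<open>The assumptions on \<open>e0, ..., e4\<close> say that the Bernstein coefficients of the
  polynomial on \<open>[0, 1]\<close> are nonnegative.\<close>

lemma quartic_nonneg:
  fixes x :: real
  assumes "0 \<le> x" "x \<le> 1"
    "0 \<le> e0" "0 \<le> 4 * e0 + e1" "0 \<le> 6 * e0 + 3 * e1 + e2" "0 \<le> 4 * e0 + 3 * e1 + 2 * e2 + e3" "0 \<le> e0 + e1 + e2 + e3 + e4"
  shows "0 \<le> e0 + e1 * x + e2 * x\<^sup>2 + e3 * x ^ 3 + e4 * x ^ 4"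
proof -
  have "e0 + e1 * x + e2 * x\<^sup>2 + e3 * x ^ 3 + e4 * x ^ 4 = e0 * (1 - x) ^ 4 + (4 * e0 + e1) * (x * (1 - x) ^ 3)
      + (6 * e0 + 3 * e1 + e2) * (x\<^sup>2 * (1 - x)\<^sup>2) + (4 * e0 + 3 * e1 + 2 * e2 + e3) * (x ^ 3 * (1 - x)) + (e0 + e1 + e2 + e3 + e4) * x ^ 4"
    by (simp add: power2_eq_square power3_eq_cube power4_eq_xxxx algebra_simps)
  also have "0 \<le> \<dots>"
  proof (rule add_nonneg_nonneg[OF add_nonneg_nonneg[OF add_nonneg_nonneg[OF add_nonneg_nonneg]]])
  qed (rule mult_nonneg_nonneg, rule assms, use assms in simp)+
  finally show ?thesis .
qed

text \<open>Integer polynomials as lists of coefficients, lowest degree first, evaluated by Horner's rule.\<close>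

fun pv :: "int list \<Rightarrow> real \<Rightarrow> real" where
  "pv [] x = 0" | "pv (c # cs) x = real_of_int c + x * pv cs x"

fun synth_cons :: "int \<Rightarrow> int \<Rightarrow> int list \<Rightarrow> int list" where
  "synth_cons a c [] = [c]" | "synth_cons a c (r # rs) = (c + a * r) # r # rs"

text \<open>Synthetic division by \<open>x - a\<close>: the head is the value at \<open>a\<close>, the tail
  is the quotient.\<close>

fun synth :: "int \<Rightarrow> int list \<Rightarrow> int list" where
  "synth a [] = []" | "synth a (c # cs) = synth_cons a c (synth a cs)"

text \<open>Horner's rule in interval arithmetic, giving an upper bound of the polynomial on \<open>[A,
  B]\<close>.\<close>

fun pmax :: "int \<Rightarrow> int \<Rightarrow> int list \<Rightarrow> int" where
  "pmax A B [] = 0" | "pmax A B (c # cs) = (let u = pmax A B cs in c + (if 0 \<le> u then B else A) * u)"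

text \<open>The substitution \<open>v = x / D\<close>, cleared of denominators, so that all computations
  stay in the integers.\<close>

fun rescale :: "int \<Rightarrow> int list \<Rightarrow> int list" where
  "rescale D [] = []" | "rescale D (c # cs) = D ^ length cs * c # rescale D cs"

lemma pv_synth: "synth a cs = r # rs \<Longrightarrow> pv cs x = real_of_int r + (x - real_of_int a) * pv rs x"
proof (induction cs arbitrary: r rs)
  case (Cons c cs)
  show ?case
  proof (cases "synth a cs")
    case Nil
    then have "cs = []" by (cases cs; cases "synth a (tl cs)") auto
    then show ?thesis using Cons.prems by auto
  next
    case (Cons r' rs')
    then have "r = c + a * r'" "rs = r' # rs'" using Cons.prems by auto
    then show ?thesis unfolding pv.simps Cons.IH[OF Cons] by (simp add: algebra_simps)
  qed
qed simp

lemma pv_pmax: assumes "0 \<le> A" "real_of_int A \<le> x" "x \<le> real_of_int B" shows "pv cs x \<le> real_of_int (pmax A B cs)"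
proof (induction cs)
  case (Cons c cs)
  have "x * pv cs x \<le> x * real_of_int (pmax A B cs)" using Cons.IH assms by (intro mult_left_mono) auto
  also have "\<dots> \<le> real_of_int ((if 0 \<le> pmax A B cs then B else A) * pmax A B cs)"
  proof (cases "0 \<le> pmax A B cs")
    case True
    then show ?thesis using mult_right_mono[OF assms(3), of "real_of_int (pmax A B cs)"] by simp
  next
    case False
    then show ?thesis using mult_right_mono_neg[OF assms(2), of "real_of_int (pmax A B cs)"] by simp
  qed
  finally show ?case by (simp add: Let_def)
qed simp

lemma pv_rescale: "real_of_int D * pv (rescale D cs) (real_of_int D * v) = real_of_int D ^ length cs * pv cs v"
proof (induction cs)
  case (Cons c cs)
  have "real_of_int D * pv (rescale D (c # cs)) (real_of_int D * v) =
      real_of_int D * real_of_int D ^ length cs * real_of_int c + real_of_int D * v * (real_of_int D * pv (rescale D cs) (real_of_int D * v))"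
    by (simp add: algebra_simps)
  then show ?case unfolding Cons.IH by (simp add: algebra_simps)
qed simp

text \<open>Four synthetic divisions expand the polynomial at \<open>A\<close>; the remaining quotient is
  replaced by its upper bound on the interval, and the resulting quartic is treated by
  \<open>quartic_nonneg\<close>. The premises are ordered such that they can be evaluated one
  after the other.\<close>

lemma pv_nonpos:
  assumes p: "rescale D cs = p" and D: "0 < D" and AB: "0 \<le> A" "A < B" and v: "real_of_int A \<le> real_of_int D * v" "real_of_int D * v \<le> real_of_int B"
    and s: "synth A p = t0 # p1" "synth A p1 = t1 # p2" "synth A p2 = t2 # p3" "synth A p3 = t3 # p4" "pmax A B p4 = t4"
    and G: "B - A = G" "t1 * G = e1" "t2 * G ^ 2 = e2" "t3 * G ^ 3 = e3" "t4 * G ^ 4 = e4"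
    and c: "t0 \<le> 0" "4 * t0 + e1 \<le> 0" "6 * t0 + 3 * e1 + e2 \<le> 0" "4 * t0 + 3 * e1 + 2 * e2 + e3 \<le> 0" "t0 + e1 + e2 + e3 + e4 \<le> 0"
  shows "pv cs v \<le> 0"
proof -
  define X where "X = real_of_int D * v"
  define g where "g = real_of_int G"
  define x where "x = (X - real_of_int A) / g"
  have g0: "0 < g" using AB G(1) by (simp add: g_def)
  have X: "X - real_of_int A = x * g" using g0 by (simp add: x_def)
  have x01: "0 \<le> x" "x \<le> 1" using v g0 G(1) unfolding x_def X_def[symmetric] g_def by auto
  have "pv p X = real_of_int t0 + (x * g) * (real_of_int t1 + (x * g) * (real_of_int t2 + (x * g) * (real_of_int t3 + (x * g) * pv p4 X)))"
    unfolding pv_synth[OF s(1), of X] pv_synth[OF s(2), of X] pv_synth[OF s(3), of X] pv_synth[OF s(4), of X] X ..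
  also have "\<dots> = real_of_int t0 + real_of_int t1 * g * x + real_of_int t2 * g\<^sup>2 * x\<^sup>2 + real_of_int t3 * g ^ 3 * x ^ 3 + pv p4 X * (g ^ 4 * x ^ 4)"
    by (simp add: power2_eq_square power3_eq_cube power4_eq_xxxx algebra_simps)
  also have "\<dots> \<le> real_of_int t0 + real_of_int t1 * g * x + real_of_int t2 * g\<^sup>2 * x\<^sup>2 + real_of_int t3 * g ^ 3 * x ^ 3 + real_of_int t4 * (g ^ 4 * x ^ 4)"
    using pv_pmax[OF AB(1), of X B p4] v g0 x01 unfolding s(5) X_def[symmetric] by (intro add_left_mono mult_right_mono) auto
  also have "\<dots> = - (- real_of_int t0 + (- real_of_int e1) * x + (- real_of_int e2) * x\<^sup>2 + (- real_of_int e3) * x ^ 3 + (- real_of_int e4) * x ^ 4)"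
    unfolding G(2-5)[symmetric] g_def by (simp add: algebra_simps)
  also have "\<dots> \<le> 0"
  proof -
    have "real_of_int t0 \<le> 0" "real_of_int (4 * t0 + e1) \<le> 0" "real_of_int (6 * t0 + 3 * e1 + e2) \<le> 0"
      "real_of_int (4 * t0 + 3 * e1 + 2 * e2 + e3) \<le> 0" "real_of_int (t0 + e1 + e2 + e3 + e4) \<le> 0"
      using c by (simp_all only: of_int_le_0_iff)
    then show ?thesis using quartic_nonneg[OF x01, of "- real_of_int t0" "- real_of_int e1" "- real_of_int e2" "- real_of_int e3" "- real_of_int e4"] by simp
  qed
  finally have "pv p X \<le> 0" .
  then have "real_of_int D * pv p X \<le> 0" using D by (simp add: mult_nonneg_nonpos)
  then have "real_of_int D ^ length cs * pv cs v \<le> 0" unfolding p[symmetric] X_def pv_rescale .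
  moreover have "0 < real_of_int D ^ length cs" using D by simp
  ultimately show ?thesis by (simp add: mult_le_0_iff)
qed

text \<open>The bound of \<open>pv_small\<close> below, scaled to integer coefficients, minus the scaled
  value \<open>17651 / 787500\<close> to be proved as an upper bound of the variance.\<close>

definition poly_small :: "int list" where
  "poly_small = [-282416, 0, 0, 0, 0, 0, 6720000, 0, 0, -6444375, -40893750, 85050000, -58950000, 0, -31500000, 29745000, 103050000, -226800000, 213200000, 0, -50400000, -8400000, -25200000, 0, -10740000, 0, 25200000, -8400000, 0, 0, 6780000, 0, 0, 0, 0, 0, -2095000]"

text \<open>The maximum of the variance is close to \<open>v = 0.7263\<close>, that is, \<open>128 v =
  92.97\<close>; this is why the intervals shrink there.\<close>

lemma poly_small_0: "0 \<le> 128 * v \<Longrightarrow> 128 * v \<le> 75 \<Longrightarrow> pv poly_small v \<le> 0"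
  unfolding poly_small_def
  by (rule pv_nonpos[where A = 0 and B = 75 and D = 128], (simp del: list.inject)+)

lemma poly_small_1: "75 \<le> 128 * v \<Longrightarrow> 128 * v \<le> 91 \<Longrightarrow> pv poly_small v \<le> 0"
  unfolding poly_small_def
  by (rule pv_nonpos[where A = 75 and B = 91 and D = 128], (simp del: list.inject)+)

lemma poly_small_2: "91 \<le> 128 * v \<Longrightarrow> 128 * v \<le> 93 \<Longrightarrow> pv poly_small v \<le> 0"
  unfolding poly_small_def
  by (rule pv_nonpos[where A = 91 and B = 93 and D = 128], (simp del: list.inject)+)

lemma poly_small_3: "93 \<le> 128 * v \<Longrightarrow> 128 * v \<le> 109 \<Longrightarrow> pv poly_small v \<le> 0"
  unfolding poly_small_def
  by (rule pv_nonpos[where A = 93 and B = 109 and D = 128], (simp del: list.inject)+)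

text \<open>The same for \<open>pv_large\<close>.\<close>

definition poly_large :: "int list" where
  "poly_large = [-282416, 0, 0, 0, 0, 0, 6720000, 0, 0, -11760000, -9000000, 0, 56175000, -75600000, -12600000, 43920000, 18000000, 0, -93800000, 201600000, -100800000, -8400000, -25200000, 0, -10740000, 0, 25200000, -8400000, 0, 0, 6780000, 0, 0, 0, 0, 0, -2095000]"

lemma poly_large_0: "108 \<le> 128 * v \<Longrightarrow> 128 * v \<le> 128 \<Longrightarrow> pv poly_large v \<le> 0"
  unfolding poly_large_def
  by (rule pv_nonpos[where A = 108 and B = 128 and D = 128], (simp del: list.inject)+)

section \<open>A closed form of the variance\<close>

text \<open>The function \<open>\<xi>\<close> as a sum of terms \<open>k v^p 1{s < c t} exp(b s /
  6)\<close>, listed as \<open>(c, k, p, b)\<close> with \<open>v = exp(-t/6)\<close>.\<close>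

definition xi_terms :: "(nat \<times> real \<times> nat \<times> nat) list" where
  "xi_terms = [(1, 2 / 3, 0, 0), (1, - 2, 6, 0), (1, 1, 12, 0), (1, 1, 12, 12), (1, - 2 / 3, 18, 18),
     (2, - 1 / 3, 0, 0), (2, 1 / 2, 6, 3), (2, - 1 / 6, 18, 9), (3, - 1 / 3, 0, 0), (3, 2 / 3, 6, 2), (3, - 1 / 3, 12, 4)]"

fun tval :: "real \<Rightarrow> nat \<times> real \<times> nat \<times> nat \<Rightarrow> real \<Rightarrow> real" where
  "tval t (c, k, p, b) s = k * exp (- (real p * t / 6)) * (of_bool (s < real c * t) * exp (real b / 6 * s))"

text \<open>The inner product of two such terms under \<open>E\<close>. The case \<open>b + b' = 6\<close>,
  in which the exponentials cancel the density, is the source of the factor \<open>t\<close>. The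
  exponent in the other case is a natural number because \<open>b c \<le> p\<close> for all terms.\<close>

fun gram :: "real \<Rightarrow> real \<Rightarrow> nat \<times> real \<times> nat \<times> nat \<Rightarrow> nat \<times> real \<times> nat \<times> nat \<Rightarrow> real" where
  "gram t v (c, k, p, b) (c', k', p', b') = (let d = min c c' in
     if b + b' = 6 then k * k' * (real d * (t * v ^ (p + p')))
     else k * k' * 6 / (real b + real b' - 6) * (v ^ (p + p' + 6 * d - (b + b') * d) - v ^ (p + p')))"

lemma xi3_terms: "xi3 s t = (\<Sum>x\<leftarrow>xi_terms. tval t x s)"
proof -
  have e: "exp (- (2 * (t - s))) = exp (- (2 * t)) * exp (2 * s)" "exp (- (3 * (t - s))) = exp (- (3 * t)) * exp (3 * s)"
    "exp (- (t - s / 2)) = exp (- t) * exp (s / 2)" "exp (- (3 * (t - s / 2))) = exp (- (3 * t)) * exp (3 / 2 * s)"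
    "exp (- (t - s / 3)) = exp (- t) * exp (s / 3)" "exp (- (2 * (t - s / 3))) = exp (- (2 * t)) * exp (2 / 3 * s)"
    "(1 - exp (- t))\<^sup>2 = 1 - 2 * exp (- t) + exp (- (2 * t))"
    unfolding exp_add[symmetric] by (simp_all add: algebra_simps power2_eq_square exp_add[symmetric])
  show ?thesis unfolding xi3_def F_exp_def e xi_terms_def by (simp add: field_simps)
qed

lemma tval_gram:
  assumes t: "0 \<le> t" and w: "b * c \<le> p" "b' * c' \<le> p'"
  shows "(\<integral>s. tval t (c, k, p, b) s * tval t (c', k', p', b') s \<partial>std_exp) = gram t (exp (- t / 6)) (c, k, p, b) (c', k', p', b')"
    and "integrable std_exp (\<lambda>s. tval t (c, k, p, b) s * tval t (c', k', p', b') s)"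
proof -
  define d where "d = min c c'"
  define \<beta> where "\<beta> = (real b + real b') / 6"
  have dt: "of_bool (s < real c * t) * of_bool (s < real c' * t) = (of_bool (s < real d * t) :: real)" for s
  proof -
    have "real d * t = min (real c * t) (real c' * t)" using t by (simp add: d_def min_mult_distrib_right of_nat_min)
    then show ?thesis by simp
  qed
  have vp: "exp (- t / 6) ^ n = exp (- (real n * t / 6))" for n by (simp add: exp_of_nat_mult[symmetric])
  have eq: "tval t (c, k, p, b) s * tval t (c', k', p', b') s = k * k' * exp (- t / 6) ^ (p + p') * (of_bool (s < real d * t) * exp (\<beta> * s))" for s
  proof -
    have "exp (\<beta> * s) = exp (real b / 6 * s) * exp (real b' / 6 * s)" unfolding exp_add[symmetric] by (simp add: \<beta>_def field_simps)
    then show ?thesis unfolding dt[symmetric] tval.simps power_add vp by (simp only: ac_simps)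
  qed
  show "integrable std_exp (\<lambda>s. tval t (c, k, p, b) s * tval t (c', k', p', b') s)" unfolding eq by (intro integrable_mult_right std_exp_integrable_exp)
  have "d * b \<le> p" "d * b' \<le> p'" using order_trans[OF mult_le_mono2[of d c b] w(1)] order_trans[OF mult_le_mono2[of d c' b'] w(2)] by (simp_all add: d_def mult.commute)
  then have le: "(b + b') * d \<le> p + p' + 6 * d" by (simp add: algebra_simps)
  have dt0: "0 \<le> real d * t" using t by simp
  show "(\<integral>s. tval t (c, k, p, b) s * tval t (c', k', p', b') s \<partial>std_exp) = gram t (exp (- t / 6)) (c, k, p, b) (c', k', p', b')"
  proof (cases "b + b' = 6")
    case True
    then have "\<beta> = 1" unfolding \<beta>_def of_nat_add[symmetric] by simp
    then show ?thesis unfolding eq integral_mult_right_zero using True std_exp_integral_exp(2)[OF dt0, of \<beta>] by (simp add: d_def[symmetric] Let_def)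
  next
    case False
    then have "real (b + b') \<noteq> 6" by (metis of_nat_eq_iff of_nat_numeral)
    then have b6: "real b + real b' - 6 \<noteq> 0" by simp
    then have b1: "\<beta> \<noteq> 1" by (simp add: \<beta>_def field_simps)
    have "exp (- t / 6) ^ (p + p') * exp ((\<beta> - 1) * (real d * t)) = exp (- t / 6) ^ (p + p' + 6 * d - (b + b') * d)"
      unfolding vp exp_add[symmetric] using le by (simp add: of_nat_diff \<beta>_def field_simps)
    moreover have "1 / (\<beta> - 1) = 6 / (real b + real b' - 6)" using b6 b1 by (simp add: \<beta>_def field_simps)
    moreover have "(\<integral>s. tval t (c, k, p, b) s * tval t (c', k', p', b') s \<partial>std_exp) =
        k * k' * (exp (- t / 6) ^ (p + p') * exp ((\<beta> - 1) * (real d * t)) - exp (- t / 6) ^ (p + p')) * (1 / (\<beta> - 1))"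
      unfolding eq integral_mult_right_zero std_exp_integral_exp(1)[OF dt0 b1] by (simp add: right_diff_distrib diff_divide_distrib)
    ultimately show ?thesis using False by (simp add: d_def[symmetric] Let_def)
  qed
qed

lemma integral_sum_list:
  fixes f :: "'b \<Rightarrow> real \<Rightarrow> real"
  assumes "\<And>x. x \<in> set L \<Longrightarrow> integrable M (f x)"
  shows "integrable M (\<lambda>s. \<Sum>x\<leftarrow>L. f x s)" "(\<integral>s. (\<Sum>x\<leftarrow>L. f x s) \<partial>M) = (\<Sum>x\<leftarrow>L. \<integral>s. f x s \<partial>M)"
  using assms by (induction L) auto

lemma delta3_sq_at_gram:
  assumes t: "0 \<le> t"
  shows "delta3_sq_at t = (\<Sum>x\<leftarrow>xi_terms. \<Sum>y\<leftarrow>xi_terms. gram t (exp (- t / 6)) y x)"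
proof -
  have wf: "b * c \<le> p" if "(c, k, p, b) \<in> set xi_terms" for c k p b using that by (auto simp: xi_terms_def)
  have i: "integrable std_exp (\<lambda>s. tval t x s * tval t y s)" "(\<integral>s. tval t x s * tval t y s \<partial>std_exp) = gram t (exp (- t / 6)) x y"
    if xy: "x \<in> set xi_terms" "y \<in> set xi_terms" for x y
  proof -
    obtain c k p b c' k' p' b' where e: "x = (c, k, p, b)" "y = (c', k', p', b')" by (cases x, cases y) auto
    note g = tval_gram[OF t wf[OF xy(1)[unfolded e]] wf[OF xy(2)[unfolded e]], of k k']
    show "integrable std_exp (\<lambda>s. tval t x s * tval t y s)" unfolding e by (rule g(2))
    show "(\<integral>s. tval t x s * tval t y s \<partial>std_exp) = gram t (exp (- t / 6)) x y" unfolding e by (rule g(1))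
  qed
  have "(xi3 s t)\<^sup>2 = (\<Sum>x\<leftarrow>xi_terms. \<Sum>y\<leftarrow>xi_terms. tval t y s * tval t x s)" for s
    unfolding xi3_terms power2_eq_square sum_list_mult_const[symmetric] sum_list_const_mult[symmetric] ..
  then have "delta3_sq_at t = (\<Sum>x\<leftarrow>xi_terms. \<Sum>y\<leftarrow>xi_terms. \<integral>s. tval t y s * tval t x s \<partial>std_exp)"
    unfolding delta3_sq_at_eq[OF t] by (simp add: integral_sum_list i cong: map_cong)
  also have "\<dots> = (\<Sum>x\<leftarrow>xi_terms. \<Sum>y\<leftarrow>xi_terms. gram t (exp (- t / 6)) y x)"
    by (simp add: i cong: map_cong)
  finally show ?thesis .
qed

lemma gram_sum:
  "(\<Sum>x\<leftarrow>xi_terms. \<Sum>y\<leftarrow>xi_terms. gram t v y x) =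
    8 / 15 * v ^ 6 - 14 / 15 * v ^ 9 - 5 / 7 * v ^ 10 - 1 / 24 * v ^ 12 - 5 / 2 * v ^ 14 + 122 / 35 * v ^ 15 + 10 / 7 * v ^ 16
    + 41 / 9 * v ^ 18 - 4 * v ^ 20 - 2 / 3 * v ^ 21 - 2 * v ^ 22 - 179 / 210 * v ^ 24 + 2 * v ^ 26 - 2 / 3 * v ^ 27
    + 113 / 210 * v ^ 30 - 419 / 2520 * v ^ 36 + t * (v ^ 12 / 2 - 4 / 3 * v ^ 18)"
  apply (simp add: xi_terms_def Let_def min_def)
  by argo

section \<open>The numerical value of the supremum\<close>

text \<open>The part of the variance without the factor \<open>t\<close>.\<close>

definition vpoly :: "real \<Rightarrow> real" where
  "vpoly v = 8 / 15 * v ^ 6 - 14 / 15 * v ^ 9 - 5 / 7 * v ^ 10 - 1 / 24 * v ^ 12 - 5 / 2 * v ^ 14 + 122 / 35 * v ^ 15 + 10 / 7 * v ^ 16 + 41 / 9 * v ^ 18 - 4 * v ^ 20 - 2 / 3 * v ^ 21 - 2 * v ^ 22 - 179 / 210 * v ^ 24 + 2 * v ^ 26 - 2 / 3 * v ^ 27 + 113 / 210 * v ^ 30 - 419 / 2520 * v ^ 36"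

lemma delta3_sq_at_vpoly:
  assumes t: "0 \<le> t" and v: "v = exp (- t / 6)"
  shows "delta3_sq_at t = vpoly v + t * (v ^ 12 / 2 - 4 / 3 * v ^ 18)"
  unfolding delta3_sq_at_gram[OF t] v gram_sum vpoly_def ..

text \<open>The exponents are integers so that the simplifier keeps them as numerals.\<close>

fun monomials :: "int \<Rightarrow> int list \<Rightarrow> real \<Rightarrow> real" where
  "monomials k [] v = 0" | "monomials k (c # cs) v = real_of_int c * v ^ nat k + monomials (k + 1) cs v"

lemma pv_monomials: "pv cs v = monomials 0 cs v"
proof -
  have "v ^ nat k * pv cs v = monomials k cs v" if "0 \<le> k" for k
    using that
  proof (induction cs arbitrary: k)
    case (Cons c cs)
    have "v ^ nat (k + 1) = v ^ nat k * v" using Cons.prems by (simp add: nat_add_distrib)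
    then show ?case using Cons.IH[of "k + 1"] Cons.prems by (simp add: algebra_simps)
  qed simp
  from this[of 0] show ?thesis by simp
qed

text \<open>For \<open>v ^ 6 \<le> 3/8\<close> the factor of \<open>t\<close> is nonnegative and an upper
  bound of \<open>t\<close> is needed. With \<open>y = 3 / (4 v) - 1\<close> it is \<open>145/84 +
  6 (y - y\<^sup>2/2 + y^3/3)\<close>, expanded at \<open>v = 3/4\<close> in powers of
  \<open>1/v\<close>; multiplying by \<open>v ^ 3\<close> gives the cubic polynomial below.\<close>

lemma pv_small:
  "pv poly_small v = 12600000 * (vpoly v + ((145 / 84 - 11) * v ^ 3 + 27 / 2 * v\<^sup>2 - 81 / 16 * v + 27 / 32) * (v ^ 9 / 2 - 4 / 3 * v ^ 15)) - 282416"
proof -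
  have e: "((145 / 84 - 11) * v ^ 3 + 27 / 2 * v\<^sup>2 - 81 / 16 * v + 27 / 32) * (v ^ 9 / 2 - 4 / 3 * v ^ 15) =
    (145 / 84 - 11) / 2 * v ^ 12 + 27 / 4 * v ^ 11 - 81 / 32 * v ^ 10 + 27 / 64 * v ^ 9
    - (145 / 84 - 11) * 4 / 3 * v ^ 18 - 18 * v ^ 17 + 27 / 4 * v ^ 16 - 9 / 8 * v ^ 15"
  proof -
    have p: "v ^ 12 = v ^ 3 * v ^ 9" "v ^ 11 = v\<^sup>2 * v ^ 9" "v ^ 10 = v * v ^ 9" "v ^ 18 = v ^ 3 * v ^ 15" "v ^ 17 = v\<^sup>2 * v ^ 15" "v ^ 16 = v * v ^ 15"
      by (simp_all add: power_add[symmetric] power_Suc[symmetric])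
    show ?thesis unfolding p by (simp add: field_simps)
  qed
  show ?thesis unfolding e pv_monomials vpoly_def by (simp add: poly_small_def)
qed

text \<open>For \<open>v ^ 6 > 3/8\<close> the factor of \<open>t\<close> is negative, and the lower bound
  \<open>6 (1 - v) + 3 (1 - v)\<^sup>2\<close> of \<open>t\<close> is used.\<close>

lemma pv_large:
  "pv poly_large v = 12600000 * (vpoly v + (9 - 12 * v + 3 * v\<^sup>2) * (v ^ 12 / 2 - 4 / 3 * v ^ 18)) - 282416"
proof -
  have e: "(9 - 12 * v + 3 * v\<^sup>2) * (v ^ 12 / 2 - 4 / 3 * v ^ 18) =
    9 / 2 * v ^ 12 - 6 * v ^ 13 + 3 / 2 * v ^ 14 - 12 * v ^ 18 + 16 * v ^ 19 - 4 * v ^ 20"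
  proof -
    have p: "v ^ 13 = v * v ^ 12" "v ^ 14 = v\<^sup>2 * v ^ 12" "v ^ 19 = v * v ^ 18" "v ^ 20 = v\<^sup>2 * v ^ 18"
      by (simp_all add: power_add[symmetric] power_Suc[symmetric])
    show ?thesis unfolding p by (simp add: field_simps)
  qed
  show ?thesis unfolding e pv_monomials vpoly_def by (simp add: poly_large_def)
qed

lemma delta3_sq_at_le: assumes t: "0 \<le> t" shows "delta3_sq_at t \<le> 17651 / 787500"
proof -
  define v where "v = exp (- t / 6)"
  have v0: "0 < v" and v1: "v \<le> 1" using t by (auto simp: v_def)
  have tv: "t = - 6 * ln v" by (simp add: v_def)
  note d = delta3_sq_at_vpoly[OF t v_def]
  have R: "v ^ 12 / 2 - 4 / 3 * v ^ 18 = v ^ 12 * (1 / 2 - 4 / 3 * v ^ 6)" by (simp add: algebra_simps power_add[symmetric])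
  show ?thesis
  proof (cases "v ^ 6 \<le> 3 / 8")
    case True
    have v128: "128 * v \<le> 109"
    proof (rule ccontr)
      assume "\<not> 128 * v \<le> 109"
      then have "(109 / 128) ^ 6 \<le> v ^ 6" by (intro power_mono) auto
      then show False using True by (simp add: power_divide)
    qed
    define y where "y = 3 / (4 * v) - 1"
    have "ln (4 / 3 :: real) \<le> 145 / 504" using ln_bounds4(2)[of "4 / 3" "1 / 7"] by (simp add: power_divide)
    moreover have "ln (3 / (4 * v)) = - ln (4 / 3) - ln v" using v0 by (simp add: ln_div ln_mult)
    moreover have "ln (3 / (4 * v)) \<le> y - y\<^sup>2 / 2 + y ^ 3 / 3" using ln_cubic_upper[of y] v0 by (simp add: y_def)
    ultimately have tb: "t \<le> 145 / 84 + 6 * (y - y\<^sup>2 / 2 + y ^ 3 / 3)" unfolding tv by argo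
    have "t * (v ^ 12 / 2 - 4 / 3 * v ^ 18) \<le> (145 / 84 + 6 * (y - y\<^sup>2 / 2 + y ^ 3 / 3)) * (v ^ 12 / 2 - 4 / 3 * v ^ 18)"
      using tb True v0 unfolding R by (intro mult_right_mono mult_nonneg_nonneg) auto
    also have "\<dots> = ((145 / 84 + 6 * (y - y\<^sup>2 / 2 + y ^ 3 / 3)) * v ^ 3) * (v ^ 9 / 2 - 4 / 3 * v ^ 15)"
    proof -
      have "v ^ 12 / 2 - 4 / 3 * v ^ 18 = v ^ 3 * (v ^ 9 / 2 - 4 / 3 * v ^ 15)" by (simp add: right_diff_distrib power_add[symmetric])
      then show ?thesis by simp
    qed
    also have "(145 / 84 + 6 * (y - y\<^sup>2 / 2 + y ^ 3 / 3)) * v ^ 3 = (145 / 84 - 11) * v ^ 3 + 27 / 2 * v\<^sup>2 - 81 / 16 * v + 27 / 32"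
    proof -
      define u where "u = y * v"
      have u: "u = 3 / 4 - v" using v0 by (simp add: u_def y_def field_simps)
      have "(145 / 84 + 6 * (y - y\<^sup>2 / 2 + y ^ 3 / 3)) * v ^ 3 = 145 / 84 * v ^ 3 + 6 * (u * v\<^sup>2 - u\<^sup>2 * v / 2 + u ^ 3 / 3)"
        by (simp add: u_def power2_eq_square power3_eq_cube field_simps)
      then show ?thesis unfolding u by (simp add: power2_eq_square power3_eq_cube field_simps)
    qed
    finally have le: "12600000 * delta3_sq_at t - 282416 \<le> pv poly_small v" unfolding d pv_small by argo
    have "128 * v \<le> 75 \<or> (75 \<le> 128 * v \<and> 128 * v \<le> 91) \<or> (91 \<le> 128 * v \<and> 128 * v \<le> 93) \<or> 93 \<le> 128 * v" by linarith
    then have "pv poly_small v \<le> 0" using v0 v128 poly_small_0[of v] poly_small_1[of v] poly_small_2[of v] poly_small_3[of v] by auto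
    then show ?thesis using le by argo
  next
    case False
    have v128: "108 \<le> 128 * v"
    proof (rule ccontr)
      assume "\<not> 108 \<le> 128 * v"
      then have "v ^ 6 \<le> (108 / 128) ^ 6" using v0 by (intro power_mono) auto
      then show False using False by (simp add: power_divide)
    qed
    have "ln v \<le> (v - 1) - (v - 1)\<^sup>2 / 2 + (v - 1) ^ 3 / 3" using v0 ln_cubic_upper[of "v - 1"] by simp
    moreover have "(v - 1) ^ 3 \<le> 0" using v1 by (simp add: power_le_zero_eq)
    ultimately have "6 * (1 - v) + 3 * (v - 1)\<^sup>2 \<le> t" unfolding tv by argo
    then have tb: "9 - 12 * v + 3 * v\<^sup>2 \<le> t" by (simp add: power2_eq_square algebra_simps)
    have "v ^ 12 * (1 / 2 - 4 / 3 * v ^ 6) \<le> 0" using False v0 by (intro mult_nonneg_nonpos) auto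
    then have "t * (v ^ 12 / 2 - 4 / 3 * v ^ 18) \<le> (9 - 12 * v + 3 * v\<^sup>2) * (v ^ 12 / 2 - 4 / 3 * v ^ 18)"
      using tb unfolding R by (intro mult_right_mono_neg)
    then have le: "12600000 * delta3_sq_at t - 282416 \<le> pv poly_large v" unfolding d pv_large by argo
    have "pv poly_large v \<le> 0" using v1 v128 by (intro poly_large_0) auto
    then show ?thesis using le by argo
  qed
qed

text \<open>The variance at \<open>t\<close>, scaled to integer coefficients, with \<open>t\<close> replaced
  by a lower bound at \<open>v = 93/128\<close>, minus the scaled value \<open>56463 /
  2520000\<close>.\<close>

definition poly_low :: "int list" where
  "poly_low = [-56463000, 0, 0, 0, 0, 0, 1344000000, 0, 0, -2352000000, -1800000000, 0, 2309895840, 0, -6300000000, 8784000000, 3600000000, 0, 5040277760, 0, -10080000000, -1680000000, -5040000000, 0, -2148000000, 0, 5040000000, -1680000000, 0, 0, 1356000000, 0, 0, 0, 0, 0, -419000000]"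

lemma poly_low_pos: "0 \<le> pv poly_low (93 / 128)"
proof -
  have *: "0 \<le> pv cs (93 / 128)" if "rescale 128 cs = p" "synth 93 p = r # rs" "0 \<le> r" for cs p r rs
  proof -
    have "0 \<le> real_of_int 128 * pv p (real_of_int 128 * (93 / 128))" using that(3) pv_synth[OF that(2), of 93] by simp
    moreover have "0 < real_of_int 128 ^ length cs" by simp
    ultimately show ?thesis unfolding that(1)[symmetric] pv_rescale using zero_le_mult_iff not_le by blast
  qed
  show ?thesis unfolding poly_low_def by (rule *, (simp del: list.inject)+)
qed

text \<open>The point \<open>v = 93/128\<close> is so close to the maximum that this bound misses the
  supremum by less than \<open>3 * 10^(-7)\<close>.\<close>

lemma delta3_sq_at_ge: "56463 / 2520000 \<le> delta3_sq_at (- 6 * ln (93 / 128))"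
proof -
  define t :: real where "t = - 6 * ln (93 / 128)"
  have v: "93 / 128 = exp (- t / 6)" by (simp add: t_def)
  have "ln (128 / 93 :: real) \<ge> 1916584 / 6000000" using ln_bounds4(1)[of "128 / 93" "35 / 221"] by (simp add: power_divide)
  moreover have "ln (128 / 93 :: real) = - ln (93 / 128)" by (simp add: ln_div)
  ultimately have t: "1916584 / 1000000 \<le> t" unfolding t_def by argo
  then have t0: "0 \<le> t" by linarith
  have "(1916584 / 1000000) * ((93 / 128) ^ 12 / 2 - 4 / 3 * (93 / 128) ^ 18) \<le> t * ((93 / 128) ^ 12 / 2 - 4 / 3 * (93 / 128) ^ 18)"
    using t by (intro mult_right_mono) (auto simp: power_divide)
  moreover have "pv poly_low w = 2520000000 * (vpoly w + (1916584 / 1000000) * (w ^ 12 / 2 - 4 / 3 * w ^ 18)) - 56463000" for w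
    unfolding pv_monomials vpoly_def by (simp add: poly_low_def) argo
  then have "0 \<le> 2520000000 * (vpoly (93 / 128) + (1916584 / 1000000) * ((93 / 128) ^ 12 / 2 - 4 / 3 * (93 / 128) ^ 18)) - 56463000"
    using poly_low_pos by metis
  ultimately have "56463 / 2520000 \<le> delta3_sq_at t" unfolding delta3_sq_at_vpoly[OF t0 v] by argo
  then show ?thesis unfolding t_def .
qed

lemma delta3_sq_bounds: "56463 / 2520000 \<le> delta3_sq" "delta3_sq \<le> 17651 / 787500"
proof -
  show "delta3_sq \<le> 17651 / 787500" unfolding delta3_sq_def
  proof (rule cSUP_least)
    show "delta3_sq_at t \<le> 17651 / 787500" if "t \<in> {0..}" for t using that by (intro delta3_sq_at_le) simp
  qed simp
  have "0 \<le> - 6 * ln (93 / 128 :: real)" by simp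
  then show "56463 / 2520000 \<le> delta3_sq" using delta3_sq_upper delta3_sq_at_ge order_trans by blast
qed

lemma delta3_sq_numeric: "0 < delta3_sq" "\<bar>1 / (18 * delta3_sq) - 2.479\<bar> \<le> 0.0005"
proof -
  show p: "0 < delta3_sq" using delta3_sq_bounds by linarith
  have h: "1 / (18 * delta3_sq) \<le> 1 / (18 * (56463 / 2520000))" "1 / (18 * (17651 / 787500)) \<le> 1 / (18 * delta3_sq)"
    using delta3_sq_bounds p by (intro divide_left_mono; simp)+
  have k: "1 / (18 * (56463 / 2520000)) \<le> (24795 / 10000 :: real)" "(24785 / 10000 :: real) \<le> 1 / (18 * (17651 / 787500))" by simp_all
  have "1 / (18 * delta3_sq) \<le> 24795 / 10000" "24785 / 10000 \<le> 1 / (18 * delta3_sq)"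
    by (rule order_trans[OF h(1) k(1)], rule order_trans[OF k(2) h(2)])
  moreover have "\<bar>d - 2.479\<bar> \<le> 0.0005" if "d \<le> 24795 / 10000" "24785 / 10000 \<le> d" for d :: real
  proof -
    have "d - 2.479 \<le> 0.0005" "2.479 - d \<le> 0.0005" using that by simp_all
    then show ?thesis unfolding abs_le_iff by linarith
  qed
  ultimately show "\<bar>1 / (18 * delta3_sq) - 2.479\<bar> \<le> 0.0005" by blast
qed

section \<open>The limit theorem\<close>

text \<open>The statistic is invariant under scaling of the sample, up to a change of \<open>t\<close>.\<close>

lemma D3_scale:
  assumes "0 < c" "n \<ge> 1"
  shows "D3 n x > a \<longleftrightarrow> (\<exists>t\<ge>0. a < \<bar>Tf (emp n (\<lambda>i. c * x i)) t\<bar>)"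
proof -
  have "H3 n (\<lambda>i. c * x i) (c * t) = H3 n x t" for t
    unfolding H3_def using assms(1) by (simp add: max_mult_distrib_left[symmetric])
  moreover have "G3 n (\<lambda>i. c * x i) (c * t) = G3 n x t" for t
  proof -
    have "(c * x i1 / real (\<sigma> 1) + c * x i2 / real (\<sigma> 2) + c * x i3 / real (\<sigma> 3) < c * t) \<longleftrightarrow>
        (x i1 / real (\<sigma> 1) + x i2 / real (\<sigma> 2) + x i3 / real (\<sigma> 3) < t)" for i1 i2 i3 and \<sigma> :: "nat \<Rightarrow> nat"
      using mult_less_cancel_left_pos[OF assms(1), of "x i1 / real (\<sigma> 1) + x i2 / real (\<sigma> 2) + x i3 / real (\<sigma> 3)" t]
      by (simp only: distrib_left times_divide_eq_right)
    then show ?thesis unfolding G3_def by (simp only:)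
  qed
  ultimately have sc: "Tf (emp n (\<lambda>i. c * x i)) (c * t) = Tf (emp n x) t" for t
    unfolding HG_eq[OF assms(2), symmetric] by simp
  show ?thesis unfolding D3_gt_iff[OF assms(2)]
  proof
    assume "\<exists>t\<ge>0. a < \<bar>Tf (emp n x) t\<bar>"
    then obtain t where "0 \<le> t" "a < \<bar>Tf (emp n x) t\<bar>" by blast
    then show "\<exists>t\<ge>0. a < \<bar>Tf (emp n (\<lambda>i. c * x i)) t\<bar>" using assms(1) by (intro exI[of _ "c * t"]) (simp add: sc)
  next
    assume "\<exists>t\<ge>0. a < \<bar>Tf (emp n (\<lambda>i. c * x i)) t\<bar>"
    then obtain t where "0 \<le> t" "a < \<bar>Tf (emp n (\<lambda>i. c * x i)) t\<bar>" by blast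
    then show "\<exists>t\<ge>0. a < \<bar>Tf (emp n x) t\<bar>" using assms(1) sc[of "t / c"] by (intro exI[of _ "t / c"]) simp
  qed
qed

lemma iid_exp_scaled:
  fixes X :: "nat \<Rightarrow> 'a \<Rightarrow> real"
  assumes M: "prob_space M" and lam: "0 < lam" and ind: "prob_space.indep_vars M (\<lambda>_. borel) X {1..}"
    and X: "\<And>i. i \<ge> 1 \<Longrightarrow> distributed M lborel (X i) (exponential_density lam)"
  shows "iid_exp M (\<lambda>i \<omega>. lam * X i \<omega>)"
proof -
  interpret prob_space M by (rule M)
  show ?thesis
  proof
    show "indep_vars (\<lambda>_. borel) (\<lambda>i \<omega>. lam * X i \<omega>) {1..}"
      by (rule indep_vars_compose2[OF ind, where Y = "\<lambda>_ x. lam * x"]) measurable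
    fix i :: nat assume i: "i \<ge> 1"
    note Xi = X[OF i, unfolded exponential_distributed_iff[OF lam]]
    have [measurable]: "X i \<in> borel_measurable M" using Xi by simp
    have "distributed M lborel (\<lambda>\<omega>. lam * X i \<omega>) (exponential_density 1)"
      unfolding exponential_distributed_iff[OF zero_less_one]
    proof (intro conjI allI impI)
      fix a :: real assume a: "0 \<le> a"
      have "{\<omega> \<in> space M. lam * X i \<omega> \<le> a} = {\<omega> \<in> space M. X i \<omega> \<le> a / lam}" using lam by (auto simp: field_simps)
      then show "\<P>(\<omega> in M. lam * X i \<omega> \<le> a) = 1 - exp (- a * 1)" using Xi a lam by simp
    qed auto
    then have "distr M lborel (\<lambda>\<omega>. lam * X i \<omega>) = std_exp" unfolding std_exp_def by (rule distributed_distr_eq_density)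
    moreover have "distr M lborel (\<lambda>\<omega>. lam * X i \<omega>) = distr M borel (\<lambda>\<omega>. lam * X i \<omega>)" by (rule distr_cong) auto
    ultimately show "distr M borel (\<lambda>\<omega>. lam * X i \<omega>) = std_exp" by simp
  qed
qed

text \<open>The form in which left continuity enters the upper bound: a strict lower bound of
  \<open>J\<close> persists slightly to the left.\<close>

lemma J_left_approx:
  assumes "0 < a" "a < 1" "ereal c < J a"
  shows "\<exists>b<a. ereal c < J b"
proof (rule ccontr)
  assume neg: "\<not> (\<exists>b<a. ereal c < J b)"
  have "J b \<le> ereal c" if "b < a" for b using neg that not_less by blast
  then have "J a \<le> ereal c" by (intro J_left[OF assms(1,2)])
  then show False using assms(3) by simp
qed

lemma J_witness:
  assumes "J a < y"
  shows "\<exists>f t. DQ f \<and> 0 \<le> t \<and> a < \<bar>Tf (Qd f) t\<bar> \<and> ereal (Kl f) < y"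
  using assms unfolding J_def INF_less_iff by blast

text \<open>For \<open>a \<ge> 1\<close> the event is empty and both sides are \<open>-\<infinity>\<close>.
  The prefactors \<open>1/2\<close> and \<open>(n + 1) ^ m\<close> of the two large deviation
  bounds vanish on the logarithmic scale.\<close>

lemma (in iid_exp) Ev_limit:
  assumes a: "0 < a"
  shows "(\<lambda>n. ereal (1 / real n) * ln_prob (prob (Ev n a))) \<longlonglongrightarrow> - J a"
proof (rule order_tendstoI)
  fix y assume "y < - J a"
  then have "J a < - y" by (simp add: ereal_less_uminus_reorder)
  then obtain f t where f: "DQ f" "0 \<le> t" "a < \<bar>Tf (Qd f) t\<bar>" and K: "ereal (Kl f) < - y" using J_witness by blast
  obtain r where r: "ereal (Kl f) < ereal r" "ereal r < - y" using ereal_dense2[OF K] by blast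
  have e: "0 < r - Kl f" using r(1) by simp
  obtain n0 where n0: "\<And>n. n0 \<le> n \<Longrightarrow> exp (- real n * (Kl f + (r - Kl f))) / 2 \<le> prob (Ev n a)"
    using ldp_lower[OF f e] by blast
  have "(\<lambda>n. ereal (- r - ln 2 / real n)) \<longlonglongrightarrow> ereal (- r - 0)"
    by (intro tendsto_ereal tendsto_diff tendsto_const lim_const_over_n)
  moreover have "y < ereal (- r - 0)" using r(2) by (simp add: ereal_less_uminus_reorder)
  ultimately have "eventually (\<lambda>n. y < ereal (- r - ln 2 / real n)) sequentially" by (rule order_tendstoD(1))
  then show "eventually (\<lambda>n. y < ereal (1 / real n) * ln_prob (prob (Ev n a))) sequentially"
    using eventually_ge_at_top[of n0] eventually_ge_at_top[of 1]
  proof eventually_elim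
    case (elim n)
    have p: "exp (- real n * r) / 2 \<le> prob (Ev n a)" using n0[OF elim(2)] by simp
    have p0: "0 < prob (Ev n a)" using p by (rule less_le_trans[rotated]) simp
    have "- real n * r - ln 2 = ln (exp (- real n * r) / 2)" by (simp add: ln_divide_pos)
    also have "\<dots> \<le> ln (prob (Ev n a))" using p by (intro ln_mono) auto
    finally have "(- real n * r - ln 2) / real n \<le> ln (prob (Ev n a)) / real n" by (intro divide_right_mono) auto
    moreover have "(- real n * r - ln 2) / real n = - r - ln 2 / real n" using elim(3) by (simp add: field_simps)
    ultimately have "ereal (- r - ln 2 / real n) \<le> ereal (1 / real n) * ln_prob (prob (Ev n a))"
      using p0 by (simp add: ln_prob_def)
    then show ?case using elim(1) by (rule less_le_trans[rotated])
  qed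
next
  fix y assume y: "- J a < y"
  show "eventually (\<lambda>n. ereal (1 / real n) * ln_prob (prob (Ev n a)) < y) sequentially"
  proof (cases "a < 1")
    case False
    have "- \<infinity> < y" using y by (cases y) auto
    moreover have "Ev n a = {}" if "n \<ge> 1" for n
    proof -
      have "\<not> a < \<bar>Tf (emp n x) t\<bar>" for x t using Tf_abs_le[OF emp_rd[OF that], of x t] False by linarith
      then show ?thesis by (simp add: Ev_def)
    qed
    ultimately show ?thesis
      by (intro eventually_sequentiallyI[of 1]) (simp add: ln_prob_def)
  next
    case True
    have "- y < J a" using y by (simp add: ereal_uminus_less_reorder)
    then obtain c where c: "- y < ereal c" "ereal c < J a" using ereal_dense2 by blast
    obtain b where b: "b < a" "ereal c < J b" using J_left_approx[OF a True c(2)] by blast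
    have "a - 6 * ((a - b) / 6) = b" by (simp add: field_simps)
    then have "ereal c < J (a - 6 * ((a - b) / 6))" "0 < (a - b) / 6" using b by simp_all
    then obtain m where m: "\<And>n. 1 \<le> n \<Longrightarrow> prob (Ev n a) \<le> real (n + 1) ^ m * exp (- real n * c)" using ldp_upper by blast
    have "(\<lambda>n. ln (real (n + 1)) / real n) \<longlonglongrightarrow> 0" by real_asymp
    then have "(\<lambda>n. ereal (real m * (ln (real (n + 1)) / real n) - c)) \<longlonglongrightarrow> ereal (real m * 0 - c)"
      by (intro tendsto_ereal tendsto_diff tendsto_const tendsto_mult)
    moreover have "ereal (real m * 0 - c) < y" using c(1) by (cases y) auto
    ultimately have "eventually (\<lambda>n. ereal (real m * (ln (real (n + 1)) / real n) - c) < y) sequentially" by (rule order_tendstoD(2))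
    then show ?thesis using eventually_ge_at_top[of 1]
    proof eventually_elim
      case (elim n)
      have "ereal (1 / real n) * ln_prob (prob (Ev n a)) \<le> ereal (real m * (ln (real (n + 1)) / real n) - c)"
      proof (cases "prob (Ev n a) = 0")
        case True
        then show ?thesis using elim(2) by (simp add: ln_prob_def)
      next
        case False
        then have p0: "0 < prob (Ev n a)" by (simp add: zero_less_measure_iff)
        have "ln (prob (Ev n a)) \<le> ln (real (n + 1) ^ m * exp (- real n * c))" using m[OF elim(2)] p0 by (intro ln_mono)
        also have "\<dots> = real m * ln (real (n + 1)) - real n * c" by (simp add: ln_mult_pos ln_realpow)
        finally have "ln (prob (Ev n a)) / real n \<le> (real m * ln (real (n + 1)) - real n * c) / real n" by (intro divide_right_mono) auto
        also have "\<dots> = real m * (ln (real (n + 1)) / real n) - c" using elim(2) by (simp add: diff_divide_distrib)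
        finally show ?thesis using False by (simp add: ln_prob_def)
      qed
      then show ?case using elim(1) by (rule le_less_trans)
    qed
  qed
qed

lemma J_nonneg: "0 \<le> J a"
  unfolding J_def by (rule INF_greatest) (auto simp: Kl_nonneg)

text \<open>Continuity from the left is \<open>J_left\<close>; from the right a density that exceeds
  \<open>a\<close> strictly also exceeds slightly larger levels.\<close>

lemma J_isCont:
  assumes a: "0 < a" "a < 1"
  shows "isCont J a"
  unfolding isCont_def
proof (rule order_tendstoI)
  fix y assume "y < J a"
  then obtain c where c: "y < ereal c" "ereal c < J a" using ereal_dense2 by blast
  obtain b where b: "b < a" "ereal c < J b" using J_left_approx[OF a c(2)] by blast
  have "eventually (\<lambda>x. x \<in> {b<..}) (at a)" using b by (intro eventually_at_topological[THEN iffD2] exI[of _ "{b<..}"]) auto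
  then show "eventually (\<lambda>x. y < J x) (at a)"
  proof eventually_elim
    case (elim x)
    then have "J b \<le> J x" by (intro J_mono) auto
    then show ?case using c(1) b(2) by (meson less_le_trans less_trans)
  qed
next
  fix y assume "J a < y"
  then obtain f t where f: "DQ f" "0 \<le> t" "a < \<bar>Tf (Qd f) t\<bar>" "ereal (Kl f) < y" using J_witness by blast
  have "eventually (\<lambda>x. x \<in> {..<\<bar>Tf (Qd f) t\<bar>}) (at a)"
    using f by (intro eventually_at_topological[THEN iffD2] exI[of _ "{..<\<bar>Tf (Qd f) t\<bar>}"]) auto
  then show "eventually (\<lambda>x. J x < y) (at a)"
  proof eventually_elim
    case (elim x)
    then have "J x \<le> ereal (Kl f)" by (intro J_le[OF f(1,2)]) auto
    then show ?case using f(4) by (rule le_less_trans)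
  qed
qed

lemma J_finite_near_0: "\<exists>\<epsilon>>0. \<forall>a\<in>{0<..<\<epsilon>}. \<bar>J a\<bar> \<noteq> \<infinity>"
proof -
  obtain t where t: "0 \<le> t" "0 < delta3_sq_at t"
  proof (rule ccontr)
    assume "\<not> thesis"
    then have "delta3_sq \<le> 0" unfolding delta3_sq_def using that by (intro cSUP_least) (auto simp: not_less[symmetric])
    then show False using delta3_sq_numeric(1) by simp
  qed
  obtain C a0 where a0: "0 < a0" "\<And>a. 0 < a \<Longrightarrow> a < a0 \<Longrightarrow> J a \<le> ereal (a\<^sup>2 / (18 * delta3_sq_at t) + C * a ^ 3)"
    using rate_upper[OF t] by blast
  have "\<bar>J a\<bar> \<noteq> \<infinity>" if "a \<in> {0<..<a0}" for a
  proof -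
    have "J a \<le> ereal (a\<^sup>2 / (18 * delta3_sq_at t) + C * a ^ 3)" using that by (intro a0(2)) auto
    then show ?thesis using J_nonneg[of a] by (cases "J a") auto
  qed
  then show ?thesis using a0(1) by (intro exI[of _ a0] conjI ballI)
qed

definition rel_err :: "real \<Rightarrow> real" where
  "rel_err a = real_of_ereal (J a) * (18 * delta3_sq) / a\<^sup>2 - 1"

text \<open>The bounds \<open>rate_lower\<close> and \<open>rate_upper\<close> have relative error
  \<open>O(a)\<close>. The supremum defining the constant need not be attained for this argument:
  \<open>t\<close> is chosen such that its variance is within a factor \<open>1 + y/2\<close> of
  it.\<close>

lemma rel_err_lim: "(rel_err \<longlongrightarrow> 0) (at_right 0)"
proof (rule order_tendstoI)
  let ?d = delta3_sq
  have d: "0 < ?d" by (rule delta3_sq_numeric(1))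
  obtain \<epsilon> where \<epsilon>: "0 < \<epsilon>" "\<And>a. 0 < a \<Longrightarrow> a < \<epsilon> \<Longrightarrow> \<bar>J a\<bar> \<noteq> \<infinity>" using J_finite_near_0 by auto
  {
    fix y :: real assume y: "y < 0"
    obtain C a0 where a0: "0 < a0" "\<And>a. 0 < a \<Longrightarrow> a < a0 \<Longrightarrow> ereal (a\<^sup>2 / (18 * ?d) - C * a ^ 3) \<le> J a" using rate_lower[OF d] by blast
    define b where "b = min (min \<epsilon> a0) (- y / (18 * ?d * (\<bar>C\<bar> + 1)))"
    have "0 < - y / (18 * ?d * (\<bar>C\<bar> + 1))" using y d by (intro divide_pos_pos mult_pos_pos) auto
    then have b: "0 < b" unfolding b_def using \<epsilon>(1) a0(1) by simp
    show "eventually (\<lambda>a. y < rel_err a) (at_right 0)"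
    proof (rule eventually_at_rightI[OF _ b])
      fix a assume a: "a \<in> {0<..<b}"
      then have "ereal (a\<^sup>2 / (18 * ?d) - C * a ^ 3) \<le> ereal (real_of_ereal (J a))" using a0(2)[of a] \<epsilon>(2)[of a] by (simp add: b_def ereal_real)
      then have "(a\<^sup>2 / (18 * ?d) - C * a ^ 3) * (18 * ?d / a\<^sup>2) \<le> real_of_ereal (J a) * (18 * ?d / a\<^sup>2)" using d by (intro mult_right_mono) auto
      moreover have "(a\<^sup>2 / (18 * ?d) - C * a ^ 3) * (18 * ?d / a\<^sup>2) = 1 - 18 * ?d * C * a" using a d by (simp add: field_simps power2_eq_square power3_eq_cube)
      moreover have "18 * ?d * C * a < - y"
      proof -
        have "a < - y / (18 * ?d * (\<bar>C\<bar> + 1))" using a by (simp add: b_def)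
        then have "a * (18 * ?d * (\<bar>C\<bar> + 1)) < - y" using d by (subst (asm) pos_less_divide_eq) auto
        moreover have "18 * ?d * a * C \<le> 18 * ?d * a * (\<bar>C\<bar> + 1)" using a d by (intro mult_left_mono) auto
        ultimately show ?thesis by (simp add: algebra_simps)
      qed
      ultimately show "y < rel_err a" unfolding rel_err_def by (simp add: algebra_simps)
    qed
  next
    fix y :: real assume y: "0 < y"
    have "?d / (1 + y / 2) < ?d" using d y by (simp add: divide_less_eq)
    then obtain t where t: "0 \<le> t" "?d / (1 + y / 2) < delta3_sq_at t"
    proof -
      have "bdd_above (delta3_sq_at ` {0..})" using delta3_sq_at_bounds by (intro bdd_aboveI[of _ 1]) auto
      then show thesis using that \<open>?d / (1 + y / 2) < ?d\<close> less_cSUP_iff[of "{0..}" delta3_sq_at "?d / (1 + y / 2)"] unfolding delta3_sq_def[symmetric] by auto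
    qed
    have "0 < ?d / (1 + y / 2)" using d y by (intro divide_pos_pos) auto
    then have v: "0 < delta3_sq_at t" using t(2) by linarith
    have q: "?d / delta3_sq_at t < 1 + y / 2" using t(2) v y by (simp add: field_simps)
    obtain C a0 where a0: "0 < a0" "\<And>a. 0 < a \<Longrightarrow> a < a0 \<Longrightarrow> J a \<le> ereal (a\<^sup>2 / (18 * delta3_sq_at t) + C * a ^ 3)"
      using rate_upper[OF t(1) v] by blast
    define b where "b = min (min \<epsilon> a0) (y / 2 / (18 * ?d * (\<bar>C\<bar> + 1)))"
    have b: "0 < b" using \<epsilon> a0 y d by (simp add: b_def)
    show "eventually (\<lambda>a. rel_err a < y) (at_right 0)"
    proof (rule eventually_at_rightI[OF _ b])
      fix a assume a: "a \<in> {0<..<b}"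
      then have "ereal (real_of_ereal (J a)) \<le> ereal (a\<^sup>2 / (18 * delta3_sq_at t) + C * a ^ 3)" using a0(2)[of a] \<epsilon>(2)[of a] by (simp add: b_def ereal_real)
      then have "real_of_ereal (J a) * (18 * ?d / a\<^sup>2) \<le> (a\<^sup>2 / (18 * delta3_sq_at t) + C * a ^ 3) * (18 * ?d / a\<^sup>2)" using d by (intro mult_right_mono) auto
      moreover have "(a\<^sup>2 / (18 * delta3_sq_at t) + C * a ^ 3) * (18 * ?d / a\<^sup>2) = ?d / delta3_sq_at t + 18 * ?d * C * a" using a v by (simp add: field_simps power2_eq_square power3_eq_cube)
      moreover have "18 * ?d * C * a < y / 2"
      proof -
        have "a < y / 2 / (18 * ?d * (\<bar>C\<bar> + 1))" using a by (simp add: b_def)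
        then have "a * (18 * ?d * (\<bar>C\<bar> + 1)) < y / 2" using d by (subst (asm) pos_less_divide_eq) auto
        moreover have "18 * ?d * a * C \<le> 18 * ?d * a * (\<bar>C\<bar> + 1)" using a d by (intro mult_left_mono) auto
        ultimately show ?thesis by (simp add: algebra_simps)
      qed
      ultimately show "rel_err a < y" using q unfolding rel_err_def by (simp add: algebra_simps)
    qed
  }
qed

theorem theorem4:
  shows "\<exists>f3 :: real \<Rightarrow> ereal.
    (\<forall>(M :: 'a measure) (X :: nat \<Rightarrow> 'a \<Rightarrow> real) (lam :: real).
       prob_space M \<longrightarrow> lam > 0 \<longrightarrow>
       prob_space.indep_vars M (\<lambda>_. borel) X {1..} \<longrightarrow>
       (\<forall>i\<ge>1. distributed M lborel (X i) (exponential_density lam)) \<longrightarrow>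
       (\<forall>a>0. (\<lambda>n. ereal (1 / real n) *
                   ln_prob (measure M {\<omega> \<in> space M. D3 n (\<lambda>i. X i \<omega>) > a}))
               \<longlonglongrightarrow> - f3 a))
    \<and> (\<exists>\<epsilon>>0. (\<forall>a\<in>{0<..<\<epsilon>}. \<bar>f3 a\<bar> \<noteq> \<infinity>) \<and> continuous_on {0<..<\<epsilon>} f3)
    \<and> (\<exists>r :: real \<Rightarrow> real. r \<in> o[at_right 0](\<lambda>_. 1) \<and>
         (\<forall>\<^sub>F a in at_right 0. f3 a = ereal (1 / (18 * delta3_sq) * a\<^sup>2 * (1 + r a))))
    \<and> \<bar>1 / (18 * delta3_sq) - 2.479\<bar> \<le> 0.0005"
proof (intro exI[of _ J] conjI allI impI)
  fix M :: "'a measure" and X :: "nat \<Rightarrow> 'a \<Rightarrow> real" and lam a :: real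
  assume h: "prob_space M" "lam > 0" "prob_space.indep_vars M (\<lambda>_. borel) X {1..}"
    "\<forall>i\<ge>1. distributed M lborel (X i) (exponential_density lam)" and a: "a > 0"
  interpret iid_exp M "\<lambda>i \<omega>. lam * X i \<omega>" using h by (intro iid_exp_scaled) auto
  have "{\<omega> \<in> space M. D3 n (\<lambda>i. X i \<omega>) > a} = Ev n a" if "n \<ge> 1" for n
    unfolding Ev_def D3_scale[OF h(2) that] ..
  then have "eventually (\<lambda>n. ereal (1 / real n) * ln_prob (measure M (Ev n a)) =
      ereal (1 / real n) * ln_prob (measure M {\<omega> \<in> space M. D3 n (\<lambda>i. X i \<omega>) > a})) sequentially"
    by (intro eventually_sequentiallyI[of 1]) simp
  then show "(\<lambda>n. ereal (1 / real n) * ln_prob (measure M {\<omega> \<in> space M. D3 n (\<lambda>i. X i \<omega>) > a})) \<longlonglongrightarrow> - J a"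
    using Ev_limit[OF a] by (rule Lim_transform_eventually[rotated])
next
  obtain \<epsilon> where \<epsilon>: "0 < \<epsilon>" "\<forall>a\<in>{0<..<\<epsilon>}. \<bar>J a\<bar> \<noteq> \<infinity>" using J_finite_near_0 by blast
  show "\<exists>\<epsilon>>0. (\<forall>a\<in>{0<..<\<epsilon>}. \<bar>J a\<bar> \<noteq> \<infinity>) \<and> continuous_on {0<..<\<epsilon>} J"
  proof (intro exI[of _ "min \<epsilon> 1"] conjI)
    show "continuous_on {0<..<min \<epsilon> 1} J" by (intro continuous_at_imp_continuous_on ballI J_isCont) auto
  qed (use \<epsilon> in auto)
next
  obtain \<epsilon> where \<epsilon>: "0 < \<epsilon>" "\<And>a. 0 < a \<Longrightarrow> a < \<epsilon> \<Longrightarrow> \<bar>J a\<bar> \<noteq> \<infinity>" using J_finite_near_0 by auto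
  show "\<exists>r :: real \<Rightarrow> real. r \<in> o[at_right 0](\<lambda>_. 1) \<and>
      (\<forall>\<^sub>F a in at_right 0. J a = ereal (1 / (18 * delta3_sq) * a\<^sup>2 * (1 + r a)))"
  proof (intro exI[of _ rel_err] conjI)
    show "rel_err \<in> o[at_right 0](\<lambda>_. 1)" by (rule smalloI_tendsto) (use rel_err_lim in auto)
    show "\<forall>\<^sub>F a in at_right 0. J a = ereal (1 / (18 * delta3_sq) * a\<^sup>2 * (1 + rel_err a))"
    proof (rule eventually_at_rightI[OF _ \<epsilon>(1)])
      fix a assume a: "a \<in> {0<..<\<epsilon>}"
      then have "1 / (18 * delta3_sq) * a\<^sup>2 * (1 + rel_err a) = real_of_ereal (J a)"
        using delta3_sq_numeric(1) by (simp add: rel_err_def field_simps)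
      then show "J a = ereal (1 / (18 * delta3_sq) * a\<^sup>2 * (1 + rel_err a))" using \<epsilon>(2)[of a] a by (simp add: ereal_real)
    qed
  qed
next
  show "\<bar>1 / (18 * delta3_sq) - 2.479\<bar> \<le> 0.0005" by (rule delta3_sq_numeric(2))
qed

end
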